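(* Let $M$ be a Noetherian graded $S$-module of Krull dimension $d$, and let $\theta_1,\dots,\theta_d$ be a linear system of parameters (l.s.o.p.) for $M$. If $M$ is Buchsbaum, then there is a graded submodule $\mathcal{S}$ of $\operatorname{Soc} H^d(M)$ such that for all integers $k$, $$\left(\operatorname{Soc}\, M/(\theta_1,\dots,\theta_d)M\right)_k \;\cong\; \left(\bigoplus_{j=0}^{d-1}\binom{d}{j}\, H^j(M)_{k-j}\right)\oplus \mathcal{S}_{k-d}.$$
   Context: Let $\mathbf{k}$ be an infinite field of arbitrary characteristic, $S=\mathbf{k}[x_1,\dots,x_n]$ the polynomial ring with its standard $\mathbb{Z}$-grading ($\deg x_i=1$), $\mathfrak{M}=(x_1,\dots,x_n)$ its irrelevant ideal. All modules are Noetherian $\mathbb{Z}$-graded $S$-modules (local cohomology modules are graded but need not be Noetherian). $M_k$ is the $k$th homogeneous component of a graded module $M$, and $rM$ denotes the direct sum of $r$ copies of $M$. $H^i(M)$ is the $i$th local cohomology module of $M$ with respect to $\mathfrak{M}$, with its natural grading. The socle is $\operatorname{Soc} M=\{y\in M : \mathfrak{M}\cdot y=0\}$. A homogeneous system of parameters (h.s.o.p.) of $M$ with $\dim M=d$ is a sequence $\theta_1,\dots,\theta_d$ of homogeneous elements of $\mathfrak{M}$ such that $\dim M/(\theta_1,\dots,\theta_d)M=0$ (equivalently, $M/(\theta_1,\dots,\theta_d)M$ is finite-dimensional over $\mathbf{k}$); it is a linear system of parameters (l.s.o.p.) if all $\theta_i$ have degree 1. A sequence $\theta_1,\dots,\theta_r\in\mathfrak{M}$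 is a weak $M$-sequence if $(\theta_1,\dots,\theta_{i-1})M:\theta_i=(\theta_1,\dots,\theta_{i-1})M:\mathfrak{M}$ for $i=1,\dots,r$ (colons taken in $M$). $M$ is Buchsbaum if every h.s.o.p. of $M$ is a weak $M$-sequence. *)

theory Defs
  imports "HOL-Library.Poly_Mapping" "HOL-Algebra.Module" "HOL-Algebra.Ideal"
begin

section \<open>The polynomial ring\<close>

text \<open>Polynomials in variables indexed by \<open>nat\<close>; the paper's \<open>x\<^sub>1, \<dots>, x\<^sub>n\<close> are
  \<open>Var 0, \<dots>, Var (n - 1)\<close>.\<close>

type_synonym 'k mpoly = "(nat \<Rightarrow>\<^sub>0 nat) \<Rightarrow>\<^sub>0 'k"

definition Var :: "nat \<Rightarrow> 'k::field mpoly" where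
  "Var v = Poly_Mapping.single (Poly_Mapping.single v 1) 1"

definition Const :: "'k::field \<Rightarrow> 'k mpoly" where
  "Const c = Poly_Mapping.single 0 c"

definition mpoly_ring :: "nat \<Rightarrow> 'k::field mpoly ring" where
  "mpoly_ring n =
    \<lparr>carrier = {p. \<forall>m\<in>Poly_Mapping.keys p. Poly_Mapping.keys m \<subseteq> {..<n}},
     mult = (*), one = 1, zero = 0, add = (+)\<rparr>"

definition field_ring :: "'k::field ring" where
  "field_ring = \<lparr>carrier = UNIV, mult = (*), one = 1, zero = 0, add = (+)\<rparr>"

definition monom_degree :: "(nat \<Rightarrow>\<^sub>0 nat) \<Rightarrow> nat" where
  "monom_degree m = (\<Sum>v\<in>Poly_Mapping.keys m. Poly_Mapping.lookup m v)"

definition homogeneous :: "nat \<Rightarrow> 'k::field mpoly \<Rightarrow> bool" where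
  "homogeneous i p \<longleftrightarrow> (\<forall>m\<in>Poly_Mapping.keys p. monom_degree m = i)"

definition irrelevant_ideal :: "nat \<Rightarrow> 'k::field mpoly set" where
  "irrelevant_ideal n = genideal (mpoly_ring n) (Var ` {..<n})"

section \<open>Modules\<close>

text \<open>The record type \<open>module\<close> inherits the fields \<open>mult\<close> and \<open>one\<close> from \<open>ring\<close>; they play
  no role for modules and are left undefined in the constructions below.\<close>

definition submodule_span :: "('a, 'r) ring_scheme \<Rightarrow> ('a, 'b, 'c) module_scheme \<Rightarrow> 'b set \<Rightarrow> 'b set"
  where "submodule_span R M A = \<Inter>{N. submodule N R M \<and> A \<subseteq> N}"

definition noetherian_module :: "('a, 'r) ring_scheme \<Rightarrow> ('a, 'b, 'c) module_scheme \<Rightarrow> bool" where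
  "noetherian_module R M \<longleftrightarrow> module R M \<and>
    (\<forall>N. submodule N R M \<longrightarrow> (\<exists>A. finite A \<and> A \<subseteq> carrier M \<and> N = submodule_span R M A))"

text \<open>The submodule \<open>T M\<close> for a set \<open>T\<close> of scalars, and the colon \<open>N :\<^sub>M T\<close>.\<close>

definition scalar_set_mult ::
  "('a, 'r) ring_scheme \<Rightarrow> 'a set \<Rightarrow> ('a, 'b, 'c) module_scheme \<Rightarrow> 'b set" where
  "scalar_set_mult R T M = submodule_span R M {t \<odot>\<^bsub>M\<^esub> x | t x. t \<in> T \<and> x \<in> carrier M}"

definition colon :: "('a, 'b, 'c) module_scheme \<Rightarrow> 'b set \<Rightarrow> 'a set \<Rightarrow> 'b set" where
  "colon M N T = {x \<in> carrier M. \<forall>t\<in>T. t \<odot>\<^bsub>M\<^esub> x \<in> N}"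

definition annihilator :: "('a, 'r) ring_scheme \<Rightarrow> ('a, 'b, 'c) module_scheme \<Rightarrow> 'a set" where
  "annihilator R M = {r \<in> carrier R. \<forall>x\<in>carrier M. r \<odot>\<^bsub>M\<^esub> x = \<zero>\<^bsub>M\<^esub>}"

definition prime_chain ::
  "('a, 'r) ring_scheme \<Rightarrow> 'a set \<Rightarrow> nat \<Rightarrow> (nat \<Rightarrow> 'a set) \<Rightarrow> bool" where
  "prime_chain R I l P \<longleftrightarrow>
    (\<forall>i\<le>l. primeideal (P i) R \<and> I \<subseteq> P i) \<and> (\<forall>i<l. P i \<subset> P (Suc i))"

text \<open>The Krull dimension of \<open>M\<close> is that of \<open>R / Ann M\<close>. The zero module has no Krull
  dimension in \<open>nat\<close>.\<close>

definition has_krull_dim :: "('a, 'r) ring_scheme \<Rightarrow> ('a, 'b, 'c) module_scheme \<Rightarrow> nat \<Rightarrow> bool" where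
  "has_krull_dim R M d \<longleftrightarrow>
    (\<exists>P. prime_chain R (annihilator R M) d P) \<and>
    (\<forall>l P. prime_chain R (annihilator R M) l P \<longrightarrow> l \<le> d)"

definition direct_sum :: "'i set \<Rightarrow> ('i \<Rightarrow> ('a, 'b, 'c) module_scheme) \<Rightarrow> ('a, 'i \<Rightarrow> 'b) module" where
  \<comment> \<open>used for finite \<open>I\<close> only, where direct sums and products agree\<close>
  "direct_sum I N =
    \<lparr>carrier = (\<Pi>\<^sub>E i\<in>I. carrier (N i)), mult = undefined, one = undefined,
     zero = (\<lambda>i\<in>I. \<zero>\<^bsub>N i\<^esub>), add = (\<lambda>x y. \<lambda>i\<in>I. x i \<oplus>\<^bsub>N i\<^esub> y i),
     smult = (\<lambda>r x. \<lambda>i\<in>I. r \<odot>\<^bsub>N i\<^esub> x i)\<rparr>"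

definition copies :: "nat \<Rightarrow> ('a, 'b, 'c) module_scheme \<Rightarrow> ('a, nat \<Rightarrow> 'b) module" where
  "copies r M = direct_sum {..<r} (\<lambda>_. M)"

definition direct_sum2 ::
  "('a, 'b, 'c) module_scheme \<Rightarrow> ('a, 'd, 'e) module_scheme \<Rightarrow> ('a, 'b \<times> 'd) module"
  (infixr \<open>\<oplus>\<^sub>m\<close> 65) where
  "M \<oplus>\<^sub>m N =
    \<lparr>carrier = carrier M \<times> carrier N, mult = undefined, one = undefined,
     zero = (\<zero>\<^bsub>M\<^esub>, \<zero>\<^bsub>N\<^esub>), add = (\<lambda>x y. (fst x \<oplus>\<^bsub>M\<^esub> fst y, snd x \<oplus>\<^bsub>N\<^esub> snd y)),
     smult = (\<lambda>r x. (r \<odot>\<^bsub>M\<^esub> fst x, r \<odot>\<^bsub>N\<^esub> snd x))\<rparr>"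

definition module_iso ::
  "('a, 'r) ring_scheme \<Rightarrow> ('a, 'b, 'c) module_scheme \<Rightarrow> ('a, 'd, 'e) module_scheme \<Rightarrow> bool" where
  "module_iso R M N \<longleftrightarrow> (\<exists>f. bij_betw f (carrier M) (carrier N) \<and>
    (\<forall>x\<in>carrier M. \<forall>y\<in>carrier M. f (x \<oplus>\<^bsub>M\<^esub> y) = f x \<oplus>\<^bsub>N\<^esub> f y) \<and>
    (\<forall>r\<in>carrier R. \<forall>x\<in>carrier M. f (r \<odot>\<^bsub>M\<^esub> x) = r \<odot>\<^bsub>N\<^esub> f x))"

section \<open>Graded modules\<close>

record ('a, 'b) gmodule = "('a, 'b) module" +
  component :: "int \<Rightarrow> 'b set"

definition graded_module :: "nat \<Rightarrow> ('k::field mpoly, 'b, 'c) gmodule_scheme \<Rightarrow> bool" where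
  "graded_module n M \<longleftrightarrow> module (mpoly_ring n) M \<and>
    (\<forall>k. subgroup (component M k) (add_monoid M)) \<and>
    (\<forall>x\<in>carrier M. \<exists>!c. (\<forall>k. c k \<in> component M k) \<and> finite {k. c k \<noteq> \<zero>\<^bsub>M\<^esub>} \<and>
       x = finsum M c {k. c k \<noteq> \<zero>\<^bsub>M\<^esub>}) \<and>
    (\<forall>i k. \<forall>p\<in>carrier (mpoly_ring n). \<forall>x\<in>component M k.
       homogeneous i p \<longrightarrow> p \<odot>\<^bsub>M\<^esub> x \<in> component M (k + int i))"

definition component_space ::
  "('k::field mpoly, 'b, 'c) gmodule_scheme \<Rightarrow> int \<Rightarrow> ('k, 'b) module" where
  "component_space M k =
    \<lparr>carrier = component M k, mult = undefined, one = undefined,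
     zero = \<zero>\<^bsub>M\<^esub>, add = (\<oplus>\<^bsub>M\<^esub>), smult = (\<lambda>c x. Const c \<odot>\<^bsub>M\<^esub> x)\<rparr>"

definition restrict_gmodule :: "('a, 'b) gmodule \<Rightarrow> 'b set \<Rightarrow> ('a, 'b) gmodule" where
  "restrict_gmodule M N = M\<lparr>carrier := N, component := (\<lambda>k. component M k \<inter> N)\<rparr>"

definition graded_submodule :: "nat \<Rightarrow> 'b set \<Rightarrow> ('k::field mpoly, 'b) gmodule \<Rightarrow> bool" where
  "graded_submodule n N M \<longleftrightarrow>
    submodule N (mpoly_ring n) M \<and> graded_module n (restrict_gmodule M N)"

definition quotient_gmodule :: "('a, 'b) gmodule \<Rightarrow> 'b set \<Rightarrow> ('a, 'b set) gmodule" where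
  "quotient_gmodule M N =
    \<lparr>carrier = a_rcosets\<^bsub>M\<^esub> N, mult = undefined, one = undefined,
     zero = N, add = (<+>\<^bsub>M\<^esub>), smult = (\<lambda>r A. \<Union>x\<in>A. N +>\<^bsub>M\<^esub> (r \<odot>\<^bsub>M\<^esub> x)),
     component = (\<lambda>k. (\<lambda>x. N +>\<^bsub>M\<^esub> x) ` component M k)\<rparr>"

definition socle :: "nat \<Rightarrow> ('k::field mpoly, 'b) gmodule \<Rightarrow> ('k mpoly, 'b) gmodule" where
  "socle n M = restrict_gmodule M
    {y \<in> carrier M. \<forall>p\<in>irrelevant_ideal n. p \<odot>\<^bsub>M\<^esub> y = \<zero>\<^bsub>M\<^esub>}"

section \<open>Systems of parameters and Buchsbaum modules\<close>

definition quotient_by_seq ::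
  "nat \<Rightarrow> ('k::field mpoly, 'b) gmodule \<Rightarrow> 'k mpoly list \<Rightarrow> ('k mpoly, 'b set) gmodule" where
  "quotient_by_seq n M \<theta>s = quotient_gmodule M (scalar_set_mult (mpoly_ring n) (set \<theta>s) M)"

definition hsop :: "nat \<Rightarrow> ('k::field mpoly, 'b) gmodule \<Rightarrow> 'k mpoly list \<Rightarrow> bool" where
  "hsop n M \<theta>s \<longleftrightarrow> has_krull_dim (mpoly_ring n) M (length \<theta>s) \<and>
    (\<forall>\<theta>\<in>set \<theta>s. \<theta> \<in> irrelevant_ideal n \<and> (\<exists>i. homogeneous i \<theta>)) \<and>
    has_krull_dim (mpoly_ring n) (quotient_by_seq n M \<theta>s) 0"

definition lsop :: "nat \<Rightarrow> ('k::field mpoly, 'b) gmodule \<Rightarrow> 'k mpoly list \<Rightarrow> bool" where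
  "lsop n M \<theta>s \<longleftrightarrow> hsop n M \<theta>s \<and> (\<forall>\<theta>\<in>set \<theta>s. homogeneous 1 \<theta>)"

definition weak_sequence :: "nat \<Rightarrow> ('k::field mpoly, 'b) gmodule \<Rightarrow> 'k mpoly list \<Rightarrow> bool" where
  "weak_sequence n M \<theta>s \<longleftrightarrow> set \<theta>s \<subseteq> irrelevant_ideal n \<and>
    (\<forall>i<length \<theta>s.
      colon M (scalar_set_mult (mpoly_ring n) (set (take i \<theta>s)) M) {\<theta>s ! i} =
      colon M (scalar_set_mult (mpoly_ring n) (set (take i \<theta>s)) M) (irrelevant_ideal n))"

definition buchsbaum :: "nat \<Rightarrow> ('k::field mpoly, 'b) gmodule \<Rightarrow> bool" where
  "buchsbaum n M \<longleftrightarrow> (\<forall>\<theta>s. hsop n M \<theta>s \<longrightarrow> weak_sequence n M \<theta>s)"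

section \<open>Local cohomology\<close>

text \<open>Local cohomology with respect to the irrelevant ideal is the cohomology of the Cech
  complex (stable Koszul complex)
  \<open>0 \<rightarrow> M \<rightarrow> \<Oplus>\<^sub>v M[1/x\<^sub>v] \<rightarrow> \<Oplus>\<^sub>u\<^sub><\<^sub>v M[1/(x\<^sub>u x\<^sub>v)] \<rightarrow> \<dots> \<rightarrow> M[1/(x\<^sub>1 \<dots> x\<^sub>n)] \<rightarrow> 0\<close>,
  which also carries the natural grading.\<close>

text \<open>The fraction \<open>m / f\<^sup>a\<close>, as the class of all pairs \<open>(m', b)\<close> with \<open>m' / f\<^sup>b = m / f\<^sup>a\<close>.\<close>

definition fraction :: "'k::field mpoly \<Rightarrow> ('k mpoly, 'b) gmodule \<Rightarrow> 'b \<Rightarrow> nat \<Rightarrow> ('b \<times> nat) set" where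
  "fraction f M m a =
    {(m', b). m' \<in> carrier M \<and> (\<exists>c. f ^ (c + b) \<odot>\<^bsub>M\<^esub> m = f ^ (c + a) \<odot>\<^bsub>M\<^esub> m')}"

text \<open>The localization of \<open>M\<close> at the powers of \<open>f\<close>. The grading is meaningful only if \<open>f\<close>
  is homogeneous and nonzero: if \<open>f\<close> has degree \<open>e\<close> and \<open>m\<close> has degree \<open>j\<close>, then \<open>m / f\<^sup>a\<close> has
  degree \<open>j - e * a\<close>.\<close>

definition localization ::
  "'k::field mpoly \<Rightarrow> ('k mpoly, 'b) gmodule \<Rightarrow> ('k mpoly, ('b \<times> nat) set) gmodule" where
  "localization f M =
    \<lparr>carrier = {fraction f M m a | m a. m \<in> carrier M},
     mult = undefined, one = undefined, zero = fraction f M \<zero>\<^bsub>M\<^esub> 0,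
     add = (\<lambda>A B. \<Union>(m, a)\<in>A. \<Union>(m', b)\<in>B.
              fraction f M (f ^ b \<odot>\<^bsub>M\<^esub> m \<oplus>\<^bsub>M\<^esub> f ^ a \<odot>\<^bsub>M\<^esub> m') (a + b)),
     smult = (\<lambda>r A. \<Union>(m, a)\<in>A. fraction f M (r \<odot>\<^bsub>M\<^esub> m) a),
     component = (\<lambda>k. {fraction f M m a | m a e j.
              homogeneous e f \<and> m \<in> component M j \<and> k = j - int (e * a)})\<rparr>"

text \<open>The natural map from the localization at \<open>f\<close> to the localization at \<open>f * g\<close>.\<close>

definition localization_map ::
  "'k::field mpoly \<Rightarrow> 'k mpoly \<Rightarrow> ('k mpoly, 'b) gmodule \<Rightarrow> ('b \<times> nat) set \<Rightarrow> ('b \<times> nat) set" where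
  "localization_map f g M A = (\<Union>(m, a)\<in>A. fraction (f * g) M (g ^ a \<odot>\<^bsub>M\<^esub> m) a)"

definition var_subsets :: "nat \<Rightarrow> nat \<Rightarrow> nat set set" where
  "var_subsets n i = {F. F \<subseteq> {..<n} \<and> card F = i}"

definition var_prod :: "nat set \<Rightarrow> 'k::field mpoly" where
  "var_prod F = (\<Prod>v\<in>F. Var v)"

definition cech ::
  "nat \<Rightarrow> nat \<Rightarrow> ('k::field mpoly, 'b) gmodule \<Rightarrow> ('k mpoly, nat set \<Rightarrow> ('b \<times> nat) set) gmodule" where
  "cech n i M = module.extend
    (direct_sum (var_subsets n i) (\<lambda>F. localization (var_prod F) M))
    (gmodule.fields (\<lambda>k. \<Pi>\<^sub>E F\<in>var_subsets n i. component (localization (var_prod F) M) k))"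

definition cech_diff ::
  "nat \<Rightarrow> nat \<Rightarrow> ('k::field mpoly, 'b) gmodule \<Rightarrow>
   (nat set \<Rightarrow> ('b \<times> nat) set) \<Rightarrow> (nat set \<Rightarrow> ('b \<times> nat) set)" where
  "cech_diff n i M x = (\<lambda>F\<in>var_subsets n (Suc i).
    finsum (localization (var_prod F) M)
      (\<lambda>v. (- 1) ^ card {u \<in> F. u < v} \<odot>\<^bsub>localization (var_prod F) M\<^esub>
             localization_map (var_prod (F - {v})) (Var v) M (x (F - {v}))) F)"

definition cocycles ::
  "nat \<Rightarrow> nat \<Rightarrow> ('k::field mpoly, 'b) gmodule \<Rightarrow> (nat set \<Rightarrow> ('b \<times> nat) set) set" where
  "cocycles n i M = {x \<in> carrier (cech n i M). cech_diff n i M x = \<zero>\<^bsub>cech n (Suc i) M\<^esub>}"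

fun coboundaries ::
  "nat \<Rightarrow> nat \<Rightarrow> ('k::field mpoly, 'b) gmodule \<Rightarrow> (nat set \<Rightarrow> ('b \<times> nat) set) set" where
  "coboundaries n 0 M = {\<zero>\<^bsub>cech n 0 M\<^esub>}"
| "coboundaries n (Suc i) M = cech_diff n i M ` carrier (cech n i M)"

definition local_cohomology ::
  "nat \<Rightarrow> nat \<Rightarrow> ('k::field mpoly, 'b) gmodule \<Rightarrow>
   ('k mpoly, (nat set \<Rightarrow> ('b \<times> nat) set) set) gmodule" where
  "local_cohomology n i M =
    quotient_gmodule (restrict_gmodule (cech n i M) (cocycles n i M)) (coboundaries n i M)"

end

theory Submission
  imports Defs
begin

text \<open>For \<open>F \<subseteq> {1, \<dots>, d}\<close> let \<open>N\<^sub>F\<close> be the sum of the \<open>\<theta>\<^sub>i M\<close> with \<open>i \<in> F\<close>, and let \<open>N\<close> be \<open>N\<^sub>F\<close> for the full set.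
  By the Buchsbaum property the irrelevant ideal annihilates the local cohomology of \<open>M/N\<^sub>F\<close> below the top
  degree, so the long exact sequences of multiplication by the \<open>\<theta>\<^sub>i\<close> break up. Iterating their
  connecting homomorphisms relates elements of degree \<open>k\<close> of \<open>H\<^sup>0(M/N\<^sub>F)\<close> to elements of degree \<open>k - j\<close> of
  \<open>H\<^sup>j(M)\<close>, where \<open>j = |F|\<close>. For \<open>j < d\<close> the relation is onto and lives on representatives of socle elements
  of \<open>M/N\<close>; for \<open>j = d\<close> the classes related to socle elements form \<open>\<S>\<close>. An element related to zero comes
  from \<open>N\<close> and from the proper subsets of \<open>F\<close>. Hence the sum over all \<open>F\<close> of linear sections of these
  relations is the isomorphism: it is onto by induction on \<open>|F|\<close>, and injective because the \<open>F\<close>-component can be read off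
  once the components of the larger sets vanish.\<close>

text \<open>The local cohomology of the quotients \<open>M/N_F\<close> is handled without forming
  them: a class of \<open>M/N_F\<close> is a Cech cochain of \<open>M\<close> that is a cocycle up
  to cochains with values in \<open>N_F\<close>. A connecting homomorphism is then a relation
  between cochains of one fixed complex, and such relations compose without choices. The submodules
  carry exponents because annihilation must be bootstrapped. At first only some power of \<theta>_i,
  depending on the class, is known to kill it; that power is divided out, and the induction
  continues in a smaller cohomological degree. The final argument uses exponents 0 and 1 only.
  Powers of \<theta>_i can be cancelled in positive Cech degree, because (N : \<theta>_i^s)/N is
  killed by every variable and so dies in a localization at a nonempty product of variables. The top
  degree differs because each annihilation step needs a parameter not yet divided out: for |F| = d
  surjectivity may fail, and \<S> has to be an image. It is a submodule because on a socle
  polynomials act through their constant terms. The coefficients of the theorem count the subsets F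
  of each size.\<close>

section \<open>Differences and subgroups in abelian groups\<close>

lemma (in abelian_group) minus_minus_minus:
  assumes "a \<in> carrier G" "b \<in> carrier G" "c \<in> carrier G" "e \<in> carrier G"
  shows "(a \<ominus> b) \<ominus> (c \<ominus> e) = (a \<ominus> c) \<ominus> (b \<ominus> e)"
  using assms by (simp add: a_minus_def minus_add a_ac)

lemma (in abelian_group) minus_minus_cancel:
  assumes "a \<in> carrier G" "b \<in> carrier G"
  shows "a \<ominus> (a \<ominus> b) = b"
  using assms by (simp add: a_minus_def minus_add r_neg2)

lemma (in abelian_group) minus_add_cancel:
  assumes "a \<in> carrier G" "b \<in> carrier G"
  shows "(a \<ominus> b) \<oplus> b = a" "b \<oplus> (a \<ominus> b) = a" "(a \<oplus> b) \<ominus> b = a" "(b \<oplus> a) \<ominus> b = a"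
  using assms by (simp_all add: a_minus_def a_ac r_neg1 r_neg2 r_neg l_neg)

lemma (in abelian_group) minus_self [simp]: "a \<in> carrier G \<Longrightarrow> a \<ominus> a = \<zero>"
  by (simp add: a_minus_def r_neg)

lemma (in abelian_group) minus_zero_right [simp]: "a \<in> carrier G \<Longrightarrow> a \<ominus> \<zero> = a"
  by (simp add: a_minus_def)

lemma (in module) smult_r_diff:
  assumes "r \<in> carrier R" "x \<in> carrier M" "y \<in> carrier M"
  shows "r \<odot>\<^bsub>M\<^esub> (x \<ominus>\<^bsub>M\<^esub> y) = r \<odot>\<^bsub>M\<^esub> x \<ominus>\<^bsub>M\<^esub> r \<odot>\<^bsub>M\<^esub> y"
  using assms by (simp add: a_minus_def smult_r_distr smult_r_minus)

lemma (in module) smult_left_comm: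
  assumes "r \<in> carrier R" "s \<in> carrier R" "x \<in> carrier M"
  shows "r \<odot>\<^bsub>M\<^esub> (s \<odot>\<^bsub>M\<^esub> x) = s \<odot>\<^bsub>M\<^esub> (r \<odot>\<^bsub>M\<^esub> x)"
  using assms by (metis R.m_comm smult_assoc1)

lemma (in abelian_group) subgroup_mem:
  assumes "subgroup H (add_monoid G)"
  shows "\<zero> \<in> H" "x \<in> H \<Longrightarrow> x \<in> carrier G" "x \<in> H \<Longrightarrow> y \<in> H \<Longrightarrow> x \<oplus> y \<in> H"
    "x \<in> H \<Longrightarrow> \<ominus> x \<in> H" "x \<in> H \<Longrightarrow> y \<in> H \<Longrightarrow> x \<ominus> y \<in> H"
  using subgroup.one_closed[OF assms] subgroup.mem_carrier[OF assms] subgroup.m_closed[OF assms]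
    subgroup.m_inv_closed[OF assms]
  by (auto simp: a_minus_def a_inv_def)

lemma (in abelian_group) subgroup_cancel:
  assumes "subgroup H (add_monoid G)" "y \<in> H" "x \<in> carrier G"
  shows "x \<ominus> y \<in> H \<longleftrightarrow> x \<in> H" "x \<oplus> y \<in> H \<longleftrightarrow> x \<in> H" "y \<oplus> x \<in> H \<longleftrightarrow> x \<in> H" "y \<ominus> x \<in> H \<longleftrightarrow> x \<in> H"
  using subgroup_mem[OF assms(1)] assms(2,3) minus_add_cancel[of x y] minus_minus_cancel[of y x]
  by metis+

lemma (in abelian_group) subgroupI_diff:
  assumes "H \<subseteq> carrier G" "\<zero> \<in> H" "\<And>x y. x \<in> H \<Longrightarrow> y \<in> H \<Longrightarrow> x \<ominus> y \<in> H"
  shows "subgroup H (add_monoid G)"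
proof -
  have neg: "\<ominus> x \<in> H" if "x \<in> H" for x
    using assms(3)[OF assms(2) that] assms(1) that by (auto simp: a_minus_def)
  have "x \<oplus> y \<in> H" if "x \<in> H" "y \<in> H" for x y
    using assms(3)[OF that(1) neg[OF that(2)]] assms(1) that by (auto simp: a_minus_def subset_eq)
  then show ?thesis
    using assms(1,2) neg by (intro add.subgroupI) (auto simp: a_inv_def)
qed

section \<open>A graded complex modulo a family of subcomplexes\<close>

text \<open>An exponent function \<open>b\<close> stands for the submodule generated by the
  multiples of all \<open>\<theta> i ^ b i\<close> with \<open>b i > 0\<close>; the value 0 says
  that the parameter is left out.\<close>

definition put :: "(nat \<Rightarrow> nat) \<Rightarrow> nat \<Rightarrow> nat \<Rightarrow> nat \<Rightarrow> nat" where
  "put b i s = b(i := s)"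

definition unused :: "nat \<Rightarrow> (nat \<Rightarrow> nat) \<Rightarrow> nat \<Rightarrow> bool" where
  "unused d b i \<longleftrightarrow> b i = 0 \<and> i < d"

text \<open>In the application \<open>C\<close> is the Cech complex of \<open>M\<close>, and
  \<open>CN b\<close> consists of the cochains with values in the submodule belonging to
  \<open>b\<close>. By exactness of localization, \<open>C\<close> modulo \<open>CN b\<close> is the
  Cech complex of the quotient of \<open>M\<close>, so its cohomology is accessible without that
  quotient.\<close>

locale graded_complex =
  fixes R :: "('a, 'r) ring_scheme" and C :: "nat \<Rightarrow> ('a, 'c, 'e) module_scheme"
    and g :: "nat \<Rightarrow> int \<Rightarrow> 'c set" and D :: "nat \<Rightarrow> 'c \<Rightarrow> 'c"
    and CN :: "'i \<Rightarrow> nat \<Rightarrow> 'c set"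
  assumes module_C: "module R (C j)"
    and subgroup_g: "subgroup (g j k) (add_monoid (C j))"
    and D_closed [simp]: "x \<in> carrier (C j) \<Longrightarrow> D j x \<in> carrier (C (Suc j))"
    and D_g: "x \<in> g j k \<Longrightarrow> D j x \<in> g (Suc j) k"
    and D_add: "x \<in> carrier (C j) \<Longrightarrow> y \<in> carrier (C j) \<Longrightarrow>
      D j (x \<oplus>\<^bsub>C j\<^esub> y) = D j x \<oplus>\<^bsub>C (Suc j)\<^esub> D j y"
    and D_smult: "r \<in> carrier R \<Longrightarrow> x \<in> carrier (C j) \<Longrightarrow>
      D j (r \<odot>\<^bsub>C j\<^esub> x) = r \<odot>\<^bsub>C (Suc j)\<^esub> D j x"
    and D_D: "x \<in> carrier (C j) \<Longrightarrow> D (Suc j) (D j x) = \<zero>\<^bsub>C (Suc (Suc j))\<^esub>"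
    and submodule_CN: "submodule (CN b j) R (C j)"
    and D_CN: "x \<in> CN b j \<Longrightarrow> D j x \<in> CN b (Suc j)"
begin

sublocale C: module R "C j" for j by (rule module_C)

lemmas g_mem = C.subgroup_mem[OF subgroup_g]
lemmas g_in = g_mem(1,3,4,5)

lemma CN_sub: "subgroup (CN b j) (add_monoid (C j))"
  using submodule_CN by (simp add: submodule_def)

lemmas CN_mem = C.subgroup_mem[OF CN_sub]
lemmas CN_in = CN_mem(1,3,4,5)

lemma CN_smult: "r \<in> carrier R \<Longrightarrow> x \<in> CN b j \<Longrightarrow> r \<odot>\<^bsub>C j\<^esub> x \<in> CN b j"
  by (rule submodule.smult_closed[OF submodule_CN])

lemma D_zero [simp]: "D j \<zero>\<^bsub>C j\<^esub> = \<zero>\<^bsub>C (Suc j)\<^esub>"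
  using D_smult[of "\<zero>\<^bsub>R\<^esub>" "\<zero>\<^bsub>C j\<^esub>" j] by simp

lemma D_diff:
  assumes "x \<in> carrier (C j)" "y \<in> carrier (C j)"
  shows "D j (x \<ominus>\<^bsub>C j\<^esub> y) = D j x \<ominus>\<^bsub>C (Suc j)\<^esub> D j y"
proof -
  have "D j (x \<ominus>\<^bsub>C j\<^esub> y) \<oplus>\<^bsub>C (Suc j)\<^esub> D j y = D j x"
    using D_add[of "x \<ominus>\<^bsub>C j\<^esub> y" j y] assms by (simp add: C.minus_add_cancel)
  then show ?thesis
    using assms C.minus_add_cancel(3)[of "D j (x \<ominus>\<^bsub>C j\<^esub> y)" "Suc j" "D j y"] by simp
qed

text \<open>\<open>Zc b j k\<close> modulo \<open>Bc b j k\<close> is the degree \<open>k\<close>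
  part of the j-th cohomology of \<open>C\<close> modulo \<open>CN b\<close>, with both groups
  pulled back to \<open>C\<close>.\<close>

definition Zc :: "'i \<Rightarrow> nat \<Rightarrow> int \<Rightarrow> 'c set" where
  "Zc b j k = {x \<in> g j k. D j x \<in> CN b (Suc j)}"

text \<open>The primitive \<open>e\<close> is asked to be homogeneous of the same degree as
  \<open>x\<close>. In cohomological degree 0 there is no incoming differential, so only cochains of
  the subcomplex are trivial.\<close>

fun Bc :: "'i \<Rightarrow> nat \<Rightarrow> int \<Rightarrow> 'c set" where
  "Bc b 0 k = g 0 k \<inter> CN b 0"
| "Bc b (Suc j) k = {x \<in> g (Suc j) k. \<exists>e\<in>g j k. x \<ominus>\<^bsub>C (Suc j)\<^esub> D j e \<in> CN b (Suc j)}"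

lemma Zc_sub: "subgroup (Zc b j k) (add_monoid (C j))"
  by (rule C.subgroupI_diff) (auto simp: Zc_def D_diff g_mem(2) intro: g_in CN_in)

lemmas Zc_mem = C.subgroup_mem[OF Zc_sub]
lemmas Zc_in = Zc_mem(1,3,4,5)

lemma Bc_sub: "subgroup (Bc b j k) (add_monoid (C j))"
proof (cases j)
  case 0
  then show ?thesis by (auto intro!: C.subgroupI_diff intro: g_in CN_in simp: g_mem(2))
next
  case (Suc i)
  have "x \<ominus>\<^bsub>C j\<^esub> y \<in> Bc b j k" if x: "x \<in> Bc b j k" and y: "y \<in> Bc b j k" for x y
  proof -
    obtain e e' where e: "e \<in> g i k" "x \<ominus>\<^bsub>C j\<^esub> D i e \<in> CN b j"
      and e': "e' \<in> g i k" "y \<ominus>\<^bsub>C j\<^esub> D i e' \<in> CN b j" "x \<in> g j k" "y \<in> g j k"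
      using x y Suc by auto
    have "(x \<ominus>\<^bsub>C j\<^esub> y) \<ominus>\<^bsub>C j\<^esub> D i (e \<ominus>\<^bsub>C i\<^esub> e') \<in> CN b j"
      using CN_mem(5)[OF e(2) e'(2)] e(1) e' Suc
      by (simp add: D_diff g_mem(2) C.minus_minus_minus)
    then show ?thesis
      using e e' Suc by (auto intro: g_in)
  qed
  moreover have "\<zero>\<^bsub>C j\<^esub> \<in> Bc b j k"
    using Suc by (auto intro!: bexI[of _ "\<zero>\<^bsub>C i\<^esub>"] g_in CN_in)
  ultimately show ?thesis
    using Suc by (intro C.subgroupI_diff) (auto intro: g_in simp: g_mem(2))
qed

lemmas Bc_mem = C.subgroup_mem[OF Bc_sub]
lemma CN_Bc: "x \<in> CN b j \<Longrightarrow> x \<in> g j k \<Longrightarrow> x \<in> Bc b j k"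
  by (cases j) (auto intro!: bexI[of _ "\<zero>\<^bsub>C _\<^esub>"] g_in simp: CN_mem(2))

lemma D_Bc: "e \<in> g j k \<Longrightarrow> D j e \<in> Bc b (Suc j) k"
  by (auto intro!: bexI[of _ e] D_g simp: CN_in g_mem(2))

text \<open>A coboundary modulo \<open>CN b\<close> is a cochain \<open>y\<close> of the subcomplex
  plus a true coboundary \<open>D e\<close>. The latter is trivial modulo every subcomplex, hence
  the free \<open>b'\<close>.\<close>

lemma BcE:
  assumes "x \<in> Bc b j k"
  obtains y where "y \<in> CN b j" "y \<in> g j k" "D j x = D j y" "x \<ominus>\<^bsub>C j\<^esub> y \<in> Bc b' j k"
proof (cases j)
  case 0
  then show ?thesis using assms that[of x] by (auto simp: g_mem CN_mem)
next
  case (Suc i)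
  then obtain e where e: "e \<in> g i k" "x \<ominus>\<^bsub>C j\<^esub> D i e \<in> CN b j" "x \<in> g j k"
    using assms by auto
  show ?thesis
  proof (rule that[OF e(2)])
    show "x \<ominus>\<^bsub>C j\<^esub> D i e \<in> g j k"
      using e Suc by (auto intro: g_in D_g)
    show "D j x = D j (x \<ominus>\<^bsub>C j\<^esub> D i e)"
      using e Suc by (simp add: D_diff D_D g_mem(2))
    show "x \<ominus>\<^bsub>C j\<^esub> (x \<ominus>\<^bsub>C j\<^esub> D i e) \<in> Bc b' j k"
      using e Suc D_Bc[OF e(1)] by (simp add: C.minus_minus_cancel g_mem(2) del: Bc.simps)
  qed
qed

text \<open>Homogeneity of degree \<open>e\<close>, stated through the action on the complex because
  the ring \<open>R\<close> carries no grading here.\<close>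

definition shifts :: "int \<Rightarrow> 'a set" where
  "shifts e = {r \<in> carrier R. \<forall>j k. \<forall>x\<in>g j k. r \<odot>\<^bsub>C j\<^esub> x \<in> g j (k + e)}"

lemma Zc_smult: "r \<in> shifts e \<Longrightarrow> x \<in> Zc b j k \<Longrightarrow> r \<odot>\<^bsub>C j\<^esub> x \<in> Zc b j (k + e)"
  by (auto simp: Zc_def shifts_def D_smult g_mem(2) intro: CN_smult)

lemma Bc_smult: "r \<in> shifts e \<Longrightarrow> x \<in> Bc b j k \<Longrightarrow> r \<odot>\<^bsub>C j\<^esub> x \<in> Bc b j (k + e)"
proof (cases j)
  case (Suc i)
  assume r: "r \<in> shifts e" and "x \<in> Bc b j k"
  then obtain f where f: "f \<in> g i k" "x \<ominus>\<^bsub>C j\<^esub> D i f \<in> CN b j" "x \<in> g j k"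
    using Suc by auto
  have "r \<odot>\<^bsub>C j\<^esub> x \<ominus>\<^bsub>C j\<^esub> D i (r \<odot>\<^bsub>C i\<^esub> f) \<in> CN b j"
    using CN_smult[OF _ f(2), of r] r f Suc
    by (simp add: shifts_def D_smult g_mem(2) C.smult_r_diff)
  then show ?thesis
    using f Suc r by (auto simp: shifts_def)
qed (auto simp: shifts_def CN_smult)

lemma shifts_pow: "p \<in> shifts 1 \<Longrightarrow> p [^]\<^bsub>R\<^esub> (s::nat) \<in> shifts (int s)"
proof (induction s)
  case (Suc s)
  have "(p [^]\<^bsub>R\<^esub> Suc s) \<odot>\<^bsub>C j\<^esub> x \<in> g j (k + int (Suc s))" if x: "x \<in> g j k" for j k x
  proof -
    have "p \<odot>\<^bsub>C j\<^esub> x \<in> g j (k + 1)" using Suc.prems x by (simp add: shifts_def)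
    then have "(p [^]\<^bsub>R\<^esub> s) \<odot>\<^bsub>C j\<^esub> (p \<odot>\<^bsub>C j\<^esub> x) \<in> g j (k + 1 + int s)"
      using Suc by (simp add: shifts_def)
    then show ?thesis
      using Suc.prems x g_mem(2) by (simp add: shifts_def C.smult_assoc1 ac_simps)
  qed
  then show ?case using Suc.prems by (simp add: shifts_def)
qed (simp add: shifts_def g_mem)

lemma shifts_add: "p \<in> shifts e \<Longrightarrow> q \<in> shifts e \<Longrightarrow> p \<oplus>\<^bsub>R\<^esub> q \<in> shifts e"
  by (auto simp: shifts_def C.smult_l_distr g_mem(2) intro: g_mem(3))

lemma shifts_closed: "p \<in> shifts e \<Longrightarrow> p \<in> carrier R"
  by (simp add: shifts_def)

lemma Bc_pow_mono:
  assumes "p \<in> shifts 1" "x \<in> g j k" "(p [^]\<^bsub>R\<^esub> s) \<odot>\<^bsub>C j\<^esub> x \<in> Bc b j (k + int s)"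
  shows "(p [^]\<^bsub>R\<^esub> (s + t)) \<odot>\<^bsub>C j\<^esub> x \<in> Bc b j (k + int (s + t))"
proof -
  have "(p [^]\<^bsub>R\<^esub> t) \<odot>\<^bsub>C j\<^esub> ((p [^]\<^bsub>R\<^esub> s) \<odot>\<^bsub>C j\<^esub> x) \<in> Bc b j (k + int s + int t)"
    by (rule Bc_smult[OF shifts_pow[OF assms(1)] assms(3)])
  then show ?thesis
    using shifts_closed[OF assms(1)] g_mem(2)[OF assms(2)]
    by (simp add: C.smult_assoc1[symmetric] C.R.nat_pow_mult add.commute[of t] ac_simps del: Bc.simps)
qed

text \<open>Replacing \<open>x\<close> by \<open>p x\<close> lowers the exponent needed for
  \<open>p\<close> and keeps the one for \<open>q\<close>, and symmetrically for \<open>q x\<close>;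
  one more factor \<open>p + q\<close> distributes over these two elements. The induction on
  \<open>s + t\<close> takes the place of a binomial expansion. It extends nilpotency from the
  variables to linear forms.\<close>

lemma nilpotent_add:
  "p \<in> shifts 1 \<Longrightarrow> q \<in> shifts 1 \<Longrightarrow> x \<in> g j k \<Longrightarrow>
    (p [^]\<^bsub>R\<^esub> (s::nat)) \<odot>\<^bsub>C j\<^esub> x \<in> Bc b j (k + int s) \<Longrightarrow>
    (q [^]\<^bsub>R\<^esub> (t::nat)) \<odot>\<^bsub>C j\<^esub> x \<in> Bc b j (k + int t) \<Longrightarrow>
    \<exists>r::nat. ((p \<oplus>\<^bsub>R\<^esub> q) [^]\<^bsub>R\<^esub> r) \<odot>\<^bsub>C j\<^esub> x \<in> Bc b j (k + int r)"
proof (induction "s + t" arbitrary: s t x k rule: less_induct)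
  case less
  note pq = shifts_closed[OF less.prems(1)] shifts_closed[OF less.prems(2)]
  note x = g_mem(2)[OF less.prems(3)]
  show ?case
  proof (cases "s = 0 \<or> t = 0")
    case True
    then have "x \<in> Bc b j k" using less.prems x by (auto simp del: Bc.simps)
    then show ?thesis using x by (intro exI[of _ 0]) (simp del: Bc.simps)
  next
    case False
    then obtain s' t' where st: "s = Suc s'" "t = Suc t'" by (metis not0_implies_Suc)
    have px: "p \<odot>\<^bsub>C j\<^esub> x \<in> g j (k + 1)" "q \<odot>\<^bsub>C j\<^esub> x \<in> g j (k + 1)"
      using less.prems by (auto simp: shifts_def)
    have "(q [^]\<^bsub>R\<^esub> t) \<odot>\<^bsub>C j\<^esub> (p \<odot>\<^bsub>C j\<^esub> x) \<in> Bc b j (k + 1 + int t)"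
      using Bc_smult[OF less.prems(1,5)] pq x by (simp add: C.smult_left_comm ac_simps del: Bc.simps)
    moreover have "(p [^]\<^bsub>R\<^esub> s') \<odot>\<^bsub>C j\<^esub> (p \<odot>\<^bsub>C j\<^esub> x) \<in> Bc b j (k + 1 + int s')"
      using less.prems(4) pq x by (simp add: st C.smult_assoc1 ac_simps del: Bc.simps)
    ultimately obtain r1 :: nat where r1: "((p \<oplus>\<^bsub>R\<^esub> q) [^]\<^bsub>R\<^esub> r1) \<odot>\<^bsub>C j\<^esub> (p \<odot>\<^bsub>C j\<^esub> x) \<in> Bc b j (k + 1 + int r1)"
      using less.hyps[of s' t "p \<odot>\<^bsub>C j\<^esub> x" "k + 1"] less.prems(1,2) px st by auto
    have "(p [^]\<^bsub>R\<^esub> s) \<odot>\<^bsub>C j\<^esub> (q \<odot>\<^bsub>C j\<^esub> x) \<in> Bc b j (k + 1 + int s)"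
      using Bc_smult[OF less.prems(2,4)] pq x by (simp add: C.smult_left_comm ac_simps del: Bc.simps)
    moreover have "(q [^]\<^bsub>R\<^esub> t') \<odot>\<^bsub>C j\<^esub> (q \<odot>\<^bsub>C j\<^esub> x) \<in> Bc b j (k + 1 + int t')"
      using less.prems(5) pq x by (simp add: st C.smult_assoc1 ac_simps del: Bc.simps)
    ultimately obtain r2 :: nat where r2: "((p \<oplus>\<^bsub>R\<^esub> q) [^]\<^bsub>R\<^esub> r2) \<odot>\<^bsub>C j\<^esub> (q \<odot>\<^bsub>C j\<^esub> x) \<in> Bc b j (k + 1 + int r2)"
      using less.hyps[of s t' "q \<odot>\<^bsub>C j\<^esub> x" "k + 1"] less.prems(1,2) px st by auto
    let ?pq = "p \<oplus>\<^bsub>R\<^esub> q"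
    have pq1: "?pq \<in> shifts 1" by (rule shifts_add[OF less.prems(1,2)])
    have "(?pq [^]\<^bsub>R\<^esub> (r1 + r2)) \<odot>\<^bsub>C j\<^esub> (p \<odot>\<^bsub>C j\<^esub> x) \<oplus>\<^bsub>C j\<^esub> (?pq [^]\<^bsub>R\<^esub> (r1 + r2)) \<odot>\<^bsub>C j\<^esub> (q \<odot>\<^bsub>C j\<^esub> x)
        \<in> Bc b j (k + 1 + int (r1 + r2))"
      using Bc_pow_mono[OF pq1 px(1) r1, of r2] Bc_pow_mono[OF pq1 px(2) r2, of r1]
      by (simp add: add.commute[of r2] Bc_mem(3) del: Bc.simps)
    then have "(?pq [^]\<^bsub>R\<^esub> Suc (r1 + r2)) \<odot>\<^bsub>C j\<^esub> x \<in> Bc b j (k + int (Suc (r1 + r2)))"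
      using pq x
      by (simp add: C.smult_assoc1 C.smult_l_distr C.smult_r_distr ac_simps del: Bc.simps)
    then show ?thesis by blast
  qed
qed

end

section \<open>Multiplication by powers of the parameters and its connecting homomorphisms\<close>

text \<open>These are the properties of the submodules that the computation with cocycles needs.
  \<open>CN_colon0\<close> is weaker than \<open>CN_colon\<close>: in degree 0 the Cech module is
  \<open>M\<close> itself, where a colon quotient is annihilated by the parameters without being
  zero. In \<open>CN_updE\<close> the coefficient \<open>z\<close> is homogeneous, so that all
  relations built from it respect degrees.\<close>

locale filtered_complex = graded_complex R C g D CN
  for R :: "('a, 'r) ring_scheme" and C :: "nat \<Rightarrow> ('a, 'c, 'e) module_scheme"
    and g :: "nat \<Rightarrow> int \<Rightarrow> 'c set" and D :: "nat \<Rightarrow> 'c \<Rightarrow> 'c"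
    and CN :: "(nat \<Rightarrow> nat) \<Rightarrow> nat \<Rightarrow> 'c set" +
  fixes \<theta> :: "nat \<Rightarrow> 'a" and d :: nat
  assumes \<theta>_shifts1: "i < d \<Longrightarrow> \<theta> i \<in> shifts 1"
    and CN_zero: "CN (\<lambda>_. 0) j = {\<zero>\<^bsub>C j\<^esub>}"
    and CN_mono: "unused d b i \<Longrightarrow> CN b j \<subseteq> CN (put b i s) j"
    and CN_\<theta>: "unused d b i \<Longrightarrow> s > 0 \<Longrightarrow> x \<in> carrier (C j) \<Longrightarrow>
      (\<theta> i [^]\<^bsub>R\<^esub> s) \<odot>\<^bsub>C j\<^esub> x \<in> CN (put b i s) j"
    and CN_updE: "unused d b i \<Longrightarrow> s > 0 \<Longrightarrow> x \<in> CN (put b i s) j \<Longrightarrow> x \<in> g j k \<Longrightarrow>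
      \<exists>z\<in>g j (k - int s). x \<ominus>\<^bsub>C j\<^esub> (\<theta> i [^]\<^bsub>R\<^esub> s) \<odot>\<^bsub>C j\<^esub> z \<in> CN b j"
    \<comment> \<open>\<open>(N\<^sub>b : \<theta>\<^sub>i\<^sup>s) / N\<^sub>b\<close> is annihilated by the irrelevant ideal, hence vanishes in every proper localization\<close>
    and CN_colon: "unused d b i \<Longrightarrow> s > 0 \<Longrightarrow> x \<in> carrier (C (Suc j)) \<Longrightarrow>
      (\<theta> i [^]\<^bsub>R\<^esub> s) \<odot>\<^bsub>C (Suc j)\<^esub> x \<in> CN b (Suc j) \<Longrightarrow> x \<in> CN b (Suc j)"
    and CN_colon0: "unused d b i \<Longrightarrow> s > 0 \<Longrightarrow> x \<in> carrier (C 0) \<Longrightarrow>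
      (\<theta> i [^]\<^bsub>R\<^esub> s) \<odot>\<^bsub>C 0\<^esub> x \<in> CN b 0 \<Longrightarrow> l < d \<Longrightarrow> \<theta> l \<odot>\<^bsub>C 0\<^esub> x \<in> CN b 0"
    and nilpotent: "x \<in> Zc b j k \<Longrightarrow> i < d \<Longrightarrow>
      \<exists>s::nat. (\<theta> i [^]\<^bsub>R\<^esub> s) \<odot>\<^bsub>C j\<^esub> x \<in> Bc b j (k + int s)"
begin

lemma \<theta>_closed [simp]: "i < d \<Longrightarrow> \<theta> i \<in> carrier R"
  using \<theta>_shifts1 shifts_closed by blast

lemma \<theta>_g: "i < d \<Longrightarrow> x \<in> g j k \<Longrightarrow> \<theta> i \<odot>\<^bsub>C j\<^esub> x \<in> g j (k + 1)"
  using \<theta>_shifts1 by (simp add: shifts_def)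

lemma \<theta>_pow_g: "i < d \<Longrightarrow> x \<in> g j k \<Longrightarrow> (\<theta> i [^]\<^bsub>R\<^esub> s) \<odot>\<^bsub>C j\<^esub> x \<in> g j (k + int s)"
  using shifts_pow[OF \<theta>_shifts1] by (simp add: shifts_def)

lemma Bc_mono: "unused d b i \<Longrightarrow> Bc b j k \<subseteq> Bc (put b i s) j k"
  using CN_mono[of b i _ s] by (cases j) (simp_all, blast+)

lemma Zc_mono: "unused d b i \<Longrightarrow> Zc b j k \<subseteq> Zc (put b i s) j k"
  using CN_mono[of b i _ s] by (auto simp: Zc_def)

lemma \<theta>_shifts: "i < d \<Longrightarrow> \<theta> i \<in> shifts 1" "i < d \<Longrightarrow> \<theta> i [^]\<^bsub>R\<^esub> s \<in> shifts (int s)"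
  using \<theta>_shifts1 shifts_pow by blast+

text \<open>\<open>delta\<close> is the graph of the connecting homomorphism of the short exact sequence
  \<open>M/N \<rightarrow> M/N \<rightarrow> M/(N + \<theta>\<^sub>i\<^sup>s M)\<close>, on the level of cochains.\<close>

definition delta :: "(nat \<Rightarrow> nat) \<Rightarrow> nat \<Rightarrow> nat \<Rightarrow> nat \<Rightarrow> int \<Rightarrow> 'c \<Rightarrow> 'c \<Rightarrow> bool" where
  "delta b i s j k x y \<longleftrightarrow> x \<in> g j k \<and> y \<in> g (Suc j) (k - int s) \<and>
     D j x \<ominus>\<^bsub>C (Suc j)\<^esub> (\<theta> i [^]\<^bsub>R\<^esub> s) \<odot>\<^bsub>C (Suc j)\<^esub> y \<in> CN b (Suc j)"

context
  fixes b :: "nat \<Rightarrow> nat" and i s :: nat assumes b: "unused d b i" "s > 0"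
begin

lemma i_less [simp]: "i < d"
  using b by (simp add: unused_def)

lemma pow_closed [simp]: "\<theta> i [^]\<^bsub>R\<^esub> s \<in> carrier R"
  by simp

lemma delta_exists:
  assumes "x \<in> Zc (put b i s) j k" shows "\<exists>y. delta b i s j k x y"
  using CN_updE[OF b, of "D j x" "Suc j" k] assms by (auto simp: Zc_def delta_def D_g)

lemma delta_diff:
  assumes "delta b i s j k x y" "delta b i s j k x' y'"
  shows "delta b i s j k (x \<ominus>\<^bsub>C j\<^esub> x') (y \<ominus>\<^bsub>C (Suc j)\<^esub> y')"
proof -
  have c: "x \<in> carrier (C j)" "x' \<in> carrier (C j)" "y \<in> carrier (C (Suc j))" "y' \<in> carrier (C (Suc j))"
    using assms by (auto simp: delta_def g_mem)
  have "(D j x \<ominus>\<^bsub>C (Suc j)\<^esub> (\<theta> i [^]\<^bsub>R\<^esub> s) \<odot>\<^bsub>C (Suc j)\<^esub> y) \<ominus>\<^bsub>C (Suc j)\<^esub>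
      (D j x' \<ominus>\<^bsub>C (Suc j)\<^esub> (\<theta> i [^]\<^bsub>R\<^esub> s) \<odot>\<^bsub>C (Suc j)\<^esub> y') \<in> CN b (Suc j)"
    using assms by (auto simp: delta_def intro: CN_in)
  then show ?thesis
    using assms c b by (auto simp: delta_def D_diff C.smult_r_diff C.minus_minus_minus intro: g_in)
qed

lemma delta_smult:
  assumes "delta b i s j k x y" "r \<in> shifts e"
  shows "delta b i s j (k + e) (r \<odot>\<^bsub>C j\<^esub> x) (r \<odot>\<^bsub>C (Suc j)\<^esub> y)"
proof -
  have c: "x \<in> carrier (C j)" "y \<in> carrier (C (Suc j))" "r \<in> carrier R"
    using assms by (auto simp: delta_def g_mem shifts_def)
  have "r \<odot>\<^bsub>C (Suc j)\<^esub> (D j x \<ominus>\<^bsub>C (Suc j)\<^esub> (\<theta> i [^]\<^bsub>R\<^esub> s) \<odot>\<^bsub>C (Suc j)\<^esub> y) \<in> CN b (Suc j)"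
    using assms c by (auto simp: delta_def intro: CN_smult)
  moreover have "r \<odot>\<^bsub>C j\<^esub> x \<in> g j (k + e)" "r \<odot>\<^bsub>C (Suc j)\<^esub> y \<in> g (Suc j) (k - int s + e)"
    using assms by (auto simp: delta_def shifts_def)
  ultimately show ?thesis
    using c b
    by (simp add: delta_def D_smult C.smult_r_diff C.smult_left_comm[of r "\<theta> i [^]\<^bsub>R\<^esub> s"] algebra_simps)
qed

lemma delta_Zc1: "delta b i s j k x y \<Longrightarrow> x \<in> Zc (put b i s) j k"
proof -
  assume *: "delta b i s j k x y"
  then have c: "x \<in> carrier (C j)" "y \<in> carrier (C (Suc j))"
    by (auto simp: delta_def g_mem)
  have "D j x \<ominus>\<^bsub>C (Suc j)\<^esub> (\<theta> i [^]\<^bsub>R\<^esub> s) \<odot>\<^bsub>C (Suc j)\<^esub> y \<in> CN (put b i s) (Suc j)"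
    using * CN_mono[OF b(1)] by (auto simp: delta_def)
  then have "D j x \<in> CN (put b i s) (Suc j)"
    using C.subgroup_cancel(1)[OF CN_sub CN_\<theta>[OF b c(2)]] c by simp
  with * show ?thesis by (simp add: delta_def Zc_def)
qed

text \<open>Applying \<open>D\<close> to the defining congruence removes \<open>D x\<close> and
  leaves a power of \<open>\<theta> i\<close> times \<open>D y\<close> in the subcomplex; in
  positive degree \<open>CN_colon\<close> cancels that power.\<close>

lemma delta_Zc2: "delta b i s j k x y \<Longrightarrow> y \<in> Zc b (Suc j) (k - int s)"
proof -
  assume *: "delta b i s j k x y"
  then have c: "x \<in> carrier (C j)" "y \<in> carrier (C (Suc j))"
    by (auto simp: delta_def g_mem)
  have "D (Suc j) (D j x \<ominus>\<^bsub>C (Suc j)\<^esub> (\<theta> i [^]\<^bsub>R\<^esub> s) \<odot>\<^bsub>C (Suc j)\<^esub> y) \<in> CN b (Suc (Suc j))"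
    using * D_CN by (auto simp: delta_def)
  then have "\<zero>\<^bsub>C (Suc (Suc j))\<^esub> \<ominus>\<^bsub>C (Suc (Suc j))\<^esub>
      (\<theta> i [^]\<^bsub>R\<^esub> s) \<odot>\<^bsub>C (Suc (Suc j))\<^esub> D (Suc j) y \<in> CN b (Suc (Suc j))"
    using c b by (simp add: D_diff D_D D_smult)
  then have "D (Suc j) y \<in> CN b (Suc (Suc j))"
    using c C.subgroup_cancel(4)[OF CN_sub CN_mem(1)] by (simp add: CN_colon[OF b])
  with * show ?thesis by (simp add: delta_def Zc_def)
qed

text \<open>Well-definedness of the connecting homomorphism. Only \<open>D x\<close> enters, so
  \<open>x\<close> may be replaced by a cochain \<open>u\<close> of the larger subcomplex; writing
  \<open>u\<close> as a multiple \<open>\<theta> i ^ s z\<close> modulo \<open>CN b\<close> shows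
  that \<open>y\<close> and \<open>D z\<close> agree modulo \<open>CN b\<close> after cancelling the
  power.\<close>

lemma delta_Bc:
  assumes "delta b i s j k x y" "x \<in> Bc (put b i s) j k"
  shows "y \<in> Bc b (Suc j) (k - int s)"
proof -
  obtain u where u: "u \<in> CN (put b i s) j" "u \<in> g j k" "D j x = D j u"
    using BcE[OF assms(2)] by metis
  obtain z where z: "z \<in> g j (k - int s)" "u \<ominus>\<^bsub>C j\<^esub> (\<theta> i [^]\<^bsub>R\<^esub> s) \<odot>\<^bsub>C j\<^esub> z \<in> CN b j"
    using CN_updE[OF b u(1,2)] by blast
  have c: "u \<in> carrier (C j)" "z \<in> carrier (C j)" "y \<in> carrier (C (Suc j))"
    using u z assms by (auto simp: g_mem delta_def)
  let ?p = "\<lambda>j x. (\<theta> i [^]\<^bsub>R\<^esub> s) \<odot>\<^bsub>C j\<^esub> x"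
  have "D j u \<ominus>\<^bsub>C (Suc j)\<^esub> ?p (Suc j) (D j z) \<in> CN b (Suc j)"
    using D_CN[OF z(2)] c by (simp add: D_diff D_smult)
  moreover have "D j u \<ominus>\<^bsub>C (Suc j)\<^esub> ?p (Suc j) y \<in> CN b (Suc j)"
    using assms u by (simp add: delta_def)
  ultimately have "(D j u \<ominus>\<^bsub>C (Suc j)\<^esub> ?p (Suc j) (D j z)) \<ominus>\<^bsub>C (Suc j)\<^esub>
     (D j u \<ominus>\<^bsub>C (Suc j)\<^esub> ?p (Suc j) y) \<in> CN b (Suc j)"
    by (rule CN_mem)
  then have "?p (Suc j) (y \<ominus>\<^bsub>C (Suc j)\<^esub> D j z) \<in> CN b (Suc j)"
    using c by (simp add: C.minus_minus_minus C.smult_r_diff)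
      (simp add: a_minus_def C.minus_add C.a_ac)
  then have "y \<ominus>\<^bsub>C (Suc j)\<^esub> D j z \<in> CN b (Suc j)"
    using c by (simp add: CN_colon[OF b])
  with z assms show ?thesis by (auto simp: delta_def)
qed

text \<open>Exactness of the long sequence at the quotient by the larger submodule: a primitive
  \<open>e\<close> of \<open>y\<close> corrects \<open>x\<close> to a cocycle modulo the smaller
  one.\<close>

lemma delta_ker:
  assumes "delta b i s j k x y" "y \<in> Bc b (Suc j) (k - int s)"
  shows "\<exists>e\<in>g j (k - int s). x \<ominus>\<^bsub>C j\<^esub> (\<theta> i [^]\<^bsub>R\<^esub> s) \<odot>\<^bsub>C j\<^esub> e \<in> Zc b j k"
proof -
  let ?p = "\<lambda>j x. (\<theta> i [^]\<^bsub>R\<^esub> s) \<odot>\<^bsub>C j\<^esub> x"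
  obtain e where e: "e \<in> g j (k - int s)" "y \<ominus>\<^bsub>C (Suc j)\<^esub> D j e \<in> CN b (Suc j)"
    using assms(2) by auto
  have c: "x \<in> carrier (C j)" "e \<in> carrier (C j)" "y \<in> carrier (C (Suc j))"
    using e assms by (auto simp: g_mem delta_def)
  have "(D j x \<ominus>\<^bsub>C (Suc j)\<^esub> ?p (Suc j) y) \<oplus>\<^bsub>C (Suc j)\<^esub> ?p (Suc j) (y \<ominus>\<^bsub>C (Suc j)\<^esub> D j e) \<in> CN b (Suc j)"
    using assms e by (auto simp: delta_def intro!: CN_in CN_smult)
  also have "(D j x \<ominus>\<^bsub>C (Suc j)\<^esub> ?p (Suc j) y) \<oplus>\<^bsub>C (Suc j)\<^esub> ?p (Suc j) (y \<ominus>\<^bsub>C (Suc j)\<^esub> D j e)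
     = D j (x \<ominus>\<^bsub>C j\<^esub> ?p j e)"
    using c by (simp add: D_diff D_smult C.smult_r_diff)
      (simp add: a_minus_def C.minus_add C.a_ac C.r_neg1 C.r_neg2)
  finally show ?thesis
    using e assms \<theta>_pow_g[OF i_less e(1), of s] by (auto simp: Zc_def delta_def intro!: bexI[of _ e] g_in)
qed

text \<open>Exactness at the next spot: the primitive of \<open>\<theta> i ^ s y\<close> is itself a
  preimage of \<open>y\<close>.\<close>

lemma delta_surj:
  assumes "y \<in> Zc b (Suc j) k" "(\<theta> i [^]\<^bsub>R\<^esub> s) \<odot>\<^bsub>C (Suc j)\<^esub> y \<in> Bc b (Suc j) (k + int s)"
  shows "\<exists>x. delta b i s j (k + int s) x y"
proof -
  obtain e where e: "e \<in> g j (k + int s)"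
      "(\<theta> i [^]\<^bsub>R\<^esub> s) \<odot>\<^bsub>C (Suc j)\<^esub> y \<ominus>\<^bsub>C (Suc j)\<^esub> D j e \<in> CN b (Suc j)"
    using assms(2) by auto
  have c: "e \<in> carrier (C j)" "y \<in> carrier (C (Suc j))"
    using e assms by (auto simp: g_mem Zc_mem)
  have "D j e \<ominus>\<^bsub>C (Suc j)\<^esub> (\<theta> i [^]\<^bsub>R\<^esub> s) \<odot>\<^bsub>C (Suc j)\<^esub> y \<in> CN b (Suc j)"
    using CN_mem(4)[OF e(2)] c by (simp add: a_minus_def C.minus_add C.a_ac)
  with e assms show ?thesis by (auto simp: delta_def Zc_def)
qed

end

definition supp :: "(nat \<Rightarrow> nat) \<Rightarrow> nat set" where
  "supp b = {i. i < d \<and> b i > 0}"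

lemma finite_supp [simp]: "finite (supp b)"
  by (simp add: supp_def)

lemma card_supp_upd: "unused d b i \<Longrightarrow> s > 0 \<Longrightarrow> card (supp (put b i s)) = Suc (card (supp b))"
proof -
  assume "unused d b i" "s > 0"
  then have "supp (put b i s) = insert i (supp b)" "i \<notin> supp b"
    by (auto simp: supp_def unused_def put_def)
  then show ?thesis by simp
qed

lemma supp_free: "card (supp b) < d \<Longrightarrow> \<exists>i<d. unused d b i"
proof (rule ccontr)
  assume "card (supp b) < d" and *: "\<not> (\<exists>i<d. unused d b i)"
  have "supp b = {..<d}"
    unfolding supp_def using * by (force simp: unused_def)
  with \<open>card (supp b) < d\<close> show False by simp
qed

text \<open>The irrelevant ideal annihilates the cohomology of \<open>M/N\<^sub>b\<close> below the top degree. A class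
  killed by \<open>\<theta>\<^sub>i\<^sup>s\<close> comes from the cohomology of \<open>M/(N\<^sub>b + \<theta>\<^sub>i\<^sup>s M)\<close> in the previous degree.\<close>

lemma \<theta>_kills:
  assumes "card (supp b) + j < d" "x \<in> Zc b j k" "l < d"
  shows "\<theta> l \<odot>\<^bsub>C j\<^esub> x \<in> Bc b j (k + 1)"
  using assms
proof (induction j arbitrary: b k x)
  case 0
  obtain i where i: "i < d" "unused d b i" using supp_free 0 by force
  have x: "x \<in> g 0 k" "x \<in> carrier (C 0)" "D 0 x \<in> CN b (Suc 0)"
    using 0 by (auto simp: Zc_def g_mem)
  obtain s :: nat where s: "(\<theta> i [^]\<^bsub>R\<^esub> s) \<odot>\<^bsub>C 0\<^esub> x \<in> CN b 0"
    using nilpotent[OF 0(2) i(1)] by auto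
  \<comment> \<open>The exponent \<open>s\<close> may be 0, while the colon condition needs a
    positive one.\<close>
  have "(\<theta> i [^]\<^bsub>R\<^esub> Suc s) \<odot>\<^bsub>C 0\<^esub> x = \<theta> i \<odot>\<^bsub>C 0\<^esub> ((\<theta> i [^]\<^bsub>R\<^esub> s) \<odot>\<^bsub>C 0\<^esub> x)"
    using i x by (simp add: C.smult_assoc1[symmetric] C.R.m_comm)
  then have "(\<theta> i [^]\<^bsub>R\<^esub> Suc s) \<odot>\<^bsub>C 0\<^esub> x \<in> CN b 0"
    using s i by (simp add: CN_smult del: C.R.nat_pow_Suc)
  then show ?case
    using CN_colon0[OF i(2) _ x(2) _ 0(3), of "Suc s"] x 0 by (auto simp: \<theta>_g simp del: C.R.nat_pow_Suc)
next
  case (Suc j)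
  obtain i where i: "unused d b i" "i < d" using supp_free Suc.prems by force
  have x: "x \<in> g (Suc j) k" "x \<in> carrier (C (Suc j))" "D (Suc j) x \<in> CN b (Suc (Suc j))"
    using Suc by (auto simp: Zc_def g_mem)
  obtain s :: nat where "(\<theta> i [^]\<^bsub>R\<^esub> s) \<odot>\<^bsub>C (Suc j)\<^esub> x \<in> Bc b (Suc j) (k + int s)"
    using nilpotent[OF Suc.prems(2) i(2)] by blast
  then have "\<theta> i \<odot>\<^bsub>C (Suc j)\<^esub> ((\<theta> i [^]\<^bsub>R\<^esub> s) \<odot>\<^bsub>C (Suc j)\<^esub> x) \<in> Bc b (Suc j) (k + int s + 1)"
    by (rule Bc_smult[OF \<theta>_shifts(1)[OF i(2)]])
  then have *: "(\<theta> i [^]\<^bsub>R\<^esub> Suc s) \<odot>\<^bsub>C (Suc j)\<^esub> x \<in> Bc b (Suc j) (k + int (Suc s))"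
    using i x by (simp add: C.smult_assoc1[symmetric] C.R.m_comm algebra_simps del: Bc.simps)
  have s0: "Suc s > 0" by simp
  obtain y where y: "delta b i (Suc s) j (k + int (Suc s)) y x"
    using delta_surj[OF i(1) s0 Suc.prems(2) *] by blast
  \<comment> \<open>Dividing out one more parameter while going down one degree keeps the sum of
    support size and degree unchanged, so the bound by \<open>d\<close> survives.\<close>
  have "\<theta> l \<odot>\<^bsub>C j\<^esub> y \<in> Bc (put b i (Suc s)) j (k + int (Suc s) + 1)"
    using Suc.prems delta_Zc1[OF i(1) s0 y] i by (intro Suc.IH) (simp_all add: card_supp_upd)
  with delta_Bc[OF i(1) s0 delta_smult[OF i(1) s0 y \<theta>_shifts(1)[OF Suc.prems(3)]]]
  show ?case by (simp del: Bc.simps add: algebra_simps)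
qed

text \<open>By \<open>\<theta>_kills\<close> multiplication by \<open>\<theta> i\<close> is zero on
  this cohomology, so the long exact sequence makes the map induced by passing to the larger
  submodule injective.\<close>

lemma Bc_inj:
  assumes "card (supp b) + j < d" "unused d b i" "x \<in> Zc b j k" "x \<in> Bc (put b i 1) j k"
  shows "x \<in> Bc b j k"
proof -
  have b: "unused d b i" "(1::nat) > 0" and i: "i < d" using assms by (auto simp: unused_def)
  obtain y where y: "y \<in> CN (put b i 1) j" "y \<in> g j k" "D j x = D j y" "x \<ominus>\<^bsub>C j\<^esub> y \<in> Bc b j k"
    using BcE[OF assms(4)] by blast
  obtain z where z: "z \<in> g j (k - 1)" "y \<ominus>\<^bsub>C j\<^esub> \<theta> i \<odot>\<^bsub>C j\<^esub> z \<in> CN b j"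
    using CN_updE[OF b y(1,2)] i by auto
  have c: "x \<in> carrier (C j)" "y \<in> carrier (C j)" "z \<in> carrier (C j)"
    using assms y z by (auto simp: g_mem Zc_mem)
  have "D j y \<in> CN b (Suc j)" using assms(3) y by (simp add: Zc_def)
  moreover have "D j y \<ominus>\<^bsub>C (Suc j)\<^esub> \<theta> i \<odot>\<^bsub>C (Suc j)\<^esub> D j z \<in> CN b (Suc j)"
    using D_CN[OF z(2)] c i by (simp add: D_diff D_smult)
  ultimately have "\<theta> i \<odot>\<^bsub>C (Suc j)\<^esub> D j z \<in> CN b (Suc j)"
    using C.subgroup_cancel(4)[OF CN_sub] c i by (metis C.smult_closed D_closed \<theta>_closed)
  then have "D j z \<in> CN b (Suc j)"
    using CN_colon[OF b] c i by simp
  then have "\<theta> i \<odot>\<^bsub>C j\<^esub> z \<in> Bc b j k"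
    using \<theta>_kills[OF assms(1), of z "k - 1" i] z b i by (simp add: Zc_def)
  moreover have "y \<ominus>\<^bsub>C j\<^esub> \<theta> i \<odot>\<^bsub>C j\<^esub> z \<in> Bc b j k"
    using z y \<theta>_g[OF i z(1)] by (intro CN_Bc) (auto intro: g_in)
  ultimately have "y \<in> Bc b j k"
    using C.subgroup_cancel(1)[OF Bc_sub] c i by (metis)
  then show ?thesis
    using C.subgroup_cancel(1)[OF Bc_sub] c y(4) by (metis)
qed

section \<open>Iterated connecting homomorphisms\<close>

definition upd :: "(nat \<Rightarrow> nat) \<Rightarrow> nat list \<Rightarrow> nat \<Rightarrow> nat" where
  "upd b F = (\<lambda>i. if i \<in> set F then 1 else b i)"

lemma upd_Nil [simp]: "upd b [] = b"
  by (simp add: upd_def)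

lemma upd_upd1: "upd (put b i 1) F = upd b (i # F)" "upd (put b i (Suc 0)) F = upd b (i # F)"
  by (auto simp: upd_def put_def)

lemma upd_Cons: "upd b (i # F) = put (upd b F) i 1"
  by (auto simp: upd_def put_def)

text \<open>The composite of the connecting homomorphisms of the parameters in \<open>F\<close>,
  from degree 0 modulo \<open>upd b F\<close> to degree \<open>length F\<close> modulo
  \<open>b\<close>. The head of the list is undone last, so the tail works over
  \<open>put b i 1\<close>. A relation is used because every step determines its value only up to
  coboundaries.\<close>

fun rel :: "nat list \<Rightarrow> (nat \<Rightarrow> nat) \<Rightarrow> int \<Rightarrow> 'c \<Rightarrow> 'c \<Rightarrow> bool" where
  "rel [] b k u x \<longleftrightarrow> u \<in> Zc b 0 k \<and> x = u"
| "rel (i # F) b k u x \<longleftrightarrow>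
    (\<exists>y. rel F (put b i 1) k u y \<and> delta b i 1 (length F) (k - int (length F)) y x)"

definition admissible :: "nat list \<Rightarrow> (nat \<Rightarrow> nat) \<Rightarrow> bool" where
  "admissible F b \<longleftrightarrow> distinct F \<and> (\<forall>i\<in>set F. unused d b i)"

lemma admissible_Cons:
  assumes "admissible (i # F) b"
  shows "unused d b i" "i < d" "admissible F (put b i 1)" "admissible F b" "i \<notin> set F"
  using assms unfolding admissible_def unused_def put_def by (simp_all, metis)

lemma one_pos: "(1::nat) > 0" by simp

lemma rel_Zc1: "admissible F b \<Longrightarrow> rel F b k u x \<Longrightarrow> u \<in> Zc (upd b F) 0 k"
  by (induction F arbitrary: b x) (auto dest: admissible_Cons simp: upd_upd1(2)[symmetric])

lemma rel_Zc2: "admissible F b \<Longrightarrow> rel F b k u x \<Longrightarrow> x \<in> Zc b (length F) (k - int (length F))"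
proof (cases F)
  case (Cons i F')
  assume "admissible F b" "rel F b k u x"
  then show ?thesis
    using Cons delta_Zc2[OF admissible_Cons(1)[of i F' b] one_pos]
    by (fastforce simp: algebra_simps)
qed auto

lemma rel_exists: "admissible F b \<Longrightarrow> u \<in> Zc (upd b F) 0 k \<Longrightarrow> \<exists>x. rel F b k u x"
proof (induction F arbitrary: b)
  case (Cons i F)
  note a = admissible_Cons[OF Cons.prems(1)]
  obtain y where y: "rel F (put b i 1) k u y"
    using Cons.IH[OF a(3)] Cons.prems by (auto simp: upd_upd1)
  then show ?case
    using delta_exists[OF a(1) one_pos rel_Zc2[OF a(3) y]] by auto
qed auto

lemma rel_diff:
  "admissible F b \<Longrightarrow> rel F b k u x \<Longrightarrow> rel F b k u' x' \<Longrightarrow>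
    rel F b k (u \<ominus>\<^bsub>C 0\<^esub> u') (x \<ominus>\<^bsub>C (length F)\<^esub> x')"
proof (induction F arbitrary: b x x')
  case (Cons i F)
  note a = admissible_Cons[OF Cons.prems(1)]
  from Cons.prems obtain y y' where y: "rel F (put b i 1) k u y" "rel F (put b i 1) k u' y'"
    and "delta b i 1 (length F) (k - int (length F)) y x" "delta b i 1 (length F) (k - int (length F)) y' x'"
    by auto
  with delta_diff[OF a(1) one_pos] Cons.IH[OF a(3) y] show ?case
    by auto
qed (auto intro: Zc_in)

lemma rel_smult:
  "admissible F b \<Longrightarrow> rel F b k u x \<Longrightarrow> r \<in> shifts e \<Longrightarrow>
    rel F b (k + e) (r \<odot>\<^bsub>C 0\<^esub> u) (r \<odot>\<^bsub>C (length F)\<^esub> x)"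
proof (induction F arbitrary: b x)
  case (Cons i F)
  note a = admissible_Cons[OF Cons.prems(1)]
  from Cons.prems obtain y where y: "rel F (put b i 1) k u y"
    and "delta b i 1 (length F) (k - int (length F)) y x"
    by auto
  with delta_smult[OF a(1) one_pos _ Cons.prems(3)] Cons.IH[OF a(3) y Cons.prems(3)] show ?case
    by (fastforce simp: algebra_simps)
qed (auto intro: Zc_smult)

text \<open>Naturality of the connecting homomorphisms in the base: dividing out a further
  \<open>\<theta> l\<close> only weakens the congruences.\<close>

lemma rel_mono:
  "admissible F b \<Longrightarrow> rel F b k u x \<Longrightarrow> unused d b l \<Longrightarrow> l \<notin> set F \<Longrightarrow>
     rel F (put b l 1) k u x"
proof (induction F arbitrary: b x)
  case (Cons i F)
  note a = admissible_Cons[OF Cons.prems(1)]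
  from Cons.prems obtain y where y: "rel F (put b i 1) k u y"
    and d: "delta b i 1 (length F) (k - int (length F)) y x"
    by auto
  have "rel F (put (put b i 1) l 1) k u y"
    using Cons.prems by (intro Cons.IH[OF a(3) y]) (auto simp: unused_def put_def)
  moreover have "put (put b i 1) l 1 = put (put b l 1) i 1"
    using Cons.prems by (auto simp: fun_eq_iff put_def)
  moreover have "delta (put b l 1) i 1 (length F) (k - int (length F)) y x"
    using d CN_mono[of b l _ 1] Cons.prems by (auto simp: delta_def)
  ultimately show ?case by auto
qed (use Zc_mono in \<open>simp, blast\<close>)

text \<open>A cochain of the subcomplex represents the zero class, and by \<open>delta_Bc\<close>
  each step keeps it zero.\<close>

lemma rel_CN:
  "admissible F b \<Longrightarrow> rel F b k u x \<Longrightarrow> u \<in> CN (upd b F) 0 \<Longrightarrow>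
     x \<in> Bc b (length F) (k - int (length F))"
proof (induction F arbitrary: b x)
  case (Cons i F)
  note a = admissible_Cons[OF Cons.prems(1)]
  from Cons.prems obtain y where y: "rel F (put b i 1) k u y"
    and d: "delta b i 1 (length F) (k - int (length F)) y x"
    by auto
  have "y \<in> Bc (put b i 1) (length F) (k - int (length F))"
    using Cons.prems by (intro Cons.IH[OF a(3) y]) (simp add: upd_upd1)
  from delta_Bc[OF a(1) one_pos d this] show ?case
    by (simp add: algebra_simps del: Bc.simps)
qed (auto simp: Zc_def)

lemma rel_unique:
  assumes "admissible F b" "rel F b k u x" "rel F b k u y"
  shows "x \<ominus>\<^bsub>C (length F)\<^esub> y \<in> Bc b (length F) (k - int (length F))"
proof -
  have "u \<in> carrier (C 0)"
    using rel_Zc1[OF assms(1,2)] by (rule Zc_mem)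
  then show ?thesis
    using rel_CN[OF assms(1) rel_diff[OF assms]] by (simp add: CN_mem)
qed

text \<open>Two consecutive maps of a long exact sequence compose to zero: a class that lifts to the
  quotient not divided by \<open>\<theta> i\<close> is killed by the connecting homomorphism of
  \<open>\<theta> i\<close>. If \<open>i\<close> is not the head, the vanishing happens earlier in
  the chain and persists.\<close>

lemma rel_colon:
  "admissible F b \<Longrightarrow> rel F b k u x \<Longrightarrow> i \<in> set F \<Longrightarrow> u \<in> Zc (upd b (removeAll i F)) 0 k \<Longrightarrow>
     x \<in> Bc b (length F) (k - int (length F))"
proof (induction F arbitrary: b x)
  case (Cons l F)
  note a = admissible_Cons[OF Cons.prems(1)]
  from Cons.prems obtain y where y: "rel F (put b l 1) k u y"
    and d: "delta b l 1 (length F) (k - int (length F)) y x"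
    by auto
  show ?case
  proof (cases "i = l")
    case False
    have "y \<in> Bc (put b l 1) (length F) (k - int (length F))"
      using Cons.prems False by (intro Cons.IH[OF a(3) y]) (auto simp: upd_upd1)
    from delta_Bc[OF a(1) one_pos d this] show ?thesis
      by (simp add: algebra_simps del: Bc.simps)
  next
    case True
    let ?j = "length F" and ?k = "k - int (length F)"
    have "u \<in> Zc (upd b F) 0 k"
      using Cons.prems True a by simp
    then obtain z where z: "rel F b k u z"
      using rel_exists[OF a(4)] by blast
    have z': "z \<in> Zc b ?j ?k" by (rule rel_Zc2[OF a(4) z])
    have y': "y \<in> Zc (put b l 1) ?j ?k" by (rule rel_Zc2[OF a(3) y])
    have c: "z \<in> carrier (C ?j)" "y \<in> carrier (C ?j)" "x \<in> carrier (C (Suc ?j))"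
      using z' y' d by (auto simp: Zc_mem delta_def g_mem)
    \<comment> \<open>\<open>z\<close> is a value of \<open>u\<close> over the smaller base
      \<open>b\<close>; by naturality it is also one over the base of \<open>y\<close>, and two
      values of \<open>u\<close> differ by a coboundary.\<close>
    have B: "y \<ominus>\<^bsub>C ?j\<^esub> z \<in> Bc (put b l 1) ?j ?k"
      using a by (intro rel_unique[OF a(3) y] rel_mono[OF a(4) z])
    have "delta b l 1 ?j ?k z \<zero>\<^bsub>C (Suc ?j)\<^esub>"
      using z' c a by (auto simp: Zc_def delta_def g_mem)
    from delta_diff[OF a(1) one_pos d this] have "delta b l 1 ?j ?k (y \<ominus>\<^bsub>C ?j\<^esub> z) x"
      using c by simp
    from delta_Bc[OF a(1) one_pos this B] show ?thesis
      by (simp add: algebra_simps del: Bc.simps)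
  qed
qed simp

text \<open>By \<open>\<theta>_kills\<close> every class in this range is annihilated by
  \<open>\<theta> i\<close>, hence lies in the image of its connecting homomorphism; the preimages
  are treated in the same way, one degree lower.\<close>

lemma rel_surj:
  "admissible F b \<Longrightarrow> card (supp b) + length F < d \<Longrightarrow> x \<in> Zc b (length F) (k - int (length F)) \<Longrightarrow>
     \<exists>u y. rel F b k u y \<and> x \<ominus>\<^bsub>C (length F)\<^esub> y \<in> Bc b (length F) (k - int (length F))"
proof (induction F arbitrary: b x)
  case Nil
  then show ?case by (auto simp: Bc_mem Zc_mem simp del: Bc.simps intro!: exI[of _ x])
next
  case (Cons i F)
  note a = admissible_Cons[OF Cons.prems(1)]
  let ?j = "length F" and ?k = "k - int (length F)"
  have x: "x \<in> Zc b (Suc ?j) (?k - 1)"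
    using Cons.prems by (simp add: algebra_simps)
  have "\<theta> i \<odot>\<^bsub>C (Suc ?j)\<^esub> x \<in> Bc b (Suc ?j) (?k - 1 + 1)"
    using Cons.prems a x by (intro \<theta>_kills) auto
  then obtain y where y: "delta b i 1 ?j ?k y x"
    using delta_surj[OF a(1) one_pos x] a by (auto simp del: Bc.simps)
  obtain u z where uz: "rel F (put b i 1) k u z" "y \<ominus>\<^bsub>C ?j\<^esub> z \<in> Bc (put b i 1) ?j ?k"
    using Cons.IH[OF a(3) _ delta_Zc1[OF a(1) one_pos y]] Cons.prems a by (auto simp: card_supp_upd)
  obtain w where w: "delta b i 1 ?j ?k z w"
    using delta_exists[OF a(1) one_pos rel_Zc2[OF a(3) uz(1)]] by blast
  have "x \<ominus>\<^bsub>C (Suc ?j)\<^esub> w \<in> Bc b (Suc ?j) (?k - 1)"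
    using delta_Bc[OF a(1) one_pos delta_diff[OF a(1) one_pos y w] uz(2)] by simp
  with uz w show ?case by (auto simp: algebra_simps simp del: Bc.simps)
qed

text \<open>The kernel of the composite is described by an arbitrary subgroup \<open>I\<close>
  containing its expected generators, which spares an explicit sum over subsets. The bound
  \<open>\<le> d\<close> suffices because surjectivity is applied to the tail of the list
  only.\<close>

lemma rel_ker:
  "admissible F b \<Longrightarrow> card (supp b) + length F \<le> d \<Longrightarrow> rel F b k u x \<Longrightarrow>
     x \<in> Bc b (length F) (k - int (length F)) \<Longrightarrow> subgroup I (add_monoid (C 0)) \<Longrightarrow>
     g 0 k \<inter> CN (upd b F) 0 \<subseteq> I \<Longrightarrow> (\<And>i. i \<in> set F \<Longrightarrow> Zc (upd b (removeAll i F)) 0 k \<subseteq> I) \<Longrightarrow>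
     u \<in> I"
proof (induction F arbitrary: b u x)
  case (Cons i F)
  note a = admissible_Cons[OF Cons.prems(1)]
  let ?j = "length F" and ?k = "k - int (length F)"
  from Cons.prems obtain y where y: "rel F (put b i 1) k u y" and d: "delta b i 1 ?j ?k y x"
    by auto
  have x: "x \<in> Bc b (Suc ?j) (?k - int 1)"
    using Cons.prems(4) by (simp add: algebra_simps del: Bc.simps)
  obtain e where e: "e \<in> g ?j (?k - 1)" "y \<ominus>\<^bsub>C ?j\<^esub> \<theta> i \<odot>\<^bsub>C ?j\<^esub> e \<in> Zc b ?j ?k"
    using delta_ker[OF a(1) one_pos d x] a by auto
  \<comment> \<open>\<open>w\<close> is a cocycle even without \<open>\<theta> i\<close> divided
    out, so it lies in \<open>I\<close>. It carries the part of \<open>y\<close> that lifts to the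
    smaller submodule, and \<open>u\<close> minus \<open>w\<close> already goes to zero one step
    earlier.\<close>
  obtain w z where wz: "rel F b k w z"
      "(y \<ominus>\<^bsub>C ?j\<^esub> \<theta> i \<odot>\<^bsub>C ?j\<^esub> e) \<ominus>\<^bsub>C ?j\<^esub> z \<in> Bc b ?j ?k"
    using rel_surj[OF a(4) _ e(2)] Cons.prems(2) by auto
  have c: "y \<in> carrier (C ?j)" "e \<in> carrier (C ?j)" "z \<in> carrier (C ?j)"
      "u \<in> carrier (C 0)" "w \<in> carrier (C 0)"
    using e rel_Zc2[OF a(4) wz(1)] rel_Zc1[OF a(4) wz(1)] rel_Zc2[OF a(3) y] rel_Zc1[OF a(3) y]
    by (auto simp: Zc_mem g_mem)
  have r: "rel F (put b i 1) k (u \<ominus>\<^bsub>C 0\<^esub> w) (y \<ominus>\<^bsub>C ?j\<^esub> z)"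
    using a by (intro rel_diff[OF a(3) y] rel_mono[OF a(4) wz(1)])
  have "\<theta> i \<odot>\<^bsub>C ?j\<^esub> e \<in> CN (put b i 1) ?j"
    using CN_\<theta>[OF a(1) one_pos c(2)] a by simp
  then have "\<theta> i \<odot>\<^bsub>C ?j\<^esub> e \<in> Bc (put b i 1) ?j ?k"
    using \<theta>_g[OF a(2) e(1)] by (intro CN_Bc) auto
  then have "((y \<ominus>\<^bsub>C ?j\<^esub> \<theta> i \<odot>\<^bsub>C ?j\<^esub> e) \<ominus>\<^bsub>C ?j\<^esub> z) \<oplus>\<^bsub>C ?j\<^esub> \<theta> i \<odot>\<^bsub>C ?j\<^esub> e \<in> Bc (put b i 1) ?j ?k"
    using subsetD[OF Bc_mono[OF a(1)] wz(2)] by (simp add: Bc_mem(3))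
  also have "((y \<ominus>\<^bsub>C ?j\<^esub> \<theta> i \<odot>\<^bsub>C ?j\<^esub> e) \<ominus>\<^bsub>C ?j\<^esub> z) \<oplus>\<^bsub>C ?j\<^esub> \<theta> i \<odot>\<^bsub>C ?j\<^esub> e = y \<ominus>\<^bsub>C ?j\<^esub> z"
    using c a by (simp add: a_minus_def C.a_ac C.r_neg C.r_neg1 C.r_neg2)
  finally have B: "y \<ominus>\<^bsub>C ?j\<^esub> z \<in> Bc (put b i 1) ?j ?k" .
  have 1: "u \<ominus>\<^bsub>C 0\<^esub> w \<in> I"
  proof (rule Cons.IH[OF a(3) _ r B Cons.prems(5)])
    show "card (supp (put b i 1)) + length F \<le> d"
      using Cons.prems(2) a by (simp add: card_supp_upd)
    show "g 0 k \<inter> CN (upd (put b i 1) F) 0 \<subseteq> I"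
      using Cons.prems(6) by (simp add: upd_upd1)
    show "Zc (upd (put b i 1) (removeAll i' F)) 0 k \<subseteq> I" if "i' \<in> set F" for i'
      using Cons.prems(7)[of i'] that a by (auto simp: upd_upd1)
  qed
  have "w \<in> I"
    using Cons.prems(7)[of i] rel_Zc1[OF a(4) wz(1)] a by auto
  with 1 c show ?case
    using C.subgroup_cancel(1)[OF Cons.prems(5)] by metis
qed auto

end

section \<open>Modules as directed unions of images, direct sums and quotients\<close>

text \<open>Finitely many elements of \<open>Q\<close> have preimages under one common map
  \<open>\<pi> c\<close>, so every module law is inherited from \<open>M\<close>. A single map gives
  quotients; the maps sending \<open>x\<close> to \<open>x / f ^ a\<close> give localizations, where
  in general no single one of them is onto.\<close>

lemma module_directed_image:
  fixes \<pi> :: "'i \<Rightarrow> 'b \<Rightarrow> 'q"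
  assumes "module R M"
    and carrier: "carrier Q = (\<Union>a. \<pi> a ` carrier M)"
    and directed: "\<And>a b. \<exists>c. \<pi> a ` carrier M \<subseteq> \<pi> c ` carrier M \<and> \<pi> b ` carrier M \<subseteq> \<pi> c ` carrier M"
    and add: "\<And>a x y. x \<in> carrier M \<Longrightarrow> y \<in> carrier M \<Longrightarrow> \<pi> a (x \<oplus>\<^bsub>M\<^esub> y) = \<pi> a x \<oplus>\<^bsub>Q\<^esub> \<pi> a y"
    and smult: "\<And>a r x. r \<in> carrier R \<Longrightarrow> x \<in> carrier M \<Longrightarrow> \<pi> a (r \<odot>\<^bsub>M\<^esub> x) = r \<odot>\<^bsub>Q\<^esub> \<pi> a x"
    and zero: "\<And>a. \<pi> a \<zero>\<^bsub>M\<^esub> = \<zero>\<^bsub>Q\<^esub>"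
  shows "module R Q"
proof -
  interpret module R M by fact
  have two: "\<exists>a u v. x = \<pi> a u \<and> y = \<pi> a v \<and> u \<in> carrier M \<and> v \<in> carrier M"
    if "x \<in> carrier Q" "y \<in> carrier Q" for x y
  proof -
    obtain a b where "x \<in> \<pi> a ` carrier M" "y \<in> \<pi> b ` carrier M"
      using \<open>x \<in> carrier Q\<close> \<open>y \<in> carrier Q\<close> carrier by auto
    then show ?thesis using directed[of a b] by blast
  qed
  have three: "\<exists>a u v w. x = \<pi> a u \<and> y = \<pi> a v \<and> z = \<pi> a w \<and> u \<in> carrier M \<and> v \<in> carrier M \<and> w \<in> carrier M"
    if "x \<in> carrier Q" "y \<in> carrier Q" "z \<in> carrier Q" for x y z
  proof -
    obtain a u v where "x = \<pi> a u" "y = \<pi> a v" "u \<in> carrier M" "v \<in> carrier M"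
      using two \<open>x \<in> carrier Q\<close> \<open>y \<in> carrier Q\<close> by blast
    moreover obtain b where "z \<in> \<pi> b ` carrier M" using carrier \<open>z \<in> carrier Q\<close> by auto
    moreover obtain c where "\<pi> a ` carrier M \<subseteq> \<pi> c ` carrier M" "\<pi> b ` carrier M \<subseteq> \<pi> c ` carrier M"
      using directed[of a b] by blast
    ultimately have "x \<in> \<pi> c ` carrier M" "y \<in> \<pi> c ` carrier M" "z \<in> \<pi> c ` carrier M"
      by auto
    then show ?thesis by blast
  qed
  have mem: "\<pi> a u \<in> carrier Q" if "u \<in> carrier M" for a u
    using that carrier by auto
  show ?thesis
  proof (rule moduleI)
    show "abelian_group Q"
    proof (rule abelian_groupI)
      fix x y assume "x \<in> carrier Q" "y \<in> carrier Q"
      then obtain a u v where "x = \<pi> a u" "y = \<pi> a v" "u \<in> carrier M" "v \<in> carrier M"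
        using two by meson
      then show "x \<oplus>\<^bsub>Q\<^esub> y \<in> carrier Q" "x \<oplus>\<^bsub>Q\<^esub> y = y \<oplus>\<^bsub>Q\<^esub> x"
        using mem by (simp_all add: add[symmetric] M.a_comm)
    next
      fix x y z assume "x \<in> carrier Q" "y \<in> carrier Q" "z \<in> carrier Q"
      then obtain a u v w where "x = \<pi> a u" "y = \<pi> a v" "z = \<pi> a w"
          "u \<in> carrier M" "v \<in> carrier M" "w \<in> carrier M"
        using three by meson
      then show "x \<oplus>\<^bsub>Q\<^esub> y \<oplus>\<^bsub>Q\<^esub> z = x \<oplus>\<^bsub>Q\<^esub> (y \<oplus>\<^bsub>Q\<^esub> z)"
        by (simp add: add[symmetric] M.a_assoc)
    next
      show "\<zero>\<^bsub>Q\<^esub> \<in> carrier Q" using zero mem by (metis M.zero_closed)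
    next
      fix x assume "x \<in> carrier Q"
      then obtain a u where u: "x = \<pi> a u" "u \<in> carrier M" using carrier by auto
      then show "\<zero>\<^bsub>Q\<^esub> \<oplus>\<^bsub>Q\<^esub> x = x"
        using add[of "\<zero>\<^bsub>M\<^esub>" u a] zero[of a] by simp
      have "\<pi> a (\<ominus>\<^bsub>M\<^esub> u) \<oplus>\<^bsub>Q\<^esub> x = \<zero>\<^bsub>Q\<^esub>"
        using u add[of "\<ominus>\<^bsub>M\<^esub> u" u a] zero[of a] by (simp add: M.l_neg)
      then show "\<exists>y\<in>carrier Q. y \<oplus>\<^bsub>Q\<^esub> x = \<zero>\<^bsub>Q\<^esub>"
        using u mem by blast
    qed
  next
    fix r x assume "r \<in> carrier R" "x \<in> carrier Q"
    then obtain a u where "x = \<pi> a u" "u \<in> carrier M" using carrier by auto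
    then show "r \<odot>\<^bsub>Q\<^esub> x \<in> carrier Q"
      using \<open>r \<in> carrier R\<close> mem by (simp add: smult[symmetric])
  next
    fix r s x assume rs: "r \<in> carrier R" "s \<in> carrier R" and "x \<in> carrier Q"
    then obtain a u where u: "x = \<pi> a u" "u \<in> carrier M" using carrier by auto
    show "(r \<oplus>\<^bsub>R\<^esub> s) \<odot>\<^bsub>Q\<^esub> x = r \<odot>\<^bsub>Q\<^esub> x \<oplus>\<^bsub>Q\<^esub> s \<odot>\<^bsub>Q\<^esub> x"
      using rs u by (simp add: smult[symmetric] add[symmetric] smult_l_distr)
    show "(r \<otimes>\<^bsub>R\<^esub> s) \<odot>\<^bsub>Q\<^esub> x = r \<odot>\<^bsub>Q\<^esub> (s \<odot>\<^bsub>Q\<^esub> x)"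
      using rs u by (simp add: smult[symmetric] smult_assoc1)
  next
    fix r x y assume r: "r \<in> carrier R" and "x \<in> carrier Q" "y \<in> carrier Q"
    then obtain a u v where "x = \<pi> a u" "y = \<pi> a v" "u \<in> carrier M" "v \<in> carrier M"
      using two by meson
    then show "r \<odot>\<^bsub>Q\<^esub> (x \<oplus>\<^bsub>Q\<^esub> y) = r \<odot>\<^bsub>Q\<^esub> x \<oplus>\<^bsub>Q\<^esub> r \<odot>\<^bsub>Q\<^esub> y"
      using r by (simp add: smult[symmetric] add[symmetric] smult_r_distr)
  next
    fix x assume "x \<in> carrier Q"
    then obtain a u where "x = \<pi> a u" "u \<in> carrier M" using carrier by auto
    then show "\<one>\<^bsub>R\<^esub> \<odot>\<^bsub>Q\<^esub> x = x"
      using smult[of "\<one>\<^bsub>R\<^esub>" u a] by simp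
  qed (rule R.is_cring)
qed

lemma module_cong:
  assumes "module R M" "carrier Q = carrier M" "zero Q = zero M" "add Q = add M" "smult Q = smult M"
  shows "module R Q"
  by (rule module_directed_image[OF assms(1), where \<pi> = "\<lambda>_ x. x"]) (auto simp: assms)

lemma module_restrict:
  assumes "module R M" "submodule N R M"
    "carrier Q = N" "zero Q = zero M" "add Q = add M" "smult Q = smult M"
  shows "module R Q"
  by (rule module_cong[OF submodule.submodule_is_module[OF assms(2,1)]]) (auto simp: assms)

lemma module_direct_sum:
  assumes "cring R" "\<And>i. i \<in> I \<Longrightarrow> module R (N i)"
  shows "module R (direct_sum I N)"
proof -
  have ag: "abelian_group (N i)" if "i \<in> I" for i
    using assms(2)[OF that] by (simp add: module_def)
  show ?thesis
  proof (rule moduleI[OF assms(1)])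
    show "abelian_group (direct_sum I N)"
    proof (rule abelian_groupI)
      fix x assume x: "x \<in> carrier (direct_sum I N)"
      have "(\<lambda>i\<in>I. \<ominus>\<^bsub>N i\<^esub> x i) \<oplus>\<^bsub>direct_sum I N\<^esub> x = \<zero>\<^bsub>direct_sum I N\<^esub>"
        "(\<lambda>i\<in>I. \<ominus>\<^bsub>N i\<^esub> x i) \<in> carrier (direct_sum I N)"
        using x ag by (auto simp: direct_sum_def abelian_group.l_neg abelian_group.a_inv_closed PiE_iff
            intro!: restrict_ext)
      then show "\<exists>y\<in>carrier (direct_sum I N). y \<oplus>\<^bsub>direct_sum I N\<^esub> x = \<zero>\<^bsub>direct_sum I N\<^esub>"
        by blast
      show "\<zero>\<^bsub>direct_sum I N\<^esub> \<oplus>\<^bsub>direct_sum I N\<^esub> x = x"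
        using x ag by (auto simp: direct_sum_def abelian_monoid.l_zero[OF abelian_group.axioms(1)]
            abelian_monoid.zero_closed[OF abelian_group.axioms(1)] PiE_iff extensional_def restrict_def)
    qed (use ag in \<open>auto simp: direct_sum_def abelian_monoid.a_closed[OF abelian_group.axioms(1)]
          abelian_monoid.zero_closed[OF abelian_group.axioms(1)]
          abelian_monoid.a_assoc[OF abelian_group.axioms(1)] abelian_monoid.a_comm[OF abelian_group.axioms(1)]
          abelian_monoid.a_lcomm[OF abelian_group.axioms(1)]
          PiE_iff intro!: restrict_ext\<close>)
    fix x assume x: "x \<in> carrier (direct_sum I N)"
    show "\<one>\<^bsub>R\<^esub> \<odot>\<^bsub>direct_sum I N\<^esub> x = x"
      using x assms(2) by (auto simp: direct_sum_def module.smult_one PiE_iff extensional_def restrict_def)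
  qed (auto simp: direct_sum_def PiE_iff module.smult_closed[OF assms(2)] module.smult_assoc1[OF assms(2)]
        module.smult_l_distr[OF assms(2)] module.smult_r_distr[OF assms(2)] intro!: restrict_ext)
qed

context
  fixes R :: "('a, 'r) ring_scheme" and M :: "('a, 'b) gmodule" and N :: "'b set"
  assumes mod: "module R M" and sub: "submodule N R M"
begin

interpretation M: module R M by (rule mod)

lemma coset_eq_iff:
  assumes "x \<in> carrier M" "y \<in> carrier M"
  shows "N +>\<^bsub>M\<^esub> x = N +>\<^bsub>M\<^esub> y \<longleftrightarrow> x \<ominus>\<^bsub>M\<^esub> y \<in> N"
proof -
  interpret abelian_subgroup N M
    using sub M.abelian_group_axioms
    by (intro abelian_subgroupI3) (auto simp: submodule_def additive_subgroup_def)
  have "x \<in> N +>\<^bsub>M\<^esub> y \<longleftrightarrow> x \<ominus>\<^bsub>M\<^esub> y \<in> N"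
    using a_rcos_module[OF assms(2,1)] by (simp add: a_minus_def)
  moreover have "N +>\<^bsub>M\<^esub> x = N +>\<^bsub>M\<^esub> y \<longleftrightarrow> x \<in> N +>\<^bsub>M\<^esub> y"
    using a_repr_independence'[OF _ assms(2), of x] a_rcos_self[OF assms(1)] by blast
  ultimately show ?thesis by simp
qed

lemma coset_self: "x \<in> carrier M \<Longrightarrow> x \<in> N +>\<^bsub>M\<^esub> x"
  using M.subgroup_mem(1)[of N] sub by (force simp: a_r_coset_def' submodule_def)

lemma mem_coset_iff:
  assumes "x \<in> carrier M"
  shows "y \<in> N +>\<^bsub>M\<^esub> x \<longleftrightarrow> y \<in> carrier M \<and> y \<ominus>\<^bsub>M\<^esub> x \<in> N"
proof -
  have sg: "subgroup N (add_monoid M)" using sub by (simp add: submodule_def)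
  show ?thesis
  proof
    assume "y \<in> N +>\<^bsub>M\<^esub> x"
    then obtain z where "z \<in> N" "y = z \<oplus>\<^bsub>M\<^esub> x" by (auto simp: a_r_coset_def')
    then show "y \<in> carrier M \<and> y \<ominus>\<^bsub>M\<^esub> x \<in> N"
      using assms M.subgroup_mem(2)[OF sg] by (simp add: M.minus_add_cancel)
  next
    assume "y \<in> carrier M \<and> y \<ominus>\<^bsub>M\<^esub> x \<in> N"
    then show "y \<in> N +>\<^bsub>M\<^esub> x"
      using assms M.minus_add_cancel(1)[of y x] by (simp add: a_r_coset_def', metis)
  qed
qed

lemma carrier_quotient: "carrier (quotient_gmodule M N) = (\<lambda>x. N +>\<^bsub>M\<^esub> x) ` carrier M"
  by (auto simp: quotient_gmodule_def A_RCOSETS_def' )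

lemma quotient_zero: "\<zero>\<^bsub>quotient_gmodule M N\<^esub> = N +>\<^bsub>M\<^esub> \<zero>\<^bsub>M\<^esub>"
proof -
  have "N \<subseteq> carrier M" using M.subgroup_mem(2)[of N] sub by (auto simp: submodule_def)
  then show ?thesis by (auto simp: quotient_gmodule_def a_r_coset_def' subset_eq)
qed

lemma quotient_add:
  assumes "x \<in> carrier M" "y \<in> carrier M"
  shows "(N +>\<^bsub>M\<^esub> x) \<oplus>\<^bsub>quotient_gmodule M N\<^esub> (N +>\<^bsub>M\<^esub> y) = N +>\<^bsub>M\<^esub> (x \<oplus>\<^bsub>M\<^esub> y)"
proof -
  interpret abelian_subgroup N M
    using sub M.abelian_group_axioms
    by (intro abelian_subgroupI3) (auto simp: submodule_def additive_subgroup_def)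
  show ?thesis using a_rcos_sum[OF assms] by (simp add: quotient_gmodule_def)
qed

text \<open>In the quotient a scalar acts by a union over all representatives; they all contribute
  the same coset, so the union collapses.\<close>

lemma quotient_smult:
  assumes "r \<in> carrier R" "x \<in> carrier M"
  shows "r \<odot>\<^bsub>quotient_gmodule M N\<^esub> (N +>\<^bsub>M\<^esub> x) = N +>\<^bsub>M\<^esub> (r \<odot>\<^bsub>M\<^esub> x)"
proof -
  have *: "N +>\<^bsub>M\<^esub> (r \<odot>\<^bsub>M\<^esub> y) = N +>\<^bsub>M\<^esub> (r \<odot>\<^bsub>M\<^esub> x)" if "y \<in> N +>\<^bsub>M\<^esub> x" for y
    using that assms submodule.smult_closed[OF sub assms(1), of "y \<ominus>\<^bsub>M\<^esub> x"]
    by (simp add: coset_eq_iff mem_coset_iff M.smult_r_diff)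
  have "(\<Union>y\<in>N +>\<^bsub>M\<^esub> x. N +>\<^bsub>M\<^esub> (r \<odot>\<^bsub>M\<^esub> y)) = N +>\<^bsub>M\<^esub> (r \<odot>\<^bsub>M\<^esub> x)"
    using coset_self[OF assms(2)] by (intro SUP_eq_const *) blast+
  then show ?thesis by (simp add: quotient_gmodule_def)
qed

lemma component_quotient: "component (quotient_gmodule M N) k = (\<lambda>x. N +>\<^bsub>M\<^esub> x) ` component M k"
  by (simp add: quotient_gmodule_def)

lemma module_quotient: "module R (quotient_gmodule M N)"
  by (rule module_directed_image[OF mod, where \<pi> = "\<lambda>_::unit. \<lambda>x. N +>\<^bsub>M\<^esub> x"])
    (auto simp: carrier_quotient quotient_add quotient_smult quotient_zero)

end

section \<open>Degrees, linear forms and the irrelevant ideal\<close>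

lemma mpoly_ring_simps [simp]:
  "mult (mpoly_ring n) = (*)" "one (mpoly_ring n) = 1" "zero (mpoly_ring n) = 0" "add (mpoly_ring n) = (+)"
  by (simp_all add: mpoly_ring_def)

lemma mem_mpoly_ring: "p \<in> carrier (mpoly_ring n) \<longleftrightarrow> (\<forall>m\<in>Poly_Mapping.keys p. Poly_Mapping.keys m \<subseteq> {..<n})"
  by (simp add: mpoly_ring_def)

lemma mpoly_ring_add [simp]:
  "p \<in> carrier (mpoly_ring n) \<Longrightarrow> q \<in> carrier (mpoly_ring n) \<Longrightarrow> p + q \<in> carrier (mpoly_ring n)"
  using Poly_Mapping.keys_add[of p q] by (auto simp: mem_mpoly_ring dest!: subsetD)

lemma mpoly_ring_mult [simp]:
  assumes "p \<in> carrier (mpoly_ring n)" "q \<in> carrier (mpoly_ring n)"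
  shows "p * q \<in> carrier (mpoly_ring n)"
proof -
  have "Poly_Mapping.keys m \<subseteq> {..<n}" if "m \<in> Poly_Mapping.keys (p * q)" for m
  proof -
    from that obtain a b where "a \<in> Poly_Mapping.keys p" "b \<in> Poly_Mapping.keys q" "m = a + b"
      using keys_mult[of p q] by blast
    then show ?thesis
      using assms Poly_Mapping.keys_add[of a b] by (force simp: mem_mpoly_ring)
  qed
  then show ?thesis by (simp add: mem_mpoly_ring)
qed

lemma mpoly_ring_uminus [simp]: "p \<in> carrier (mpoly_ring n) \<Longrightarrow> - p \<in> carrier (mpoly_ring n)"
  by (simp add: mem_mpoly_ring in_keys_iff)

lemma mpoly_ring_0_1 [simp]: "0 \<in> carrier (mpoly_ring n)" "1 \<in> carrier (mpoly_ring n)"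
  by (simp_all add: mem_mpoly_ring)

lemma mpoly_ring_power [simp]: "p \<in> carrier (mpoly_ring n) \<Longrightarrow> p ^ s \<in> carrier (mpoly_ring n)"
  by (induction s) simp_all

lemma mpoly_ring_prod: "(\<And>v. v \<in> A \<Longrightarrow> f v \<in> carrier (mpoly_ring n)) \<Longrightarrow> prod f A \<in> carrier (mpoly_ring n)"
  by (induction A rule: infinite_finite_induct) auto

lemma Var_closed [simp]: "v < n \<Longrightarrow> (Var v :: 'k::field mpoly) \<in> carrier (mpoly_ring n)"
  by (simp add: mem_mpoly_ring Var_def)

lemma Const_closed [simp]: "Const c \<in> carrier (mpoly_ring n)"
  by (simp add: mem_mpoly_ring Const_def)

lemma var_prod_closed [simp]: "F \<subseteq> {..<n} \<Longrightarrow> (var_prod F :: 'k::field mpoly) \<in> carrier (mpoly_ring n)"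
  by (auto simp: var_prod_def intro!: mpoly_ring_prod)

lemma cring_mpoly_ring: "cring (mpoly_ring n)"
proof (rule cringI)
  show "abelian_group (mpoly_ring n)"
    by (rule abelian_groupI) (auto simp: algebra_simps intro: bexI[of _ "- _"])
  show "comm_monoid (mpoly_ring n)"
    by unfold_locales (auto simp: algebra_simps)
qed (simp add: algebra_simps)

lemma mpoly_ring_pow [simp]: "p [^]\<^bsub>mpoly_ring n\<^esub> (s::nat) = p ^ s"
  by (induction s) (simp_all add: nat_pow_def mult.commute)

lemma mpoly_ring_a_inv [simp]: "p \<in> carrier (mpoly_ring n) \<Longrightarrow> \<ominus>\<^bsub>mpoly_ring n\<^esub> p = - p"
proof -
  interpret cring "mpoly_ring n" by (rule cring_mpoly_ring)
  show "p \<in> carrier (mpoly_ring n) \<Longrightarrow> \<ominus>\<^bsub>mpoly_ring n\<^esub> p = - p"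
    using minus_equality[of "- p" p] by simp
qed

lemma Const_simps: "Const 0 = 0" "Const 1 = 1" "Const (a + b) = Const a + Const b" "Const (a * b) = Const a * Const b"
  by (simp_all add: Const_def single_add mult_single)

lemma monom_degree_eq:
  assumes "finite A" "Poly_Mapping.keys m \<subseteq> A"
  shows "monom_degree m = (\<Sum>v\<in>A. Poly_Mapping.lookup m v)"
  unfolding monom_degree_def using assms by (intro sum.mono_neutral_left) (auto simp: in_keys_iff)

lemma monom_degree_add: "monom_degree (a + b) = monom_degree a + monom_degree b"
proof -
  let ?A = "Poly_Mapping.keys a \<union> Poly_Mapping.keys b"
  show ?thesis
    using Poly_Mapping.keys_add[of a b]
    by (simp add: monom_degree_eq[of ?A] sum.distrib lookup_add)
qed

lemma monom_degree_single: "monom_degree (Poly_Mapping.single v s) = s"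
  by (subst monom_degree_eq[of "{v}"]) auto

lemma monom_degree_0: "monom_degree 0 = 0"
  by (simp add: monom_degree_def)

lemma homogeneous_mult:
  assumes "homogeneous i p" "homogeneous j q" shows "homogeneous (i + j) (p * q)"
  unfolding homogeneous_def
proof
  fix m assume "m \<in> Poly_Mapping.keys (p * q)"
  then obtain a b where "a \<in> Poly_Mapping.keys p" "b \<in> Poly_Mapping.keys q" "m = a + b"
    using keys_mult[of p q] by blast
  then show "monom_degree m = i + j"
    using assms by (simp add: homogeneous_def monom_degree_add)
qed

lemma homogeneous_1: "homogeneous 0 1"
  by (simp add: homogeneous_def monom_degree_0)

lemma homogeneous_Const: "homogeneous 0 (Const c)"
  by (simp add: homogeneous_def Const_def monom_degree_0)

lemma homogeneous_uminus: "homogeneous i p \<Longrightarrow> homogeneous i (- p)"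
  by (simp add: homogeneous_def in_keys_iff)

lemma homogeneous_power: "homogeneous i p \<Longrightarrow> homogeneous (i * s) (p ^ s)"
  by (induction s) (auto simp: homogeneous_1 dest: homogeneous_mult[of i p])

lemma homogeneous_Var: "homogeneous 1 (Var v)"
  by (simp add: homogeneous_def Var_def monom_degree_single)

lemma homogeneous_var_prod: "finite F \<Longrightarrow> homogeneous (card F) (var_prod F)"
proof (induction F rule: finite_induct)
  case (insert v F)
  then show ?case
    using homogeneous_mult[OF homogeneous_Var insert.IH, of v] by (simp add: var_prod_def)
qed (simp add: homogeneous_1 var_prod_def)

lemma homogeneous_sign: "homogeneous 0 ((- 1) ^ s)"
  using homogeneous_power[OF homogeneous_uminus[OF homogeneous_1], of s] by simp

lemma homogeneous_unique: "homogeneous i p \<Longrightarrow> homogeneous j p \<Longrightarrow> p \<noteq> 0 \<Longrightarrow> i = j"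
  by (metis homogeneous_def keys_eq_empty equals0I)

lemma Var_nonzero: "Var v \<noteq> (0 :: 'k::field mpoly)"
  by (metis Var_def lookup_single_eq lookup_zero zero_neq_one)

lemma var_prod_nonzero: "finite F \<Longrightarrow> var_prod F \<noteq> (0 :: 'k::field mpoly)"
  by (simp add: var_prod_def Var_nonzero)

lemma monom_degree_1:
  assumes "monom_degree m = 1"
  obtains v where "m = Poly_Mapping.single v 1" "v \<in> Poly_Mapping.keys m"
proof -
  have "m \<noteq> 0" using assms monom_degree_0 by auto
  then obtain v where v: "v \<in> Poly_Mapping.keys m"
    by (metis keys_eq_empty ex_in_conv)
  have pos: "Poly_Mapping.lookup m u \<ge> 1" if "u \<in> Poly_Mapping.keys m" for u
    using that by (simp add: in_keys_iff)
  have split: "monom_degree m = Poly_Mapping.lookup m v + (\<Sum>u\<in>Poly_Mapping.keys m - {v}. Poly_Mapping.lookup m u)"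
    unfolding monom_degree_def using v by (simp add: sum.remove)
  have "Poly_Mapping.lookup m v = 1" "(\<Sum>u\<in>Poly_Mapping.keys m - {v}. Poly_Mapping.lookup m u) = 0"
    using split pos[OF v] assms by auto
  then have "m = Poly_Mapping.single v 1"
    by (intro poly_mapping_eqI) (auto simp: lookup_single when_def in_keys_iff)
  with v that show thesis by blast
qed

text \<open>The parameters are linear forms, whereas the Cech complex is built from the variables;
  this expansion transfers nilpotency from the latter to the former.\<close>

lemma linear_form:
  assumes "p \<in> carrier (mpoly_ring n)" "homogeneous 1 p"
  shows "p = (\<Sum>v<n. Const (Poly_Mapping.lookup p (Poly_Mapping.single v 1)) * Var v)"
proof (rule poly_mapping_eqI)
  fix m
  have "Poly_Mapping.lookup (\<Sum>v<n. Const (Poly_Mapping.lookup p (Poly_Mapping.single v 1)) * Var v) m =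
      (\<Sum>v<n. Poly_Mapping.lookup p (Poly_Mapping.single v 1) when Poly_Mapping.single v 1 = m)"
    by (simp add: lookup_sum Const_def Var_def mult_single lookup_single)
  also have "\<dots> = Poly_Mapping.lookup p m"
  proof (cases "m \<in> Poly_Mapping.keys p")
    case True
    then obtain w where w: "m = Poly_Mapping.single w 1" "w \<in> Poly_Mapping.keys m"
      using assms(2) monom_degree_1 by (auto simp: homogeneous_def)
    then have "w < n" using assms(1) True by (auto simp: mem_mpoly_ring)
    moreover have "Poly_Mapping.single v (1::nat) = m \<longleftrightarrow> v = w" for v
      using w(1) by (metis keys_single singleton_inject zero_neq_one)
    ultimately show ?thesis
      using w by (simp add: when_def sum.delta cong: if_cong)
  next
    case False
    then show ?thesis by (auto simp: when_def in_keys_iff intro!: sum.neutral)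
  qed
  finally show "Poly_Mapping.lookup p m = Poly_Mapping.lookup (\<Sum>v<n. Const (Poly_Mapping.lookup p (Poly_Mapping.single v 1)) * Var v) m"
    by simp
qed

lemma Var_irrelevant: "v < n \<Longrightarrow> Var v \<in> irrelevant_ideal n"
  unfolding irrelevant_ideal_def
  by (rule subsetD[OF ring.genideal_self[OF cring.axioms(1)[OF cring_mpoly_ring]]]) auto

lemma ideal_irrelevant: "ideal (irrelevant_ideal n :: 'k::field mpoly set) (mpoly_ring n)"
  unfolding irrelevant_ideal_def
  by (rule ring.genideal_ideal[OF cring.axioms(1)[OF cring_mpoly_ring]]) auto

lemma irrelevant_subset:
  assumes "ideal I (mpoly_ring n)" "\<And>v. v < n \<Longrightarrow> (Var v :: 'k::field mpoly) \<in> I"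
  shows "irrelevant_ideal n \<subseteq> I"
  unfolding irrelevant_ideal_def
  by (rule ring.genideal_minimal[OF cring.axioms(1)[OF cring_mpoly_ring] assms(1)]) (use assms in auto)

lemma irrelevant_closed: "p \<in> irrelevant_ideal n \<Longrightarrow> p \<in> carrier (mpoly_ring n)"
  using ideal.Icarr[OF ideal_irrelevant] by blast

lemma irrelevant_add: "p \<in> irrelevant_ideal n \<Longrightarrow> q \<in> irrelevant_ideal n \<Longrightarrow> p + q \<in> irrelevant_ideal n"
  using additive_subgroup.a_closed[OF ideal.axioms(1)[OF ideal_irrelevant]] by fastforce

lemma irrelevant_mult:
  "p \<in> irrelevant_ideal n \<Longrightarrow> q \<in> carrier (mpoly_ring n) \<Longrightarrow> q * p \<in> irrelevant_ideal n"
  using ideal.I_l_closed[OF ideal_irrelevant] by fastforce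

lemma irrelevant_0: "0 \<in> irrelevant_ideal n"
  using additive_subgroup.zero_closed[OF ideal.axioms(1)[OF ideal_irrelevant]] by fastforce

lemma irrelevant_power: "p \<in> irrelevant_ideal n \<Longrightarrow> s > 0 \<Longrightarrow> p ^ s \<in> irrelevant_ideal n"
  using irrelevant_mult[of p n "p ^ (s - 1)"] by (cases s) (simp_all add: irrelevant_closed mult.commute)

text \<open>Every monomial other than 1 is divisible by a variable. Consequently a polynomial acts
  on a socle through its constant term, and a linear form lies in the irrelevant ideal.\<close>

lemma minus_constant_term_irrelevant:
  assumes "p \<in> carrier (mpoly_ring n)"
  shows "p - Const (Poly_Mapping.lookup p 0) \<in> irrelevant_ideal n"
proof -
  define q where "q = p - Const (Poly_Mapping.lookup p 0)"
  have q: "q \<in> carrier (mpoly_ring n)" "0 \<notin> Poly_Mapping.keys q"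
    using assms mpoly_ring_add[of p n "- Const (Poly_Mapping.lookup p 0)"]
    by (simp_all add: q_def in_keys_iff lookup_minus) (simp add: Const_def)
  have "q = (\<Sum>m\<in>Poly_Mapping.keys q. Poly_Mapping.single m (Poly_Mapping.lookup q m))"
    by (intro poly_mapping_eqI)
      (auto simp: lookup_sum lookup_single when_def in_keys_iff sum.delta cong: if_cong)
  moreover have "Poly_Mapping.single m (Poly_Mapping.lookup q m) \<in> irrelevant_ideal n" if m: "m \<in> Poly_Mapping.keys q" for m
  proof -
    have "m \<noteq> 0" using m q by auto
    then obtain v where v: "v \<in> Poly_Mapping.keys m"
      by (metis keys_eq_empty ex_in_conv)
    have "v < n" using v m q(1) by (auto simp: mem_mpoly_ring)
    \<comment> \<open>Subtraction of exponents is truncated; the identity holds because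
      \<open>v\<close> occurs in \<open>m\<close>.\<close>
    have dec: "m = (m - Poly_Mapping.single v 1) + Poly_Mapping.single v 1"
    proof (rule poly_mapping_eqI)
      fix u
      show "Poly_Mapping.lookup m u =
          Poly_Mapping.lookup (m - Poly_Mapping.single v 1 + Poly_Mapping.single v 1) u"
        using v by (cases "v = u") (simp_all add: lookup_add lookup_minus lookup_single in_keys_iff when_def)
    qed
    have "Poly_Mapping.single m (Poly_Mapping.lookup q m) =
        Poly_Mapping.single (m - Poly_Mapping.single v 1) (Poly_Mapping.lookup q m) * Var v"
      using arg_cong[OF dec, of "\<lambda>u. Poly_Mapping.single u (Poly_Mapping.lookup q m)"]
      unfolding Var_def mult_single mult_1_right .
    moreover have "Poly_Mapping.single (m - Poly_Mapping.single v 1) (Poly_Mapping.lookup q m) \<in> carrier (mpoly_ring n)"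
    proof -
      have "Poly_Mapping.keys (m - Poly_Mapping.single v 1) \<subseteq> Poly_Mapping.keys m"
        by (auto simp: in_keys_iff lookup_minus)
      then show ?thesis
        using m q(1) by (simp add: mem_mpoly_ring subset_trans)
    qed
    ultimately show ?thesis
      using Var_irrelevant[OF \<open>v < n\<close>] irrelevant_mult by metis
  qed
  then have "(\<Sum>m\<in>A. Poly_Mapping.single m (Poly_Mapping.lookup q m)) \<in> irrelevant_ideal n"
    if "A \<subseteq> Poly_Mapping.keys q" for A
    using finite_subset[OF that] that
    by (induction A rule: infinite_finite_induct) (auto simp: irrelevant_0 intro!: irrelevant_add)
  ultimately show ?thesis unfolding q_def[symmetric] by (metis order_refl)
qed

section \<open>Localizations as sets of fractions\<close>

text \<open>Operations on fractions are defined as unions over all representatives; once the result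
  is independent of the representative, the union is that result.\<close>

lemma UN_pair_const:
  assumes "(x, a) \<in> A" "\<And>y b. (y, b) \<in> A \<Longrightarrow> F y b = C"
  shows "(\<Union>(y, b)\<in>A. F y b) = C"
  using assms by (intro SUP_eq_const) auto

locale mpoly_module = module "mpoly_ring n" M for n and M :: "('k::field mpoly, 'm) gmodule"
begin

lemma smult_mult:
  "p \<in> carrier (mpoly_ring n) \<Longrightarrow> q \<in> carrier (mpoly_ring n) \<Longrightarrow> x \<in> carrier M \<Longrightarrow>
    (p * q) \<odot>\<^bsub>M\<^esub> x = p \<odot>\<^bsub>M\<^esub> (q \<odot>\<^bsub>M\<^esub> x)"
  using smult_assoc1[of p q x] by simp

lemma smult_1 [simp]: "x \<in> carrier M \<Longrightarrow> 1 \<odot>\<^bsub>M\<^esub> x = x"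
  using smult_one[of x] by simp

lemma smult_0 [simp]: "x \<in> carrier M \<Longrightarrow> 0 \<odot>\<^bsub>M\<^esub> x = \<zero>\<^bsub>M\<^esub>"
  using smult_l_null[of x] by simp

lemma smult_uminus:
  "p \<in> carrier (mpoly_ring n) \<Longrightarrow> x \<in> carrier M \<Longrightarrow> (- p) \<odot>\<^bsub>M\<^esub> x = \<ominus>\<^bsub>M\<^esub> (p \<odot>\<^bsub>M\<^esub> x)"
  using smult_l_minus[of p x] by simp

lemma smult_zero [simp]: "p \<in> carrier (mpoly_ring n) \<Longrightarrow> p \<odot>\<^bsub>M\<^esub> \<zero>\<^bsub>M\<^esub> = \<zero>\<^bsub>M\<^esub>"
  by (rule smult_r_null)

lemma smult_closed' [simp]: "p \<in> carrier (mpoly_ring n) \<Longrightarrow> x \<in> carrier M \<Longrightarrow> p \<odot>\<^bsub>M\<^esub> x \<in> carrier M"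
  by (rule smult_closed)

lemma finsum_smult:
  "finite A \<Longrightarrow> p \<in> carrier (mpoly_ring n) \<Longrightarrow> (\<And>v. v \<in> A \<Longrightarrow> f v \<in> carrier M) \<Longrightarrow>
    p \<odot>\<^bsub>M\<^esub> finsum M f A = finsum M (\<lambda>v. p \<odot>\<^bsub>M\<^esub> f v) A"
  by (rule finsum_smult_ldistr) auto

context
  fixes f :: "'k mpoly" assumes f [simp]: "f \<in> carrier (mpoly_ring n)"
begin

text \<open>Equality of fractions is transitive: the first equation is multiplied by
  \<open>f ^ (c' + e)\<close> and the second by \<open>f ^ (c + a)\<close>, which leaves
  \<open>c + c' + b\<close> as the common surplus exponent.\<close>

lemma frac_trans:
  assumes "x \<in> carrier M" "y \<in> carrier M" "z \<in> carrier M"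
    and "f ^ (c + b) \<odot>\<^bsub>M\<^esub> x = f ^ (c + a) \<odot>\<^bsub>M\<^esub> y"
    and "f ^ (c' + e) \<odot>\<^bsub>M\<^esub> y = f ^ (c' + b) \<odot>\<^bsub>M\<^esub> z"
  shows "f ^ (c + c' + b + e) \<odot>\<^bsub>M\<^esub> x = f ^ (c + c' + b + a) \<odot>\<^bsub>M\<^esub> z"
proof -
  have "f ^ (c + c' + b + e) \<odot>\<^bsub>M\<^esub> x = f ^ (c' + e) \<odot>\<^bsub>M\<^esub> (f ^ (c + b) \<odot>\<^bsub>M\<^esub> x)"
    using assms(1-3) by (simp add: smult_mult[symmetric] power_add[symmetric] ac_simps)
  also have "\<dots> = f ^ (c + a) \<odot>\<^bsub>M\<^esub> (f ^ (c' + e) \<odot>\<^bsub>M\<^esub> y)"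
    using assms(1-3) unfolding assms(4) by (simp add: smult_mult[symmetric] power_add[symmetric] ac_simps)
  also have "\<dots> = f ^ (c + c' + b + a) \<odot>\<^bsub>M\<^esub> z"
    using assms(1-3) unfolding assms(5) by (simp add: smult_mult[symmetric] power_add[symmetric] ac_simps)
  finally show ?thesis .
qed

lemma mem_fraction:
  "(y, b) \<in> fraction f M x a \<longleftrightarrow> y \<in> carrier M \<and> (\<exists>c. f ^ (c + b) \<odot>\<^bsub>M\<^esub> x = f ^ (c + a) \<odot>\<^bsub>M\<^esub> y)"
  by (simp add: fraction_def)

lemma fraction_eq_iff:
  assumes "x \<in> carrier M" "y \<in> carrier M"
  shows "fraction f M x a = fraction f M y b \<longleftrightarrow> (\<exists>c. f ^ (c + b) \<odot>\<^bsub>M\<^esub> x = f ^ (c + a) \<odot>\<^bsub>M\<^esub> y)"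
proof
  assume "fraction f M x a = fraction f M y b"
  moreover have "(y, b) \<in> fraction f M y b"
    using assms by (auto simp: mem_fraction)
  ultimately show "\<exists>c. f ^ (c + b) \<odot>\<^bsub>M\<^esub> x = f ^ (c + a) \<odot>\<^bsub>M\<^esub> y"
    by (metis mem_fraction)
next
  have *: "fraction f M x a \<subseteq> fraction f M y b"
    if x: "x \<in> carrier M" "y \<in> carrier M" and c: "f ^ (c + b) \<odot>\<^bsub>M\<^esub> x = f ^ (c + a) \<odot>\<^bsub>M\<^esub> y" for x y a b c
  proof
    fix p assume "p \<in> fraction f M x a"
    then obtain z e c' where z: "p = (z, e)" "z \<in> carrier M" "f ^ (c' + e) \<odot>\<^bsub>M\<^esub> x = f ^ (c' + a) \<odot>\<^bsub>M\<^esub> z"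
      by (cases p) (auto simp: mem_fraction)
    have "f ^ (c + c' + a + e) \<odot>\<^bsub>M\<^esub> y = f ^ (c + c' + a + b) \<odot>\<^bsub>M\<^esub> z"
      using frac_trans[OF x(2,1) z(2) c[symmetric] z(3)] .
    with z show "p \<in> fraction f M y b"
      unfolding z(1) mem_fraction by blast
  qed
  assume "\<exists>c. f ^ (c + b) \<odot>\<^bsub>M\<^esub> x = f ^ (c + a) \<odot>\<^bsub>M\<^esub> y"
  then show "fraction f M x a = fraction f M y b"
    using *[OF assms] *[OF assms(2,1)] by (metis subset_antisym)
qed

lemma fraction_self: "x \<in> carrier M \<Longrightarrow> (x, a) \<in> fraction f M x a"
  by (auto simp: mem_fraction)

lemma fraction_shift:
  "x \<in> carrier M \<Longrightarrow> fraction f M (f ^ t \<odot>\<^bsub>M\<^esub> x) (a + t) = fraction f M x a"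
  by (auto simp: fraction_eq_iff smult_mult[symmetric] power_add[symmetric] ac_simps)

lemma localization_add:
  assumes "x \<in> carrier M" "y \<in> carrier M"
  shows "fraction f M x a \<oplus>\<^bsub>localization f M\<^esub> fraction f M y b =
    fraction f M (f ^ b \<odot>\<^bsub>M\<^esub> x \<oplus>\<^bsub>M\<^esub> f ^ a \<odot>\<^bsub>M\<^esub> y) (a + b)"
proof -
  have *: "fraction f M (f ^ b' \<odot>\<^bsub>M\<^esub> x' \<oplus>\<^bsub>M\<^esub> f ^ a' \<odot>\<^bsub>M\<^esub> y') (a' + b') =
      fraction f M (f ^ b \<odot>\<^bsub>M\<^esub> x \<oplus>\<^bsub>M\<^esub> f ^ a \<odot>\<^bsub>M\<^esub> y) (a + b)"
    if "(x', a') \<in> fraction f M x a" "(y', b') \<in> fraction f M y b" for x' a' y' b'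
  proof -
    from that obtain c c' where c: "x' \<in> carrier M" "y' \<in> carrier M"
      "f ^ (c + a) \<odot>\<^bsub>M\<^esub> x' = f ^ (c + a') \<odot>\<^bsub>M\<^esub> x" "f ^ (c' + b) \<odot>\<^bsub>M\<^esub> y' = f ^ (c' + b') \<odot>\<^bsub>M\<^esub> y"
      unfolding mem_fraction by metis
    have "f ^ (c + c' + (a + b)) \<odot>\<^bsub>M\<^esub> (f ^ b' \<odot>\<^bsub>M\<^esub> x') = f ^ (c' + b + b') \<odot>\<^bsub>M\<^esub> (f ^ (c + a) \<odot>\<^bsub>M\<^esub> x')"
      using c(1,2) by (simp add: smult_mult[symmetric] power_add[symmetric] ac_simps)
    also have "\<dots> = f ^ (c + c' + (a' + b')) \<odot>\<^bsub>M\<^esub> (f ^ b \<odot>\<^bsub>M\<^esub> x)"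
      using assms unfolding c(3) by (simp add: smult_mult[symmetric] power_add[symmetric] ac_simps)
    finally have 1: "f ^ (c + c' + (a + b)) \<odot>\<^bsub>M\<^esub> (f ^ b' \<odot>\<^bsub>M\<^esub> x') = f ^ (c + c' + (a' + b')) \<odot>\<^bsub>M\<^esub> (f ^ b \<odot>\<^bsub>M\<^esub> x)" .
    have "f ^ (c + c' + (a + b)) \<odot>\<^bsub>M\<^esub> (f ^ a' \<odot>\<^bsub>M\<^esub> y') = f ^ (c + a + a') \<odot>\<^bsub>M\<^esub> (f ^ (c' + b) \<odot>\<^bsub>M\<^esub> y')"
      using c(1,2) by (simp add: smult_mult[symmetric] power_add[symmetric] ac_simps)
    also have "\<dots> = f ^ (c + c' + (a' + b')) \<odot>\<^bsub>M\<^esub> (f ^ a \<odot>\<^bsub>M\<^esub> y)"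
      using assms unfolding c(4) by (simp add: smult_mult[symmetric] power_add[symmetric] ac_simps)
    finally have 2: "f ^ (c + c' + (a + b)) \<odot>\<^bsub>M\<^esub> (f ^ a' \<odot>\<^bsub>M\<^esub> y') = f ^ (c + c' + (a' + b')) \<odot>\<^bsub>M\<^esub> (f ^ a \<odot>\<^bsub>M\<^esub> y)" .
    show ?thesis
      using assms c(1,2) 1 2 by (subst fraction_eq_iff) (auto simp: smult_r_distr intro!: exI[of _ "c + c'"])
  qed
  have "(\<Union>(m, a)\<in>fraction f M x a. \<Union>(m', b)\<in>fraction f M y b.
              fraction f M (f ^ b \<odot>\<^bsub>M\<^esub> m \<oplus>\<^bsub>M\<^esub> f ^ a \<odot>\<^bsub>M\<^esub> m') (a + b)) =
     fraction f M (f ^ b \<odot>\<^bsub>M\<^esub> x \<oplus>\<^bsub>M\<^esub> f ^ a \<odot>\<^bsub>M\<^esub> y) (a + b)"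
    by (intro UN_pair_const[OF fraction_self[OF assms(1)]] UN_pair_const[OF fraction_self[OF assms(2)]] *)
  then show ?thesis by (simp add: localization_def)
qed

lemma localization_add_same:
  assumes "x \<in> carrier M" "y \<in> carrier M"
  shows "fraction f M x a \<oplus>\<^bsub>localization f M\<^esub> fraction f M y a = fraction f M (x \<oplus>\<^bsub>M\<^esub> y) a"
  using assms fraction_shift[of "x \<oplus>\<^bsub>M\<^esub> y" a a]
  by (simp add: localization_add smult_r_distr)

lemma localization_smult:
  assumes "r \<in> carrier (mpoly_ring n)" "x \<in> carrier M"
  shows "r \<odot>\<^bsub>localization f M\<^esub> fraction f M x a = fraction f M (r \<odot>\<^bsub>M\<^esub> x) a"
proof -
  have *: "fraction f M (r \<odot>\<^bsub>M\<^esub> y) b = fraction f M (r \<odot>\<^bsub>M\<^esub> x) a" if "(y, b) \<in> fraction f M x a" for y b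
  proof -
    from that obtain c where c: "y \<in> carrier M" "f ^ (c + a) \<odot>\<^bsub>M\<^esub> y = f ^ (c + b) \<odot>\<^bsub>M\<^esub> x"
      unfolding mem_fraction by metis
    then have "f ^ (c + a) \<odot>\<^bsub>M\<^esub> (r \<odot>\<^bsub>M\<^esub> y) = f ^ (c + b) \<odot>\<^bsub>M\<^esub> (r \<odot>\<^bsub>M\<^esub> x)"
      using assms by (simp add: smult_left_comm[of _ r])
    then show ?thesis using assms c by (auto simp: fraction_eq_iff)
  qed
  have "(\<Union>(m, a)\<in>fraction f M x a. fraction f M (r \<odot>\<^bsub>M\<^esub> m) a) = fraction f M (r \<odot>\<^bsub>M\<^esub> x) a"
    by (rule UN_pair_const[OF fraction_self[OF assms(2)] *])
  then show ?thesis by (simp add: localization_def)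
qed

lemma localization_zero: "\<zero>\<^bsub>localization f M\<^esub> = fraction f M \<zero>\<^bsub>M\<^esub> a"
proof -
  have "fraction f M \<zero>\<^bsub>M\<^esub> 0 = fraction f M \<zero>\<^bsub>M\<^esub> a"
    by (simp add: fraction_eq_iff)
  then show ?thesis by (simp add: localization_def)
qed

lemma carrier_localization: "carrier (localization f M) = (\<Union>a. (\<lambda>x. fraction f M x a) ` carrier M)"
  by (auto simp: localization_def)

text \<open>The elements with denominator \<open>f ^ a\<close> form an increasing family in
  \<open>a\<close>, because numerator and denominator can be multiplied by a power of
  \<open>f\<close>.\<close>

lemma module_localization: "module (mpoly_ring n) (localization f M)"
proof (rule module_directed_image[OF module_axioms, where \<pi> = "\<lambda>a x. fraction f M x a"])
  fix a b :: nat
  have "(\<lambda>x. fraction f M x a) ` carrier M \<subseteq> (\<lambda>x. fraction f M x (a + b)) ` carrier M" for a b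
  proof
    fix z assume "z \<in> (\<lambda>x. fraction f M x a) ` carrier M"
    then obtain x where "x \<in> carrier M" "z = fraction f M x a" by blast
    then show "z \<in> (\<lambda>x. fraction f M x (a + b)) ` carrier M"
      using fraction_shift[of x b a] by (metis f imageI mpoly_ring_power smult_closed)
  qed
  from this[of a b] this[of b a]
  show "\<exists>c. (\<lambda>x. fraction f M x a) ` carrier M \<subseteq> (\<lambda>x. fraction f M x c) ` carrier M \<and>
      (\<lambda>x. fraction f M x b) ` carrier M \<subseteq> (\<lambda>x. fraction f M x c) ` carrier M"
    by (metis add.commute)
qed (auto simp: carrier_localization localization_add_same localization_smult localization_zero[symmetric])

lemma fraction_closed: "x \<in> carrier M \<Longrightarrow> fraction f M x a \<in> carrier (localization f M)"
  by (auto simp: carrier_localization)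

lemma finsum_fraction:
  assumes "finite A" "\<And>v. v \<in> A \<Longrightarrow> x v \<in> carrier M"
  shows "finsum (localization f M) (\<lambda>v. fraction f M (x v) a) A = fraction f M (finsum M x A) a"
proof -
  interpret L: module "mpoly_ring n" "localization f M" by (rule module_localization)
  show ?thesis
    using assms
  proof (induction A rule: finite_induct)
    case empty
    then show ?case by (simp add: localization_zero[of a])
  next
    case (insert v A)
    then have "x \<in> A \<rightarrow> carrier M" by auto
    with insert show ?case
      by (simp add: L.finsum_insert finsum_insert fraction_closed localization_add_same)
  qed
qed

end

lemma localization_map_fraction:
  assumes [simp]: "f \<in> carrier (mpoly_ring n)" "h \<in> carrier (mpoly_ring n)" and x: "x \<in> carrier M"
  shows "localization_map f h M (fraction f M x a) = fraction (f * h) M (h ^ a \<odot>\<^bsub>M\<^esub> x) a"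
proof -
  have fh [simp]: "f * h \<in> carrier (mpoly_ring n)" by simp
  have *: "fraction (f * h) M (h ^ b \<odot>\<^bsub>M\<^esub> y) b = fraction (f * h) M (h ^ a \<odot>\<^bsub>M\<^esub> x) a"
    if "(y, b) \<in> fraction f M x a" for y b
  proof -
    from that obtain c where c: "y \<in> carrier M" "f ^ (c + a) \<odot>\<^bsub>M\<^esub> y = f ^ (c + b) \<odot>\<^bsub>M\<^esub> x"
      unfolding mem_fraction[OF assms(1)] by metis
    have "(f * h) ^ (c + a) \<odot>\<^bsub>M\<^esub> (h ^ b \<odot>\<^bsub>M\<^esub> y) = h ^ (c + a + b) \<odot>\<^bsub>M\<^esub> (f ^ (c + a) \<odot>\<^bsub>M\<^esub> y)"
      using c(1) by (simp add: smult_mult[symmetric] power_add power_mult_distrib ac_simps)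
    also have "\<dots> = (f * h) ^ (c + b) \<odot>\<^bsub>M\<^esub> (h ^ a \<odot>\<^bsub>M\<^esub> x)"
      using x unfolding c(2) by (simp add: smult_mult[symmetric] power_add power_mult_distrib ac_simps)
    finally show ?thesis
      using x c by (auto simp: fraction_eq_iff[OF fh])
  qed
  show ?thesis
    unfolding localization_map_def
    by (rule UN_pair_const[OF fraction_self[OF assms(1) x] *])
qed

end

section \<open>Signs in the Cech differential\<close>

text \<open>The terms for \<open>(u, v)\<close> and \<open>(v, u)\<close> cancel in pairs. The
  pairing is made explicit by an induction on \<open>A\<close>, since in characteristic 2 it would
  prove nothing that the whole sum equals its own negative.\<close>

lemma (in abelian_group) finsum_antisym:
  assumes "finite A" "\<And>u v. u \<in> A \<Longrightarrow> v \<in> A \<Longrightarrow> u \<noteq> v \<Longrightarrow> t u v \<in> carrier G"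
    "\<And>u v. u \<in> A \<Longrightarrow> v \<in> A \<Longrightarrow> u \<noteq> v \<Longrightarrow> t u v = \<ominus> t v u"
  shows "finsum G (\<lambda>v. finsum G (t v) (A - {v})) A = \<zero>"
  using assms
proof (induction A rule: finite_induct)
  case empty
  show ?case by simp
next
  case (insert w A)
  have 1: "finsum G (\<lambda>v. finsum G (t v) (insert w A - {v})) A =
      finsum G (\<lambda>v. t v w \<oplus> finsum G (t v) (A - {v})) A"
  proof (rule finsum_cong')
    fix v assume v: "v \<in> A"
    then have "insert w A - {v} = insert w (A - {v})" "w \<noteq> v" using insert.hyps by auto
    moreover have "t v \<in> A - {v} \<rightarrow> carrier G" "t v w \<in> carrier G" "w \<notin> A - {v}" "finite (A - {v})"
      using v insert.hyps insert.prems(1) \<open>w \<noteq> v\<close> by auto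
    ultimately show "finsum G (t v) (insert w A - {v}) = t v w \<oplus> finsum G (t v) (A - {v})"
      using finsum_insert[of "A - {v}" w "t v"] by simp
  next
    show "(\<lambda>v. t v w \<oplus> finsum G (t v) (A - {v})) \<in> A \<rightarrow> carrier G"
      using insert.hyps insert.prems(1) by (auto intro!: a_closed finsum_closed)
  qed simp
  have w: "insert w A - {w} = A" using insert.hyps by auto
  have c1: "(\<lambda>v. t v w) \<in> A \<rightarrow> carrier G" and c2: "t w \<in> A \<rightarrow> carrier G"
    and c3: "(\<lambda>v. finsum G (t v) (A - {v})) \<in> A \<rightarrow> carrier G"
    using insert.hyps insert.prems(1) by (auto intro!: finsum_closed)
  have c4: "(\<lambda>v. finsum G (t v) (insert w A - {v})) \<in> A \<rightarrow> carrier G"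
    using insert.hyps insert.prems(1) by (auto intro!: finsum_closed)
  have c5: "finsum G (t w) (insert w A - {w}) \<in> carrier G"
    unfolding w using c2 by (rule finsum_closed)
  have IH: "finsum G (\<lambda>v. finsum G (t v) (A - {v})) A = \<zero>"
    by (intro insert.IH insert.prems) auto
  have "finsum G (\<lambda>v. finsum G (t v) (insert w A - {v})) (insert w A) =
      finsum G (t w) A \<oplus> (finsum G (\<lambda>v. t v w) A \<oplus> finsum G (\<lambda>v. finsum G (t v) (A - {v})) A)"
    using finsum_insert[OF insert(1,2) c4 c5] 1 w finsum_addf[OF c1 c3] by simp
  also have "\<dots> = finsum G (\<lambda>v. t w v \<oplus> t v w) A"
    using IH c1 c2 by (simp add: finsum_addf)
  also have "\<dots> = finsum G (\<lambda>v. \<zero>) A"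
  proof (rule finsum_cong')
    fix v assume "v \<in> A"
    then have "t w v = \<ominus> t v w" "t v w \<in> carrier G"
      using insert.hyps insert.prems(2)[of w v] insert.prems(1)[of v w] by auto
    then show "t w v \<oplus> t v w = \<zero>" by (simp add: l_neg)
  qed auto
  finally show ?case by simp
qed

definition sg :: "nat set \<Rightarrow> nat \<Rightarrow> 'k::field mpoly" where
  "sg A v = (- 1) ^ card {u \<in> A. u < v}"

lemma sg_remove:
  assumes "finite A" "u \<in> A"
  shows "u < v \<Longrightarrow> (sg (A - {u}) v :: 'k::field mpoly) = - sg A v"
    "\<not> u < v \<Longrightarrow> (sg (A - {u}) v :: 'k::field mpoly) = sg A v"
proof -
  assume "u < v"
  let ?B = "{w \<in> A - {u}. w < v}"
  have "{w \<in> A. w < v} = insert u ?B" "finite ?B" "u \<notin> ?B" using assms \<open>u < v\<close> by auto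
  then have "card {w \<in> A. w < v} = Suc (card ?B)"
    by (metis card_insert_disjoint)
  then show "(sg (A - {u}) v :: 'k mpoly) = - sg A v"
    by (simp only: sg_def power_Suc mult_minus1 minus_minus)
next
  assume "\<not> u < v"
  then have "{w \<in> A - {u}. w < v} = {w \<in> A. w < v}" by auto
  then show "(sg (A - {u}) v :: 'k mpoly) = sg A v" by (simp only: sg_def)
qed

text \<open>Removing an element changes the sign only at larger elements, and exactly one of
  \<open>u\<close>, \<open>v\<close> is the larger one. Hence the two orders of removal cancel in
  the square of the differential.\<close>

lemma sg_swap:
  assumes "finite A" "u \<in> A" "v \<in> A" "u \<noteq> v"
  shows "sg A v * sg (A - {v}) u = - (sg A u * sg (A - {u}) v)"
proof (cases "u < v")
  case True
  then have "\<not> v < u" by simp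
  with True show ?thesis
    using assms by (simp add: sg_remove)
next
  case False
  with assms have "v < u" by simp
  with False show ?thesis
    using assms by (simp add: sg_remove)
qed

text \<open>Exactly one of deleting \<open>u\<close> below \<open>v\<close> and inserting
  \<open>v\<close> below \<open>u\<close> flips a sign. The identity compares a face of the cone
  over \<open>A\<close> with the cone over a face.\<close>

lemma sg_insert:
  assumes "finite A" "u \<in> A" "v \<notin> A"
  shows "sg (A - {u}) u * sg (A - {u}) v = - (sg A v * sg (insert v A) u :: 'k::field mpoly)"
proof -
  have A: "A = insert v A - {v}" using assms by auto
  have *: "v < u \<Longrightarrow> (sg A u :: 'k mpoly) = - sg (insert v A) u"
    "\<not> v < u \<Longrightarrow> (sg A u :: 'k mpoly) = sg (insert v A) u"
    using sg_remove[of "insert v A" v u] assms A by auto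
  show ?thesis
  proof (cases "u < v")
    case True
    then have "\<not> v < u" by simp
    with True show ?thesis
      using assms * by (simp add: sg_remove)
  next
    case False
    with assms have "v < u" by (metis nat_neq_iff)
    with False show ?thesis
      using assms * by (simp add: sg_remove)
  qed
qed

lemma sg_self: "sg A v * sg A v = 1"
  by (simp add: sg_def power_mult_distrib[symmetric])

lemma sg_closed [simp]: "sg A v \<in> carrier (mpoly_ring n)"
  by (simp add: sg_def)

lemma finite_var_subsets [simp]: "finite (var_subsets n j)"
  by (simp add: var_subsets_def)

lemma var_subsetsD:
  assumes "A \<in> var_subsets n j"
  shows "finite A" "A \<subseteq> {..<n}" "card A = j" "v \<in> A \<Longrightarrow> v < n"
  using assms finite_subset[of A "{..<n}"] by (auto simp: var_subsets_def)

lemma var_subsets_remove: "A \<in> var_subsets n (Suc j) \<Longrightarrow> v \<in> A \<Longrightarrow> A - {v} \<in> var_subsets n j"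
  unfolding var_subsets_def by (auto simp: card_Diff_singleton)

lemma var_subsets_insert: "A \<in> var_subsets n j \<Longrightarrow> v < n \<Longrightarrow> v \<notin> A \<Longrightarrow> insert v A \<in> var_subsets n (Suc j)"
  unfolding var_subsets_def using finite_subset[of A "{..<n}"] by auto

lemma var_prod_remove: "finite A \<Longrightarrow> v \<in> A \<Longrightarrow> var_prod (A - {v}) * Var v = (var_prod A :: 'k::field mpoly)"
  by (simp add: var_prod_def prod.remove[of A v] mult.commute)

lemma var_prod_insert: "finite A \<Longrightarrow> v \<notin> A \<Longrightarrow> var_prod (insert v A) = var_prod A * (Var v :: 'k::field mpoly)"
  by (simp add: var_prod_def mult.commute)

section \<open>Cech cochains over a common denominator\<close>

context mpoly_module
begin

lemma xA [simp]: "A \<in> var_subsets n j \<Longrightarrow> var_prod A \<in> carrier (mpoly_ring n)"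
  using var_subsetsD(2) by simp

lemma sign_closed [simp]: "(- 1) ^ s \<in> carrier (mpoly_ring n)"
  by simp

lemma cech_simps:
  "\<zero>\<^bsub>cech n j M\<^esub> = (\<lambda>A\<in>var_subsets n j. \<zero>\<^bsub>localization (var_prod A) M\<^esub>)"
  "carrier (cech n j M) = (\<Pi>\<^sub>E A\<in>var_subsets n j. carrier (localization (var_prod A) M))"
  "x \<oplus>\<^bsub>cech n j M\<^esub> y = (\<lambda>A\<in>var_subsets n j. x A \<oplus>\<^bsub>localization (var_prod A) M\<^esub> y A)"
  "r \<odot>\<^bsub>cech n j M\<^esub> x = (\<lambda>A\<in>var_subsets n j. r \<odot>\<^bsub>localization (var_prod A) M\<^esub> x A)"
  "component (cech n j M) k = (\<Pi>\<^sub>E A\<in>var_subsets n j. component (localization (var_prod A) M) k)"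
  by (simp_all add: cech_def direct_sum_def module.extend_def gmodule.fields_def)

lemma module_cech: "module (mpoly_ring n) (cech n j M)"
  by (rule module_cong[OF module_direct_sum[OF cring_mpoly_ring,
        of "var_subsets n j" n "\<lambda>A. localization (var_prod A) M"]])
    (simp_all add: module_localization cech_def direct_sum_def module.extend_def gmodule.fields_def)

text \<open>A Cech cochain written with the common denominators \<open>(\<Prod>v\<in>A. x\<^sub>v)\<^sup>a\<close>.\<close>

definition mk :: "nat \<Rightarrow> (nat set \<Rightarrow> 'm) \<Rightarrow> nat \<Rightarrow> nat set \<Rightarrow> ('m \<times> nat) set" where
  "mk j m a = (\<lambda>A\<in>var_subsets n j. fraction (var_prod A) M (m A) a)"

text \<open>Values outside \<open>var_subsets n j\<close> are unconstrained: \<open>mk\<close>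
  restricts them away.\<close>

definition tup :: "nat \<Rightarrow> 'm set \<Rightarrow> (nat set \<Rightarrow> 'm) set" where
  "tup j N = {m. \<forall>A\<in>var_subsets n j. m A \<in> N}"

abbreviation "tups j \<equiv> tup j (carrier M)"

lemma tupD: "m \<in> tup j N \<Longrightarrow> A \<in> var_subsets n j \<Longrightarrow> m A \<in> N"
  by (simp add: tup_def)

lemma tupI: "(\<And>A. A \<in> var_subsets n j \<Longrightarrow> m A \<in> N) \<Longrightarrow> m \<in> tup j N"
  by (simp add: tup_def)

lemma mk_closed [simp]: "m \<in> tups j \<Longrightarrow> mk j m a \<in> carrier (cech n j M)"
  unfolding mk_def cech_simps restrict_PiE_iff by (auto intro!: fraction_closed dest: tupD)

lemma mk_shift: "m \<in> tups j \<Longrightarrow> mk j (\<lambda>A. var_prod A ^ t \<odot>\<^bsub>M\<^esub> m A) (a + t) = mk j m a"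
  unfolding mk_def by (intro restrict_ext) (simp add: fraction_shift tupD)

text \<open>The sum of the finitely many exponents bounds each of them, so every fraction can be
  extended to it. The predicate \<open>Q\<close> records what survives the extension; it is trivial
  for plain cochains and carries the degree of the numerator for homogeneous ones.\<close>

lemma common_denominator:
  assumes "finite S" "\<And>A. A \<in> S \<Longrightarrow> (var_prod A :: 'k mpoly) \<in> carrier (mpoly_ring n)"
    and "\<And>A. A \<in> S \<Longrightarrow> \<exists>x a. Q A x a \<and> x \<in> carrier M \<and> c A = fraction (var_prod A) M x a"
    and shift: "\<And>A x a t. A \<in> S \<Longrightarrow> Q A x a \<Longrightarrow> Q A (var_prod A ^ t \<odot>\<^bsub>M\<^esub> x) (a + t)"
  shows "\<exists>m a. \<forall>A\<in>S. Q A (m A) a \<and> m A \<in> carrier M \<and> c A = fraction (var_prod A) M (m A) a"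
proof -
  obtain y e where ye: "\<And>A. A \<in> S \<Longrightarrow> Q A (y A) (e A) \<and> y A \<in> carrier M \<and> c A = fraction (var_prod A) M (y A) (e A)"
    using assms(3) by metis
  define a where "a = sum e S"
  have le: "e A \<le> a" if "A \<in> S" for A
    unfolding a_def using that assms(1) by (intro member_le_sum) auto
  have "Q A (var_prod A ^ (a - e A) \<odot>\<^bsub>M\<^esub> y A) a \<and> var_prod A ^ (a - e A) \<odot>\<^bsub>M\<^esub> y A \<in> carrier M
      \<and> c A = fraction (var_prod A) M (var_prod A ^ (a - e A) \<odot>\<^bsub>M\<^esub> y A) a" if A: "A \<in> S" for A
  proof (intro conjI)
    have y: "Q A (y A) (e A)" "y A \<in> carrier M" "c A = fraction (var_prod A) M (y A) (e A)"
      using ye[OF A] by auto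
    show "Q A (var_prod A ^ (a - e A) \<odot>\<^bsub>M\<^esub> y A) a"
      using shift[OF A y(1), of "a - e A"] le[OF A] by simp
    show "var_prod A ^ (a - e A) \<odot>\<^bsub>M\<^esub> y A \<in> carrier M"
      using y(2) assms(2)[OF A] by simp
    show "c A = fraction (var_prod A) M (var_prod A ^ (a - e A) \<odot>\<^bsub>M\<^esub> y A) a"
      using fraction_shift[OF assms(2)[OF A] y(2), of "a - e A" "e A"] le[OF A] y(3) by simp
  qed
  then show ?thesis by (intro exI[of _ "\<lambda>A. var_prod A ^ (a - e A) \<odot>\<^bsub>M\<^esub> y A"]) blast
qed

lemma cech_cases:
  assumes "x \<in> carrier (cech n j M)"
  obtains m a where "m \<in> tups j" "x = mk j m a"
proof -
  have "\<exists>m a. \<forall>A\<in>var_subsets n j. True \<and> m A \<in> carrier M \<and> x A = fraction (var_prod A) M (m A) a"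
  proof (rule common_denominator)
    fix A assume A: "A \<in> var_subsets n j"
    then have "x A \<in> carrier (localization (var_prod A) M)" using assms by (auto simp: cech_simps PiE_iff)
    then show "\<exists>y a. True \<and> y \<in> carrier M \<and> x A = fraction (var_prod A) M y a"
      using A by (auto simp: carrier_localization)
  qed auto
  then obtain m a where "m \<in> tups j" "\<And>A. A \<in> var_subsets n j \<Longrightarrow> x A = fraction (var_prod A) M (m A) a"
    by (auto simp: tup_def)
  moreover from this have "x = mk j m a"
    using assms unfolding mk_def cech_simps by (intro extensionalityI[of x "var_subsets n j"]) (auto simp: PiE_iff)
  ultimately show thesis using that by blast
qed

lemma tup_shift: "m \<in> tups j \<Longrightarrow> (\<lambda>A. var_prod A ^ t \<odot>\<^bsub>M\<^esub> m A) \<in> tups j"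
  by (intro tupI) (simp add: tupD)

lemma cech_cases2:
  assumes "x \<in> carrier (cech n j M)" "y \<in> carrier (cech n i M)"
  obtains m m' a where "m \<in> tups j" "m' \<in> tups i" "x = mk j m a" "y = mk i m' a"
proof -
  obtain m a m' b where "m \<in> tups j" "m' \<in> tups i" "x = mk j m a" "y = mk i m' b"
    using assms by (metis cech_cases)
  then show thesis
    using that[OF tup_shift[of m j b] tup_shift[of m' i a], of "a + b"]
      mk_shift[of m j b a] mk_shift[of m' i a b] by (simp add: add.commute[of b])
qed

lemma mk_add:
  "m \<in> tups j \<Longrightarrow> m' \<in> tups j \<Longrightarrow> mk j m a \<oplus>\<^bsub>cech n j M\<^esub> mk j m' a = mk j (\<lambda>A. m A \<oplus>\<^bsub>M\<^esub> m' A) a"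
  unfolding mk_def cech_simps by (intro restrict_ext) (simp add: localization_add_same tupD)

lemma mk_smult:
  "r \<in> carrier (mpoly_ring n) \<Longrightarrow> m \<in> tups j \<Longrightarrow> r \<odot>\<^bsub>cech n j M\<^esub> mk j m a = mk j (\<lambda>A. r \<odot>\<^bsub>M\<^esub> m A) a"
  unfolding mk_def cech_simps by (intro restrict_ext) (simp add: localization_smult tupD)

lemma mk_zero: "\<zero>\<^bsub>cech n j M\<^esub> = mk j (\<lambda>_. \<zero>\<^bsub>M\<^esub>) a"
  by (auto simp: mk_def cech_simps localization_zero[symmetric] intro!: restrict_ext)

lemma mk_diff:
  assumes "m \<in> tups j" "m' \<in> tups j"
  shows "mk j m a \<ominus>\<^bsub>cech n j M\<^esub> mk j m' a = mk j (\<lambda>A. m A \<ominus>\<^bsub>M\<^esub> m' A) a"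
proof -
  interpret C: module "mpoly_ring n" "cech n j M" by (rule module_cech)
  have "(\<lambda>A. m A \<ominus>\<^bsub>M\<^esub> m' A) \<in> tups j" using assms by (intro tupI) (simp add: tupD)
  then have "mk j (\<lambda>A. m A \<ominus>\<^bsub>M\<^esub> m' A) a \<oplus>\<^bsub>cech n j M\<^esub> mk j m' a = mk j (\<lambda>A. m A \<ominus>\<^bsub>M\<^esub> m' A \<oplus>\<^bsub>M\<^esub> m' A) a"
    using assms by (simp add: mk_add)
  also have "\<dots> = mk j m a"
    using assms unfolding mk_def by (intro restrict_ext) (simp add: M.minus_add_cancel tupD)
  finally show ?thesis
    using C.minus_add_cancel(3)[of "mk j (\<lambda>A. m A \<ominus>\<^bsub>M\<^esub> m' A) a" "mk j m' a"] assms
      \<open>(\<lambda>A. m A \<ominus>\<^bsub>M\<^esub> m' A) \<in> tups j\<close> by simp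
qed

text \<open>There are finitely many sets \<open>A\<close>, and an exponent that works for one
  fraction may be increased, so a single \<open>c\<close> serves all of them.\<close>

lemma mk_eq_iff:
  assumes "m \<in> tups j" "m' \<in> tups j"
  shows "mk j m a = mk j m' b \<longleftrightarrow>
    (\<exists>c. \<forall>A\<in>var_subsets n j. var_prod A ^ (c + b) \<odot>\<^bsub>M\<^esub> m A = var_prod A ^ (c + a) \<odot>\<^bsub>M\<^esub> m' A)"
proof
  assume "mk j m a = mk j m' b"
  then have "\<exists>c. var_prod A ^ (c + b) \<odot>\<^bsub>M\<^esub> m A = var_prod A ^ (c + a) \<odot>\<^bsub>M\<^esub> m' A" if "A \<in> var_subsets n j" for A
  proof -
    have "fraction (var_prod A) M (m A) a = fraction (var_prod A) M (m' A) b"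
      using that fun_cong[OF \<open>mk j m a = mk j m' b\<close>, of A] by (simp add: mk_def)
    then show ?thesis
      using fraction_eq_iff[OF _ tupD[OF assms(1) that] tupD[OF assms(2) that], of "var_prod A" a b] that
      by simp
  qed
  then obtain c where c: "\<And>A. A \<in> var_subsets n j \<Longrightarrow>
      var_prod A ^ (c A + b) \<odot>\<^bsub>M\<^esub> m A = var_prod A ^ (c A + a) \<odot>\<^bsub>M\<^esub> m' A" by metis
  define t where "t = sum c (var_subsets n j)"
  have "var_prod A ^ (t + b) \<odot>\<^bsub>M\<^esub> m A = var_prod A ^ (t + a) \<odot>\<^bsub>M\<^esub> m' A" if A: "A \<in> var_subsets n j" for A
  proof -
    have le: "c A \<le> t" unfolding t_def using A by (intro member_le_sum) auto
    have "var_prod A ^ (t - c A) \<odot>\<^bsub>M\<^esub> (var_prod A ^ (c A + b) \<odot>\<^bsub>M\<^esub> m A) =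
        var_prod A ^ (t - c A) \<odot>\<^bsub>M\<^esub> (var_prod A ^ (c A + a) \<odot>\<^bsub>M\<^esub> m' A)"
      using c[OF A] by simp
    then show ?thesis
      using A tupD[OF assms(1) A] tupD[OF assms(2) A] le by (simp add: smult_mult[symmetric] power_add[symmetric])
  qed
  then show "\<exists>c. \<forall>A\<in>var_subsets n j. var_prod A ^ (c + b) \<odot>\<^bsub>M\<^esub> m A = var_prod A ^ (c + a) \<odot>\<^bsub>M\<^esub> m' A" by blast
next
  assume "\<exists>c. \<forall>A\<in>var_subsets n j. var_prod A ^ (c + b) \<odot>\<^bsub>M\<^esub> m A = var_prod A ^ (c + a) \<odot>\<^bsub>M\<^esub> m' A"
  then show "mk j m a = mk j m' b"
    unfolding mk_def using assms by (intro restrict_ext) (auto simp: fraction_eq_iff tupD)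
qed

text \<open>The numerators of the Cech differential: rewriting a fraction over
  \<open>var_prod (A - {v}) ^ a\<close> with the denominator \<open>var_prod A ^ a\<close> costs the
  factor \<open>Var v ^ a\<close>.\<close>

definition bd :: "nat \<Rightarrow> (nat set \<Rightarrow> 'm) \<Rightarrow> nat set \<Rightarrow> 'm" where
  "bd a m A = finsum M (\<lambda>v. sg A v \<odot>\<^bsub>M\<^esub> (Var v ^ a \<odot>\<^bsub>M\<^esub> m (A - {v}))) A"

lemma bd_closed [simp]: "m \<in> tups j \<Longrightarrow> A \<in> var_subsets n (Suc j) \<Longrightarrow> bd a m A \<in> carrier M"
  unfolding bd_def by (rule finsum_closed) (auto simp: var_subsetsD(4) var_subsets_remove tupD)

lemma bd_tup [simp]: "m \<in> tups j \<Longrightarrow> bd a m \<in> tups (Suc j)"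
  by (intro tupI) simp

lemma cech_diff_mk:
  assumes "m \<in> tups j"
  shows "cech_diff n j M (mk j m a) = mk (Suc j) (bd a m) a"
proof -
  have "finsum (localization (var_prod A) M)
      (\<lambda>v. sg A v \<odot>\<^bsub>localization (var_prod A) M\<^esub>
         localization_map (var_prod (A - {v})) (Var v) M (mk j m a (A - {v}))) A = fraction (var_prod A) M (bd a m A) a"
    if A: "A \<in> var_subsets n (Suc j)" for A
  proof -
    interpret L: module "mpoly_ring n" "localization (var_prod A) M"
      using A by (intro module_localization) simp
    have "finsum (localization (var_prod A) M)
      (\<lambda>v. sg A v \<odot>\<^bsub>localization (var_prod A) M\<^esub>
         localization_map (var_prod (A - {v})) (Var v) M (mk j m a (A - {v}))) A =
      finsum (localization (var_prod A) M)
        (\<lambda>v. fraction (var_prod A) M (sg A v \<odot>\<^bsub>M\<^esub> (Var v ^ a \<odot>\<^bsub>M\<^esub> m (A - {v}))) a) A"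
    proof (rule L.finsum_cong')
      fix v assume v: "v \<in> A"
      note r = var_subsets_remove[OF A v]
      show "sg A v \<odot>\<^bsub>localization (var_prod A) M\<^esub>
         localization_map (var_prod (A - {v})) (Var v) M (mk j m a (A - {v})) =
         fraction (var_prod A) M (sg A v \<odot>\<^bsub>M\<^esub> (Var v ^ a \<odot>\<^bsub>M\<^esub> m (A - {v}))) a"
        using A v r assms var_subsetsD[OF A]
        by (simp add: mk_def localization_map_fraction var_prod_remove localization_smult tupD)
    qed (use A assms var_subsetsD[OF A] in \<open>auto intro!: fraction_closed simp: var_subsets_remove tupD[OF assms]\<close>)
    also have "\<dots> = fraction (var_prod A) M (bd a m A) a"
      unfolding bd_def using A assms var_subsetsD[OF A]
      by (intro finsum_fraction) (auto simp: var_subsets_remove tupD[OF assms])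
    finally show ?thesis .
  qed
  then show ?thesis
    unfolding cech_diff_def sg_def[symmetric] mk_def[of "Suc j"] by (intro restrict_ext)
qed

lemma bd_add:
  assumes "m \<in> tups j" "m' \<in> tups j" "A \<in> var_subsets n (Suc j)"
  shows "bd a (\<lambda>A. m A \<oplus>\<^bsub>M\<^esub> m' A) A = bd a m A \<oplus>\<^bsub>M\<^esub> bd a m' A"
proof -
  have c: "(\<lambda>v. sg A v \<odot>\<^bsub>M\<^esub> (Var v ^ a \<odot>\<^bsub>M\<^esub> m (A - {v}))) \<in> A \<rightarrow> carrier M"
    "(\<lambda>v. sg A v \<odot>\<^bsub>M\<^esub> (Var v ^ a \<odot>\<^bsub>M\<^esub> m' (A - {v}))) \<in> A \<rightarrow> carrier M"
    using assms var_subsetsD[OF assms(3)] by (auto simp: var_subsets_remove tupD[OF assms(1)] tupD[OF assms(2)])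
  show ?thesis
    unfolding bd_def finsum_addf[OF c, symmetric]
    using assms var_subsetsD[OF assms(3)] c
    by (intro finsum_cong') (auto simp: var_subsets_remove smult_r_distr tupD[OF assms(1)] tupD[OF assms(2)])
qed

lemma bd_smult:
  assumes "m \<in> tups j" "r \<in> carrier (mpoly_ring n)" "A \<in> var_subsets n (Suc j)"
  shows "bd a (\<lambda>A. r \<odot>\<^bsub>M\<^esub> m A) A = r \<odot>\<^bsub>M\<^esub> bd a m A"
proof -
  have "r \<odot>\<^bsub>M\<^esub> bd a m A = finsum M (\<lambda>v. r \<odot>\<^bsub>M\<^esub> (sg A v \<odot>\<^bsub>M\<^esub> (Var v ^ a \<odot>\<^bsub>M\<^esub> m (A - {v})))) A"
    unfolding bd_def using assms var_subsetsD[OF assms(3)]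
    by (intro finsum_smult) (auto simp: var_subsets_remove tupD[OF assms(1)])
  also have "\<dots> = bd a (\<lambda>A. r \<odot>\<^bsub>M\<^esub> m A) A"
    unfolding bd_def using assms var_subsetsD[OF assms(3)]
    by (intro finsum_cong') (auto simp: var_subsets_remove smult_left_comm[of r] tupD[OF assms(1)])
  finally show ?thesis by simp
qed

text \<open>Each pair \<open>u\<close>, \<open>v\<close> of elements of \<open>A\<close> is removed
  in both orders, with the same monomial factor and with opposite signs.\<close>

lemma bd_bd:
  assumes "m \<in> tups j" "A \<in> var_subsets n (Suc (Suc j))"
  shows "bd a (bd a m) A = \<zero>\<^bsub>M\<^esub>"
proof -
  note A = var_subsetsD[OF assms(2)]
  define t where "t v u = (sg A v * sg (A - {v}) u) \<odot>\<^bsub>M\<^esub> ((Var v ^ a * Var u ^ a) \<odot>\<^bsub>M\<^esub> m (A - {v} - {u}))" for u v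
  have mem: "m (A - {v} - {u}) \<in> carrier M" if "v \<in> A" "u \<in> A" "u \<noteq> v" for u v
    using that assms by (auto intro!: tupD[OF assms(1)] var_subsets_remove)
  have tc: "t v u \<in> carrier M" if "v \<in> A" "u \<in> A" "u \<noteq> v" for u v
    using mem[OF that] that A by (simp add: t_def)
  have "bd a (bd a m) A = finsum M (\<lambda>v. finsum M (t v) (A - {v})) A"
    unfolding bd_def[of a "bd a m"]
  proof (rule finsum_cong')
    fix v assume v: "v \<in> A"
    have "sg A v \<odot>\<^bsub>M\<^esub> (Var v ^ a \<odot>\<^bsub>M\<^esub> bd a m (A - {v})) =
       (sg A v * Var v ^ a) \<odot>\<^bsub>M\<^esub> bd a m (A - {v})"
      using v A assms var_subsets_remove[OF assms(2) v] by (simp add: smult_mult)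
    also have "\<dots> = finsum M (\<lambda>u. (sg A v * Var v ^ a) \<odot>\<^bsub>M\<^esub>
        (sg (A - {v}) u \<odot>\<^bsub>M\<^esub> (Var u ^ a \<odot>\<^bsub>M\<^esub> m (A - {v} - {u})))) (A - {v})"
      unfolding bd_def using v A mem by (intro finsum_smult) auto
    also have "\<dots> = finsum M (t v) (A - {v})"
      using v A mem tc by (intro finsum_cong') (auto simp: t_def smult_mult[symmetric] ac_simps)
    finally show "sg A v \<odot>\<^bsub>M\<^esub> (Var v ^ a \<odot>\<^bsub>M\<^esub> bd a m (A - {v})) = finsum M (t v) (A - {v})" .
  qed (use tc in \<open>auto intro!: finsum_closed\<close>)
  also have "\<dots> = \<zero>\<^bsub>M\<^esub>"
  proof (rule finsum_antisym[OF A(1) tc])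
    fix u v assume uv: "u \<in> A" "v \<in> A" "u \<noteq> v"
    have "A - {u} - {v} = A - {v} - {u}" by auto
    moreover have e: "(sg A u * sg (A - {u}) v :: 'k mpoly) = - (sg A v * sg (A - {v}) u)"
      using uv by (intro sg_swap[OF A(1)]) auto
    ultimately show "t u v = \<ominus>\<^bsub>M\<^esub> t v u"
      using uv mem[OF uv(2,1)] A unfolding t_def e by (simp add: smult_uminus mult.commute)
  qed auto
  finally show ?thesis .
qed

lemma cech_diff_closed: "x \<in> carrier (cech n j M) \<Longrightarrow> cech_diff n j M x \<in> carrier (cech n (Suc j) M)"
  by (metis cech_cases cech_diff_mk bd_tup mk_closed)

lemma cech_diff_add:
  assumes "x \<in> carrier (cech n j M)" "y \<in> carrier (cech n j M)"
  shows "cech_diff n j M (x \<oplus>\<^bsub>cech n j M\<^esub> y) = cech_diff n j M x \<oplus>\<^bsub>cech n (Suc j) M\<^esub> cech_diff n j M y"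
proof -
  obtain m m' a where m: "m \<in> tups j" "m' \<in> tups j" "x = mk j m a" "y = mk j m' a"
    using cech_cases2[OF assms] .
  then have "(\<lambda>A. m A \<oplus>\<^bsub>M\<^esub> m' A) \<in> tups j" by (intro tupI) (simp add: tupD)
  with m show ?thesis
    by (simp add: mk_add cech_diff_mk) (simp add: mk_def bd_add cong: restrict_cong)
qed

lemma cech_diff_smult:
  assumes "r \<in> carrier (mpoly_ring n)" "x \<in> carrier (cech n j M)"
  shows "cech_diff n j M (r \<odot>\<^bsub>cech n j M\<^esub> x) = r \<odot>\<^bsub>cech n (Suc j) M\<^esub> cech_diff n j M x"
proof -
  obtain m a where m: "m \<in> tups j" "x = mk j m a"
    using cech_cases[OF assms(2)] .
  then have "(\<lambda>A. r \<odot>\<^bsub>M\<^esub> m A) \<in> tups j" using assms by (intro tupI) (simp add: tupD)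
  with m assms(1) show ?thesis
    by (simp add: mk_smult cech_diff_mk) (simp add: mk_def bd_smult cong: restrict_cong)
qed

lemma cech_diff_diff:
  assumes "x \<in> carrier (cech n j M)"
  shows "cech_diff n (Suc j) M (cech_diff n j M x) = \<zero>\<^bsub>cech n (Suc (Suc j)) M\<^esub>"
proof -
  obtain m a where m: "m \<in> tups j" "x = mk j m a"
    using cech_cases[OF assms] .
  then show ?thesis
    by (simp add: cech_diff_mk mk_zero[of _ a]) (simp add: mk_def bd_bd cong: restrict_cong)
qed

end

section \<open>Homogeneous components and the grading of the Cech complex\<close>

locale graded_mod =
  fixes n and M :: "('k::field mpoly, 'm) gmodule"
  assumes graded: "graded_module n M"
begin

sublocale mpoly_module n M
  using graded by (simp add: graded_module_def mpoly_module_def)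

abbreviation comp :: "int \<Rightarrow> 'm set" where "comp \<equiv> component M"

lemma comp_sub: "subgroup (comp k) (add_monoid M)"
  using graded by (simp add: graded_module_def)

lemmas comp_mem = M.subgroup_mem[OF comp_sub]
lemma comp_smult:
  "homogeneous i p \<Longrightarrow> p \<in> carrier (mpoly_ring n) \<Longrightarrow> x \<in> comp k \<Longrightarrow> p \<odot>\<^bsub>M\<^esub> x \<in> comp (k + int i)"
  using graded unfolding graded_module_def by blast

lemma comp_finsum:
  assumes "\<And>v. v \<in> A \<Longrightarrow> f v \<in> comp k"
  shows "finsum M f A \<in> comp k"
  using assms
proof (induction A rule: infinite_finite_induct)
  case (insert v A)
  then have "f \<in> A \<rightarrow> carrier M" "f v \<in> carrier M" by (auto intro: comp_mem)
  with insert show ?case by (simp add: finsum_insert comp_mem(3))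
qed (simp_all add: comp_mem(1) M.finsum_infinite)

text \<open>The homogeneous component of \<open>x\<close> in degree \<open>k\<close>.\<close>

definition hc :: "int \<Rightarrow> 'm \<Rightarrow> 'm" where
  "hc k x = (THE c. (\<forall>k. c k \<in> comp k) \<and> finite {k. c k \<noteq> \<zero>\<^bsub>M\<^esub>} \<and>
       x = finsum M c {k. c k \<noteq> \<zero>\<^bsub>M\<^esub>}) k"

lemma hc_props:
  assumes "x \<in> carrier M"
  shows "hc k x \<in> comp k" "finite {k. hc k x \<noteq> \<zero>\<^bsub>M\<^esub>}"
    "finsum M (\<lambda>k. hc k x) {k. hc k x \<noteq> \<zero>\<^bsub>M\<^esub>} = x"
proof -
  let ?P = "\<lambda>c. (\<forall>k. c k \<in> comp k) \<and> finite {k. c k \<noteq> \<zero>\<^bsub>M\<^esub>} \<and> x = finsum M c {k. c k \<noteq> \<zero>\<^bsub>M\<^esub>}"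
  have "\<exists>!c. ?P c" using graded assms by (simp add: graded_module_def)
  from theI'[OF this] have "?P (\<lambda>k. hc k x)" unfolding hc_def .
  then show "hc k x \<in> comp k" "finite {k. hc k x \<noteq> \<zero>\<^bsub>M\<^esub>}"
    "finsum M (\<lambda>k. hc k x) {k. hc k x \<noteq> \<zero>\<^bsub>M\<^esub>} = x" by simp_all
qed

text \<open>The index set \<open>K\<close> may exceed the support, so that decompositions of several
  elements can be compared over one common set.\<close>

lemma hc_unique:
  assumes "\<And>k. c k \<in> comp k" "finite K" "\<And>k. k \<notin> K \<Longrightarrow> c k = \<zero>\<^bsub>M\<^esub>" "x = finsum M c K"
  shows "hc k x = c k"
proof -
  let ?P = "\<lambda>c. (\<forall>k. c k \<in> comp k) \<and> finite {k. c k \<noteq> \<zero>\<^bsub>M\<^esub>} \<and> x = finsum M c {k. c k \<noteq> \<zero>\<^bsub>M\<^esub>}"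
  have c: "c \<in> A \<rightarrow> carrier M" for A using assms(1) comp_mem(2) by blast
  have sub: "{k. c k \<noteq> \<zero>\<^bsub>M\<^esub>} \<subseteq> K" using assms(3) by blast
  have "x \<in> carrier M" unfolding assms(4) by (rule M.finsum_closed[OF c])
  then have ex: "\<exists>!c. ?P c" using graded by (simp add: graded_module_def)
  have "finsum M c {k. c k \<noteq> \<zero>\<^bsub>M\<^esub>} = finsum M c K"
    by (rule M.add.finprod_mono_neutral_cong_left[OF assms(2) sub]) (use c in auto)
  then have "?P c" using assms(1,4) finite_subset[OF sub assms(2)] by simp
  then have "(THE c. ?P c) = c" by (rule the1_equality[where P = ?P, OF ex])
  then show ?thesis unfolding hc_def by simp
qed

lemma hc_sum:
  assumes "x \<in> carrier M" "finite K" "{k. hc k x \<noteq> \<zero>\<^bsub>M\<^esub>} \<subseteq> K"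
  shows "finsum M (\<lambda>k. hc k x) K = x"
proof -
  have "finsum M (\<lambda>k. hc k x) {k. hc k x \<noteq> \<zero>\<^bsub>M\<^esub>} = finsum M (\<lambda>k. hc k x) K"
    by (rule M.add.finprod_mono_neutral_cong_left[OF assms(2,3)])
      (use hc_props(1)[OF assms(1)] comp_mem(2) in auto)
  then show ?thesis using hc_props(3)[OF assms(1)] by simp
qed

lemma hc_closed [simp]: "x \<in> carrier M \<Longrightarrow> hc k x \<in> carrier M"
  using hc_props(1) comp_mem(2) by blast

lemma hc_comp: "x \<in> comp k \<Longrightarrow> hc l x = (if l = k then x else \<zero>\<^bsub>M\<^esub>)"
proof -
  assume x: "x \<in> comp k"
  let ?c = "\<lambda>l. if l = k then x else \<zero>\<^bsub>M\<^esub>"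
  have "hc l x = ?c l"
  proof (rule hc_unique[of _ "{k}"])
    show "x = finsum M ?c {k}" using x comp_mem(2) by (simp add: M.finsum_insert)
  qed (use x comp_mem(1) in auto)
  then show ?thesis .
qed

lemma hc_add:
  assumes "x \<in> carrier M" "y \<in> carrier M"
  shows "hc k (x \<oplus>\<^bsub>M\<^esub> y) = hc k x \<oplus>\<^bsub>M\<^esub> hc k y"
proof -
  let ?K = "{k. hc k x \<noteq> \<zero>\<^bsub>M\<^esub>} \<union> {k. hc k y \<noteq> \<zero>\<^bsub>M\<^esub>}"
  have K: "finite ?K" using hc_props(2) assms by blast
  have "finsum M (\<lambda>k. hc k x \<oplus>\<^bsub>M\<^esub> hc k y) ?K =
      finsum M (\<lambda>k. hc k x) ?K \<oplus>\<^bsub>M\<^esub> finsum M (\<lambda>k. hc k y) ?K"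
    by (rule M.finsum_addf) (use assms in auto)
  also have "\<dots> = x \<oplus>\<^bsub>M\<^esub> y"
    using hc_sum[OF assms(1) K] hc_sum[OF assms(2) K] by simp
  finally show ?thesis
    by (intro hc_unique[OF _ K]) (use assms hc_props(1) in \<open>auto intro: comp_mem(3)\<close>)
qed

lemma hc_zero [simp]: "hc k \<zero>\<^bsub>M\<^esub> = \<zero>\<^bsub>M\<^esub>"
  using hc_comp[OF comp_mem(1)] by simp

lemma hc_smult:
  assumes "homogeneous i p" "p \<in> carrier (mpoly_ring n)" "x \<in> carrier M"
  shows "hc k (p \<odot>\<^bsub>M\<^esub> x) = p \<odot>\<^bsub>M\<^esub> hc (k - int i) x"
proof -
  let ?S = "{k. hc k x \<noteq> \<zero>\<^bsub>M\<^esub>}" and ?h = "\<lambda>k. k + int i"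
  have S: "finite ?S" using hc_props(2) assms by blast
  have "p \<odot>\<^bsub>M\<^esub> x = finsum M (\<lambda>k. p \<odot>\<^bsub>M\<^esub> hc k x) ?S"
    using finsum_smult[OF S assms(2), of "\<lambda>k. hc k x"] hc_props(3)[OF assms(3)] assms(3) by simp
  also have "\<dots> = finsum M (\<lambda>k. p \<odot>\<^bsub>M\<^esub> hc (k - int i) x) (?h ` ?S)"
    using assms by (subst M.finsum_reindex) (auto intro: inj_onI)
  finally show ?thesis
  proof (intro hc_unique[of _ "?h ` ?S"])
    show "p \<odot>\<^bsub>M\<^esub> hc (k - int i) x \<in> comp k" for k
      using comp_smult[OF assms(1,2) hc_props(1)[OF assms(3)], of "k - int i"] by simp
    show "p \<odot>\<^bsub>M\<^esub> hc (k - int i) x = \<zero>\<^bsub>M\<^esub>" if "k \<notin> ?h ` ?S" for k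
    proof -
      have "k - int i \<notin> ?S" using that by (metis diff_add_cancel imageI)
      then show ?thesis using assms by simp
    qed
  qed (use S in auto)
qed

lemma hc_finsum:
  assumes "\<And>v. v \<in> A \<Longrightarrow> f v \<in> carrier M"
  shows "hc k (finsum M f A) = finsum M (\<lambda>v. hc k (f v)) A"
  using assms
proof (induction A rule: infinite_finite_induct)
  case (insert v A)
  then have "f \<in> A \<rightarrow> carrier M" "(\<lambda>v. hc k (f v)) \<in> A \<rightarrow> carrier M" by auto
  with insert show ?case by (simp add: M.finsum_insert hc_add M.finsum_closed)
qed (simp_all add: M.finsum_infinite)

abbreviation g :: "nat \<Rightarrow> int \<Rightarrow> (nat set \<Rightarrow> ('m \<times> nat) set) set" where
  "g j k \<equiv> component (cech n j M) k"

lemma xA_pow_comp: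
  assumes "A \<in> var_subsets n j" "x \<in> comp k"
  shows "var_prod A ^ t \<odot>\<^bsub>M\<^esub> x \<in> comp (k + int (j * t))"
  using comp_smult[OF homogeneous_power[OF homogeneous_var_prod] _ assms(2), of A t] var_subsetsD[OF assms(1)]
  by simp

text \<open>The degree of \<open>var_prod A\<close> is quantified in the definition of the
  localization; it is forced to be \<open>j\<close>, because a nonzero polynomial has at most one
  degree.\<close>

lemma component_localization:
  assumes "A \<in> var_subsets n j"
  shows "x \<in> component (localization (var_prod A) M) k \<longleftrightarrow>
    (\<exists>y a. y \<in> comp (k + int (j * a)) \<and> x = fraction (var_prod A) M y a)"
proof -
  note A = var_subsetsD[OF assms]
  have h: "homogeneous j (var_prod A :: 'k mpoly)" using homogeneous_var_prod[OF A(1)] A by simp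
  have "e = j" if "homogeneous e (var_prod A :: 'k mpoly)" for e
    using homogeneous_unique[OF that h var_prod_nonzero[OF A(1)]] .
  then have "x \<in> component (localization (var_prod A) M) k \<longleftrightarrow>
      (\<exists>y a l. x = fraction (var_prod A) M y a \<and> y \<in> comp l \<and> k = l - int (j * a))"
    using h unfolding localization_def gmodule.simps mem_Collect_eq by metis
  also have "\<dots> \<longleftrightarrow> (\<exists>y a. y \<in> comp (k + int (j * a)) \<and> x = fraction (var_prod A) M y a)"
    by (metis add_diff_cancel_right' diff_add_cancel)
  finally show ?thesis .
qed

lemma mk_g:
  assumes "m \<in> tup j (comp (k + int (j * a)))" shows "mk j m a \<in> g j k"
proof -
  have "fraction (var_prod A) M (m A) a \<in> component (localization (var_prod A) M) k"
    if "A \<in> var_subsets n j" for A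
    unfolding component_localization[OF that] using tupD[OF assms that] by blast
  then show ?thesis unfolding mk_def cech_simps restrict_PiE_iff by blast
qed

lemma g_cases:
  assumes "x \<in> g j k"
  obtains m a where "m \<in> tup j (comp (k + int (j * a)))" "x = mk j m a"
proof -
  have "\<exists>m a. \<forall>A\<in>var_subsets n j. m A \<in> comp (k + int (j * a)) \<and> m A \<in> carrier M \<and>
      x A = fraction (var_prod A) M (m A) a"
  proof (rule common_denominator)
    fix A assume A: "A \<in> var_subsets n j"
    then have "x A \<in> component (localization (var_prod A) M) k" using assms by (auto simp: cech_simps PiE_iff)
    then show "\<exists>y a. y \<in> comp (k + int (j * a)) \<and> y \<in> carrier M \<and> x A = fraction (var_prod A) M y a"
      using A comp_mem(2) by (auto simp: component_localization)
    fix y a t assume "y \<in> comp (k + int (j * a))"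
    from xA_pow_comp[OF A this, of t]
    show "var_prod A ^ t \<odot>\<^bsub>M\<^esub> y \<in> comp (k + int (j * (a + t)))"
      by (simp add: algebra_simps)
  qed auto
  then obtain m a where m: "m \<in> tup j (comp (k + int (j * a)))"
      "\<And>A. A \<in> var_subsets n j \<Longrightarrow> x A = fraction (var_prod A) M (m A) a"
    by (auto simp: tup_def)
  moreover from this have "x = mk j m a"
    using assms unfolding mk_def cech_simps by (intro extensionalityI[of x "var_subsets n j"]) (auto simp: PiE_iff)
  ultimately show thesis using that by blast
qed

lemma tup_comp: "m \<in> tup j (comp k) \<Longrightarrow> m \<in> tups j"
  using comp_mem(2) by (auto simp: tup_def)

lemma tup_comp_shift:
  "m \<in> tup j (comp (k + int (j * a))) \<Longrightarrow>
    (\<lambda>A. var_prod A ^ t \<odot>\<^bsub>M\<^esub> m A) \<in> tup j (comp (k + int (j * (a + t))))"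
  using xA_pow_comp[of _ j] by (fastforce simp: tup_def algebra_simps)

lemma g_carrier: "x \<in> g j k \<Longrightarrow> x \<in> carrier (cech n j M)"
  by (metis g_cases mk_closed tup_comp)

lemma subgroup_g: "subgroup (g j k) (add_monoid (cech n j M))"
proof -
  interpret C: module "mpoly_ring n" "cech n j M" by (rule module_cech)
  show ?thesis
  proof (rule C.subgroupI_diff)
    show "g j k \<subseteq> carrier (cech n j M)" using g_carrier by blast
    show "\<zero>\<^bsub>cech n j M\<^esub> \<in> g j k"
      unfolding mk_zero[of j 0] by (rule mk_g) (simp add: tup_def comp_mem)
    fix x y assume "x \<in> g j k" "y \<in> g j k"
    then obtain m a m' b where m: "m \<in> tup j (comp (k + int (j * a)))" "x = mk j m a"
      "m' \<in> tup j (comp (k + int (j * b)))" "y = mk j m' b"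
      by (metis g_cases)
    note s = tup_comp_shift[OF m(1), of b] tup_comp_shift[OF m(3), of a]
    have e: "x = mk j (\<lambda>A. var_prod A ^ b \<odot>\<^bsub>M\<^esub> m A) (a + b)" "y = mk j (\<lambda>A. var_prod A ^ a \<odot>\<^bsub>M\<^esub> m' A) (a + b)"
      using m mk_shift[OF tup_comp[OF m(1)], of b a] mk_shift[OF tup_comp[OF m(3)], of a b]
      by (simp_all add: add.commute)
    have "(\<lambda>A. var_prod A ^ b \<odot>\<^bsub>M\<^esub> m A \<ominus>\<^bsub>M\<^esub> var_prod A ^ a \<odot>\<^bsub>M\<^esub> m' A) \<in> tup j (comp (k + int (j * (a + b))))"
      using s by (auto simp: tup_def add.commute intro: comp_mem(5))
    then show "x \<ominus>\<^bsub>cech n j M\<^esub> y \<in> g j k"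
      unfolding e mk_diff[OF tup_comp[OF s(1)] tup_comp[OF s(2)]] by (rule mk_g)
  qed
qed

lemma g_smult:
  assumes "homogeneous i p" "p \<in> carrier (mpoly_ring n)" "x \<in> g j k"
  shows "p \<odot>\<^bsub>cech n j M\<^esub> x \<in> g j (k + int i)"
proof -
  obtain m a where m: "m \<in> tup j (comp (k + int (j * a)))" "x = mk j m a"
    using g_cases[OF assms(3)] .
  have "p \<odot>\<^bsub>M\<^esub> m A \<in> comp (k + int i + int (j * a))" if "A \<in> var_subsets n j" for A
    using comp_smult[OF assms(1,2) tupD[OF m(1) that]] by (simp add: algebra_simps)
  then show ?thesis
    unfolding m(2) mk_smult[OF assms(2) tup_comp[OF m(1)]] by (intro mk_g tupI)
qed

lemma bd_comp:
  assumes "m \<in> tup j (comp k)"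
  shows "bd a m \<in> tup (Suc j) (comp (k + int a))"
proof (rule tupI)
  fix A assume A: "A \<in> var_subsets n (Suc j)"
  show "bd a m A \<in> comp (k + int a)"
    unfolding bd_def
  proof (rule comp_finsum)
    fix v assume v: "v \<in> A"
    have "sg A v \<odot>\<^bsub>M\<^esub> (Var v ^ a \<odot>\<^bsub>M\<^esub> m (A - {v})) \<in> comp (k + int (1 * a) + int 0)"
      using v var_subsetsD[OF A]
      by (intro comp_smult homogeneous_power homogeneous_Var tupD[OF assms] var_subsets_remove[OF A])
        (simp_all add: homogeneous_sign sg_def)
    then show "sg A v \<odot>\<^bsub>M\<^esub> (Var v ^ a \<odot>\<^bsub>M\<^esub> m (A - {v})) \<in> comp (k + int a)" by simp
  qed
qed

lemma cech_diff_g: "x \<in> g j k \<Longrightarrow> cech_diff n j M x \<in> g (Suc j) k"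
proof -
  assume "x \<in> g j k"
  then obtain m a where m: "m \<in> tup j (comp (k + int (j * a)))" "x = mk j m a"
    by (rule g_cases)
  show ?thesis
    unfolding m(2) cech_diff_mk[OF tup_comp[OF m(1)]]
    using bd_comp[OF m(1), of a] by (intro mk_g) (simp add: algebra_simps)
qed

section \<open>Cochains with numerators in a submodule\<close>

text \<open>The image of the Cech complex of \<open>N\<close> in that of \<open>M\<close>. Other
  numerators of the same cochain need not lie in \<open>N\<close>.\<close>

definition CNs :: "'m set \<Rightarrow> nat \<Rightarrow> (nat set \<Rightarrow> ('m \<times> nat) set) set" where
  "CNs N j = {mk j m a | m a. m \<in> tup j N}"

context
  fixes N assumes N: "submodule N (mpoly_ring n) M"
begin

lemma N_sub: "subgroup N (add_monoid M)"
  using N by (simp add: submodule_def)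

lemmas N_mem = M.subgroup_mem[OF N_sub]

lemma N_smult: "p \<in> carrier (mpoly_ring n) \<Longrightarrow> x \<in> N \<Longrightarrow> p \<odot>\<^bsub>M\<^esub> x \<in> N"
  by (rule submodule.smult_closed[OF N])

lemma N_finsum: "(\<And>v. v \<in> A \<Longrightarrow> f v \<in> N) \<Longrightarrow> finsum M f A \<in> N"
proof (induction A rule: infinite_finite_induct)
  case (insert v A)
  then have "f \<in> A \<rightarrow> carrier M" "f v \<in> carrier M" by (auto intro: N_mem)
  with insert show ?case by (simp add: finsum_insert N_mem(3))
qed (simp_all add: N_mem(1) M.finsum_infinite)

lemma tup_N: "m \<in> tup j N \<Longrightarrow> m \<in> tups j"
  using N_mem(2) by (auto simp: tup_def)

lemma tup_N_shift: "m \<in> tup j N \<Longrightarrow> (\<lambda>A. var_prod A ^ t \<odot>\<^bsub>M\<^esub> m A) \<in> tup j N"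
  by (intro tupI N_smult) (auto dest: tupD)

text \<open>Two representations of a fraction agree after multiplication by powers of the
  denominator; hence a given numerator lies in \<open>N\<close> only up to such a power.\<close>

lemma CNs_iff:
  assumes "m \<in> tups j"
  shows "mk j m a \<in> CNs N j \<longleftrightarrow> (\<exists>c. \<forall>A\<in>var_subsets n j. var_prod A ^ c \<odot>\<^bsub>M\<^esub> m A \<in> N)"
proof
  assume "mk j m a \<in> CNs N j"
  then obtain m' b where m': "m' \<in> tup j N" "mk j m a = mk j m' b" by (auto simp: CNs_def)
  then obtain c where "\<forall>A\<in>var_subsets n j. var_prod A ^ (c + b) \<odot>\<^bsub>M\<^esub> m A = var_prod A ^ (c + a) \<odot>\<^bsub>M\<^esub> m' A"
    using mk_eq_iff[OF assms tup_N[OF m'(1)]] by blast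
  then have "\<forall>A\<in>var_subsets n j. var_prod A ^ (c + b) \<odot>\<^bsub>M\<^esub> m A \<in> N"
    using tup_N_shift[OF m'(1), of "c + a"] by (auto dest: tupD)
  then show "\<exists>c. \<forall>A\<in>var_subsets n j. var_prod A ^ c \<odot>\<^bsub>M\<^esub> m A \<in> N" by blast
next
  assume "\<exists>c. \<forall>A\<in>var_subsets n j. var_prod A ^ c \<odot>\<^bsub>M\<^esub> m A \<in> N"
  then obtain c where "(\<lambda>A. var_prod A ^ c \<odot>\<^bsub>M\<^esub> m A) \<in> tup j N" by (auto simp: tup_def)
  with mk_shift[OF assms, of c a, symmetric] show "mk j m a \<in> CNs N j" unfolding CNs_def by blast
qed

lemma submodule_CNs: "submodule (CNs N j) (mpoly_ring n) (cech n j M)"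
proof -
  interpret C: module "mpoly_ring n" "cech n j M" by (rule module_cech)
  have "subgroup (CNs N j) (add_monoid (cech n j M))"
  proof (rule C.subgroupI_diff)
    show "CNs N j \<subseteq> carrier (cech n j M)" by (auto simp: CNs_def tup_N)
    show "\<zero>\<^bsub>cech n j M\<^esub> \<in> CNs N j"
      unfolding mk_zero[of j 0] CNs_def using N_mem(1) by (auto simp: tup_def)
    fix x y assume "x \<in> CNs N j" "y \<in> CNs N j"
    then obtain m a m' b where m: "m \<in> tup j N" "x = mk j m a" "m' \<in> tup j N" "y = mk j m' b"
      by (auto simp: CNs_def)
    note s = tup_N_shift[OF m(1), of b] tup_N_shift[OF m(3), of a]
    have e: "x = mk j (\<lambda>A. var_prod A ^ b \<odot>\<^bsub>M\<^esub> m A) (a + b)" "y = mk j (\<lambda>A. var_prod A ^ a \<odot>\<^bsub>M\<^esub> m' A) (a + b)"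
      using m mk_shift[OF tup_N[OF m(1)], of b a] mk_shift[OF tup_N[OF m(3)], of a b]
      by (simp_all add: add.commute)
    have "(\<lambda>A. var_prod A ^ b \<odot>\<^bsub>M\<^esub> m A \<ominus>\<^bsub>M\<^esub> var_prod A ^ a \<odot>\<^bsub>M\<^esub> m' A) \<in> tup j N"
      using s by (auto simp: tup_def intro: N_mem(5))
    then show "x \<ominus>\<^bsub>cech n j M\<^esub> y \<in> CNs N j"
      unfolding e mk_diff[OF tup_N[OF s(1)] tup_N[OF s(2)]] unfolding CNs_def by blast
  qed
  moreover have "p \<odot>\<^bsub>cech n j M\<^esub> x \<in> CNs N j" if p: "p \<in> carrier (mpoly_ring n)" and "x \<in> CNs N j" for p x
  proof -
    from \<open>x \<in> CNs N j\<close> obtain m a where m: "m \<in> tup j N" "x = mk j m a" by (auto simp: CNs_def)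
    have "(\<lambda>A. p \<odot>\<^bsub>M\<^esub> m A) \<in> tup j N" using m p by (auto simp: tup_def intro: N_smult)
    then show ?thesis
      unfolding m(2) mk_smult[OF p tup_N[OF m(1)]] unfolding CNs_def by blast
  qed
  ultimately show ?thesis
    by (intro submodule.intro) (simp_all add: submodule_axioms_def)
qed

lemma bd_N: "m \<in> tup j N \<Longrightarrow> bd a m \<in> tup (Suc j) N"
  unfolding bd_def
  by (intro tupI N_finsum N_smult) (auto dest: tupD var_subsetsD(4) intro: var_subsets_remove)

lemma cech_diff_CNs: "x \<in> CNs N j \<Longrightarrow> cech_diff n j M x \<in> CNs N (Suc j)"
  unfolding CNs_def using tup_N cech_diff_mk bd_N by fastforce

text \<open>A homogeneous numerator and a numerator in \<open>N\<close> may be different ones;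
  multiplying the homogeneous one by a power of the denominator gives one with both
  properties.\<close>

lemma CNs_g_cases:
  assumes "x \<in> CNs N j" "x \<in> g j k"
  obtains m a where "m \<in> tup j N" "m \<in> tup j (comp (k + int (j * a)))" "x = mk j m a"
proof -
  obtain m a where m: "m \<in> tup j (comp (k + int (j * a)))" "x = mk j m a"
    using g_cases[OF assms(2)] .
  obtain c where "(\<lambda>A. var_prod A ^ c \<odot>\<^bsub>M\<^esub> m A) \<in> tup j N"
    using assms(1) CNs_iff[OF tup_comp[OF m(1)]] m(2) by (auto simp: tup_def)
  from that[OF this tup_comp_shift[OF m(1), of c]] show thesis
    using mk_shift[OF tup_comp[OF m(1)], of c a] m(2) by simp
qed

text \<open>The colon hypothesis says that the irrelevant ideal annihilates
  \<open>(N : p) / N\<close>. In positive cohomological degree the index sets \<open>A\<close> are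
  nonempty, so \<open>var_prod A\<close> lies in that ideal, and one further factor of it brings the
  numerator into \<open>N\<close>.\<close>

lemma CNs_colon:
  assumes "p \<in> carrier (mpoly_ring n)" "x \<in> carrier (cech n (Suc j) M)"
    and "p \<odot>\<^bsub>cech n (Suc j) M\<^esub> x \<in> CNs N (Suc j)"
    and colon: "\<And>u q. u \<in> carrier M \<Longrightarrow> p \<odot>\<^bsub>M\<^esub> u \<in> N \<Longrightarrow> q \<in> irrelevant_ideal n \<Longrightarrow> q \<odot>\<^bsub>M\<^esub> u \<in> N"
  shows "x \<in> CNs N (Suc j)"
proof -
  obtain m a where m: "m \<in> tups (Suc j)" "x = mk (Suc j) m a" using cech_cases[OF assms(2)] .
  have pm: "(\<lambda>A. p \<odot>\<^bsub>M\<^esub> m A) \<in> tups (Suc j)" using m assms(1) by (auto simp: tup_def)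
  obtain c where c: "\<And>A. A \<in> var_subsets n (Suc j) \<Longrightarrow> var_prod A ^ c \<odot>\<^bsub>M\<^esub> (p \<odot>\<^bsub>M\<^esub> m A) \<in> N"
    using assms(3) unfolding m(2) mk_smult[OF assms(1) m(1)] CNs_iff[OF pm] by blast
  have "var_prod A ^ Suc c \<odot>\<^bsub>M\<^esub> m A \<in> N" if A: "A \<in> var_subsets n (Suc j)" for A
  proof -
    have "A \<noteq> {}" using var_subsetsD(3)[OF A] by auto
    then obtain v where v: "v \<in> A" by blast
    have "(var_prod (A - {v}) :: 'k mpoly) * Var v = var_prod A"
      using var_prod_remove[OF var_subsetsD(1)[OF A] v] .
    then have irr: "var_prod A \<in> (irrelevant_ideal n :: 'k mpoly set)"
      using irrelevant_mult[OF Var_irrelevant[OF var_subsetsD(4)[OF A v]], of "var_prod (A - {v})"]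
        var_subsetsD(2)[OF A] by (metis Diff_subset subset_trans var_prod_closed)
    have "p \<odot>\<^bsub>M\<^esub> (var_prod A ^ c \<odot>\<^bsub>M\<^esub> m A) \<in> N"
      using c[OF A] assms(1) A tupD[OF m(1) A] by (simp add: smult_left_comm[of p])
    then have "var_prod A \<odot>\<^bsub>M\<^esub> (var_prod A ^ c \<odot>\<^bsub>M\<^esub> m A) \<in> N"
      using colon[OF _ _ irr] A tupD[OF m(1) A] by simp
    then show ?thesis
      using A tupD[OF m(1) A] by (simp add: smult_mult)
  qed
  then show ?thesis unfolding m(2) CNs_iff[OF m(1)] by blast
qed

end

lemma CNs_mono: "N \<subseteq> N' \<Longrightarrow> CNs N j \<subseteq> CNs N' j"
  unfolding CNs_def tup_def by blast

lemma CNs_zero: "CNs {\<zero>\<^bsub>M\<^esub>} j = {\<zero>\<^bsub>cech n j M\<^esub>}"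
proof -
  have e: "mk j m a = mk j (\<lambda>_. \<zero>\<^bsub>M\<^esub>) a" if "m \<in> tup j {\<zero>\<^bsub>M\<^esub>}" for m a
    using that unfolding mk_def by (intro restrict_ext) (auto dest: tupD)
  have "CNs {\<zero>\<^bsub>M\<^esub>} j \<subseteq> {\<zero>\<^bsub>cech n j M\<^esub>}"
    unfolding CNs_def using e mk_zero[of j] by auto
  moreover have "\<zero>\<^bsub>cech n j M\<^esub> \<in> CNs {\<zero>\<^bsub>M\<^esub>} j"
    unfolding mk_zero[of j 0] CNs_def by (auto simp: tup_def)
  ultimately show ?thesis by blast
qed

end

section \<open>Homogeneous parts in the Cech complex and nilpotency of the variables\<close>

context graded_mod
begin

lemma finsum_mk:
  assumes "finite I" "\<And>l. l \<in> I \<Longrightarrow> m l \<in> tups j"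
  shows "finsum (cech n j M) (\<lambda>l. mk j (m l) a) I = mk j (\<lambda>A. finsum M (\<lambda>l. m l A) I) a"
proof -
  interpret C: module "mpoly_ring n" "cech n j M" by (rule module_cech)
  show ?thesis
    using assms
  proof (induction I rule: finite_induct)
    case empty
    then show ?case by (simp add: mk_zero[of j a])
  next
    case (insert i I)
    have c: "(\<lambda>l. mk j (m l) a) \<in> I \<rightarrow> carrier (cech n j M)" "mk j (m i) a \<in> carrier (cech n j M)"
      using insert.prems mk_closed by auto
    have t: "(\<lambda>A. finsum M (\<lambda>l. m l A) I) \<in> tups j"
      using insert.prems by (intro tupI M.finsum_closed) (auto dest: tupD)
    have "finsum (cech n j M) (\<lambda>l. mk j (m l) a) (insert i I) =
       mk j (\<lambda>A. m i A \<oplus>\<^bsub>M\<^esub> finsum M (\<lambda>l. m l A) I) a"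
      using insert c t by (simp add: C.finsum_insert mk_add)
    also have "\<dots> = mk j (\<lambda>A. finsum M (\<lambda>l. m l A) (insert i I)) a"
      unfolding mk_def
    proof (rule restrict_ext)
      fix A assume A: "A \<in> var_subsets n j"
      have "(\<lambda>l. m l A) \<in> I \<rightarrow> carrier M" "m i A \<in> carrier M"
        using insert.prems tupD[OF _ A] by auto
      with insert.hyps show "fraction (var_prod A) M (m i A \<oplus>\<^bsub>M\<^esub> finsum M (\<lambda>l. m l A) I) a =
         fraction (var_prod A) M (finsum M (\<lambda>l. m l A) (insert i I)) a"
        by (simp add: M.finsum_insert)
    qed
    finally show ?case .
  qed
qed

text \<open>The decomposition is computed on numerators. Over a common denominator, and after a
  power of it has removed the ambiguity of fractions, the equation holds in \<open>M\<close>, where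
  homogeneous components can be taken.\<close>

lemma homogeneous_part_of_sum:
  assumes "finite I" "\<And>l. l \<in> I \<Longrightarrow> c l \<in> g j l" "w \<in> tups j" "finsum (cech n j M) c I = mk j w b" "l \<in> I"
  shows "c l = mk j (\<lambda>A. hc (l + int (j * b)) (w A)) b"
proof -
  interpret C: module "mpoly_ring n" "cech n j M" by (rule module_cech)
  have "\<exists>m a. m \<in> tup j (comp (l + int (j * a))) \<and> c l = mk j m a" if "l \<in> I" for l
    using g_cases[OF assms(2)[OF that]] by metis
  then obtain m a where m: "\<And>l. l \<in> I \<Longrightarrow> m l \<in> tup j (comp (l + int (j * a l))) \<and> c l = mk j (m l) (a l)"
    by metis
  \<comment> \<open>A common exponent for all summands that is also at least
    \<open>b\<close>.\<close>
  define e where "e = b + sum a I"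
  have le: "a l \<le> e" if "l \<in> I" for l
    using member_le_sum[of l I a] that assms(1) by (simp add: e_def)
  define m' where "m' l A = var_prod A ^ (e - a l) \<odot>\<^bsub>M\<^esub> m l A" for l A
  have m': "m' l \<in> tup j (comp (l + int (j * e)))" "c l = mk j (m' l) e" if "l \<in> I" for l
    using tup_comp_shift[of "m l" j l "a l" "e - a l"] mk_shift[OF tup_comp, of "m l" j _ "e - a l" "a l"]
      m[OF that] le[OF that] unfolding m'_def by (auto simp del: of_nat_mult)
  define w' where "w' A = var_prod A ^ (e - b) \<odot>\<^bsub>M\<^esub> w A" for A
  have w': "w' \<in> tups j" "mk j w b = mk j w' e"
    using tup_shift[OF assms(3), of "e - b"] mk_shift[OF assms(3), of "e - b" b] unfolding w'_def by (simp_all add: e_def)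
  have "mk j w' e = finsum (cech n j M) (\<lambda>l. mk j (m' l) e) I"
    unfolding w'(2)[symmetric] assms(4)[symmetric]
    using m'(2) mk_closed[OF tup_comp[OF m'(1)]] by (intro C.finsum_cong') (simp_all)
  also have "\<dots> = mk j (\<lambda>A. finsum M (\<lambda>l. m' l A) I) e"
    by (rule finsum_mk[OF assms(1)]) (use m'(1) tup_comp in blast)
  finally have eq: "mk j w' e = mk j (\<lambda>A. finsum M (\<lambda>l. m' l A) I) e" .
  have mc: "m' l A \<in> carrier M" if "l \<in> I" "A \<in> var_subsets n j" for l A
    using m'(1)[OF that(1)] that(2) tup_comp tupD by metis
  have t: "(\<lambda>A. finsum M (\<lambda>l. m' l A) I) \<in> tups j"
    using mc by (intro tupI M.finsum_closed) auto
  obtain s where s: "\<And>A. A \<in> var_subsets n j \<Longrightarrow>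
      var_prod A ^ (s + e) \<odot>\<^bsub>M\<^esub> w' A = var_prod A ^ (s + e) \<odot>\<^bsub>M\<^esub> finsum M (\<lambda>l. m' l A) I"
    using eq mk_eq_iff[OF w'(1) t] by blast
  have hom: "homogeneous (j * t) (var_prod A ^ t :: 'k mpoly)" if "A \<in> var_subsets n j" for A t
    using homogeneous_power[OF homogeneous_var_prod] var_subsetsD[OF that] by metis
  have hcm: "hc (l + int (j * e)) (m' l' A) = (if l' = l then m' l' A else \<zero>\<^bsub>M\<^esub>)"
    if "l' \<in> I" "A \<in> var_subsets n j" for l' A
    using hc_comp[OF tupD[OF m'(1)[OF that(1)] that(2)], of "l + int (j * e)"] by simp
  \<comment> \<open>The numerators of different summands have different degrees, so one component
    singles out \<open>m' l\<close>.\<close>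
  have hs: "hc (l + int (j * e)) (finsum M (\<lambda>l. m' l A) I) = m' l A" if A: "A \<in> var_subsets n j" for A
  proof -
    have "hc (l + int (j * e)) (finsum M (\<lambda>l. m' l A) I) = finsum M (\<lambda>l'. hc (l + int (j * e)) (m' l' A)) I"
      using mc A by (intro hc_finsum)
    also have "\<dots> = finsum M (\<lambda>l'. if l = l' then m' l' A else \<zero>\<^bsub>M\<^esub>) I"
      using mc A hcm by (intro M.finsum_cong') auto
    also have "\<dots> = m' l A"
      using mc A by (intro M.finsum_singleton[OF assms(5,1)]) auto
    finally show ?thesis .
  qed
  let ?h = "\<lambda>A. hc (l + int (j * b)) (w A)"
  have ht: "?h \<in> tups j" using assms(3) by (intro tupI) (simp add: tupD)
  have "var_prod A ^ (s + e + b) \<odot>\<^bsub>M\<^esub> m' l A = var_prod A ^ (s + e + e) \<odot>\<^bsub>M\<^esub> ?h A"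
    if A: "A \<in> var_subsets n j" for A
  proof -
    have "var_prod A ^ (s + e) \<odot>\<^bsub>M\<^esub> m' l A =
       hc (l + int (j * e) + int (j * (s + e))) (var_prod A ^ (s + e) \<odot>\<^bsub>M\<^esub> finsum M (\<lambda>l. m' l A) I)"
      using tupD[OF t A] A hs[OF A] by (subst hc_smult[OF hom[OF A]]) simp_all
    also have "\<dots> = hc (l + int (j * e) + int (j * (s + e))) (var_prod A ^ (s + e) \<odot>\<^bsub>M\<^esub> (var_prod A ^ (e - b) \<odot>\<^bsub>M\<^esub> w A))"
      using s[OF A] by (simp add: w'_def)
    also have "var_prod A ^ (s + e) \<odot>\<^bsub>M\<^esub> (var_prod A ^ (e - b) \<odot>\<^bsub>M\<^esub> w A) = var_prod A ^ (s + e + (e - b)) \<odot>\<^bsub>M\<^esub> w A"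
      using A tupD[OF assms(3) A] by (simp add: smult_mult power_add)
    also have "hc (l + int (j * e) + int (j * (s + e))) (var_prod A ^ (s + e + (e - b)) \<odot>\<^bsub>M\<^esub> w A) =
        var_prod A ^ (s + e + (e - b)) \<odot>\<^bsub>M\<^esub> ?h A"
    proof -
      \<comment> \<open>Multiplication by a power of \<open>var_prod A\<close> shifts degrees by
        \<open>j\<close> times the exponent, and \<open>e - b\<close> is a true difference since
        \<open>e \<ge> b\<close>.\<close>
      have deg: "l + int (j * e) + int (j * (s + e)) - int (j * (s + e + (e - b))) = l + int (j * b)"
        by (simp add: e_def algebra_simps)
      show ?thesis
        unfolding deg[symmetric] using A tupD[OF assms(3) A] by (intro hc_smult[OF hom[OF A]]) simp_all
    qed
    finally have "var_prod A ^ b \<odot>\<^bsub>M\<^esub> (var_prod A ^ (s + e) \<odot>\<^bsub>M\<^esub> m' l A) =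
       var_prod A ^ b \<odot>\<^bsub>M\<^esub> (var_prod A ^ (s + e + (e - b)) \<odot>\<^bsub>M\<^esub> ?h A)" by simp
    then show ?thesis
      using A mc[OF assms(5) A] tupD[OF ht A]
      by (simp add: smult_mult[symmetric] power_add[symmetric] e_def ac_simps)
  qed
  then have "mk j (m' l) e = mk j ?h b"
    using mk_eq_iff[OF tup_comp[OF m'(1)[OF assms(5)]] ht, of e b] by blast
  then show ?thesis using m'(2)[OF assms(5)] by simp
qed

lemma hc_bd:
  assumes "m \<in> tups j" "A \<in> var_subsets n (Suc j)"
  shows "hc (k + int a) (bd a m A) = bd a (\<lambda>A. hc k (m A)) A"
proof -
  note A = var_subsetsD[OF assms(2)] and r = var_subsets_remove[OF assms(2)]
  have "hc (k + int a) (bd a m A) = finsum M (\<lambda>v. hc (k + int a) (sg A v \<odot>\<^bsub>M\<^esub> (Var v ^ a \<odot>\<^bsub>M\<^esub> m (A - {v})))) A"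
    unfolding bd_def using A r tupD[OF assms(1)] by (intro hc_finsum) auto
  also have "\<dots> = bd a (\<lambda>A. hc k (m A)) A"
    unfolding bd_def
  proof (rule M.finsum_cong')
    fix v assume v: "v \<in> A"
    have h: "homogeneous a (Var v ^ a)" using homogeneous_power[OF homogeneous_Var, of a v] by simp
    have h0: "homogeneous 0 (sg A v)" by (simp add: sg_def homogeneous_sign)
    show "hc (k + int a) (sg A v \<odot>\<^bsub>M\<^esub> (Var v ^ a \<odot>\<^bsub>M\<^esub> m (A - {v}))) = sg A v \<odot>\<^bsub>M\<^esub> (Var v ^ a \<odot>\<^bsub>M\<^esub> hc k (m (A - {v})))"
      using A(4)[OF v] tupD[OF assms(1) r[OF v]] by (simp add: hc_smult[OF h0] hc_smult[OF h])
  qed (use A r tupD[OF assms(1)] in auto)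
  finally show ?thesis .
qed

text \<open>A primitive can be replaced by its homogeneous part, since the differential respects
  degrees. Allowing several summands at once also yields the independence of the graded pieces of
  cohomology.\<close>

lemma homogeneous_coboundary:
  assumes "finite I" "\<And>l. l \<in> I \<Longrightarrow> c l \<in> g (Suc j) l" "e \<in> carrier (cech n j M)"
    "finsum (cech n (Suc j) M) c I = cech_diff n j M e" "l \<in> I"
  shows "\<exists>e'\<in>g j l. c l = cech_diff n j M e'"
proof -
  obtain q b where q: "q \<in> tups j" "e = mk j q b" using cech_cases[OF assms(3)] .
  let ?q = "\<lambda>A. hc (l + int (j * b)) (q A)"
  have q': "?q \<in> tup j (comp (l + int (j * b)))"
    using hc_props(1) tupD[OF q(1)] by (intro tupI) blast
  have "c l = mk (Suc j) (\<lambda>A. hc (l + int (Suc j * b)) (bd b q A)) b"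
    using assms q by (intro homogeneous_part_of_sum[OF assms(1,2)]) (simp_all add: cech_diff_mk)
  also have "\<dots> = mk (Suc j) (bd b ?q) b"
    unfolding mk_def using hc_bd[OF q(1), of _ "l + int (j * b)" b]
    by (intro restrict_ext) (simp add: algebra_simps)
  also have "\<dots> = cech_diff n j M (mk j ?q b)"
    by (rule cech_diff_mk[OF tup_comp[OF q'], symmetric])
  finally show ?thesis using mk_g[OF q'] by blast
qed

lemma homogeneous_zero_sum:
  assumes "finite I" "\<And>l. l \<in> I \<Longrightarrow> c l \<in> g j l" "finsum (cech n j M) c I = \<zero>\<^bsub>cech n j M\<^esub>" "l \<in> I"
  shows "c l = \<zero>\<^bsub>cech n j M\<^esub>"
proof -
  have "c l = mk j (\<lambda>A. hc (l + int (j * 0)) \<zero>\<^bsub>M\<^esub>) 0"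
    using assms mk_zero[of j 0] by (intro homogeneous_part_of_sum[OF assms(1,2)]) (auto simp: tup_def)
  then show ?thesis by (simp add: mk_zero[of j 0])
qed

text \<open>The cone construction in direction \<open>v\<close> is a contracting homotopy after inverting
  \<open>x\<^sub>v\<close>, so a power of \<open>x\<^sub>v\<close> turns each cocycle into a coboundary.\<close>

lemma bd_cone:
  assumes m: "m \<in> tups (Suc j)" and A: "A \<in> var_subsets n (Suc j)" and v: "v < n"
  defines "l \<equiv> (\<lambda>A. if v \<in> A then \<zero>\<^bsub>M\<^esub> else sg A v \<odot>\<^bsub>M\<^esub> m (insert v A))"
  shows "Var v ^ a \<odot>\<^bsub>M\<^esub> m A \<ominus>\<^bsub>M\<^esub> bd a l A =
    (if v \<in> A then \<zero>\<^bsub>M\<^esub> else sg A v \<odot>\<^bsub>M\<^esub> bd a m (insert v A))"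
proof -
  note A' = var_subsetsD[OF A] and r = var_subsets_remove[OF A]
  have mA: "m A \<in> carrier M" by (rule tupD[OF m A])
  have vn: "(Var v :: 'k mpoly) \<in> carrier (mpoly_ring n)" using v by simp
  have lc: "l (A - {u}) \<in> carrier M" if "u \<in> A" for u
  proof (cases "v \<in> A - {u}")
    case False
    have "m (insert v (A - {u})) \<in> carrier M"
      using False v by (intro tupD[OF m] var_subsets_insert r that)
    then show ?thesis using False by (simp add: l_def)
  qed (simp add: l_def)
  have tc: "sg A u \<odot>\<^bsub>M\<^esub> (Var u ^ a \<odot>\<^bsub>M\<^esub> l (A - {u})) \<in> carrier M" if "u \<in> A" for u
    using lc[OF that] A'(4)[OF that] by simp
  show ?thesis
  proof (cases "v \<in> A")
    case True
    \<comment> \<open>\<open>l\<close> vanishes on all sets containing \<open>v\<close>, so among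
      the faces of \<open>A\<close> only \<open>A - {v}\<close> contributes.\<close>
    have "bd a l A = finsum M (\<lambda>u. if v = u then sg A u \<odot>\<^bsub>M\<^esub> (Var u ^ a \<odot>\<^bsub>M\<^esub> l (A - {u})) else \<zero>\<^bsub>M\<^esub>) A"
      unfolding bd_def
    proof (rule M.finsum_cong')
      fix u assume u: "u \<in> A"
      show "sg A u \<odot>\<^bsub>M\<^esub> (Var u ^ a \<odot>\<^bsub>M\<^esub> l (A - {u})) =
          (if v = u then sg A u \<odot>\<^bsub>M\<^esub> (Var u ^ a \<odot>\<^bsub>M\<^esub> l (A - {u})) else \<zero>\<^bsub>M\<^esub>)"
        using True A'(4)[OF u] by (simp add: l_def)
    qed (use tc in auto)
    also have "\<dots> = sg A v \<odot>\<^bsub>M\<^esub> (Var v ^ a \<odot>\<^bsub>M\<^esub> l (A - {v}))"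
      using tc by (intro M.finsum_singleton[OF True A'(1)]) auto
    also have "l (A - {v}) = sg A v \<odot>\<^bsub>M\<^esub> m A"
      using sg_remove(2)[OF A'(1) True, of v, where 'k = 'k] True by (simp add: l_def insert_absorb)
    also have "sg A v \<odot>\<^bsub>M\<^esub> (Var v ^ a \<odot>\<^bsub>M\<^esub> (sg A v \<odot>\<^bsub>M\<^esub> m A)) = (sg A v * sg A v) \<odot>\<^bsub>M\<^esub> (Var v ^ a \<odot>\<^bsub>M\<^esub> m A)"
      using mA vn by (simp add: smult_mult[symmetric] ac_simps)
    also have "\<dots> = Var v ^ a \<odot>\<^bsub>M\<^esub> m A"
      unfolding sg_self using mA vn by simp
    finally show ?thesis using True mA vn by simp
  next
    case False
    define S where "S = finsum M (\<lambda>u. sg (insert v A) u \<odot>\<^bsub>M\<^esub> (Var u ^ a \<odot>\<^bsub>M\<^esub> m (insert v A - {u}))) A"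
    have iu: "insert v A - {u} = insert v (A - {u})" if "u \<in> A" for u using that False by auto
    have mc: "m (insert v (A - {u})) \<in> carrier M" if "u \<in> A" for u
      using False v by (intro tupD[OF m] var_subsets_insert r that) auto
    have Sc: "(\<lambda>u. sg (insert v A) u \<odot>\<^bsub>M\<^esub> (Var u ^ a \<odot>\<^bsub>M\<^esub> m (insert v A - {u}))) \<in> A \<rightarrow> carrier M"
      using mc A' by (auto simp: iu)
    have Sc': "S \<in> carrier M" unfolding S_def using Sc by (rule M.finsum_closed)
    have sv: "(sg (insert v A) v :: 'k mpoly) = sg A v"
      using sg_remove(2)[of "insert v A" v v, where 'k = 'k] False A'(1) by simp
    have "bd a m (insert v A) = sg (insert v A) v \<odot>\<^bsub>M\<^esub> (Var v ^ a \<odot>\<^bsub>M\<^esub> m (insert v A - {v})) \<oplus>\<^bsub>M\<^esub> S"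
      unfolding bd_def S_def using False A'(1) Sc mA vn by (intro M.finsum_insert) simp_all
    then have 1: "bd a m (insert v A) = sg A v \<odot>\<^bsub>M\<^esub> (Var v ^ a \<odot>\<^bsub>M\<^esub> m A) \<oplus>\<^bsub>M\<^esub> S"
      using False by (simp add: sv)
    have 2: "bd a l A = (- sg A v) \<odot>\<^bsub>M\<^esub> S"
    proof -
      have "(- sg A v) \<odot>\<^bsub>M\<^esub> S = finsum M (\<lambda>u. (- sg A v) \<odot>\<^bsub>M\<^esub> (sg (insert v A) u \<odot>\<^bsub>M\<^esub> (Var u ^ a \<odot>\<^bsub>M\<^esub> m (insert v A - {u})))) A"
        unfolding S_def using A' Sc by (intro finsum_smult) auto
      also have "\<dots> = bd a l A"
        unfolding bd_def
      proof (rule M.finsum_cong')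
        fix u assume u: "u \<in> A"
        have e: "- (sg A v * sg (insert v A) u :: 'k mpoly) = sg A u * sg (A - {u}) v"
          using sg_insert[OF A'(1) u False, where 'k = 'k] sg_remove(2)[OF A'(1) u, of u, where 'k = 'k] by simp
        have "(- sg A v) \<odot>\<^bsub>M\<^esub> (sg (insert v A) u \<odot>\<^bsub>M\<^esub> (Var u ^ a \<odot>\<^bsub>M\<^esub> m (insert v A - {u}))) =
           (- (sg A v * sg (insert v A) u)) \<odot>\<^bsub>M\<^esub> (Var u ^ a \<odot>\<^bsub>M\<^esub> m (insert v (A - {u})))"
          using mc[OF u] A'(4)[OF u] by (simp add: smult_mult[symmetric] iu[OF u] mult.assoc)
        also have "\<dots> = sg A u \<odot>\<^bsub>M\<^esub> (Var u ^ a \<odot>\<^bsub>M\<^esub> l (A - {u}))"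
          unfolding e using mc[OF u] A'(4)[OF u] False by (simp add: l_def smult_mult[symmetric] ac_simps)
        finally show "(- sg A v) \<odot>\<^bsub>M\<^esub> (sg (insert v A) u \<odot>\<^bsub>M\<^esub> (Var u ^ a \<odot>\<^bsub>M\<^esub> m (insert v A - {u}))) =
           sg A u \<odot>\<^bsub>M\<^esub> (Var u ^ a \<odot>\<^bsub>M\<^esub> l (A - {u}))" .
      qed (use tc in auto)
      finally show ?thesis by simp
    qed
    have "sg A v \<odot>\<^bsub>M\<^esub> (sg A v \<odot>\<^bsub>M\<^esub> (Var v ^ a \<odot>\<^bsub>M\<^esub> m A)) = Var v ^ a \<odot>\<^bsub>M\<^esub> m A"
      using mA vn smult_mult[of "sg A v" "sg A v" "Var v ^ a \<odot>\<^bsub>M\<^esub> m A"] sg_self[of A v, where 'a = 'k] by simp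
    then have "sg A v \<odot>\<^bsub>M\<^esub> bd a m (insert v A) = Var v ^ a \<odot>\<^bsub>M\<^esub> m A \<oplus>\<^bsub>M\<^esub> sg A v \<odot>\<^bsub>M\<^esub> S"
      unfolding 1 using mA vn Sc' by (simp add: smult_r_distr)
    then show ?thesis
      unfolding 2 using False mA vn Sc' by (simp add: smult_uminus a_minus_def)
  qed
qed

lemma Var_nilpotent:
  assumes N: "submodule N (mpoly_ring n) M" and x: "x \<in> g (Suc j) k"
    and dx: "cech_diff n (Suc j) M x \<in> CNs N (Suc (Suc j))" and v: "v < n"
  shows "\<exists>s. \<exists>e\<in>g j (k + int s). Var v ^ s \<odot>\<^bsub>cech n (Suc j) M\<^esub> x \<ominus>\<^bsub>cech n (Suc j) M\<^esub> cech_diff n j M e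
    \<in> CNs N (Suc j)"
proof -
  obtain m a where m: "m \<in> tup (Suc j) (comp (k + int (Suc j * a)))" "x = mk (Suc j) m a"
    using g_cases[OF x] .
  note mt = tup_comp[OF m(1)]
  have vn [simp]: "(Var v :: 'k mpoly) \<in> carrier (mpoly_ring n)" using v by simp
  define l where "l = (\<lambda>A. if v \<in> A then \<zero>\<^bsub>M\<^esub> else sg A v \<odot>\<^bsub>M\<^esub> m (insert v A))"
  obtain c where c: "\<And>B. B \<in> var_subsets n (Suc (Suc j)) \<Longrightarrow> var_prod B ^ c \<odot>\<^bsub>M\<^esub> bd a m B \<in> N"
    using dx CNs_iff[OF N bd_tup[OF mt], of a] unfolding m(2) cech_diff_mk[OF mt] by blast
  \<comment> \<open>Membership of \<open>bd a m\<close> in \<open>N\<close> holds only after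
    multiplication by \<open>var_prod (insert v A) ^ c\<close>. Its factor \<open>Var v ^ c\<close>
    is supplied by the homotopy, the remaining \<open>var_prod A ^ c\<close> by
    \<open>CNs_iff\<close>.\<close>
  define l' where "l' A = Var v ^ c \<odot>\<^bsub>M\<^esub> l A" for A
  have lk: "l A \<in> comp (k + int (Suc j * a))" if "A \<in> var_subsets n j" for A
  proof (cases "v \<in> A")
    case False
    have "sg A v \<odot>\<^bsub>M\<^esub> m (insert v A) \<in> comp (k + int (Suc j * a) + int 0)"
      using False that v by (intro comp_smult tupD[OF m(1)] var_subsets_insert) (simp_all add: sg_def homogeneous_sign)
    then show ?thesis using False by (simp add: l_def)
  qed (simp add: l_def comp_mem)
  have lt: "l \<in> tups j" using lk comp_mem(2) by (intro tupI) blast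
  have l't: "l' \<in> tup j (comp (k + int (a + c) + int (j * a)))"
  proof (rule tupI)
    fix A assume A: "A \<in> var_subsets n j"
    have "Var v ^ c \<odot>\<^bsub>M\<^esub> l A \<in> comp (k + int (Suc j * a) + int (1 * c))"
      by (intro comp_smult homogeneous_power homogeneous_Var lk A) simp
    then show "l' A \<in> comp (k + int (a + c) + int (j * a))"
      by (simp add: l'_def algebra_simps)
  qed
  define z where "z A = Var v ^ (a + c) \<odot>\<^bsub>M\<^esub> m A \<ominus>\<^bsub>M\<^esub> bd a l' A" for A
  have "var_prod A ^ c \<odot>\<^bsub>M\<^esub> z A \<in> N" if A: "A \<in> var_subsets n (Suc j)" for A
  proof -
    have mA: "m A \<in> carrier M" by (rule tupD[OF mt A])
    have bl: "bd a l A \<in> carrier M" using lt A by simp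
    have "z A = Var v ^ c \<odot>\<^bsub>M\<^esub> (Var v ^ a \<odot>\<^bsub>M\<^esub> m A \<ominus>\<^bsub>M\<^esub> bd a l A)"
      unfolding z_def l'_def using bd_smult[OF lt _ A, of "Var v ^ c" a] mA bl
      by (simp add: smult_r_diff smult_mult[symmetric] power_add mult.commute)
    also have "\<dots> = Var v ^ c \<odot>\<^bsub>M\<^esub> (if v \<in> A then \<zero>\<^bsub>M\<^esub> else sg A v \<odot>\<^bsub>M\<^esub> bd a m (insert v A))"
      unfolding l_def bd_cone[OF mt A v] ..
    finally have z: "z A = \<dots>" .
    show ?thesis
    proof (cases "v \<in> A")
      case True
      then show ?thesis using z A N_mem(1)[OF N] by simp
    next
      case False
      have B: "insert v A \<in> var_subsets n (Suc (Suc j))" using var_subsets_insert[OF A v False] .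
      have "var_prod A ^ c \<odot>\<^bsub>M\<^esub> z A = sg A v \<odot>\<^bsub>M\<^esub> (var_prod (insert v A) ^ c \<odot>\<^bsub>M\<^esub> bd a m (insert v A))"
        using z False A bd_closed[OF mt B] var_subsetsD(1)[OF A]
        by (simp add: var_prod_insert smult_mult[symmetric] power_mult_distrib ac_simps)
      then show ?thesis using N_smult[OF N _ c[OF B]] by simp
    qed
  qed
  moreover have zt: "z \<in> tups (Suc j)"
    unfolding z_def using tupD[OF mt] bd_closed[OF tup_comp[OF l't]] by (intro tupI) simp
  ultimately have "mk (Suc j) z a \<in> CNs N (Suc j)"
    using CNs_iff[OF N zt] by blast
  moreover have "(\<lambda>A. Var v ^ (a + c) \<odot>\<^bsub>M\<^esub> m A) \<in> tups (Suc j)"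
    using tupD[OF mt] by (intro tupI) simp
  then have "mk (Suc j) z a = Var v ^ (a + c) \<odot>\<^bsub>cech n (Suc j) M\<^esub> x \<ominus>\<^bsub>cech n (Suc j) M\<^esub> cech_diff n j M (mk j l' a)"
    unfolding m(2) z_def by (simp add: mk_smult[OF _ mt] cech_diff_mk[OF tup_comp[OF l't]] mk_diff tup_comp[OF l't])
  ultimately show ?thesis
    using mk_g[OF l't] by (metis (no_types))
qed

lemma var_subsets_0: "var_subsets n 0 = {{}}"
  by (auto simp: var_subsets_def dest: finite_subset)

text \<open>In degree 0 there is nothing to take a cone over: the cocycle condition at the single
  set \<open>{v}\<close> already says that a power of \<open>Var v\<close> moves the element into
  \<open>N\<close>.\<close>

lemma Var_nilpotent_0:
  assumes N: "submodule N (mpoly_ring n) M" and x: "x \<in> carrier (cech n 0 M)"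
    and dx: "cech_diff n 0 M x \<in> CNs N (Suc 0)" and v: "v < n"
  shows "\<exists>s. Var v ^ s \<odot>\<^bsub>cech n 0 M\<^esub> x \<in> CNs N 0"
proof -
  obtain m a where m: "m \<in> tups 0" "x = mk 0 m a" using cech_cases[OF x] .
  have vn [simp]: "(Var v :: 'k mpoly) \<in> carrier (mpoly_ring n)" using v by simp
  have m0: "m {} \<in> carrier M" using tupD[OF m(1)] by (simp add: var_subsets_0)
  obtain c where c: "\<And>B. B \<in> var_subsets n (Suc 0) \<Longrightarrow> var_prod B ^ c \<odot>\<^bsub>M\<^esub> bd a m B \<in> N"
    using dx CNs_iff[OF N bd_tup[OF m(1)], of a] unfolding m(2) cech_diff_mk[OF m(1)] by blast
  have "{v} \<in> var_subsets n (Suc 0)" using v by (simp add: var_subsets_def)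
  moreover have "bd a m {v} = Var v ^ a \<odot>\<^bsub>M\<^esub> m {}"
  proof -
    have "{u \<in> {v}. u < v} = {}" by auto
    then have "sg {v} v = (1 :: 'k mpoly)" by (simp only: sg_def card.empty power_0)
    then show ?thesis using m0 by (simp add: bd_def M.finsum_insert)
  qed
  ultimately have "Var v ^ c \<odot>\<^bsub>M\<^esub> (Var v ^ a \<odot>\<^bsub>M\<^esub> m {}) \<in> N"
    using c[of "{v}"] by (simp add: var_prod_def)
  then have "Var v ^ (c + a) \<odot>\<^bsub>M\<^esub> m {} \<in> N"
    using m0 by (simp add: smult_mult power_add)
  then have "(\<lambda>A. Var v ^ (c + a) \<odot>\<^bsub>M\<^esub> m A) \<in> tup 0 N"
    by (simp add: tup_def var_subsets_0)
  then show ?thesis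
    unfolding m(2) using mk_smult[OF _ m(1), of "Var v ^ (c + a)" a] CNs_def by (auto)
qed

end

section \<open>Submodules generated by powers of the parameters\<close>

context graded_mod
begin

text \<open>\<open>Nb \<theta> d b\<close> is the submodule of \<open>M\<close> generated by all \<open>\<theta>\<^sub>i\<^sup>s M\<close> with \<open>s = b i > 0\<close>; an exponent \<open>0\<close>
  means that \<open>\<theta>\<^sub>i\<close> is not used.\<close>

definition Nb :: "(nat \<Rightarrow> 'k mpoly) \<Rightarrow> nat \<Rightarrow> (nat \<Rightarrow> nat) \<Rightarrow> 'm set" where
  "Nb \<theta> d b = {finsum M (\<lambda>i. \<theta> i ^ b i \<odot>\<^bsub>M\<^esub> m i) {i. i < d \<and> 0 < b i} | m. \<forall>i<d. m i \<in> carrier M}"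

context
  fixes \<theta> :: "nat \<Rightarrow> 'k mpoly" and d :: nat
  assumes \<theta>: "\<And>i. i < d \<Longrightarrow> \<theta> i \<in> carrier (mpoly_ring n)"
begin

lemma Nb_summand: "\<forall>i<d. m i \<in> carrier M \<Longrightarrow> (\<lambda>i. \<theta> i ^ b i \<odot>\<^bsub>M\<^esub> m i) \<in> {i. i < d \<and> 0 < b i} \<rightarrow> carrier M"
  using \<theta> by auto

lemma submodule_Nb: "submodule (Nb \<theta> d b) (mpoly_ring n) M"
proof -
  let ?S = "{i. i < d \<and> 0 < b i}"
  have "subgroup (Nb \<theta> d b) (add_monoid M)"
  proof (rule M.subgroupI_diff)
    show "Nb \<theta> d b \<subseteq> carrier M"
      using M.finsum_closed[OF Nb_summand] unfolding Nb_def by blast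
    have "finsum M (\<lambda>i. \<theta> i ^ b i \<odot>\<^bsub>M\<^esub> \<zero>\<^bsub>M\<^esub>) ?S = finsum M (\<lambda>i. \<zero>\<^bsub>M\<^esub>) ?S"
      using \<theta> by (intro M.finsum_cong') auto
    then have "\<zero>\<^bsub>M\<^esub> = finsum M (\<lambda>i. \<theta> i ^ b i \<odot>\<^bsub>M\<^esub> \<zero>\<^bsub>M\<^esub>) ?S" by simp
    then show "\<zero>\<^bsub>M\<^esub> \<in> Nb \<theta> d b" unfolding Nb_def
      by (intro CollectI exI[of _ "\<lambda>_. \<zero>\<^bsub>M\<^esub>"]) simp
    fix x y assume "x \<in> Nb \<theta> d b" "y \<in> Nb \<theta> d b"
    then obtain m m' where m: "\<forall>i<d. m i \<in> carrier M" "\<forall>i<d. m' i \<in> carrier M"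
      "x = finsum M (\<lambda>i. \<theta> i ^ b i \<odot>\<^bsub>M\<^esub> m i) ?S" "y = finsum M (\<lambda>i. \<theta> i ^ b i \<odot>\<^bsub>M\<^esub> m' i) ?S"
      unfolding Nb_def by blast
    let ?m = "\<lambda>i. m i \<ominus>\<^bsub>M\<^esub> m' i"
    have mm: "\<forall>i<d. ?m i \<in> carrier M" using m by simp
    have "finsum M (\<lambda>i. \<theta> i ^ b i \<odot>\<^bsub>M\<^esub> ?m i) ?S \<oplus>\<^bsub>M\<^esub> y =
        finsum M (\<lambda>i. \<theta> i ^ b i \<odot>\<^bsub>M\<^esub> ?m i \<oplus>\<^bsub>M\<^esub> \<theta> i ^ b i \<odot>\<^bsub>M\<^esub> m' i) ?S"
      unfolding m(4) using Nb_summand[OF mm] Nb_summand[OF m(2)] by (intro M.finsum_addf[symmetric])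
    also have "\<dots> = x"
      unfolding m(3) using m \<theta> Nb_summand[OF m(1)]
      by (intro M.finsum_cong') (auto simp: smult_r_diff M.minus_add_cancel)
    finally have "x \<ominus>\<^bsub>M\<^esub> y = finsum M (\<lambda>i. \<theta> i ^ b i \<odot>\<^bsub>M\<^esub> ?m i) ?S"
      using M.minus_add_cancel(3)[of "finsum M (\<lambda>i. \<theta> i ^ b i \<odot>\<^bsub>M\<^esub> ?m i) ?S" y]
        M.finsum_closed[OF Nb_summand[OF mm]] M.finsum_closed[OF Nb_summand[OF m(2)]] m(4) by auto
    then show "x \<ominus>\<^bsub>M\<^esub> y \<in> Nb \<theta> d b"
      unfolding Nb_def by (intro CollectI exI[of _ ?m] conjI mm)
  qed
  moreover have "p \<odot>\<^bsub>M\<^esub> x \<in> Nb \<theta> d b" if p: "p \<in> carrier (mpoly_ring n)" and "x \<in> Nb \<theta> d b" for p x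
  proof -
    obtain m where m: "\<forall>i<d. m i \<in> carrier M" "x = finsum M (\<lambda>i. \<theta> i ^ b i \<odot>\<^bsub>M\<^esub> m i) ?S"
      using \<open>x \<in> Nb \<theta> d b\<close> unfolding Nb_def by blast
    have pm: "\<forall>i<d. p \<odot>\<^bsub>M\<^esub> m i \<in> carrier M" using m p by simp
    have "p \<odot>\<^bsub>M\<^esub> x = finsum M (\<lambda>i. p \<odot>\<^bsub>M\<^esub> (\<theta> i ^ b i \<odot>\<^bsub>M\<^esub> m i)) ?S"
      unfolding m(2) using m \<theta> p by (intro finsum_smult) auto
    also have "\<dots> = finsum M (\<lambda>i. \<theta> i ^ b i \<odot>\<^bsub>M\<^esub> (p \<odot>\<^bsub>M\<^esub> m i)) ?S"
      using m \<theta> p Nb_summand[OF pm] by (intro M.finsum_cong') (auto simp: smult_left_comm[of p])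
    finally show ?thesis
      unfolding Nb_def using pm by (intro CollectI exI[of _ "\<lambda>i. p \<odot>\<^bsub>M\<^esub> m i"]) simp
  qed
  ultimately show ?thesis by (intro submodule.intro) (simp_all add: submodule_axioms_def)
qed

lemma Nb_zero: "Nb \<theta> d (\<lambda>_. 0) = {\<zero>\<^bsub>M\<^esub>}"
  by (auto simp: Nb_def)

text \<open>The parameters are homogeneous of degree 1, so components may be taken in the
  coefficients, with the degree lowered by \<open>b i\<close> in the i-th one.\<close>

lemma hc_Nb:
  assumes "\<And>i. i < d \<Longrightarrow> homogeneous 1 (\<theta> i)" "x \<in> Nb \<theta> d b"
  shows "hc k x \<in> Nb \<theta> d b"
proof -
  let ?S = "{i. i < d \<and> 0 < b i}"
  obtain m where m: "\<forall>i<d. m i \<in> carrier M" "x = finsum M (\<lambda>i. \<theta> i ^ b i \<odot>\<^bsub>M\<^esub> m i) ?S"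
    using \<open>x \<in> Nb \<theta> d b\<close> unfolding Nb_def by blast
  let ?m = "\<lambda>i. hc (k - int (1 * b i)) (m i)"
  have mm: "\<forall>i<d. ?m i \<in> carrier M" using m by simp
  have "hc k x = finsum M (\<lambda>i. hc k (\<theta> i ^ b i \<odot>\<^bsub>M\<^esub> m i)) ?S"
    unfolding m(2) using m \<theta> by (intro hc_finsum) auto
  also have "\<dots> = finsum M (\<lambda>i. \<theta> i ^ b i \<odot>\<^bsub>M\<^esub> ?m i) ?S"
  proof (rule M.finsum_cong')
    fix i assume i: "i \<in> ?S"
    then show "hc k (\<theta> i ^ b i \<odot>\<^bsub>M\<^esub> m i) = \<theta> i ^ b i \<odot>\<^bsub>M\<^esub> ?m i"
      using m \<theta> by (intro hc_smult homogeneous_power assms(1)) auto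
  qed (use Nb_summand[OF mm] in auto)
  finally show ?thesis
    unfolding Nb_def using mm by (intro CollectI exI[of _ ?m] conjI)
qed

lemma Nb_put:
  assumes "unused d b i" "s > 0"
  shows "x \<in> Nb \<theta> d (put b i s) \<longleftrightarrow> (\<exists>z\<in>carrier M. \<exists>y\<in>Nb \<theta> d b. x = \<theta> i ^ s \<odot>\<^bsub>M\<^esub> z \<oplus>\<^bsub>M\<^esub> y)"
proof -
  let ?S = "{i. i < d \<and> 0 < b i}"
  have S: "{l. l < d \<and> 0 < put b i s l} = insert i ?S" "i \<notin> ?S" "i < d"
  proof -
    have i: "i < d" "b i = 0" using assms(1) by (simp_all add: unused_def)
    show "{l. l < d \<and> 0 < put b i s l} = insert i ?S"
    proof (rule Set.set_eqI)
      fix l show "l \<in> {l. l < d \<and> 0 < put b i s l} \<longleftrightarrow> l \<in> insert i ?S"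
        using i assms(2) by (cases "l = i") (simp_all add: put_def)
    qed
    show "i \<notin> ?S" "i < d" using i by simp_all
  qed
  have split: "finsum M (\<lambda>l. \<theta> l ^ put b i s l \<odot>\<^bsub>M\<^esub> m l) {l. l < d \<and> 0 < put b i s l} =
      \<theta> i ^ s \<odot>\<^bsub>M\<^esub> m i \<oplus>\<^bsub>M\<^esub> finsum M (\<lambda>l. \<theta> l ^ b l \<odot>\<^bsub>M\<^esub> m l) ?S" if m: "\<forall>l<d. m l \<in> carrier M" for m
  proof -
    have c: "(\<lambda>l. \<theta> l ^ put b i s l \<odot>\<^bsub>M\<^esub> m l) \<in> ?S \<rightarrow> carrier M" "\<theta> i ^ put b i s i \<odot>\<^bsub>M\<^esub> m i \<in> carrier M"
      using m \<theta> S(3) by auto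
    have "finsum M (\<lambda>l. \<theta> l ^ put b i s l \<odot>\<^bsub>M\<^esub> m l) (insert i ?S) = \<theta> i ^ put b i s i \<odot>\<^bsub>M\<^esub> m i
      \<oplus>\<^bsub>M\<^esub> finsum M (\<lambda>l. \<theta> l ^ put b i s l \<odot>\<^bsub>M\<^esub> m l) ?S"
      by (rule M.finsum_insert[OF _ S(2) c]) simp
    also have "finsum M (\<lambda>l. \<theta> l ^ put b i s l \<odot>\<^bsub>M\<^esub> m l) ?S = finsum M (\<lambda>l. \<theta> l ^ b l \<odot>\<^bsub>M\<^esub> m l) ?S"
      using Nb_summand[OF m] S(2) by (intro M.finsum_cong') (auto simp: put_def)
    finally show ?thesis using S by (simp add: put_def)
  qed
  show ?thesis
  proof
    assume "x \<in> Nb \<theta> d (put b i s)"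
    then obtain m where m: "\<forall>l<d. m l \<in> carrier M"
        "x = finsum M (\<lambda>l. \<theta> l ^ put b i s l \<odot>\<^bsub>M\<^esub> m l) {l. l < d \<and> 0 < put b i s l}"
      unfolding Nb_def by blast
    have "finsum M (\<lambda>l. \<theta> l ^ b l \<odot>\<^bsub>M\<^esub> m l) ?S \<in> Nb \<theta> d b"
      unfolding Nb_def using m(1) by blast
    then show "\<exists>z\<in>carrier M. \<exists>y\<in>Nb \<theta> d b. x = \<theta> i ^ s \<odot>\<^bsub>M\<^esub> z \<oplus>\<^bsub>M\<^esub> y"
      unfolding m(2) split[OF m(1)] using m(1) S(3) by blast
  next
    assume "\<exists>z\<in>carrier M. \<exists>y\<in>Nb \<theta> d b. x = \<theta> i ^ s \<odot>\<^bsub>M\<^esub> z \<oplus>\<^bsub>M\<^esub> y"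
    then obtain z m where zm: "z \<in> carrier M" "\<forall>l<d. m l \<in> carrier M"
        "x = \<theta> i ^ s \<odot>\<^bsub>M\<^esub> z \<oplus>\<^bsub>M\<^esub> finsum M (\<lambda>l. \<theta> l ^ b l \<odot>\<^bsub>M\<^esub> m l) ?S"
      unfolding Nb_def by blast
    have m': "\<forall>l<d. (m(i := z)) l \<in> carrier M" using zm by simp
    have "finsum M (\<lambda>l. \<theta> l ^ b l \<odot>\<^bsub>M\<^esub> (m(i := z)) l) ?S = finsum M (\<lambda>l. \<theta> l ^ b l \<odot>\<^bsub>M\<^esub> m l) ?S"
    proof (rule M.finsum_cong'[OF refl Nb_summand[OF zm(2)]])
      fix l assume "l \<in> ?S"
      then have "l \<noteq> i" using S(2) by blast
      then show "\<theta> l ^ b l \<odot>\<^bsub>M\<^esub> (m(i := z)) l = \<theta> l ^ b l \<odot>\<^bsub>M\<^esub> m l" by simp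
    qed
    with split[OF m'] zm(3) have "x = finsum M (\<lambda>l. \<theta> l ^ put b i s l \<odot>\<^bsub>M\<^esub> (m(i := z)) l) {l. l < d \<and> 0 < put b i s l}"
      by simp
    with m' show "x \<in> Nb \<theta> d (put b i s)"
      unfolding Nb_def by blast
  qed
qed

end

end

lemma linear_form_irrelevant:
  assumes "p \<in> carrier (mpoly_ring n)" "homogeneous 1 p"
  shows "p \<in> irrelevant_ideal n"
proof -
  have "Poly_Mapping.lookup p 0 = 0"
    using assms(2) monom_degree_0 by (metis homogeneous_def in_keys_iff zero_neq_one)
  then show ?thesis
    using minus_constant_term_irrelevant[OF assms(1)] by (simp add: Const_simps)
qed

section \<open>Buchsbaum modules as instances of the abstract complex\<close>

text \<open>The assumption \<open>weak\<close> is the form in which the Buchsbaum property is used: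
  powers of distinct parameters, in any order, form weak sequences, and each initial segment of them
  generates some \<open>Nb \<theta> d b\<close>.\<close>

locale buchsbaum_sop = graded_mod n M for n and M :: "('k::field mpoly, 'm) gmodule" +
  fixes \<theta> :: "nat \<Rightarrow> 'k mpoly" and d :: nat
  assumes \<theta>_carrier: "i < d \<Longrightarrow> \<theta> i \<in> carrier (mpoly_ring n)"
    and \<theta>_linear: "i < d \<Longrightarrow> homogeneous 1 (\<theta> i)"
    and weak: "unused d b i \<Longrightarrow> s > 0 \<Longrightarrow> u \<in> carrier M \<Longrightarrow> \<theta> i ^ s \<odot>\<^bsub>M\<^esub> u \<in> Nb \<theta> d b \<Longrightarrow>
      p \<in> irrelevant_ideal n \<Longrightarrow> p \<odot>\<^bsub>M\<^esub> u \<in> Nb \<theta> d b"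
begin

lemma Nb_submodule: "submodule (Nb \<theta> d b) (mpoly_ring n) M"
  by (rule submodule_Nb) (rule \<theta>_carrier)

lemma Nb_put_iff:
  "unused d b i \<Longrightarrow> s > 0 \<Longrightarrow> x \<in> Nb \<theta> d (put b i s) \<longleftrightarrow>
    (\<exists>z\<in>carrier M. \<exists>y\<in>Nb \<theta> d b. x = \<theta> i ^ s \<odot>\<^bsub>M\<^esub> z \<oplus>\<^bsub>M\<^esub> y)"
  by (rule Nb_put) (rule \<theta>_carrier)

lemma hc_Nb_mem: "x \<in> Nb \<theta> d b \<Longrightarrow> hc k x \<in> Nb \<theta> d b"
  by (rule hc_Nb) (rule \<theta>_carrier \<theta>_linear, assumption)+

sublocale graded_complex "mpoly_ring n" "\<lambda>j. cech n j M" "\<lambda>j k. g j k" "\<lambda>j. cech_diff n j M" "\<lambda>b j. CNs (Nb \<theta> d b) j"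
proof (rule graded_complex.intro)
  show "module (mpoly_ring n) (cech n j M)" for j by (rule module_cech)
  show "subgroup (g j k) (add_monoid (cech n j M))" for j k by (rule subgroup_g)
  show "cech_diff n j M x \<in> carrier (cech n (Suc j) M)" if "x \<in> carrier (cech n j M)" for j x
    using that by (rule cech_diff_closed)
  show "cech_diff n j M x \<in> g (Suc j) k" if "x \<in> g j k" for j k x
    using that by (rule cech_diff_g)
  show "submodule (CNs (Nb \<theta> d b) j) (mpoly_ring n) (cech n j M)" for b j
    by (rule submodule_CNs[OF Nb_submodule])
  show "cech_diff n j M x \<in> CNs (Nb \<theta> d b) (Suc j)" if "x \<in> CNs (Nb \<theta> d b) j" for b j x
    using that by (rule cech_diff_CNs[OF Nb_submodule])
qed (simp_all only: cech_diff_add cech_diff_smult cech_diff_diff)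

lemma homogeneous_shifts: "homogeneous i p \<Longrightarrow> p \<in> carrier (mpoly_ring n) \<Longrightarrow> p \<in> shifts (int i)"
  unfolding shifts_def using g_smult by blast

lemma Var_shifts: "v < n \<Longrightarrow> Var v \<in> shifts 1"
  using homogeneous_shifts[OF homogeneous_Var] by simp

lemma Var_nil:
  assumes "x \<in> Zc b j k" "v < n"
  shows "\<exists>s. (Var v ^ s) \<odot>\<^bsub>cech n j M\<^esub> x \<in> Bc b j (k + int s)"
proof (cases j)
  case 0
  with Var_nilpotent_0[OF Nb_submodule _ _ assms(2), of x b] assms(1)
  obtain s where "Var v ^ s \<odot>\<^bsub>cech n 0 M\<^esub> x \<in> CNs (Nb \<theta> d b) 0"
    by (auto simp: Zc_def dest: g_mem(2))
  then show ?thesis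
    using 0 shifts_pow[OF Var_shifts[OF assms(2)], of s] assms(1)
    by (auto simp: Zc_def shifts_def intro!: exI[of _ s])
next
  case (Suc i)
  with Var_nilpotent[OF Nb_submodule _ _ assms(2), of x i k b] assms(1)
  obtain s e where "e \<in> g i (k + int s)" "Var v ^ s \<odot>\<^bsub>cech n (Suc i) M\<^esub> x \<ominus>\<^bsub>cech n (Suc i) M\<^esub> cech_diff n i M e
    \<in> CNs (Nb \<theta> d b) (Suc i)"
    by (auto simp: Zc_def)
  then show ?thesis
    using Suc shifts_pow[OF Var_shifts[OF assms(2)], of s] assms(1)
    by (auto simp: Zc_def shifts_def intro!: exI[of _ s])
qed

text \<open>Nilpotency is known for the variables, is preserved by constant factors, and passes to
  sums by \<open>nilpotent_add\<close>; the linear form is built up through its partial sums over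
  the variables.\<close>

lemma linear_nil:
  assumes "x \<in> Zc b j k" "p \<in> carrier (mpoly_ring n)" "homogeneous 1 p"
  shows "\<exists>s. (p ^ s) \<odot>\<^bsub>cech n j M\<^esub> x \<in> Bc b j (k + int s)"
proof -
  let ?t = "\<lambda>v. Const (Poly_Mapping.lookup p (Poly_Mapping.single v 1)) * Var v"
  have xg: "x \<in> g j k" "x \<in> carrier (cech n j M)" using assms(1) by (auto simp: Zc_def dest: g_mem(2))
  have tc: "?t v \<in> carrier (mpoly_ring n)" if "v < n" for v using that by simp
  have ts: "?t v \<in> shifts 1" if "v < n" for v
    using homogeneous_shifts[OF homogeneous_mult[OF homogeneous_Const homogeneous_Var]] tc[OF that] by simp
  have "m \<le> n \<Longrightarrow> (\<Sum>v<m. ?t v) \<in> shifts 1 \<and> (\<exists>s. ((\<Sum>v<m. ?t v) ^ s) \<odot>\<^bsub>cech n j M\<^esub> x \<in> Bc b j (k + int s))" for m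
  proof (induction m)
    case 0
    have null: "0 \<odot>\<^bsub>cech n j M\<^esub> y = \<zero>\<^bsub>cech n j M\<^esub>" if "y \<in> carrier (cech n j M)" for y j
      using C.smult_l_null[OF that] by simp
    have "0 \<in> shifts 1" unfolding shifts_def
    proof (intro CollectI conjI allI ballI)
      fix j' k' x assume "x \<in> g j' k'"
      from null[OF g_mem(2)[OF this]] show "0 \<odot>\<^bsub>cech n j' M\<^esub> x \<in> g j' (k' + 1)"
        by (simp only: g_mem(1))
    qed simp
    moreover have "0 ^ 1 \<odot>\<^bsub>cech n j M\<^esub> x \<in> Bc b j (k + int 1)"
      using null[OF xg(2)] Bc_mem(1) by ( simp del: Bc.simps)
    ultimately show ?case unfolding lessThan_0 sum.empty by blast
  next
    case (Suc m)
    then have IH: "(\<Sum>v<m. ?t v) \<in> shifts 1" "\<exists>s. ((\<Sum>v<m. ?t v) ^ s) \<odot>\<^bsub>cech n j M\<^esub> x \<in> Bc b j (k + int s)"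
      and m: "m < n" by auto
    obtain s where s: "Var m ^ s \<odot>\<^bsub>cech n j M\<^esub> x \<in> Bc b j (k + int s)"
      using Var_nil[OF assms(1) m] by blast
    let ?c = "Const (Poly_Mapping.lookup p (Poly_Mapping.single m 1)) :: 'k mpoly"
    have "?c ^ s \<in> shifts (int (0 * s))"
      by (rule homogeneous_shifts[OF homogeneous_power[OF homogeneous_Const]]) simp
    from Bc_smult[OF this s] have "?t m ^ s \<odot>\<^bsub>cech n j M\<^esub> x \<in> Bc b j (k + int s)"
      using C.smult_assoc1[of "?c ^ s" "Var m ^ s" x j] m xg
      by (simp add: power_mult_distrib del: Bc.simps)
    then obtain r where "((\<Sum>v<m. ?t v) + ?t m) ^ r \<odot>\<^bsub>cech n j M\<^esub> x \<in> Bc b j (k + int r)"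
      using nilpotent_add[OF IH(1) ts[OF m] xg(1)] IH(2) unfolding mpoly_ring_simps mpoly_ring_pow by blast
    moreover have "(\<Sum>v<Suc m. ?t v) \<in> shifts 1"
      using shifts_add[OF IH(1) ts[OF m]] by simp
    ultimately show ?case by ( simp del: Bc.simps) blast
  qed
  from this[of n] show ?thesis
    unfolding linear_form[OF assms(2,3), symmetric] by blast
qed

text \<open>A decomposition of \<open>m A\<close> as \<open>\<theta> i ^ s z + y\<close> need not be
  homogeneous; taking the component in the degree of \<open>m A\<close> makes \<open>z\<close>
  homogeneous and keeps \<open>y\<close> in the graded submodule
  \<open>Nb \<theta> d b\<close>.\<close>

lemma CNs_putE:
  assumes "unused d b i" "s > 0" "x \<in> CNs (Nb \<theta> d (put b i s)) j" "x \<in> g j k"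
  shows "\<exists>z\<in>g j (k - int s). x \<ominus>\<^bsub>cech n j M\<^esub> \<theta> i ^ s \<odot>\<^bsub>cech n j M\<^esub> z \<in> CNs (Nb \<theta> d b) j"
proof -
  have i: "i < d" using assms(1) by (simp add: unused_def)
  note ti = \<theta>_carrier[OF i]
  obtain m a where m: "m \<in> tup j (Nb \<theta> d (put b i s))" "m \<in> tup j (comp (k + int (j * a)))" "x = mk j m a"
    using CNs_g_cases[OF Nb_submodule assms(3,4)] .
  have "\<exists>z. z \<in> comp (k - int s + int (j * a)) \<and> m A \<ominus>\<^bsub>M\<^esub> \<theta> i ^ s \<odot>\<^bsub>M\<^esub> z \<in> Nb \<theta> d b"
    if A: "A \<in> var_subsets n j" for A
  proof -
    obtain z y where zy: "z \<in> carrier M" "y \<in> Nb \<theta> d b" "m A = \<theta> i ^ s \<odot>\<^bsub>M\<^esub> z \<oplus>\<^bsub>M\<^esub> y"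
      using Nb_put_iff[OF assms(1,2)] tupD[OF m(1) A] by blast
    have yc: "y \<in> carrier M" using N_mem(2)[OF Nb_submodule zy(2)] .
    let ?K = "k + int (j * a)"
    have "m A = hc ?K (m A)" using hc_comp[OF tupD[OF m(2) A], of ?K] by simp
    also have "\<dots> = \<theta> i ^ s \<odot>\<^bsub>M\<^esub> hc (?K - int (1 * s)) z \<oplus>\<^bsub>M\<^esub> hc ?K y"
      using zy yc ti hc_smult[OF homogeneous_power[OF \<theta>_linear[OF i]], of s z ?K] by (simp add: hc_add)
    finally have "m A \<ominus>\<^bsub>M\<^esub> \<theta> i ^ s \<odot>\<^bsub>M\<^esub> hc (?K - int (1 * s)) z = hc ?K y"
      using zy(1) yc ti M.minus_add_cancel(4)[of "hc ?K y" "\<theta> i ^ s \<odot>\<^bsub>M\<^esub> hc (?K - int (1 * s)) z"] by simp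
    moreover have "hc ?K y \<in> Nb \<theta> d b"
      by (rule hc_Nb_mem[OF zy(2)])
    moreover have "hc (?K - int (1 * s)) z \<in> comp (k - int s + int (j * a))"
      using hc_props(1)[OF zy(1), of "?K - int s"] by (simp add: algebra_simps)
    ultimately show ?thesis by metis
  qed
  then obtain z where z: "\<And>A. A \<in> var_subsets n j \<Longrightarrow> z A \<in> comp (k - int s + int (j * a)) \<and>
      m A \<ominus>\<^bsub>M\<^esub> \<theta> i ^ s \<odot>\<^bsub>M\<^esub> z A \<in> Nb \<theta> d b"
    by metis
  have zt: "z \<in> tup j (comp (k - int s + int (j * a)))" using z by (intro tupI) blast
  have pz: "(\<lambda>A. \<theta> i ^ s \<odot>\<^bsub>M\<^esub> z A) \<in> tups j" using tupD[OF tup_comp[OF zt]] ti by (intro tupI) simp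
  have "mk j (\<lambda>A. m A \<ominus>\<^bsub>M\<^esub> \<theta> i ^ s \<odot>\<^bsub>M\<^esub> z A) a \<in> CNs (Nb \<theta> d b) j"
    unfolding CNs_def using z by (auto simp: tup_def)
  then have "x \<ominus>\<^bsub>cech n j M\<^esub> \<theta> i ^ s \<odot>\<^bsub>cech n j M\<^esub> mk j z a \<in> CNs (Nb \<theta> d b) j"
    unfolding m(3) using mk_smult[OF _ tup_comp[OF zt], of "\<theta> i ^ s" a] mk_diff[OF tup_comp[OF m(2)] pz, of a] ti
    by simp
  then show ?thesis using mk_g[OF zt] by blast
qed

text \<open>The Buchsbaum property enters in the two colon conditions only, in positive degree
  through the localization argument of \<open>CNs_colon\<close> and in degree 0 directly.\<close>

sublocale filtered_complex "mpoly_ring n" "\<lambda>j. cech n j M" "\<lambda>j k. g j k" "\<lambda>j. cech_diff n j M"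
  "\<lambda>b j. CNs (Nb \<theta> d b) j" \<theta> d
proof
  show "\<theta> i \<in> shifts 1" if "i < d" for i
    using homogeneous_shifts[OF \<theta>_linear \<theta>_carrier] that by simp
  show "CNs (Nb \<theta> d (\<lambda>_. 0)) j = {\<zero>\<^bsub>cech n j M\<^esub>}" for j
    using CNs_zero[of j] Nb_zero[of d \<theta>] \<theta>_carrier by simp
next
  fix b i j and s :: nat assume b: "unused d b i"
  show "CNs (Nb \<theta> d b) j \<subseteq> CNs (Nb \<theta> d (put b i s)) j"
  proof (cases "s = 0")
    case True
    then have "put b i s = b" using b by (auto simp: put_def unused_def)
    then show ?thesis by simp
  next
    case False
    show ?thesis
    proof (rule CNs_mono, rule subsetI)
      fix y assume y: "y \<in> Nb \<theta> d b"
      have "y = \<theta> i ^ s \<odot>\<^bsub>M\<^esub> \<zero>\<^bsub>M\<^esub> \<oplus>\<^bsub>M\<^esub> y"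
        using b \<theta>_carrier N_mem(2)[OF Nb_submodule y] by (simp add: unused_def)
      then show "y \<in> Nb \<theta> d (put b i s)"
        using Nb_put_iff[OF b, of s] False y by (metis M.zero_closed gr0I)
    qed
  qed
next
  fix b i j x and s :: nat assume b: "unused d b i" "s > 0" and x: "x \<in> carrier (cech n j M)"
  obtain m a where m: "m \<in> tups j" "x = mk j m a" using cech_cases[OF x] .
  have ti: "\<theta> i \<in> carrier (mpoly_ring n)" using b \<theta>_carrier by (simp add: unused_def)
  have "\<theta> i ^ s \<odot>\<^bsub>M\<^esub> m A \<in> Nb \<theta> d (put b i s)" if A: "A \<in> var_subsets n j" for A
  proof -
    have "\<theta> i ^ s \<odot>\<^bsub>M\<^esub> m A = \<theta> i ^ s \<odot>\<^bsub>M\<^esub> m A \<oplus>\<^bsub>M\<^esub> \<zero>\<^bsub>M\<^esub>"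
      using tupD[OF m(1) A] ti by simp
    then show ?thesis
      using Nb_put_iff[OF b] tupD[OF m(1) A] N_mem(1)[OF Nb_submodule] by blast
  qed
  then show "(\<theta> i [^]\<^bsub>mpoly_ring n\<^esub> s) \<odot>\<^bsub>cech n j M\<^esub> x \<in> CNs (Nb \<theta> d (put b i s)) j"
    unfolding m(2) mpoly_ring_pow mk_smult[OF mpoly_ring_power[OF ti] m(1)] CNs_def tup_def by blast
next
  fix b i x j k and s :: nat
  assume "unused d b i" "s > 0" "x \<in> CNs (Nb \<theta> d (put b i s)) j" "x \<in> g j k"
  then show "\<exists>z\<in>g j (k - int s). x \<ominus>\<^bsub>cech n j M\<^esub> (\<theta> i [^]\<^bsub>mpoly_ring n\<^esub> s) \<odot>\<^bsub>cech n j M\<^esub> z \<in> CNs (Nb \<theta> d b) j"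
    unfolding mpoly_ring_pow by (rule CNs_putE)
next
  fix b i x j and s :: nat
  assume b: "unused d b i" "s > 0" and x: "x \<in> carrier (cech n (Suc j) M)"
    "(\<theta> i [^]\<^bsub>mpoly_ring n\<^esub> s) \<odot>\<^bsub>cech n (Suc j) M\<^esub> x \<in> CNs (Nb \<theta> d b) (Suc j)"
  show "x \<in> CNs (Nb \<theta> d b) (Suc j)"
    by (rule CNs_colon[OF Nb_submodule _ x(1) x(2)[unfolded mpoly_ring_pow]])
      (use b weak \<theta>_carrier in \<open>auto simp: unused_def\<close>)
next
  fix b i x and s l :: nat
  assume b: "unused d b i" "s > 0" and x: "x \<in> carrier (cech n 0 M)"
    "(\<theta> i [^]\<^bsub>mpoly_ring n\<^esub> s) \<odot>\<^bsub>cech n 0 M\<^esub> x \<in> CNs (Nb \<theta> d b) 0" and l: "l < d"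
  have ti: "\<theta> i ^ s \<in> carrier (mpoly_ring n)" using b \<theta>_carrier by (simp add: unused_def)
  obtain m a where m: "m \<in> tups 0" "x = mk 0 m a" using cech_cases[OF x(1)] .
  have m0: "m {} \<in> carrier M" using tupD[OF m(1)] by (simp add: var_subsets_0)
  have pm: "(\<lambda>A. p \<odot>\<^bsub>M\<^esub> m A) \<in> tups 0" if "p \<in> carrier (mpoly_ring n)" for p
    using tupD[OF m(1)] that by (intro tupI) simp
  have irr: "\<theta> l \<in> irrelevant_ideal n"
    using linear_form_irrelevant[OF \<theta>_carrier[OF l] \<theta>_linear[OF l]] .
  have "\<theta> i ^ s \<odot>\<^bsub>M\<^esub> m {} \<in> Nb \<theta> d b"
    using x(2) CNs_iff[OF Nb_submodule pm[OF ti], of a] m0 ti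
    unfolding m(2) mpoly_ring_pow mk_smult[OF ti m(1)] by (auto simp: var_subsets_0 var_prod_def)
  from weak[OF b m0 this irr]
  show "\<theta> l \<odot>\<^bsub>cech n 0 M\<^esub> x \<in> CNs (Nb \<theta> d b) 0"
    unfolding m(2) mk_smult[OF \<theta>_carrier[OF l] m(1)]
    using CNs_iff[OF Nb_submodule pm[OF \<theta>_carrier[OF l]], of a] m0 \<theta>_carrier[OF l]
    by (auto simp: var_subsets_0 var_prod_def)
next
  fix x b j k i assume "x \<in> Zc b j k" "i < d"
  then show "\<exists>s::nat. (\<theta> i [^]\<^bsub>mpoly_ring n\<^esub> s) \<odot>\<^bsub>cech n j M\<^esub> x \<in> Bc b j (k + int s)"
    unfolding mpoly_ring_pow using linear_nil \<theta>_carrier \<theta>_linear by blast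
qed

end

section \<open>Powers of a system of parameters\<close>

lemma unused_put_0: "i < d \<Longrightarrow> unused d (put b i 0) i"
  by (simp add: unused_def put_def)

lemma put_put [simp]: "put (put b i s) i t = put b i t"
  by (simp add: put_def)

lemma put_same [simp]: "put b i (b i) = b"
  by (simp add: put_def)

context graded_mod
begin

lemma submodule_span_eqI:
  assumes "submodule N (mpoly_ring n) M" "A \<subseteq> N"
    and "\<And>N'. submodule N' (mpoly_ring n) M \<Longrightarrow> A \<subseteq> N' \<Longrightarrow> N \<subseteq> N'"
  shows "submodule_span (mpoly_ring n) M A = N"
  unfolding submodule_span_def using assms by blast

lemma annihilator_quotient:
  assumes "submodule N (mpoly_ring n) M"
  shows "annihilator (mpoly_ring n) (quotient_gmodule M N) =
    {r \<in> carrier (mpoly_ring n). \<forall>x\<in>carrier M. r \<odot>\<^bsub>M\<^esub> x \<in> N}"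
proof -
  have "r \<odot>\<^bsub>quotient_gmodule M N\<^esub> (N +>\<^bsub>M\<^esub> x) = \<zero>\<^bsub>quotient_gmodule M N\<^esub> \<longleftrightarrow> r \<odot>\<^bsub>M\<^esub> x \<in> N"
    if "r \<in> carrier (mpoly_ring n)" "x \<in> carrier M" for r x
    unfolding quotient_zero[OF module_axioms assms] quotient_smult[OF module_axioms assms that]
    using that by (subst coset_eq_iff[OF module_axioms assms]) simp_all
  then show ?thesis
    unfolding annihilator_def carrier_quotient[OF module_axioms assms] by auto
qed

context
  fixes \<theta> :: "nat \<Rightarrow> 'k mpoly" and d :: nat
  assumes \<theta>: "\<And>i. i < d \<Longrightarrow> \<theta> i \<in> carrier (mpoly_ring n)"
begin

lemma sm: "submodule (Nb \<theta> d b) (mpoly_ring n) M"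
  by (rule submodule_Nb) (rule \<theta>)

lemma np:
  "unused d b i \<Longrightarrow> s > 0 \<Longrightarrow> x \<in> Nb \<theta> d (put b i s) \<longleftrightarrow>
    (\<exists>z\<in>carrier M. \<exists>y\<in>Nb \<theta> d b. x = \<theta> i ^ s \<odot>\<^bsub>M\<^esub> z \<oplus>\<^bsub>M\<^esub> y)"
  by (rule Nb_put) (rule \<theta>)

lemma Nb_generator:
  assumes "i < d" "b i > 0" "x \<in> carrier M"
  shows "\<theta> i ^ b i \<odot>\<^bsub>M\<^esub> x \<in> Nb \<theta> d b"
proof -
  have "\<theta> i ^ b i \<odot>\<^bsub>M\<^esub> x = \<theta> i ^ b i \<odot>\<^bsub>M\<^esub> x \<oplus>\<^bsub>M\<^esub> \<zero>\<^bsub>M\<^esub>"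
    using assms \<theta> by simp
  moreover have "\<zero>\<^bsub>M\<^esub> \<in> Nb \<theta> d (put b i 0)"
    by (rule N_mem(1)[OF sm])
  ultimately have "\<theta> i ^ b i \<odot>\<^bsub>M\<^esub> x \<in> Nb \<theta> d (put (put b i 0) i (b i))"
    using np[OF unused_put_0[OF assms(1)] assms(2)] assms(3) by blast
  then show ?thesis by simp
qed

text \<open>Turns a span, defined as an intersection of submodules, into explicit sums with one
  coefficient per parameter.\<close>

lemma scalar_set_mult_Nb:
  "scalar_set_mult (mpoly_ring n) ((\<lambda>i. \<theta> i ^ b i) ` {i. i < d \<and> 0 < b i}) M = Nb \<theta> d b"
  unfolding scalar_set_mult_def
proof (rule submodule_span_eqI)
  show "submodule (Nb \<theta> d b) (mpoly_ring n) M" by (rule sm)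
  show "{t \<odot>\<^bsub>M\<^esub> x |t x. t \<in> (\<lambda>i. \<theta> i ^ b i) ` {i. i < d \<and> 0 < b i} \<and> x \<in> carrier M} \<subseteq> Nb \<theta> d b"
    using Nb_generator by auto
  fix N assume N: "submodule N (mpoly_ring n) M"
    and sub: "{t \<odot>\<^bsub>M\<^esub> x |t x. t \<in> (\<lambda>i. \<theta> i ^ b i) ` {i. i < d \<and> 0 < b i} \<and> x \<in> carrier M} \<subseteq> N"
  show "Nb \<theta> d b \<subseteq> N"
  proof
    fix y assume "y \<in> Nb \<theta> d b"
    then obtain m where m: "\<forall>i<d. m i \<in> carrier M" "y = finsum M (\<lambda>i. \<theta> i ^ b i \<odot>\<^bsub>M\<^esub> m i) {i. i < d \<and> 0 < b i}"
      unfolding Nb_def by blast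
    show "y \<in> N" unfolding m(2) using m(1) sub by (intro N_finsum[OF N]) blast
  qed
qed

text \<open>Each multiplication by \<open>r\<close> turns the coefficient of a power of
  \<open>\<theta> i\<close> into a multiple of \<open>\<theta> i\<close> plus an element of
  \<open>Nb \<theta> d b\<close>, so the power grows by one.\<close>

lemma kill_power:
  assumes r: "r \<in> carrier (mpoly_ring n)" and b: "unused d b i"
    and kill: "\<And>x. x \<in> carrier M \<Longrightarrow> r \<odot>\<^bsub>M\<^esub> x \<in> Nb \<theta> d (put b i 1)"
  shows "x \<in> carrier M \<Longrightarrow> r ^ Suc s \<odot>\<^bsub>M\<^esub> x \<in> Nb \<theta> d (put b i (Suc s))"
proof (induction s arbitrary: x)
  case 0
  then show ?case using kill by simp
next
  case (Suc s)
  have ti: "\<theta> i \<in> carrier (mpoly_ring n)" using b \<theta> by (simp add: unused_def)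
  obtain z y where zy: "z \<in> carrier M" "y \<in> Nb \<theta> d b" "r ^ Suc s \<odot>\<^bsub>M\<^esub> x = \<theta> i ^ Suc s \<odot>\<^bsub>M\<^esub> z \<oplus>\<^bsub>M\<^esub> y"
    using Suc.IH[OF Suc.prems] np[OF b, of "Suc s"] by auto
  obtain z' y' where zy': "z' \<in> carrier M" "y' \<in> Nb \<theta> d b" "r \<odot>\<^bsub>M\<^esub> z = \<theta> i ^ 1 \<odot>\<^bsub>M\<^esub> z' \<oplus>\<^bsub>M\<^esub> y'"
    using kill[OF zy(1)] np[OF b, of 1] by auto
  have yc: "y \<in> carrier M" "y' \<in> carrier M" using zy(2) zy'(2) N_mem(2)[OF sm] by auto
  have "r ^ Suc (Suc s) \<odot>\<^bsub>M\<^esub> x = r \<odot>\<^bsub>M\<^esub> (r ^ Suc s \<odot>\<^bsub>M\<^esub> x)"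
    using r Suc.prems smult_mult[of r "r ^ Suc s" x] by simp
  also have "\<dots> = \<theta> i ^ Suc s \<odot>\<^bsub>M\<^esub> (r \<odot>\<^bsub>M\<^esub> z) \<oplus>\<^bsub>M\<^esub> r \<odot>\<^bsub>M\<^esub> y"
    unfolding zy(3) using r ti zy(1) yc smult_left_comm[of r "\<theta> i ^ Suc s" z] smult_r_distr[of r "\<theta> i ^ Suc s \<odot>\<^bsub>M\<^esub> z" y]
    by (simp del: power_Suc)
  also have "\<dots> = \<theta> i ^ Suc (Suc s) \<odot>\<^bsub>M\<^esub> z' \<oplus>\<^bsub>M\<^esub> (\<theta> i ^ Suc s \<odot>\<^bsub>M\<^esub> y' \<oplus>\<^bsub>M\<^esub> r \<odot>\<^bsub>M\<^esub> y)"
    unfolding zy'(3) using r ti zy'(1) yc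
    by (simp add: smult_r_distr smult_mult[symmetric] M.a_assoc mult.commute mult.left_commute)
  finally have "r ^ Suc (Suc s) \<odot>\<^bsub>M\<^esub> x = \<dots>" .
  moreover have "\<theta> i ^ Suc s \<odot>\<^bsub>M\<^esub> y' \<oplus>\<^bsub>M\<^esub> r \<odot>\<^bsub>M\<^esub> y \<in> Nb \<theta> d b"
    using r ti zy(2) zy'(2) by (intro N_mem(3)[OF sm] N_smult[OF sm]) auto
  ultimately show ?case using np[OF b, of "Suc (Suc s)"] zy'(1) by blast
qed

text \<open>The exponents are raised one parameter at a time; \<open>e\<close> counts those already
  raised.\<close>

lemma kill_powers:
  assumes r: "r \<in> carrier (mpoly_ring n)" and kill: "\<And>x. x \<in> carrier M \<Longrightarrow> r \<odot>\<^bsub>M\<^esub> x \<in> Nb \<theta> d (\<lambda>_. 1)"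
    and b: "\<And>i. b i > 0" and "e \<le> d"
  shows "\<exists>t. \<forall>x\<in>carrier M. r ^ t \<odot>\<^bsub>M\<^esub> x \<in> Nb \<theta> d (\<lambda>i. if i < e then b i else 1)"
  using \<open>e \<le> d\<close>
proof (induction e)
  case 0
  then show ?case using kill by (intro exI[of _ 1]) simp
next
  case (Suc e)
  let ?c = "\<lambda>i. if i < e then b i else 1"
  obtain t where t: "\<And>x. x \<in> carrier M \<Longrightarrow> r ^ t \<odot>\<^bsub>M\<^esub> x \<in> Nb \<theta> d ?c" using Suc by auto
  have e: "e < d" using Suc.prems by simp
  have c: "put (put ?c e 0) e 1 = ?c" "put (put ?c e 0) e (b e) = (\<lambda>i. if i < Suc e then b i else 1)"
    by (auto simp: put_def)
  obtain s where s: "b e = Suc s" using b[of e] by (cases "b e") auto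
  have "(r ^ t) ^ Suc s \<odot>\<^bsub>M\<^esub> x \<in> Nb \<theta> d (put (put ?c e 0) e (Suc s))" if "x \<in> carrier M" for x
    by (rule kill_power[OF _ unused_put_0[OF e] _ that]) (use r t c(1) in auto)
  then show ?case unfolding s[symmetric] c(2) power_mult[symmetric] by blast
qed

end

end

lemma prime_power_mem:
  assumes "primeideal P (mpoly_ring n)" "r \<in> carrier (mpoly_ring n)" "r ^ t \<in> P"
  shows "r \<in> P"
  using assms(3)
proof (induction t)
  case 0
  interpret primeideal P "mpoly_ring n" by fact
  have "P = carrier (mpoly_ring n)" using 0 one_imp_carrier by simp
  then show ?case using assms(2) by simp
next
  case (Suc t)
  then show ?case
    using primeideal.I_prime[OF assms(1,2), of "r ^ t"] assms(2) by auto
qed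

text \<open>Chains of primes see an annihilator only through the primes containing it, that is,
  through its radical.\<close>

lemma has_krull_dim_cong:
  assumes "\<And>P. primeideal P R \<Longrightarrow> annihilator R M \<subseteq> P \<longleftrightarrow> annihilator R M' \<subseteq> P"
  shows "has_krull_dim R M d \<longleftrightarrow> has_krull_dim R M' d"
proof -
  have "prime_chain R (annihilator R M) = prime_chain R (annihilator R M')"
    using assms unfolding prime_chain_def by (intro ext) blast
  then show ?thesis unfolding has_krull_dim_def by simp
qed

text \<open>By \<open>kill_powers\<close> the annihilators of the two quotients lie in the same
  primes, so the dimension stays 0. Of \<open>L\<close> only the length and the set of entries are
  prescribed, because the quotient does not depend on their order and the order will be chosen
  freely.\<close>

lemma (in graded_mod) hsop_powers:
  assumes hsop: "hsop n M \<theta>s" and lin: "\<forall>\<theta>\<in>set \<theta>s. homogeneous 1 \<theta>"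
    and b: "\<And>i. b i > 0"
    and L: "length L = length \<theta>s" "set L = (\<lambda>i. \<theta>s ! i ^ b i) ` {..<length \<theta>s}"
  shows "hsop n M L"
proof -
  let ?d = "length \<theta>s" and ?\<theta> = "\<lambda>i. \<theta>s ! i"
  have irr: "?\<theta> i \<in> irrelevant_ideal n" if "i < ?d" for i using hsop that by (simp add: hsop_def)
  have \<theta>: "?\<theta> i \<in> carrier (mpoly_ring n)" if "i < ?d" for i by (rule irrelevant_closed[OF irr[OF that]])
  have sm: "submodule (Nb ?\<theta> ?d c) (mpoly_ring n) M" for c by (rule submodule_Nb) (rule \<theta>)
  have ssm: "scalar_set_mult (mpoly_ring n) ((\<lambda>i. ?\<theta> i ^ c i) ` {i. i < ?d \<and> 0 < c i}) M = Nb ?\<theta> ?d c" for c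
    by (rule scalar_set_mult_Nb) (rule \<theta>)
  have all: "{i. i < ?d \<and> 0 < b i} = {..<?d}" "{i. i < ?d \<and> 0 < (1::nat)} = {..<?d}" using b by auto
  have q: "quotient_by_seq n M L = quotient_gmodule M (Nb ?\<theta> ?d b)"
    unfolding quotient_by_seq_def L(2) using ssm[of b] all(1) by simp
  have "set \<theta>s = (\<lambda>i. ?\<theta> i ^ 1) ` {..<?d}" by (auto simp: set_conv_nth)
  then have q1: "quotient_by_seq n M \<theta>s = quotient_gmodule M (Nb ?\<theta> ?d (\<lambda>_. 1))"
    unfolding quotient_by_seq_def using ssm[of "\<lambda>_. 1"] all(2) by simp
  have sub: "Nb ?\<theta> ?d b \<subseteq> Nb ?\<theta> ?d (\<lambda>_. 1)"
  proof
    fix x assume "x \<in> Nb ?\<theta> ?d b"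
    then obtain m where m: "\<forall>i<?d. m i \<in> carrier M" "x = finsum M (\<lambda>i. ?\<theta> i ^ b i \<odot>\<^bsub>M\<^esub> m i) {i. i < ?d \<and> 0 < b i}"
      unfolding Nb_def by blast
    have "?\<theta> i ^ b i \<odot>\<^bsub>M\<^esub> m i \<in> Nb ?\<theta> ?d (\<lambda>_. 1)" if i: "i < ?d" for i
    proof -
      obtain s where s: "b i = Suc s" using b[of i] by (cases "b i") auto
      have "?\<theta> i ^ (1::nat) \<odot>\<^bsub>M\<^esub> (?\<theta> i ^ s \<odot>\<^bsub>M\<^esub> m i) \<in> Nb ?\<theta> ?d (\<lambda>_. 1)"
        by (rule Nb_generator[of ?d ?\<theta> i "\<lambda>_. 1"]) (use i m(1) \<theta> in auto)
      then show ?thesis using m(1) i \<theta>[OF i] s by (simp add: smult_mult)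
    qed
    then show "x \<in> Nb ?\<theta> ?d (\<lambda>_. 1)" unfolding m(2) by (intro N_finsum[OF sm]) simp
  qed
  have "annihilator (mpoly_ring n) (quotient_by_seq n M L) \<subseteq> P \<longleftrightarrow>
      annihilator (mpoly_ring n) (quotient_by_seq n M \<theta>s) \<subseteq> P" if P: "primeideal P (mpoly_ring n)" for P
  proof
    assume "annihilator (mpoly_ring n) (quotient_by_seq n M \<theta>s) \<subseteq> P"
    then show "annihilator (mpoly_ring n) (quotient_by_seq n M L) \<subseteq> P"
      unfolding q q1 annihilator_quotient[OF sm] using sub by blast
  next
    assume sub': "annihilator (mpoly_ring n) (quotient_by_seq n M L) \<subseteq> P"
    show "annihilator (mpoly_ring n) (quotient_by_seq n M \<theta>s) \<subseteq> P"
    proof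
      fix r assume "r \<in> annihilator (mpoly_ring n) (quotient_by_seq n M \<theta>s)"
      then have r: "r \<in> carrier (mpoly_ring n)" "\<And>x. x \<in> carrier M \<Longrightarrow> r \<odot>\<^bsub>M\<^esub> x \<in> Nb ?\<theta> ?d (\<lambda>_. 1)"
        unfolding q1 annihilator_quotient[OF sm] by auto
      obtain t where "\<forall>x\<in>carrier M. r ^ t \<odot>\<^bsub>M\<^esub> x \<in> Nb ?\<theta> ?d (\<lambda>i. if i < ?d then b i else 1)"
        using kill_powers[of ?d ?\<theta> r b ?d] \<theta> r b by blast
      moreover have "Nb ?\<theta> ?d (\<lambda>i. if i < ?d then b i else 1) = Nb ?\<theta> ?d b"
        unfolding ssm[symmetric]
        by (intro arg_cong[where f = "\<lambda>T. scalar_set_mult (mpoly_ring n) T M"]) auto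
      ultimately have "r ^ t \<in> annihilator (mpoly_ring n) (quotient_by_seq n M L)"
        unfolding q annihilator_quotient[OF sm] using r(1) by simp
      then show "r \<in> P" using prime_power_mem[OF P r(1)] sub' by blast
    qed
  qed
  then have "has_krull_dim (mpoly_ring n) (quotient_by_seq n M L) 0"
    using hsop has_krull_dim_cong unfolding hsop_def by blast
  moreover have "\<theta>' \<in> irrelevant_ideal n \<and> (\<exists>i. homogeneous i \<theta>')" if mem: "\<theta>' \<in> set L" for \<theta>'
  proof -
    obtain i where i: "i < ?d" "\<theta>' = ?\<theta> i ^ b i" using mem L(2) by auto
    then show ?thesis
      using irrelevant_power[OF irr[OF i(1)] b] homogeneous_power[of 1 "?\<theta> i" "b i"] lin by auto
  qed
  ultimately show ?thesis using hsop L(1) unfolding hsop_def by simp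
qed

text \<open>A weak sequence is a condition on initial segments. Given \<open>b\<close>,
  \<open>i\<close> and \<open>s\<close>, the used parameters are placed first, then
  \<open>\<theta> i ^ s\<close>, then the others to reach full length; the condition at position
  \<open>length G\<close> is the claim.\<close>

lemma buchsbaum_sopI:
  fixes M :: "('k::field mpoly, 'm) gmodule"
  assumes "graded_module n M" "lsop n M \<theta>s" "buchsbaum n M"
  shows "buchsbaum_sop n M (\<lambda>i. \<theta>s ! i) (length \<theta>s)"
proof -
  interpret graded_mod n M by unfold_locales (rule assms(1))
  let ?d = "length \<theta>s" and ?\<theta> = "\<lambda>i. \<theta>s ! i"
  have hs: "hsop n M \<theta>s" and lin: "\<forall>\<theta>\<in>set \<theta>s. homogeneous 1 \<theta>" using assms(2) by (auto simp: lsop_def)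
  have irr: "?\<theta> i \<in> irrelevant_ideal n" if "i < ?d" for i using hs that by (simp add: hsop_def)
  have \<theta>: "?\<theta> i \<in> carrier (mpoly_ring n)" if "i < ?d" for i by (rule irrelevant_closed[OF irr[OF that]])
  show ?thesis
  proof (intro buchsbaum_sop.intro buchsbaum_sop_axioms.intro graded_mod_axioms \<theta>)
    show "homogeneous 1 (?\<theta> i)" if "i < ?d" for i using lin that by simp
    fix b i s u and p :: "'k mpoly"
    assume b: "unused ?d b i" "0 < (s::nat)" and u: "u \<in> carrier M" "?\<theta> i ^ s \<odot>\<^bsub>M\<^esub> u \<in> Nb ?\<theta> ?d b"
      and p: "p \<in> irrelevant_ideal n"
    have ssm: "scalar_set_mult (mpoly_ring n) ((\<lambda>i. ?\<theta> i ^ b i) ` {i. i < ?d \<and> 0 < b i}) M = Nb ?\<theta> ?d b"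
      by (rule scalar_set_mult_Nb) (rule \<theta>)
    have i: "i < ?d" "b i = 0" using b by (simp_all add: unused_def)
    \<comment> \<open>The filler exponent 1 completes the list to a full system of
      parameters.\<close>
    define c where "c l = (if l = i then s else if b l > 0 then b l else 1)" for l
    define G where "G = filter (\<lambda>l. b l > 0) [0..<?d]"
    define H where "H = filter (\<lambda>l. \<not> b l > 0 \<and> l \<noteq> i) [0..<?d]"
    define L where "L = map (\<lambda>l. ?\<theta> l ^ c l) (G @ i # H)"
    have "distinct (G @ i # H)" "set (G @ i # H) = {..<?d}"
      using i by (auto simp: G_def H_def)
    then have "length (G @ i # H) = ?d" by (metis card_lessThan distinct_card)
    then have "hsop n M L"
    proof (intro hsop_powers[OF hs lin, of c])
      show "set L = (\<lambda>l. ?\<theta> l ^ c l) ` {..<?d}"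
        unfolding L_def set_map \<open>set (G @ i # H) = {..<?d}\<close> ..
    qed (use b(2) in \<open>simp_all add: L_def c_def\<close>)
    then have weak: "weak_sequence n M L" using assms(3) by (simp add: buchsbaum_def)
    have len: "length G < length L" by (simp add: L_def)
    have nth: "L ! length G = ?\<theta> i ^ s" by (simp add: L_def nth_append c_def)
    have tk: "set (take (length G) L) = (\<lambda>l. ?\<theta> l ^ b l) ` {l. l < ?d \<and> 0 < b l}"
    proof -
      have "set (take (length G) L) = (\<lambda>l. ?\<theta> l ^ c l) ` {l. l < ?d \<and> 0 < b l}"
        by (auto simp: L_def G_def)
      also have "\<dots> = (\<lambda>l. ?\<theta> l ^ b l) ` {l. l < ?d \<and> 0 < b l}"
        using i(2) by (intro image_cong) (auto simp: c_def)
      finally show ?thesis .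
    qed
    have "colon M (scalar_set_mult (mpoly_ring n) (set (take (length G) L)) M) {L ! length G} =
        colon M (scalar_set_mult (mpoly_ring n) (set (take (length G) L)) M) (irrelevant_ideal n)"
      using weak len by (simp add: weak_sequence_def)
    then have "colon M (Nb ?\<theta> ?d b) {?\<theta> i ^ s} = colon M (Nb ?\<theta> ?d b) (irrelevant_ideal n)"
      unfolding nth tk ssm .
    moreover have "u \<in> colon M (Nb ?\<theta> ?d b) {?\<theta> i ^ s}" using u by (simp add: colon_def)
    ultimately show "p \<odot>\<^bsub>M\<^esub> u \<in> Nb ?\<theta> ?d b" using p by (simp add: colon_def)
  qed
qed

section \<open>Linear sections of linear relations over the field\<close>

lemma field_ring_simps [simp]:
  "carrier field_ring = UNIV" "mult field_ring = (*)" "one field_ring = 1" "zero field_ring = 0" "add field_ring = (+)"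
  by (simp_all add: field_ring_def)

lemma cring_field_ring: "cring (field_ring :: 'k::field ring)"
proof (rule cringI)
  show "abelian_group (field_ring :: 'k ring)"
    by (rule abelian_groupI) (auto simp: algebra_simps intro: exI[of _ "- _"])
  show "comm_monoid (field_ring :: 'k ring)"
    by unfold_locales (auto simp: algebra_simps)
qed (simp add: algebra_simps)

text \<open>A linear relation that is total from the right contains the graph of a linear map. The
  proof extends a maximal partial section by one more vector.\<close>

lemma linear_section:
  fixes A :: "('k::field, 'a, 'x) module_scheme" and B :: "('k, 'b, 'y) module_scheme"
  assumes "module field_ring A" "module field_ring B"
    and carr: "\<And>a b. \<rho> a b \<Longrightarrow> a \<in> carrier A \<and> b \<in> carrier B"
    and add: "\<And>a b a' b'. \<rho> a b \<Longrightarrow> \<rho> a' b' \<Longrightarrow> \<rho> (a \<oplus>\<^bsub>A\<^esub> a') (b \<oplus>\<^bsub>B\<^esub> b')"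
    and smult: "\<And>a b c. \<rho> a b \<Longrightarrow> \<rho> (c \<odot>\<^bsub>A\<^esub> a) (c \<odot>\<^bsub>B\<^esub> b)"
    and total: "\<And>b. b \<in> carrier B \<Longrightarrow> \<exists>a. \<rho> a b"
  shows "\<exists>\<sigma>. (\<forall>b\<in>carrier B. \<rho> (\<sigma> b) b) \<and>
    (\<forall>b\<in>carrier B. \<forall>b'\<in>carrier B. \<sigma> (b \<oplus>\<^bsub>B\<^esub> b') = \<sigma> b \<oplus>\<^bsub>A\<^esub> \<sigma> b') \<and>
    (\<forall>c. \<forall>b\<in>carrier B. \<sigma> (c \<odot>\<^bsub>B\<^esub> b) = c \<odot>\<^bsub>A\<^esub> \<sigma> b)"
proof -
  interpret A: module "field_ring" A by fact
  interpret B: module "field_ring" B by fact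
  \<comment> \<open>Linear subrelations of \<open>\<rho>\<close> that are graphs: the last clause,
    that only zero lies over zero, is single-valuedness in linear form.\<close>
  define good where "good \<tau> \<longleftrightarrow> (\<forall>(a, b)\<in>\<tau>. \<rho> a b) \<and> (\<zero>\<^bsub>A\<^esub>, \<zero>\<^bsub>B\<^esub>) \<in> \<tau> \<and>
    (\<forall>a b a' b'. (a, b) \<in> \<tau> \<longrightarrow> (a', b') \<in> \<tau> \<longrightarrow> (a \<oplus>\<^bsub>A\<^esub> a', b \<oplus>\<^bsub>B\<^esub> b') \<in> \<tau>) \<and>
    (\<forall>c a b. (a, b) \<in> \<tau> \<longrightarrow> (c \<odot>\<^bsub>A\<^esub> a, c \<odot>\<^bsub>B\<^esub> b) \<in> \<tau>) \<and>
    (\<forall>a. (a, \<zero>\<^bsub>B\<^esub>) \<in> \<tau> \<longrightarrow> a = \<zero>\<^bsub>A\<^esub>)" for \<tau>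
  have A0: "0 \<odot>\<^bsub>A\<^esub> a = \<zero>\<^bsub>A\<^esub>" if "a \<in> carrier A" for a using A.smult_l_null[OF that] by simp
  have B0: "0 \<odot>\<^bsub>B\<^esub> b = \<zero>\<^bsub>B\<^esub>" if "b \<in> carrier B" for b using B.smult_l_null[OF that] by simp
  have A1: "1 \<odot>\<^bsub>A\<^esub> a = a" if "a \<in> carrier A" for a using A.smult_one[OF that] by simp
  have B1: "1 \<odot>\<^bsub>B\<^esub> b = b" if "b \<in> carrier B" for b using B.smult_one[OF that] by simp
  have Ac: "c \<odot>\<^bsub>A\<^esub> a \<in> carrier A" if "a \<in> carrier A" for c a using A.smult_closed[of c a] that by simp
  have Bc: "c \<odot>\<^bsub>B\<^esub> b \<in> carrier B" if "b \<in> carrier B" for c b using B.smult_closed[of c b] that by simp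
  have Am: "c \<odot>\<^bsub>A\<^esub> (e \<odot>\<^bsub>A\<^esub> a) = (c * e) \<odot>\<^bsub>A\<^esub> a" if "a \<in> carrier A" for c e a
    using A.smult_assoc1[of c e a] that by simp
  have Bm: "c \<odot>\<^bsub>B\<^esub> (e \<odot>\<^bsub>B\<^esub> b) = (c * e) \<odot>\<^bsub>B\<^esub> b" if "b \<in> carrier B" for c e b
    using B.smult_assoc1[of c e b] that by simp
  have Ad: "(c + e) \<odot>\<^bsub>A\<^esub> a = c \<odot>\<^bsub>A\<^esub> a \<oplus>\<^bsub>A\<^esub> e \<odot>\<^bsub>A\<^esub> a" if "a \<in> carrier A" for c e a
    using A.smult_l_distr[of c e a] that by simp
  have Bd: "(c + e) \<odot>\<^bsub>B\<^esub> b = c \<odot>\<^bsub>B\<^esub> b \<oplus>\<^bsub>B\<^esub> e \<odot>\<^bsub>B\<^esub> b" if "b \<in> carrier B" for c e b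
    using B.smult_l_distr[of c e b] that by simp
  have Ar: "c \<odot>\<^bsub>A\<^esub> (a \<oplus>\<^bsub>A\<^esub> a') = c \<odot>\<^bsub>A\<^esub> a \<oplus>\<^bsub>A\<^esub> c \<odot>\<^bsub>A\<^esub> a'" if "a \<in> carrier A" "a' \<in> carrier A" for c a a'
    using A.smult_r_distr[of c a a'] that by simp
  have Br: "c \<odot>\<^bsub>B\<^esub> (b \<oplus>\<^bsub>B\<^esub> b') = c \<odot>\<^bsub>B\<^esub> b \<oplus>\<^bsub>B\<^esub> c \<odot>\<^bsub>B\<^esub> b'" if "b \<in> carrier B" "b' \<in> carrier B" for c b b'
    using B.smult_r_distr[of c b b'] that by simp
  obtain a0 where "\<rho> a0 \<zero>\<^bsub>B\<^esub>" using total[OF B.zero_closed] by blast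
  from smult[OF this, of 0] carr[OF this] have r0: "\<rho> \<zero>\<^bsub>A\<^esub> \<zero>\<^bsub>B\<^esub>" by (simp add: A0 B0)
  have "good {(\<zero>\<^bsub>A\<^esub>, \<zero>\<^bsub>B\<^esub>)}"
  proof -
    have "c \<odot>\<^bsub>A\<^esub> \<zero>\<^bsub>A\<^esub> = \<zero>\<^bsub>A\<^esub>" "c \<odot>\<^bsub>B\<^esub> \<zero>\<^bsub>B\<^esub> = \<zero>\<^bsub>B\<^esub>" for c
      using A.smult_r_null[of c] B.smult_r_null[of c] by simp_all
    then show ?thesis using r0 by (simp add: good_def)
  qed
  then have ne: "Collect good \<noteq> {}" by blast
  have "\<exists>T\<in>Collect good. \<forall>X\<in>Collect good. T \<subseteq> X \<longrightarrow> X = T"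
  proof (rule subset_Zorn_nonempty[OF ne])
    fix \<C> assume C: "\<C> \<noteq> {}" "subset.chain (Collect good) \<C>"
    then have g: "\<And>\<tau>. \<tau> \<in> \<C> \<Longrightarrow> good \<tau>" and lin: "\<And>X Y. X \<in> \<C> \<Longrightarrow> Y \<in> \<C> \<Longrightarrow> X \<subseteq> Y \<or> Y \<subseteq> X"
      by (auto simp: subset.chain_def)
    have "(a \<oplus>\<^bsub>A\<^esub> a', b \<oplus>\<^bsub>B\<^esub> b') \<in> \<Union>\<C>" if mem: "(a, b) \<in> X" "X \<in> \<C>" "(a', b') \<in> Y" "Y \<in> \<C>" for a b a' b' X Y
    proof -
      obtain Z where "Z \<in> \<C>" "(a, b) \<in> Z" "(a', b') \<in> Z" using lin[of X Y] mem by blast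
      then show ?thesis using g[of Z] unfolding good_def by blast
    qed
    then have "\<forall>a b a' b'. (a, b) \<in> \<Union>\<C> \<longrightarrow> (a', b') \<in> \<Union>\<C> \<longrightarrow> (a \<oplus>\<^bsub>A\<^esub> a', b \<oplus>\<^bsub>B\<^esub> b') \<in> \<Union>\<C>"
      by (meson UnionE)
    moreover have "\<forall>(a, b)\<in>\<Union>\<C>. \<rho> a b" using g unfolding good_def by blast
    moreover have "(\<zero>\<^bsub>A\<^esub>, \<zero>\<^bsub>B\<^esub>) \<in> \<Union>\<C>" using g C(1) unfolding good_def by blast
    moreover have "\<forall>c a b. (a, b) \<in> \<Union>\<C> \<longrightarrow> (c \<odot>\<^bsub>A\<^esub> a, c \<odot>\<^bsub>B\<^esub> b) \<in> \<Union>\<C>" using g unfolding good_def by blast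
    moreover have "\<forall>a. (a, \<zero>\<^bsub>B\<^esub>) \<in> \<Union>\<C> \<longrightarrow> a = \<zero>\<^bsub>A\<^esub>" using g unfolding good_def by blast
    ultimately show "\<Union>\<C> \<in> Collect good" unfolding mem_Collect_eq good_def by (intro conjI)
  qed
  then obtain T where T: "good T" and max: "\<And>X. good X \<Longrightarrow> T \<subseteq> X \<Longrightarrow> X = T" by blast
  have Tr: "\<rho> a b" if "(a, b) \<in> T" for a b using T that unfolding good_def by blast
  have Tc: "a \<in> carrier A" "b \<in> carrier B" if "(a, b) \<in> T" for a b using carr[OF Tr[OF that]] by auto
  have T0: "(\<zero>\<^bsub>A\<^esub>, \<zero>\<^bsub>B\<^esub>) \<in> T" using T unfolding good_def by blast
  have Ta: "(a \<oplus>\<^bsub>A\<^esub> a', b \<oplus>\<^bsub>B\<^esub> b') \<in> T" if "(a, b) \<in> T" "(a', b') \<in> T" for a b a' b'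
    using T that unfolding good_def by blast
  have Tm: "(c \<odot>\<^bsub>A\<^esub> a, c \<odot>\<^bsub>B\<^esub> b) \<in> T" if "(a, b) \<in> T" for a b c using T that unfolding good_def by blast
  have Tz: "a = \<zero>\<^bsub>A\<^esub>" if "(a, \<zero>\<^bsub>B\<^esub>) \<in> T" for a using T that unfolding good_def by blast
  have dom: "\<exists>a. (a, b) \<in> T" if b: "b \<in> carrier B" for b
  proof (rule ccontr)
    assume nb: "\<nexists>a. (a, b) \<in> T"
    obtain a where a: "\<rho> a b" using total[OF b] by blast
    have ac: "a \<in> carrier A" using carr[OF a] by simp
    \<comment> \<open>The span of \<open>T\<close> and one pair over the missing vector
      \<open>b\<close>.\<close>
    define X where "X = {(x \<oplus>\<^bsub>A\<^esub> c \<odot>\<^bsub>A\<^esub> a, y \<oplus>\<^bsub>B\<^esub> c \<odot>\<^bsub>B\<^esub> b) | x y c. (x, y) \<in> T}"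
    have XI: "(x \<oplus>\<^bsub>A\<^esub> c \<odot>\<^bsub>A\<^esub> a, y \<oplus>\<^bsub>B\<^esub> c \<odot>\<^bsub>B\<^esub> b) \<in> X" if "(x, y) \<in> T" for x y c
      using that unfolding X_def by blast
    have sub: "T \<subseteq> X"
    proof (rule subrelI)
      fix x y assume xy: "(x, y) \<in> T"
      show "(x, y) \<in> X" using XI[OF xy, of 0] Tc[OF xy] ac b by (simp add: A0 B0)
    qed
    have "(a, b) \<in> X" using XI[OF T0, of 1] ac b by (simp add: A1 B1)
    have "good X"
      unfolding good_def
    proof (intro conjI allI impI)
      show "\<forall>(a, b)\<in>X. \<rho> a b" unfolding X_def using add[OF Tr smult[OF a]] by blast
      show "(\<zero>\<^bsub>A\<^esub>, \<zero>\<^bsub>B\<^esub>) \<in> X" using sub T0 by blast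
    next
      fix u v u' v' assume "(u, v) \<in> X" "(u', v') \<in> X"
      then obtain x y c x' y' c' where 1: "(x, y) \<in> T" "u = x \<oplus>\<^bsub>A\<^esub> c \<odot>\<^bsub>A\<^esub> a" "v = y \<oplus>\<^bsub>B\<^esub> c \<odot>\<^bsub>B\<^esub> b"
        and 2: "(x', y') \<in> T" "u' = x' \<oplus>\<^bsub>A\<^esub> c' \<odot>\<^bsub>A\<^esub> a" "v' = y' \<oplus>\<^bsub>B\<^esub> c' \<odot>\<^bsub>B\<^esub> b"
        unfolding X_def by blast
      have "u \<oplus>\<^bsub>A\<^esub> u' = (x \<oplus>\<^bsub>A\<^esub> x') \<oplus>\<^bsub>A\<^esub> (c + c') \<odot>\<^bsub>A\<^esub> a" "v \<oplus>\<^bsub>B\<^esub> v' = (y \<oplus>\<^bsub>B\<^esub> y') \<oplus>\<^bsub>B\<^esub> (c + c') \<odot>\<^bsub>B\<^esub> b"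
        using Tc[OF 1(1)] Tc[OF 2(1)] ac b unfolding 1 2
        by (simp_all add: Ad Bd Ac Bc A.M.a_ac B.M.a_ac)
      then show "(u \<oplus>\<^bsub>A\<^esub> u', v \<oplus>\<^bsub>B\<^esub> v') \<in> X" using XI[OF Ta[OF 1(1) 2(1)]] by simp
    next
      fix e u v assume "(u, v) \<in> X"
      then obtain x y c where 1: "(x, y) \<in> T" "u = x \<oplus>\<^bsub>A\<^esub> c \<odot>\<^bsub>A\<^esub> a" "v = y \<oplus>\<^bsub>B\<^esub> c \<odot>\<^bsub>B\<^esub> b"
        unfolding X_def by blast
      have "e \<odot>\<^bsub>A\<^esub> u = e \<odot>\<^bsub>A\<^esub> x \<oplus>\<^bsub>A\<^esub> (e * c) \<odot>\<^bsub>A\<^esub> a" "e \<odot>\<^bsub>B\<^esub> v = e \<odot>\<^bsub>B\<^esub> y \<oplus>\<^bsub>B\<^esub> (e * c) \<odot>\<^bsub>B\<^esub> b"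
        using Tc[OF 1(1)] ac b unfolding 1 by (simp_all add: Ar Br Ac Bc Am Bm)
      then show "(e \<odot>\<^bsub>A\<^esub> u, e \<odot>\<^bsub>B\<^esub> v) \<in> X" using XI[OF Tm[OF 1(1)]] by simp
    next
      fix u assume "(u, \<zero>\<^bsub>B\<^esub>) \<in> X"
      then obtain x y c where 1: "(x, y) \<in> T" "u = x \<oplus>\<^bsub>A\<^esub> c \<odot>\<^bsub>A\<^esub> a" "\<zero>\<^bsub>B\<^esub> = y \<oplus>\<^bsub>B\<^esub> c \<odot>\<^bsub>B\<^esub> b"
        unfolding X_def by blast
      note xy = Tc[OF 1(1)]
      show "u = \<zero>\<^bsub>A\<^esub>"
      proof (cases "c = 0")
        case True
        with 1 xy ac b have "u = x" "y = \<zero>\<^bsub>B\<^esub>" by (simp_all add: A0 B0)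
        with 1(1) Tz show ?thesis by blast
      next
        case False
        \<comment> \<open>A nonzero \<open>c\<close> would exhibit \<open>b\<close> as a multiple of
          \<open>y\<close>, over which \<open>T\<close> has an element, against the choice of
          \<open>b\<close>.\<close>
        let ?e = "- inverse c"
        have "(?e \<odot>\<^bsub>A\<^esub> x, ?e \<odot>\<^bsub>B\<^esub> y) \<in> T" by (rule Tm[OF 1(1)])
        moreover have "?e \<odot>\<^bsub>B\<^esub> y = b"
        proof -
          have "?e \<odot>\<^bsub>B\<^esub> y \<oplus>\<^bsub>B\<^esub> (?e * c) \<odot>\<^bsub>B\<^esub> b = ?e \<odot>\<^bsub>B\<^esub> \<zero>\<^bsub>B\<^esub>"
            unfolding 1(3) using xy b by (simp add: Br Bc Bm)
          also have "\<dots> = \<zero>\<^bsub>B\<^esub>" using B.smult_r_null[of ?e] by simp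
          finally have "?e \<odot>\<^bsub>B\<^esub> y \<oplus>\<^bsub>B\<^esub> (- 1) \<odot>\<^bsub>B\<^esub> b = \<zero>\<^bsub>B\<^esub>" using False by simp
          moreover have "(- 1) \<odot>\<^bsub>B\<^esub> b \<oplus>\<^bsub>B\<^esub> b = \<zero>\<^bsub>B\<^esub>" using Bd[OF b, of "- 1" 1] b by (simp add: B0 B1)
          ultimately show ?thesis
            using xy b Bc by (metis B.M.a_assoc B.M.l_zero B.M.r_zero)
        qed
        ultimately show ?thesis using nb by simp
      qed
    qed
    from max[OF this sub] \<open>(a, b) \<in> X\<close> nb show False by blast
  qed
  have uniq: "a = a'" if "(a, b) \<in> T" "(a', b) \<in> T" for a a' b
  proof -
    have c: "a \<in> carrier A" "a' \<in> carrier A" "b \<in> carrier B" using Tc that by auto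
    have "(a \<oplus>\<^bsub>A\<^esub> (- 1) \<odot>\<^bsub>A\<^esub> a', b \<oplus>\<^bsub>B\<^esub> (- 1) \<odot>\<^bsub>B\<^esub> b) \<in> T" using that by (intro Ta Tm)
    moreover have "b \<oplus>\<^bsub>B\<^esub> (- 1) \<odot>\<^bsub>B\<^esub> b = \<zero>\<^bsub>B\<^esub>" using Bd[OF c(3), of 1 "- 1"] c by (simp add: B0 B1)
    ultimately have "a \<oplus>\<^bsub>A\<^esub> (- 1) \<odot>\<^bsub>A\<^esub> a' = \<zero>\<^bsub>A\<^esub>" using Tz by simp
    moreover have "(- 1) \<odot>\<^bsub>A\<^esub> a' \<oplus>\<^bsub>A\<^esub> a' = \<zero>\<^bsub>A\<^esub>" using Ad[OF c(2), of "- 1" 1] c by (simp add: A0 A1)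
    ultimately show ?thesis
      using c Ac by (metis A.M.a_assoc A.M.l_zero A.M.r_zero)
  qed
  define \<sigma> where "\<sigma> b = (SOME a. (a, b) \<in> T)" for b
  have s: "(\<sigma> b, b) \<in> T" if "b \<in> carrier B" for b
    unfolding \<sigma>_def using dom[OF that] by (rule someI_ex)
  show ?thesis
  proof (intro exI[of _ \<sigma>] conjI ballI allI)
    fix b b' assume b: "b \<in> carrier B" "b' \<in> carrier B"
    show "\<sigma> (b \<oplus>\<^bsub>B\<^esub> b') = \<sigma> b \<oplus>\<^bsub>A\<^esub> \<sigma> b'"
      by (rule uniq[OF s Ta[OF s s]]) (use b in auto)
  next
    fix c b assume b: "b \<in> carrier B"
    show "\<sigma> (c \<odot>\<^bsub>B\<^esub> b) = c \<odot>\<^bsub>A\<^esub> \<sigma> b"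
      by (rule uniq[OF s Tm[OF s]]) (use b Bc in auto)
  qed (use s Tr in blast)
qed

section \<open>Detecting the contribution of a single subset\<close>

context filtered_complex
begin

lemma admissible_0: "distinct F \<Longrightarrow> set F \<subseteq> {..<d} \<Longrightarrow> admissible F (\<lambda>_. 0)"
  by (auto simp: admissible_def unused_def)

lemma unused_upd: "unused d b i \<Longrightarrow> i \<notin> set K \<Longrightarrow> unused d (upd b K) i"
  by (simp add: unused_def upd_def)

lemma admissible_upd: "admissible F b \<Longrightarrow> set F \<inter> set K = {} \<Longrightarrow> admissible F (upd b K)"
  unfolding admissible_def using unused_upd by blast

lemma CN_upd: "admissible K b \<Longrightarrow> CN b j \<subseteq> CN (upd b K) j"
proof (induction K)
  case (Cons i K)
  note a = admissible_Cons[OF Cons.prems]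
  show ?case
    using Cons.IH[OF a(4)] CN_mono[OF unused_upd[OF a(1,5)], of j 1] by (simp add: upd_Cons)
qed simp

lemma Zc_upd: "admissible K b \<Longrightarrow> Zc b j k \<subseteq> Zc (upd b K) j k"
  using CN_upd by (auto simp: Zc_def)

lemma rel_upd:
  "admissible K b \<Longrightarrow> admissible F b \<Longrightarrow> set F \<inter> set K = {} \<Longrightarrow> rel F b k u x \<Longrightarrow> rel F (upd b K) k u x"
proof (induction K)
  case (Cons i K)
  note a = admissible_Cons[OF Cons.prems(1)]
  have "rel F (put (upd b K) i 1) k u x"
    using Cons a by (intro rel_mono admissible_upd unused_upd) auto
  then show ?case by (simp add: upd_Cons)
qed simp

lemma card_supp_upds: "admissible K b \<Longrightarrow> card (supp (upd b K)) = card (supp b) + length K"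
proof (induction K)
  case (Cons i K)
  note a = admissible_Cons[OF Cons.prems]
  show ?case
    using Cons.IH[OF a(4)] card_supp_upd[OF unused_upd[OF a(1,5)], of 1] by (simp add: upd_Cons)
qed simp

text \<open>\<open>Bc_inj\<close> removes one parameter at a time and is applied over bases that
  lack at least one element of \<open>K\<close>; hence the total may reach \<open>d\<close>.\<close>

lemma Bc_upd_inj:
  "admissible K b \<Longrightarrow> card (supp b) + length K + j \<le> d \<Longrightarrow> x \<in> Zc b j k \<Longrightarrow> x \<in> Bc (upd b K) j k \<Longrightarrow> x \<in> Bc b j k"
proof (induction K)
  case (Cons i K)
  note a = admissible_Cons[OF Cons.prems(1)]
  have "x \<in> Bc (put (upd b K) i 1) j k"
    using Cons.prems(4) by (simp add: upd_Cons del: Bc.simps)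
  then have "x \<in> Bc (upd b K) j k"
    using Cons.prems card_supp_upds[OF a(4)] subsetD[OF Zc_upd[OF a(4)] Cons.prems(3)]
    by (intro Bc_inj[OF _ unused_upd[OF a(1,5)]]) auto
  then show ?case using Cons a by auto
qed simp

definition full :: "nat \<Rightarrow> nat" where "full = upd (\<lambda>_. 0) [0..<d]"

definition others :: "nat list \<Rightarrow> nat \<Rightarrow> nat" where
  "others G = upd (\<lambda>_. 0) (filter (\<lambda>i. i \<notin> set G) [0..<d])"

text \<open>The classes whose image under \<open>rel G\<close> vanishes after all the remaining \<open>\<theta>\<^sub>i\<close> are divided out.
  These vanishing conditions read off the component of a sum that belongs to \<open>G\<close>.\<close>

definition dying :: "nat list \<Rightarrow> int \<Rightarrow> 'c set" where
  "dying G k = {w \<in> Zc full 0 k. \<forall>x. rel G (others G) k w x \<longrightarrow> x \<in> Bc (others G) (length G) (k - int (length G))}"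

context
  fixes G assumes G: "distinct G" "set G \<subseteq> {..<d}"
begin

lemma admissible_others: "admissible G (others G)"
  unfolding others_def using admissible_0[OF G] by (intro admissible_upd) auto

lemma upd_others: "upd (others G) G = full"
  using G by (auto simp: upd_def others_def full_def fun_eq_iff)

lemma CN_dying: "g 0 k \<inter> CN full 0 \<subseteq> dying G k"
  using rel_CN[OF admissible_others] D_CN unfolding dying_def Zc_def upd_others by blast

text \<open>Membership in \<open>Zc full\<close> guarantees that related elements exist, so the
  universal condition is not vacuous and can be tested on one value, by
  \<open>rel_unique\<close>.\<close>

lemma dying_sub: "subgroup (dying G k) (add_monoid (C 0))"
proof (rule C.subgroupI_diff)
  show "dying G k \<subseteq> carrier (C 0)" by (auto simp: dying_def Zc_mem(2))
  show "\<zero>\<^bsub>C 0\<^esub> \<in> dying G k" using CN_dying g_mem(1) CN_mem(1) by blast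
  fix u v assume uv: "u \<in> dying G k" "v \<in> dying G k"
  have "x \<in> Bc (others G) (length G) (k - int (length G))" if r: "rel G (others G) k (u \<ominus>\<^bsub>C 0\<^esub> v) x" for x
  proof -
    obtain y z where yz: "rel G (others G) k u y" "rel G (others G) k v z"
      using rel_exists[OF admissible_others] uv unfolding upd_others dying_def by blast
    then have B: "y \<in> Bc (others G) (length G) (k - int (length G))" "z \<in> Bc (others G) (length G) (k - int (length G))"
      using uv by (auto simp: dying_def simp del: Bc.simps)
    have "x \<ominus>\<^bsub>C (length G)\<^esub> (y \<ominus>\<^bsub>C (length G)\<^esub> z) \<in> Bc (others G) (length G) (k - int (length G))"
      by (rule rel_unique[OF admissible_others r rel_diff[OF admissible_others yz]])
    moreover have "x \<in> carrier (C (length G))"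
      using rel_Zc2[OF admissible_others r] by (rule Zc_mem)
    ultimately show ?thesis
      using C.subgroup_cancel(1)[OF Bc_sub Bc_mem(5)[OF B]] by blast
  qed
  then show "u \<ominus>\<^bsub>C 0\<^esub> v \<in> dying G k"
    using uv Zc_mem(5) unfolding dying_def by blast
qed

text \<open>A parameter \<open>i\<close> of \<open>G\<close> is missing from \<open>F\<close>.
  Dividing out everything except \<open>\<theta> i\<close> keeps the cocycle a cocycle, so
  \<open>rel_colon\<close> kills its value over \<open>others G\<close>.\<close>

lemma Zc_dying:
  assumes "distinct F" "set F \<subseteq> {..<d}" "i \<in> set G" "i \<notin> set F"
  shows "Zc (upd (\<lambda>_. 0) F) 0 k \<subseteq> dying G k"
proof
  fix w assume w: "w \<in> Zc (upd (\<lambda>_. 0) F) 0 k"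
  \<comment> \<open>All parameters outside \<open>F\<close> except \<open>i\<close>, so that
    \<open>F\<close> and \<open>?K\<close> together miss only \<open>\<theta> i\<close>.\<close>
  let ?K = "filter (\<lambda>l. l \<notin> set F \<and> l \<noteq> i) [0..<d]"
  have aK: "admissible ?K (upd (\<lambda>_. 0) F)" by (intro admissible_upd admissible_0) auto
  have "upd (upd (\<lambda>_. 0) F) ?K = upd (others G) (removeAll i G)"
    using G assms by (auto simp: upd_def others_def fun_eq_iff)
  then have 1: "w \<in> Zc (upd (others G) (removeAll i G)) 0 k"
    using subsetD[OF Zc_upd[OF aK] w] by simp
  have "upd (upd (\<lambda>_. 0) F) (filter (\<lambda>l. l \<notin> set F) [0..<d]) = full"
    using assms by (auto simp: upd_def full_def fun_eq_iff)
  moreover have "admissible (filter (\<lambda>l. l \<notin> set F) [0..<d]) (upd (\<lambda>_. 0) F)"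
    by (intro admissible_upd admissible_0) auto
  ultimately have "w \<in> Zc full 0 k" using Zc_upd w by (metis subsetD)
  then show "w \<in> dying G k"
    using rel_colon[OF admissible_others _ assms(3) 1] by (simp add: dying_def)
qed

text \<open>The number of parameters outside \<open>G\<close> plus the degree
  \<open>length G\<close> is exactly \<open>d\<close>, the largest value for which
  \<open>Bc_upd_inj\<close> makes the passage to the quotient injective on cohomology.\<close>

lemma rel_dying:
  assumes "rel G (\<lambda>_. 0) k u x" "u \<in> dying G k"
  shows "x \<in> Bc (\<lambda>_. 0) (length G) (k - int (length G))"
proof -
  let ?K = "filter (\<lambda>i. i \<notin> set G) [0..<d]"
  have K: "admissible ?K (\<lambda>_. 0)" by (rule admissible_0) auto
  have "rel G (others G) k u x"
    unfolding others_def using assms(1) K admissible_0[OF G] by (intro rel_upd) auto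
  then have B: "x \<in> Bc (upd (\<lambda>_. 0) ?K) (length G) (k - int (length G))"
    using assms(2) by (simp add: dying_def others_def[symmetric])
  have "set ?K = {..<d} - set G" by auto
  then have "length ?K = d - length G"
    using G distinct_card[of ?K] distinct_card[OF G(1)] by (simp add: card_Diff_subset)
  moreover have "length G \<le> d"
    using G distinct_card[OF G(1)] card_mono[of "{..<d}" "set G"] by simp
  ultimately show ?thesis
    using Bc_upd_inj[OF K _ rel_Zc2[OF admissible_0[OF G] assms(1)] B] by (simp add: supp_def)
qed

end

end

section \<open>Local cohomology as classes of Cech cocycles\<close>

lemma restrict_gmodule_simps [simp]:
  "carrier (restrict_gmodule Q N) = N" "zero (restrict_gmodule Q N) = zero Q" "add (restrict_gmodule Q N) = add Q"
  "smult (restrict_gmodule Q N) = smult Q" "component (restrict_gmodule Q N) k = component Q k \<inter> N"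
  by (simp_all add: restrict_gmodule_def)

lemma module_restrict_gmodule: "module R Q \<Longrightarrow> submodule N R Q \<Longrightarrow> module R (restrict_gmodule Q N)"
  by (rule module_restrict) simp_all

lemma restrict_gmodule_minus:
  assumes "module R Q" "submodule N R Q" "x \<in> N" "y \<in> N"
  shows "x \<ominus>\<^bsub>restrict_gmodule Q N\<^esub> y = x \<ominus>\<^bsub>Q\<^esub> y"
proof -
  interpret Q: module R Q by fact
  interpret S: module R "restrict_gmodule Q N" by (rule module_restrict_gmodule) fact+
  have sg: "subgroup N (add_monoid Q)" using assms(2) by (simp add: submodule_def)
  have "\<ominus>\<^bsub>restrict_gmodule Q N\<^esub> y = \<ominus>\<^bsub>Q\<^esub> y"
    using assms(4) Q.subgroup_mem[OF sg] by (intro S.M.minus_equality) (simp_all add: Q.l_neg)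
  then show ?thesis by (simp add: a_minus_def)
qed

lemma finsum_restrict_gmodule:
  assumes "module R Q" "submodule N R Q" "\<And>v. v \<in> A \<Longrightarrow> f v \<in> N"
  shows "finsum (restrict_gmodule Q N) f A = finsum Q f A"
proof -
  interpret Q: module R Q by fact
  interpret S: module R "restrict_gmodule Q N" by (rule module_restrict_gmodule) fact+
  have sg: "subgroup N (add_monoid Q)" using assms(2) by (simp add: submodule_def)
  show ?thesis
    using assms(3)
  proof (induction A rule: infinite_finite_induct)
    case (insert v A)
    have "f \<in> A \<rightarrow> N" "f v \<in> N" "f \<in> A \<rightarrow> carrier Q" "f v \<in> carrier Q"
      using insert.prems Q.subgroup_mem(2)[OF sg] by auto
    with insert show ?case by (simp add: Q.finsum_insert S.finsum_insert)
  qed (simp_all add: Q.M.finsum_infinite S.M.finsum_infinite)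
qed

lemma (in module) submoduleI_diff:
  assumes "subgroup N (add_monoid M)" "\<And>r x. r \<in> carrier R \<Longrightarrow> x \<in> N \<Longrightarrow> r \<odot>\<^bsub>M\<^esub> x \<in> N"
  shows "submodule N R M"
  using assms by (intro submodule.intro) (simp_all add: submodule_axioms_def)

context graded_mod
begin

lemma cech_zero_closed: "\<zero>\<^bsub>cech n j M\<^esub> \<in> carrier (cech n j M)"
  using mk_zero[of j 0] mk_closed by (simp add: tup_def)

lemma cech_diff_zero: "cech_diff n j M \<zero>\<^bsub>cech n j M\<^esub> = \<zero>\<^bsub>cech n (Suc j) M\<^esub>"
proof -
  interpret C: module "mpoly_ring n" "cech n i M" for i by (rule module_cech)
  show ?thesis
    using cech_diff_smult[of 0 "\<zero>\<^bsub>cech n j M\<^esub>" j] C.smult_l_null[of "\<zero>\<^bsub>cech n j M\<^esub>" j]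
      C.smult_l_null[of "cech_diff n j M \<zero>\<^bsub>cech n j M\<^esub>" "Suc j"] cech_diff_closed[of "\<zero>\<^bsub>cech n j M\<^esub>" j] by simp
qed

lemma cech_diff_minus:
  assumes "x \<in> carrier (cech n j M)" "y \<in> carrier (cech n j M)"
  shows "cech_diff n j M (x \<ominus>\<^bsub>cech n j M\<^esub> y) = cech_diff n j M x \<ominus>\<^bsub>cech n (Suc j) M\<^esub> cech_diff n j M y"
proof -
  interpret C: module "mpoly_ring n" "cech n i M" for i by (rule module_cech)
  have "cech_diff n j M (x \<ominus>\<^bsub>cech n j M\<^esub> y) \<oplus>\<^bsub>cech n (Suc j) M\<^esub> cech_diff n j M y = cech_diff n j M x"
    using cech_diff_add[of "x \<ominus>\<^bsub>cech n j M\<^esub> y" j y] assms by (simp add: C.minus_add_cancel)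
  then show ?thesis
    using assms C.minus_add_cancel(3)[of "cech_diff n j M (x \<ominus>\<^bsub>cech n j M\<^esub> y)" "Suc j" "cech_diff n j M y"]
      cech_diff_closed by simp
qed

lemma submodule_cocycles: "submodule (cocycles n j M) (mpoly_ring n) (cech n j M)"
proof -
  interpret C: module "mpoly_ring n" "cech n i M" for i by (rule module_cech)
  show ?thesis
  proof (rule C.submoduleI_diff, rule C.subgroupI_diff)
    show "\<zero>\<^bsub>cech n j M\<^esub> \<in> cocycles n j M" by (simp add: cocycles_def cech_diff_zero)
    show "x \<ominus>\<^bsub>cech n j M\<^esub> y \<in> cocycles n j M" if "x \<in> cocycles n j M" "y \<in> cocycles n j M" for x y
      using that by (simp add: cocycles_def cech_diff_minus)
    show "r \<odot>\<^bsub>cech n j M\<^esub> x \<in> cocycles n j M" if "r \<in> carrier (mpoly_ring n)" "x \<in> cocycles n j M" for r x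
      using that C.smult_r_null[OF that(1)] by (simp add: cocycles_def cech_diff_smult)
  qed (auto simp: cocycles_def)
qed

abbreviation Cz :: "nat \<Rightarrow> ('k mpoly, nat set \<Rightarrow> ('m \<times> nat) set) gmodule" where
  "Cz j \<equiv> restrict_gmodule (cech n j M) (cocycles n j M)"

lemma module_Cz: "module (mpoly_ring n) (Cz j)"
  by (rule module_restrict_gmodule[OF module_cech submodule_cocycles])

lemma Cz_minus: "x \<in> cocycles n j M \<Longrightarrow> y \<in> cocycles n j M \<Longrightarrow> x \<ominus>\<^bsub>Cz j\<^esub> y = x \<ominus>\<^bsub>cech n j M\<^esub> y"
  by (rule restrict_gmodule_minus[OF module_cech submodule_cocycles])

lemma coboundaries_cocycles: "coboundaries n j M \<subseteq> cocycles n j M"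
  by (cases j) (auto simp: cocycles_def cech_diff_zero cech_diff_diff cech_diff_closed cech_zero_closed)

lemma submodule_coboundaries: "submodule (coboundaries n j M) (mpoly_ring n) (Cz j)"
proof -
  interpret C: module "mpoly_ring n" "cech n i M" for i by (rule module_cech)
  interpret Z: module "mpoly_ring n" "Cz i" for i by (rule module_Cz)
  show ?thesis
  proof (rule Z.submoduleI_diff, rule Z.subgroupI_diff)
    show "coboundaries n j M \<subseteq> carrier (Cz j)" using coboundaries_cocycles by simp
    show "\<zero>\<^bsub>Cz j\<^esub> \<in> coboundaries n j M"
      by (cases j) (auto simp: cech_diff_zero[symmetric] intro: imageI cech_zero_closed)
    show "x \<ominus>\<^bsub>Cz j\<^esub> y \<in> coboundaries n j M" if xy: "x \<in> coboundaries n j M" "y \<in> coboundaries n j M" for x y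
    proof -
      have "x \<ominus>\<^bsub>cech n j M\<^esub> y \<in> coboundaries n j M"
        using xy by (cases j) (auto simp: cech_diff_minus[symmetric])
      then show ?thesis using Cz_minus subsetD[OF coboundaries_cocycles] xy by metis
    qed
    show "r \<odot>\<^bsub>Cz j\<^esub> x \<in> coboundaries n j M" if "r \<in> carrier (mpoly_ring n)" "x \<in> coboundaries n j M" for r x
      using that C.smult_r_null[OF that(1)] by (cases j) (auto simp: cech_diff_smult[symmetric])
  qed
qed

abbreviation H :: "nat \<Rightarrow> ('k mpoly, (nat set \<Rightarrow> ('m \<times> nat) set) set) gmodule" where
  "H j \<equiv> local_cohomology n j M"

definition cls :: "nat \<Rightarrow> (nat set \<Rightarrow> ('m \<times> nat) set) \<Rightarrow> (nat set \<Rightarrow> ('m \<times> nat) set) set" where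
  "cls j x = coboundaries n j M +>\<^bsub>Cz j\<^esub> x"

lemma module_H: "module (mpoly_ring n) (H j)"
  unfolding local_cohomology_def by (rule module_quotient[OF module_Cz submodule_coboundaries])

lemma carrier_H: "carrier (H j) = cls j ` cocycles n j M"
  unfolding local_cohomology_def cls_def carrier_quotient[OF module_Cz submodule_coboundaries] by simp

lemma component_H: "component (H j) k = cls j ` (g j k \<inter> cocycles n j M)"
  unfolding local_cohomology_def cls_def component_quotient[OF module_Cz submodule_coboundaries] by simp

lemma cls_add: "x \<in> cocycles n j M \<Longrightarrow> y \<in> cocycles n j M \<Longrightarrow> cls j x \<oplus>\<^bsub>H j\<^esub> cls j y = cls j (x \<oplus>\<^bsub>cech n j M\<^esub> y)"
  unfolding local_cohomology_def cls_def
  using quotient_add[OF module_Cz submodule_coboundaries, of x j y] by simp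

lemma cls_smult: "r \<in> carrier (mpoly_ring n) \<Longrightarrow> x \<in> cocycles n j M \<Longrightarrow> r \<odot>\<^bsub>H j\<^esub> cls j x = cls j (r \<odot>\<^bsub>cech n j M\<^esub> x)"
  unfolding local_cohomology_def cls_def
  using quotient_smult[OF module_Cz submodule_coboundaries, of r x j] by simp

lemma cls_zero: "\<zero>\<^bsub>H j\<^esub> = cls j \<zero>\<^bsub>cech n j M\<^esub>"
  unfolding local_cohomology_def cls_def
  using quotient_zero[OF module_Cz submodule_coboundaries, of j] by simp

lemma cls_eq_iff:
  "x \<in> cocycles n j M \<Longrightarrow> y \<in> cocycles n j M \<Longrightarrow> cls j x = cls j y \<longleftrightarrow> x \<ominus>\<^bsub>cech n j M\<^esub> y \<in> coboundaries n j M"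
  unfolding cls_def using coset_eq_iff[OF module_Cz submodule_coboundaries, of x j y] Cz_minus[of x j y] by simp

lemma cocycles_zero: "\<zero>\<^bsub>cech n j M\<^esub> \<in> cocycles n j M"
  by (simp add: cocycles_def cech_diff_zero cech_zero_closed)

lemma cls_zero_iff: "x \<in> cocycles n j M \<Longrightarrow> cls j x = \<zero>\<^bsub>H j\<^esub> \<longleftrightarrow> x \<in> coboundaries n j M"
proof -
  interpret C: module "mpoly_ring n" "cech n j M" by (rule module_cech)
  show "x \<in> cocycles n j M \<Longrightarrow> cls j x = \<zero>\<^bsub>H j\<^esub> \<longleftrightarrow> x \<in> coboundaries n j M"
    unfolding cls_zero using cls_eq_iff[OF _ cocycles_zero] by (simp add: cocycles_def)
qed

lemma finsum_cls:
  assumes "\<And>l. l \<in> I \<Longrightarrow> x l \<in> cocycles n j M"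
  shows "finsum (cech n j M) x I \<in> cocycles n j M" "finsum (H j) (\<lambda>l. cls j (x l)) I = cls j (finsum (cech n j M) x I)"
proof -
  interpret C: module "mpoly_ring n" "cech n j M" by (rule module_cech)
  interpret H: module "mpoly_ring n" "H j" by (rule module_H)
  note Zm = C.subgroup_mem[of "cocycles n j M"]
  have sg: "subgroup (cocycles n j M) (add_monoid (cech n j M))" using submodule_cocycles by (simp add: submodule_def)
  have "finsum (cech n j M) x I \<in> cocycles n j M \<and> finsum (H j) (\<lambda>l. cls j (x l)) I = cls j (finsum (cech n j M) x I)"
    using assms
  proof (induction I rule: infinite_finite_induct)
    case (insert l I)
    have "x \<in> I \<rightarrow> carrier (cech n j M)" "x l \<in> carrier (cech n j M)"
      "(\<lambda>l. cls j (x l)) \<in> I \<rightarrow> carrier (H j)" "cls j (x l) \<in> carrier (H j)"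
      using insert.prems by (auto simp: carrier_H cocycles_def)
    with insert show ?case
      by (simp add: C.finsum_insert H.finsum_insert cls_add C.subgroup_mem(3)[OF sg])
  qed (simp_all add: cls_zero cocycles_zero C.M.finsum_infinite H.M.finsum_infinite)
  then show "finsum (cech n j M) x I \<in> cocycles n j M"
    "finsum (H j) (\<lambda>l. cls j (x l)) I = cls j (finsum (cech n j M) x I)" by auto
qed

text \<open>Covers degree 0, where the only coboundary is zero, together with the degrees that have
  an incoming differential.\<close>

lemma homogeneous_parts_coboundaries:
  assumes "finite I" "\<And>l. l \<in> I \<Longrightarrow> x l \<in> g j l" "finsum (cech n j M) x I \<in> coboundaries n j M" "l \<in> I"
  shows "case j of 0 \<Rightarrow> x l = \<zero>\<^bsub>cech n j M\<^esub> | Suc i \<Rightarrow> \<exists>e\<in>g i l. x l = cech_diff n i M e"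
proof (cases j)
  case 0
  then show ?thesis using homogeneous_zero_sum[OF assms(1,2) _ assms(4)] assms(3) by simp
next
  case (Suc i)
  then obtain e where "e \<in> carrier (cech n i M)" "finsum (cech n (Suc i) M) x I = cech_diff n i M e"
    using assms(3) by auto
  then show ?thesis using homogeneous_coboundary[OF assms(1) _ _ _ assms(4)] assms(2) Suc by auto
qed

text \<open>If classes of different degrees sum to zero, their cocycles sum to a coboundary, and
  taking homogeneous parts of its primitive makes each of them a coboundary.\<close>

lemma H_independent:
  assumes "finite I" "\<And>l. l \<in> I \<Longrightarrow> h l \<in> component (H j) l" "finsum (H j) h I = \<zero>\<^bsub>H j\<^esub>" "l \<in> I"
  shows "h l = \<zero>\<^bsub>H j\<^esub>"
proof -
  interpret H: module "mpoly_ring n" "H j" by (rule module_H)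
  have "\<exists>x. x \<in> g j l \<and> x \<in> cocycles n j M \<and> h l = cls j x" if "l \<in> I" for l
    using assms(2)[OF that] unfolding component_H by auto
  then obtain x where x: "\<And>l. l \<in> I \<Longrightarrow> x l \<in> g j l \<and> x l \<in> cocycles n j M \<and> h l = cls j (x l)"
    by metis
  have xc: "x l \<in> cocycles n j M" if "l \<in> I" for l using x that by blast
  have "finsum (H j) h I = finsum (H j) (\<lambda>l. cls j (x l)) I"
    using x by (intro H.finsum_cong') (auto simp: carrier_H)
  then have "cls j (finsum (cech n j M) x I) = \<zero>\<^bsub>H j\<^esub>"
    using assms(3) finsum_cls(2)[OF xc, of I] by simp
  then have fb: "finsum (cech n j M) x I \<in> coboundaries n j M"
    using cls_zero_iff[OF finsum_cls(1)[OF xc, of I]] by simp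
  have "x l \<in> coboundaries n j M"
    using homogeneous_parts_coboundaries[OF assms(1) _ fb assms(4)] x g_carrier by (cases j) auto
  then show ?thesis using cls_zero_iff[OF xc[OF assms(4)]] x[OF assms(4)] by simp
qed

text \<open>The identification of \<open>M\<close> with the Cech module in degree 0, the
  localization at the empty product 1.\<close>

definition \<iota> :: "'m \<Rightarrow> nat set \<Rightarrow> ('m \<times> nat) set" where
  "\<iota> u = mk 0 (\<lambda>_. u) 0"

lemma \<iota>_tup: "u \<in> carrier M \<Longrightarrow> (\<lambda>_. u) \<in> tups 0"
  by (simp add: tup_def)

lemma \<iota>_diff: "u \<in> carrier M \<Longrightarrow> w \<in> carrier M \<Longrightarrow> \<iota> (u \<ominus>\<^bsub>M\<^esub> w) = \<iota> u \<ominus>\<^bsub>cech n 0 M\<^esub> \<iota> w"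
  unfolding \<iota>_def by (simp add: mk_diff \<iota>_tup)

lemma \<iota>_smult: "r \<in> carrier (mpoly_ring n) \<Longrightarrow> u \<in> carrier M \<Longrightarrow> \<iota> (r \<odot>\<^bsub>M\<^esub> u) = r \<odot>\<^bsub>cech n 0 M\<^esub> \<iota> u"
  unfolding \<iota>_def by (simp add: mk_smult \<iota>_tup)

lemma \<iota>_g: "u \<in> comp k \<Longrightarrow> \<iota> u \<in> g 0 k"
  unfolding \<iota>_def by (rule mk_g) (simp add: tup_def)

lemma \<iota>_CNs: "submodule N (mpoly_ring n) M \<Longrightarrow> u \<in> carrier M \<Longrightarrow> \<iota> u \<in> CNs N 0 \<longleftrightarrow> u \<in> N"
  unfolding \<iota>_def by (simp add: CNs_iff \<iota>_tup var_subsets_0 var_prod_def)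

lemma \<iota>_inj: "u \<in> carrier M \<Longrightarrow> w \<in> carrier M \<Longrightarrow> \<iota> u = \<iota> w \<longleftrightarrow> u = w"
  unfolding \<iota>_def by (simp add: mk_eq_iff \<iota>_tup var_subsets_0 var_prod_def)

lemma g0E:
  assumes "x \<in> g 0 k"
  obtains u where "u \<in> comp k" "x = \<iota> u"
proof -
  obtain m a where m: "m \<in> tup 0 (comp (k + int (0 * a)))" "x = mk 0 m a" using g_cases[OF assms] .
  have "m {} \<in> comp k" using tupD[OF m(1), of "{}"] by (simp add: var_subsets_0)
  moreover have "x = \<iota> (m {})"
    unfolding m(2) \<iota>_def using mk_eq_iff[OF tup_comp[OF m(1)] \<iota>_tup, of "m {}" a 0] comp_mem(2)[OF \<open>m {} \<in> comp k\<close>]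
    by (simp add: var_subsets_0 var_prod_def)
  ultimately show thesis using that by blast
qed

text \<open>The value at \<open>{v}\<close> is \<open>u / 1\<close>, and extending this fraction by
  \<open>Var v\<close> gives it a numerator in \<open>N\<close>.\<close>

lemma \<iota>_diff_cech:
  assumes N: "submodule N (mpoly_ring n) M" and u: "u \<in> carrier M" "\<And>v. v < n \<Longrightarrow> Var v \<odot>\<^bsub>M\<^esub> u \<in> N"
  shows "cech_diff n 0 M (\<iota> u) \<in> CNs N (Suc 0)"
proof -
  have "var_prod A ^ 1 \<odot>\<^bsub>M\<^esub> bd 0 (\<lambda>_. u) A \<in> N" if A: "A \<in> var_subsets n (Suc 0)" for A
  proof -
    obtain v where v: "A = {v}" "v < n" using A by (auto simp: var_subsets_def card_Suc_eq)
    have "{w \<in> {v}. w < v} = {}" by auto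
    then have "sg {v} v = (1 :: 'k mpoly)" by (simp only: sg_def card.empty power_0)
    then have "bd 0 (\<lambda>_. u) A = u" using u(1) v by (simp add: bd_def M.finsum_insert)
    then show ?thesis using u(2)[OF v(2)] v by (simp add: var_prod_def)
  qed
  then show ?thesis
    unfolding \<iota>_def cech_diff_mk[OF \<iota>_tup[OF u(1)]] CNs_iff[OF N bd_tup[OF \<iota>_tup[OF u(1)]]] by blast
qed

end

lemma (in abelian_group) minus_zero_minus:
  "x \<in> carrier G \<Longrightarrow> y \<in> carrier G \<Longrightarrow> x \<ominus> (\<zero> \<ominus> y) = x \<oplus> y"
  by (simp add: a_minus_def)

section \<open>Socle representatives and their classes in local cohomology\<close>

context buchsbaum_sop
begin

lemma Zc_0: "Zc (\<lambda>_. 0) j k = g j k \<inter> cocycles n j M"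
  unfolding Zc_def CN_zero cocycles_def using g_carrier by auto

text \<open>A homogeneous coboundary has a homogeneous primitive, obtained from
  \<open>homogeneous_parts_coboundaries\<close> for a sum with the single index
  \<open>k\<close>.\<close>

lemma Bc_0: "Bc (\<lambda>_. 0) j k = g j k \<inter> coboundaries n j M"
proof (cases j)
  case 0
  then show ?thesis using CN_zero by simp
next
  case (Suc i)
  have "x \<ominus>\<^bsub>cech n (Suc i) M\<^esub> cech_diff n i M e \<in> {\<zero>\<^bsub>cech n (Suc i) M\<^esub>} \<longleftrightarrow> x = cech_diff n i M e"
    if "x \<in> g (Suc i) k" "e \<in> g i k" for x e
    using that g_carrier cech_diff_closed C.minus_add_cancel(1)[of x "Suc i" "cech_diff n i M e"]
    by (metis C.M.l_zero C.minus_self insertI1 singletonD)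
  then have "Bc (\<lambda>_. 0) j k = {x \<in> g (Suc i) k. \<exists>e\<in>g i k. x = cech_diff n i M e}"
    using Suc CN_zero by auto
  also have "\<dots> = g j k \<inter> coboundaries n j M"
  proof -
    have "\<exists>e\<in>g i k. x = cech_diff n i M e" if x: "x \<in> g j k" "x \<in> coboundaries n j M" for x
    proof -
      have "finsum (cech n j M) (\<lambda>_. x) {k} = x"
        using g_carrier[OF x(1)] by (simp add: C.finsum_insert)
      then show ?thesis
        using homogeneous_parts_coboundaries[of "{k}" "\<lambda>_. x" j k] x Suc by simp
    qed
    then show ?thesis using Suc g_carrier by auto
  qed
  finally show ?thesis .
qed

lemma cls_diff:
  assumes "x \<in> cocycles n j M" "y \<in> cocycles n j M"
  shows "cls j (x \<ominus>\<^bsub>cech n j M\<^esub> y) = cls j x \<ominus>\<^bsub>H j\<^esub> cls j y"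
proof -
  interpret Hj: module "mpoly_ring n" "H j" by (rule module_H)
  have sg: "subgroup (cocycles n j M) (add_monoid (cech n j M))" using submodule_cocycles by (simp add: submodule_def)
  have "cls j (x \<ominus>\<^bsub>cech n j M\<^esub> y) \<oplus>\<^bsub>H j\<^esub> cls j y = cls j x"
    using assms C.subgroup_mem[OF sg] by (simp add: cls_add C.minus_add_cancel)
  moreover have "cls j (x \<ominus>\<^bsub>cech n j M\<^esub> y) \<in> carrier (H j)" "cls j y \<in> carrier (H j)"
    using assms C.subgroup_mem[OF sg] by (auto simp: carrier_H)
  ultimately show ?thesis using Hj.minus_add_cancel(3) by metis
qed

abbreviation NN :: "'m set" where "NN \<equiv> Nb \<theta> d full"

text \<open>The iterated connecting homomorphism over the base \<open>\<lambda>_. 0\<close>, read as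
  a relation between \<open>M\<close> in degree \<open>k\<close> and the local cohomology of
  \<open>M\<close> in degree \<open>k - length F\<close>.\<close>

definition rho :: "nat list \<Rightarrow> int \<Rightarrow> 'm \<Rightarrow> (nat set \<Rightarrow> ('m \<times> nat) set) set \<Rightarrow> bool" where
  "rho F k u h \<longleftrightarrow> u \<in> comp k \<and> (\<exists>x. rel F (\<lambda>_. 0) k (\<iota> u) x \<and> h = cls (length F) x)"

context
  fixes F assumes F: "distinct F" "set F \<subseteq> {..<d}"
begin

lemma adm: "admissible F (\<lambda>_. 0)"
  by (rule admissible_0[OF F])

lemma rel_cocycle: "rel F (\<lambda>_. 0) k u x \<Longrightarrow> x \<in> g (length F) (k - int (length F)) \<and> x \<in> cocycles n (length F) M"
  using rel_Zc2[OF adm] Zc_0 by blast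

lemma rho_comp: "rho F k u h \<Longrightarrow> u \<in> comp k" "rho F k u h \<Longrightarrow> h \<in> component (H (length F)) (k - int (length F))"
  using rel_cocycle by (auto simp: rho_def component_H)

lemma rho_carrier: "rho F k u h \<Longrightarrow> u \<in> carrier M" "rho F k u h \<Longrightarrow> h \<in> carrier (H (length F))"
proof -
  show "rho F k u h \<Longrightarrow> u \<in> carrier M" by (rule comp_mem(2)[OF rho_comp(1)])
  show "rho F k u h \<Longrightarrow> h \<in> carrier (H (length F))"
    using rho_comp(2)[of k u h] unfolding component_H carrier_H by blast
qed

lemma rho_Zc: "rho F k u h \<Longrightarrow> \<iota> u \<in> Zc (upd (\<lambda>_. 0) F) 0 k"
  using rel_Zc1[OF adm] by (auto simp: rho_def)

lemma rho_exists: "u \<in> comp k \<Longrightarrow> \<iota> u \<in> Zc (upd (\<lambda>_. 0) F) 0 k \<Longrightarrow> \<exists>h. rho F k u h"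
  using rel_exists[OF adm] by (auto simp: rho_def)

lemma rho_diff:
  assumes "rho F k u h" "rho F k u' h'"
  shows "rho F k (u \<ominus>\<^bsub>M\<^esub> u') (h \<ominus>\<^bsub>H (length F)\<^esub> h')"
proof -
  obtain x x' where x: "rel F (\<lambda>_. 0) k (\<iota> u) x" "h = cls (length F) x"
      "rel F (\<lambda>_. 0) k (\<iota> u') x'" "h' = cls (length F) x'" "u \<in> comp k" "u' \<in> comp k"
    using assms by (auto simp: rho_def)
  then show ?thesis
    using rel_diff[OF adm x(1,3)] rel_cocycle[OF x(1)] rel_cocycle[OF x(3)] comp_mem(2)
    by (auto simp: rho_def cls_diff \<iota>_diff intro: comp_mem(5))
qed

lemma rho_smult:
  assumes "rho F k u h" "r \<in> shifts e" "homogeneous i r" "e = int i"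
  shows "rho F (k + e) (r \<odot>\<^bsub>M\<^esub> u) (r \<odot>\<^bsub>H (length F)\<^esub> h)"
proof -
  obtain x where x: "rel F (\<lambda>_. 0) k (\<iota> u) x" "h = cls (length F) x" "u \<in> comp k"
    using assms by (auto simp: rho_def)
  have r: "r \<in> carrier (mpoly_ring n)" using assms(2) by (rule shifts_closed)
  show ?thesis
    using rel_smult[OF adm x(1) assms(2)] rel_cocycle[OF x(1)] x(2,3) r comp_mem(2)[OF x(3)] comp_smult[OF assms(3) r x(3)] assms(4)
    by (auto simp: rho_def cls_smult \<iota>_smult)
qed

lemma rho_CN:
  assumes "u \<in> comp k" "\<iota> u \<in> CNs (Nb \<theta> d (upd (\<lambda>_. 0) F)) 0"
  shows "rho F k u \<zero>\<^bsub>H (length F)\<^esub>"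
proof -
  have "\<iota> u \<in> Zc (upd (\<lambda>_. 0) F) 0 k" using \<iota>_g[OF assms(1)] D_CN[OF assms(2)] by (simp add: Zc_def)
  then obtain x where x: "rel F (\<lambda>_. 0) k (\<iota> u) x" using rel_exists[OF adm] by blast
  then have "x \<in> coboundaries n (length F) M"
    using rel_CN[OF adm x assms(2)] unfolding Bc_0 by blast
  then show ?thesis using x assms(1) rel_cocycle[OF x] cls_zero_iff by (auto simp: rho_def)
qed

lemma rho_zero: "rho F k \<zero>\<^bsub>M\<^esub> \<zero>\<^bsub>H (length F)\<^esub>"
  using \<iota>_CNs[OF Nb_submodule M.zero_closed] N_mem(1)[OF Nb_submodule] by (intro rho_CN comp_mem(1)) blast

text \<open>Sums arise from differences as \<open>u - (0 - u')\<close>, since closure is recorded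
  for differences.\<close>

lemma rho_add:
  assumes "rho F k u h" "rho F k u' h'"
  shows "rho F k (u \<oplus>\<^bsub>M\<^esub> u') (h \<oplus>\<^bsub>H (length F)\<^esub> h')"
proof -
  interpret Hj: module "mpoly_ring n" "H (length F)" by (rule module_H)
  show ?thesis
    using rho_diff[OF assms(1) rho_diff[OF rho_zero assms(2)]] rho_carrier[OF assms(1)] rho_carrier[OF assms(2)]
    by (simp add: M.minus_zero_minus Hj.minus_zero_minus)
qed

lemma rho_Const: "rho F k u h \<Longrightarrow> rho F k (Const c \<odot>\<^bsub>M\<^esub> u) (Const c \<odot>\<^bsub>H (length F)\<^esub> h)"
proof -
  have "Const c \<in> shifts (int 0)" by (rule homogeneous_shifts[OF homogeneous_Const Const_closed])
  then show "rho F k u h \<Longrightarrow> rho F k (Const c \<odot>\<^bsub>M\<^esub> u) (Const c \<odot>\<^bsub>H (length F)\<^esub> h)"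
    using rho_smult[of k u h "Const c" "int 0" 0, OF _ _ homogeneous_Const] by simp
qed

text \<open>A class that becomes invisible after dividing out the remaining parameters is zero, by
  the injectivity behind \<open>rel_dying\<close>.\<close>

lemma rho_dying: "rho F k u h \<Longrightarrow> \<iota> u \<in> dying F k \<Longrightarrow> h = \<zero>\<^bsub>H (length F)\<^esub>"
  using rel_dying[OF F] rel_cocycle cls_zero_iff unfolding rho_def Bc_0 by blast

lemma rho_surj:
  assumes "length F < d" "h \<in> component (H (length F)) (k - int (length F))"
  shows "\<exists>u. rho F k u h"
proof -
  obtain x where x: "x \<in> Zc (\<lambda>_. 0) (length F) (k - int (length F))" "h = cls (length F) x"
    using assms(2) unfolding component_H Zc_0 by auto
  have "card (supp (\<lambda>_. 0)) + length F < d" using assms(1) by (simp add: supp_def)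
  from rel_surj[OF adm this x(1)] obtain w y where wy: "rel F (\<lambda>_. 0) k w y"
      "x \<ominus>\<^bsub>cech n (length F) M\<^esub> y \<in> coboundaries n (length F) M"
    unfolding Bc_0 by blast
  have "w \<in> g 0 k" using rel_Zc1[OF adm wy(1)] by (simp add: Zc_def)
  then obtain u where u: "u \<in> comp k" "w = \<iota> u" by (rule g0E)
  have "cls (length F) y = h"
    using x(2) wy(2) cls_eq_iff[of x "length F" y] x(1) rel_cocycle[OF wy(1)] unfolding Zc_0 by blast
  then show ?thesis using u wy(1) by (auto simp: rho_def)
qed

lemma Nb_full: "u \<in> carrier M \<Longrightarrow> \<iota> u \<in> CNs (Nb \<theta> d (upd (\<lambda>_. 0) F)) 0 \<Longrightarrow> u \<in> NN"
proof -
  let ?K = "filter (\<lambda>l. l \<notin> set F) [0..<d]"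
  have "admissible ?K (upd (\<lambda>_. 0) F)" by (intro admissible_upd admissible_0) auto
  moreover have "upd (upd (\<lambda>_. 0) F) ?K = full" using F by (auto simp: upd_def full_def fun_eq_iff)
  ultimately have "CNs (Nb \<theta> d (upd (\<lambda>_. 0) F)) 0 \<subseteq> CNs NN 0" using CN_upd by metis
  then show "u \<in> carrier M \<Longrightarrow> \<iota> u \<in> CNs (Nb \<theta> d (upd (\<lambda>_. 0) F)) 0 \<Longrightarrow> u \<in> NN"
    using \<iota>_CNs[OF Nb_submodule] by blast
qed

lemma rho_ker:
  assumes "length F \<le> d" "rho F k u \<zero>\<^bsub>H (length F)\<^esub>" and I: "subgroup I (add_monoid M)"
    and 1: "\<And>w. w \<in> comp k \<Longrightarrow> w \<in> NN \<Longrightarrow> w \<in> I"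
    and 2: "\<And>w i. i \<in> set F \<Longrightarrow> w \<in> comp k \<Longrightarrow> \<iota> w \<in> Zc (upd (\<lambda>_. 0) (removeAll i F)) 0 k \<Longrightarrow> w \<in> I"
  shows "u \<in> I"
proof -
  obtain x where x: "rel F (\<lambda>_. 0) k (\<iota> u) x" "u \<in> comp k" "cls (length F) x = \<zero>\<^bsub>H (length F)\<^esub>"
    using assms(2) by (auto simp: rho_def)
  have xB: "x \<in> Bc (\<lambda>_. 0) (length F) (k - int (length F))"
    unfolding Bc_0 using rel_cocycle[OF x(1)] x(3) cls_zero_iff by blast
  have Ic: "w \<in> carrier M" if "w \<in> I" for w using M.subgroup_mem(2)[OF I that] .
  \<comment> \<open>Transports \<open>I\<close> to cochains of degree 0, where
    \<open>rel_ker\<close> is stated.\<close>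
  have sub: "subgroup (\<iota> ` I) (add_monoid (cech n 0 M))"
  proof (rule C.subgroupI_diff)
    show "\<iota> ` I \<subseteq> carrier (cech n 0 M)" using Ic mk_closed[OF \<iota>_tup] by (auto simp: \<iota>_def)
    show "\<zero>\<^bsub>cech n 0 M\<^esub> \<in> \<iota> ` I"
      using M.subgroup_mem(1)[OF I] mk_zero[of 0 0] by (auto simp: \<iota>_def)
    fix a b assume "a \<in> \<iota> ` I" "b \<in> \<iota> ` I"
    then obtain a' b' where ab: "a' \<in> I" "b' \<in> I" "a = \<iota> a'" "b = \<iota> b'" by auto
    then show "a \<ominus>\<^bsub>cech n 0 M\<^esub> b \<in> \<iota> ` I"
      using \<iota>_diff[OF Ic Ic, OF ab(1,2)] M.subgroup_mem(5)[OF I ab(1,2)] by (metis imageI)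
  qed
  have "\<iota> u \<in> \<iota> ` I"
  proof (rule rel_ker[OF adm _ x(1) xB sub])
    show "card (supp (\<lambda>_. 0)) + length F \<le> d" using assms(1) by (simp add: supp_def)
    show "g 0 k \<inter> CNs (Nb \<theta> d (upd (\<lambda>_. 0) F)) 0 \<subseteq> \<iota> ` I"
      using 1 Nb_full comp_mem(2) by (blast elim: g0E)
    show "Zc (upd (\<lambda>_. 0) (removeAll i F)) 0 k \<subseteq> \<iota> ` I" if i: "i \<in> set F" for i
    proof
      fix y assume y: "y \<in> Zc (upd (\<lambda>_. 0) (removeAll i F)) 0 k"
      then have "y \<in> g 0 k" by (simp add: Zc_def)
      then obtain w where "w \<in> comp k" "y = \<iota> w" by (rule g0E)
      then show "y \<in> \<iota> ` I" using 2[OF i] y by blast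
    qed
  qed
  then obtain w where "w \<in> I" "\<iota> u = \<iota> w" by auto
  then show ?thesis using \<iota>_inj[of u w] comp_mem(2)[OF x(2)] Ic by simp
qed

lemma Zc_irrelevant:
  assumes "length F < d" "u \<in> comp k" "\<iota> u \<in> Zc (upd (\<lambda>_. 0) F) 0 k" "p \<in> irrelevant_ideal n"
  shows "p \<odot>\<^bsub>M\<^esub> u \<in> NN"
proof -
  let ?b = "upd (\<lambda>_. 0) F"
  have "card (supp ?b) < d"
    using card_supp_upds[OF adm] assms(1) by (simp add: supp_def)
  then obtain i where i: "i < d" "unused d ?b i" using supp_free by blast
  have u: "u \<in> carrier M" using assms(2) by (rule comp_mem)
  obtain s :: nat where s: "(\<theta> i [^]\<^bsub>mpoly_ring n\<^esub> s) \<odot>\<^bsub>cech n 0 M\<^esub> \<iota> u \<in> Bc ?b 0 (k + int s)"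
    using nilpotent[OF assms(3) i(1)] by blast
  then have "\<iota> (\<theta> i ^ s \<odot>\<^bsub>M\<^esub> u) \<in> CNs (Nb \<theta> d ?b) 0"
    using \<theta>_carrier[OF i(1)] u by (simp add: \<iota>_smult)
  then have "\<theta> i ^ s \<odot>\<^bsub>M\<^esub> u \<in> Nb \<theta> d ?b"
    using \<iota>_CNs[OF Nb_submodule] \<theta>_carrier[OF i(1)] u by simp
  \<comment> \<open>The exponent has to be positive before \<open>weak\<close> applies.\<close>
  then have "\<theta> i ^ Suc s \<odot>\<^bsub>M\<^esub> u \<in> Nb \<theta> d ?b"
    using N_smult[OF Nb_submodule \<theta>_carrier[OF i(1)]] \<theta>_carrier[OF i(1)] u by (simp add: smult_mult)
  from weak[OF i(2) _ u this assms(4)] have "p \<odot>\<^bsub>M\<^esub> u \<in> Nb \<theta> d ?b" by simp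
  then show ?thesis
    using Nb_full \<iota>_CNs[OF Nb_submodule] u irrelevant_closed[OF assms(4)] by simp
qed

end

lemma Zc_full:
  assumes "u \<in> comp k" "\<And>v. v < n \<Longrightarrow> Var v \<odot>\<^bsub>M\<^esub> u \<in> NN"
  shows "\<iota> u \<in> Zc full 0 k"
  using \<iota>_g[OF assms(1)] \<iota>_diff_cech[OF Nb_submodule comp_mem(2)[OF assms(1)] assms(2)] by (simp add: Zc_def)

lemma irr_closed: "(p :: 'k mpoly) \<in> irrelevant_ideal n \<Longrightarrow> p \<in> carrier (mpoly_ring n)"
  by (rule irrelevant_closed)

text \<open>Representatives in \<open>M\<close> of the degree \<open>k\<close> part of the socle of
  the quotient by all parameters.\<close>

definition Soc :: "int \<Rightarrow> 'm set" where
  "Soc k = {u \<in> comp k. \<forall>p\<in>irrelevant_ideal n. p \<odot>\<^bsub>M\<^esub> u \<in> NN}"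

lemma Soc_sub: "subgroup (Soc k) (add_monoid M)"
proof (rule M.subgroupI_diff)
  show "Soc k \<subseteq> carrier M" using comp_mem(2) by (auto simp: Soc_def)
  show "\<zero>\<^bsub>M\<^esub> \<in> Soc k"
    unfolding Soc_def using comp_mem(1) N_mem(1)[OF Nb_submodule] smult_zero[OF irrelevant_closed] by simp
  show "x \<ominus>\<^bsub>M\<^esub> y \<in> Soc k" if "x \<in> Soc k" "y \<in> Soc k" for x y
    using that irr_closed comp_mem(2) N_mem(5)[OF Nb_submodule]
    by (auto simp: Soc_def smult_r_diff intro: comp_mem(5))
qed

lemma Soc_Const: "u \<in> Soc k \<Longrightarrow> Const c \<odot>\<^bsub>M\<^esub> u \<in> Soc k"
  using comp_smult[OF homogeneous_Const Const_closed, of u k c] irr_closed comp_mem(2)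
    N_smult[OF Nb_submodule Const_closed] by (auto simp: Soc_def smult_left_comm[of _ "Const c"])

lemma Soc_Zc: "u \<in> Soc k \<Longrightarrow> \<iota> u \<in> Zc full 0 k"
  by (rule Zc_full) (auto simp: Soc_def intro: Var_irrelevant)

abbreviation rhoF :: "int \<Rightarrow> 'm \<Rightarrow> (nat set \<Rightarrow> ('m \<times> nat) set) set \<Rightarrow> bool" where
  "rhoF \<equiv> rho [0..<d]"

lemma dF: "distinct [0..<d]" "set [0..<d] \<subseteq> {..<d}"
  by auto

text \<open>The polynomials killing \<open>y\<close> form an ideal, so the variables
  suffice.\<close>

lemma annihilator_ideal:
  assumes "module (mpoly_ring n) Q" "y \<in> carrier Q" "\<And>v. v < n \<Longrightarrow> Var v \<odot>\<^bsub>Q\<^esub> y = \<zero>\<^bsub>Q\<^esub>" "p \<in> irrelevant_ideal n"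
  shows "p \<odot>\<^bsub>Q\<^esub> y = \<zero>\<^bsub>Q\<^esub>"
proof -
  interpret Q: module "mpoly_ring n" Q by fact
  interpret P: cring "mpoly_ring n" by (rule cring_mpoly_ring)
  let ?I = "{p \<in> carrier (mpoly_ring n). p \<odot>\<^bsub>Q\<^esub> y = \<zero>\<^bsub>Q\<^esub>}"
  have "ideal ?I (mpoly_ring n)"
  proof (rule idealI)
    show "ring (mpoly_ring n)" by (rule P.ring_axioms)
    show "subgroup ?I (add_monoid (mpoly_ring n))"
      using assms(2) Q.smult_l_null[OF assms(2)] Q.smult_l_minus[OF _ assms(2)] Q.smult_l_distr[OF _ _ assms(2)]
      by (intro P.add.subgroupI) (auto simp: a_inv_def[symmetric])
    show "x \<otimes>\<^bsub>mpoly_ring n\<^esub> a \<in> ?I" "a \<otimes>\<^bsub>mpoly_ring n\<^esub> x \<in> ?I" if "a \<in> ?I" "x \<in> carrier (mpoly_ring n)" for a x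
      using that Q.smult_assoc1[of x a y] Q.smult_assoc1[of a x y] Q.smult_left_comm[of a x y] assms(2) Q.smult_r_null[of x] by auto
  qed
  then have "irrelevant_ideal n \<subseteq> ?I" using assms(3) by (intro irrelevant_subset) auto
  then show ?thesis using assms(4) by blast
qed

text \<open>Multiplying \<open>u\<close> by a variable gives an element of \<open>NN\<close>, whose
  class is zero, and the relation is compatible with multiplication by variables.\<close>

lemma rhoF_socle:
  assumes "rhoF k u h" "u \<in> Soc k" "p \<in> irrelevant_ideal n"
  shows "p \<odot>\<^bsub>H d\<^esub> h = \<zero>\<^bsub>H d\<^esub>"
proof (rule annihilator_ideal[OF module_H _ _ assms(3)])
  show "h \<in> carrier (H d)" using rho_carrier(2)[OF dF assms(1)] by simp
  fix v assume v: "v < n"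
  have r: "rhoF (k + 1) (Var v \<odot>\<^bsub>M\<^esub> u) (Var v \<odot>\<^bsub>H d\<^esub> h)"
    using rho_smult[OF dF assms(1) Var_shifts[OF v] homogeneous_Var] by simp
  have "Var v \<odot>\<^bsub>M\<^esub> u \<in> NN" using assms(2) Var_irrelevant[OF v] by (auto simp: Soc_def)
  then have "\<iota> (Var v \<odot>\<^bsub>M\<^esub> u) \<in> dying [0..<d] (k + 1)"
    using CN_dying[OF dF, of "k + 1"] \<iota>_g[OF rho_comp(1)[OF dF r]] \<iota>_CNs[OF Nb_submodule rho_carrier(1)[OF dF r]] by blast
  then show "Var v \<odot>\<^bsub>H d\<^esub> h = \<zero>\<^bsub>H d\<^esub>" using rho_dying[OF dF r] by simp
qed

text \<open>The degree \<open>l\<close> part of the submodule of the theorem;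
  \<open>l + int d\<close> compensates the degrees lost in \<open>d\<close> connecting
  homomorphisms.\<close>

definition SS :: "int \<Rightarrow> (nat set \<Rightarrow> ('m \<times> nat) set) set set" where
  "SS l = {h. \<exists>u\<in>Soc (l + int d). rhoF (l + int d) u h}"

lemma SS_component: "SS l \<subseteq> component (H d) l"
  using rho_comp(2)[OF dF] unfolding SS_def by fastforce

lemma SS_sub: "subgroup (SS l) (add_monoid (H d))"
proof -
  interpret Hd: module "mpoly_ring n" "H d" by (rule module_H)
  show ?thesis
  proof (rule Hd.subgroupI_diff)
    show "SS l \<subseteq> carrier (H d)" using rho_carrier(2)[OF dF] unfolding SS_def by fastforce
    show "\<zero>\<^bsub>H d\<^esub> \<in> SS l"
      using rho_zero[OF dF] M.subgroup_mem(1)[OF Soc_sub] unfolding SS_def by fastforce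
    show "x \<ominus>\<^bsub>H d\<^esub> y \<in> SS l" if "x \<in> SS l" "y \<in> SS l" for x y
      using that rho_diff[OF dF] M.subgroup_mem(5)[OF Soc_sub] unfolding SS_def by fastforce
  qed
qed

lemma SS_socle: "h \<in> SS l \<Longrightarrow> p \<in> irrelevant_ideal n \<Longrightarrow> p \<odot>\<^bsub>H d\<^esub> h = \<zero>\<^bsub>H d\<^esub>"
  using rhoF_socle by (auto simp: SS_def)

lemma SS_Const: "h \<in> SS l \<Longrightarrow> Const c \<odot>\<^bsub>H d\<^esub> h \<in> SS l"
  using rho_Const[OF dF] Soc_Const by (fastforce simp: SS_def)

end

section \<open>Homogeneous components as vector spaces\<close>

lemma module_component_space:
  fixes Q :: "('k::field mpoly, 'b, 'c) gmodule_scheme"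
  assumes "module (mpoly_ring n) Q" "subgroup (component Q k) (add_monoid Q)"
    and Const: "\<And>c x. x \<in> component Q k \<Longrightarrow> Const c \<odot>\<^bsub>Q\<^esub> x \<in> component Q k"
  shows "module field_ring (component_space Q k)"
proof -
  interpret Q: module "mpoly_ring n" Q by fact
  note m = Q.subgroup_mem[OF assms(2)]
  have sm: "Const (a * b) \<odot>\<^bsub>Q\<^esub> x = Const a \<odot>\<^bsub>Q\<^esub> (Const b \<odot>\<^bsub>Q\<^esub> x)"
    "Const (a + b) \<odot>\<^bsub>Q\<^esub> x = Const a \<odot>\<^bsub>Q\<^esub> x \<oplus>\<^bsub>Q\<^esub> Const b \<odot>\<^bsub>Q\<^esub> x" "Const 1 \<odot>\<^bsub>Q\<^esub> x = x"
    if "x \<in> component Q k" for a b x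
    using m(2)[OF that] Q.smult_assoc1[of "Const a" "Const b" x] Q.smult_l_distr[of "Const a" "Const b" x]
      Q.smult_one[of x] by (simp_all add: Const_simps)
  show ?thesis
  proof (rule moduleI[OF cring_field_ring])
    show "abelian_group (component_space Q k)"
    proof (rule abelian_groupI)
      fix x assume x: "x \<in> carrier (component_space Q k)"
      then show "\<exists>y\<in>carrier (component_space Q k). y \<oplus>\<^bsub>component_space Q k\<^esub> x = \<zero>\<^bsub>component_space Q k\<^esub>"
        using m by (auto simp: component_space_def Q.l_neg intro!: bexI[of _ "\<ominus>\<^bsub>Q\<^esub> x"])
    qed (use m in \<open>auto simp: component_space_def Q.M.a_ac\<close>)
  qed (use m sm Const in \<open>auto simp: component_space_def intro!: Q.smult_r_distr\<close>)
qed

text \<open>The natural linear map goes from the direct sum to the socle, opposite to the direction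
  in which the isomorphism is claimed.\<close>

lemma module_iso_inverse:
  assumes bij: "bij_betw f (carrier W) (carrier V)"
    and add: "\<And>x y. x \<in> carrier W \<Longrightarrow> y \<in> carrier W \<Longrightarrow> x \<oplus>\<^bsub>W\<^esub> y \<in> carrier W \<and> f (x \<oplus>\<^bsub>W\<^esub> y) = f x \<oplus>\<^bsub>V\<^esub> f y"
    and smult: "\<And>r x. r \<in> carrier R \<Longrightarrow> x \<in> carrier W \<Longrightarrow> r \<odot>\<^bsub>W\<^esub> x \<in> carrier W \<and> f (r \<odot>\<^bsub>W\<^esub> x) = r \<odot>\<^bsub>V\<^esub> f x"
  shows "module_iso R V W"
  unfolding module_iso_def
proof (intro exI conjI ballI)
  let ?g = "inv_into (carrier W) f"
  show "bij_betw ?g (carrier V) (carrier W)" using bij by (rule bij_betw_inv_into)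
  have gf: "?g (f x) = x" if "x \<in> carrier W" for x using bij_betw_inv_into_left[OF bij that] .
  have mem: "\<exists>a\<in>carrier W. x = f a" if "x \<in> carrier V" for x using bij that by (auto simp: bij_betw_def)
  show "?g (x \<oplus>\<^bsub>V\<^esub> y) = ?g x \<oplus>\<^bsub>W\<^esub> ?g y" if xy: "x \<in> carrier V" "y \<in> carrier V" for x y
  proof -
    obtain a b where ab: "a \<in> carrier W" "x = f a" "b \<in> carrier W" "y = f b" using mem xy by metis
    then have "x \<oplus>\<^bsub>V\<^esub> y = f (a \<oplus>\<^bsub>W\<^esub> b)" "a \<oplus>\<^bsub>W\<^esub> b \<in> carrier W" using add by auto
    then show ?thesis using gf ab by simp
  qed
  show "?g (r \<odot>\<^bsub>V\<^esub> x) = r \<odot>\<^bsub>W\<^esub> ?g x" if rx: "r \<in> carrier R" "x \<in> carrier V" for r x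
  proof -
    obtain a where a: "a \<in> carrier W" "x = f a" using mem rx by metis
    then have "r \<odot>\<^bsub>V\<^esub> x = f (r \<odot>\<^bsub>W\<^esub> a)" "r \<odot>\<^bsub>W\<^esub> a \<in> carrier W" using smult rx(1) by auto
    then show ?thesis using gf a by simp
  qed
qed

lemma (in graded_mod) component_H_sub: "subgroup (component (H j) l) (add_monoid (H j))"
proof -
  interpret Hj: module "mpoly_ring n" "H j" by (rule module_H)
  interpret C: module "mpoly_ring n" "cech n j M" by (rule module_cech)
  have sg: "subgroup (cocycles n j M) (add_monoid (cech n j M))" using submodule_cocycles by (simp add: submodule_def)
  note gm = C.subgroup_mem[OF subgroup_g] and zm = C.subgroup_mem[OF sg]
  have diff: "cls j x \<ominus>\<^bsub>H j\<^esub> cls j y = cls j (x \<ominus>\<^bsub>cech n j M\<^esub> y)" if xy: "x \<in> cocycles n j M" "y \<in> cocycles n j M" for x y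
  proof -
    have "cls j (x \<ominus>\<^bsub>cech n j M\<^esub> y) \<oplus>\<^bsub>H j\<^esub> cls j y = cls j x"
      using xy zm by (simp add: cls_add C.minus_add_cancel)
    moreover have "cls j (x \<ominus>\<^bsub>cech n j M\<^esub> y) \<in> carrier (H j)" "cls j y \<in> carrier (H j)"
      using xy zm by (auto simp: carrier_H)
    ultimately show ?thesis using Hj.minus_add_cancel(3) by metis
  qed
  show ?thesis
  proof (rule Hj.subgroupI_diff)
    show "component (H j) l \<subseteq> carrier (H j)" by (auto simp: component_H carrier_H)
    show "\<zero>\<^bsub>H j\<^esub> \<in> component (H j) l"
      unfolding component_H cls_zero using gm(1) zm(1) by blast
    show "x \<ominus>\<^bsub>H j\<^esub> y \<in> component (H j) l" if "x \<in> component (H j) l" "y \<in> component (H j) l" for x y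
      using that diff gm(5) zm(5) unfolding component_H by (auto intro!: imageI)
  qed
qed

lemma (in graded_mod) component_H_Const: "x \<in> component (H j) l \<Longrightarrow> Const c \<odot>\<^bsub>H j\<^esub> x \<in> component (H j) l"
proof -
  assume "x \<in> component (H j) l"
  then obtain y where y: "y \<in> g j l" "y \<in> cocycles n j M" "x = cls j y" by (auto simp: component_H)
  have "Const c \<odot>\<^bsub>cech n j M\<^esub> y \<in> g j l"
    using g_smult[OF homogeneous_Const Const_closed y(1)] by simp
  moreover have "Const c \<odot>\<^bsub>cech n j M\<^esub> y \<in> cocycles n j M"
    using submodule.smult_closed[OF submodule_cocycles Const_closed y(2)] .
  ultimately show ?thesis
    unfolding y(3) cls_smult[OF Const_closed y(2)] component_H by blast
qed

section \<open>The graded submodule of the socle in top degree\<close>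

context buchsbaum_sop
begin

definition SocH :: "(nat set \<Rightarrow> ('m \<times> nat) set) set set" where
  "SocH = {y \<in> carrier (H d). \<forall>p\<in>irrelevant_ideal n. p \<odot>\<^bsub>H d\<^esub> y = \<zero>\<^bsub>H d\<^esub>}"

lemma socle_H: "socle n (H d) = restrict_gmodule (H d) SocH"
  by (simp add: socle_def SocH_def)

text \<open>The direct sum of the spaces \<open>SS l\<close>. Families are indexed by all degrees
  and vanish off a finite set, so two of them can be subtracted over the union of their index
  sets.\<close>

definition SU :: "(nat set \<Rightarrow> ('m \<times> nat) set) set set" where
  "SU = {finsum (H d) f I | f I. finite I \<and> (\<forall>l. f l \<in> SS l) \<and> (\<forall>l. l \<notin> I \<longrightarrow> f l = \<zero>\<^bsub>H d\<^esub>)}"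

interpretation Hd: module "mpoly_ring n" "H d" by (rule module_H)

lemmas SS_mem = Hd.subgroup_mem[OF SS_sub]

lemma finsum_SS_extend:
  assumes "finite K" "I \<subseteq> K" "\<And>l. f l \<in> SS l" "\<And>l. l \<notin> I \<Longrightarrow> f l = \<zero>\<^bsub>H d\<^esub>"
  shows "finsum (H d) f I = finsum (H d) f K"
  by (rule Hd.M.add.finprod_mono_neutral_cong_left[OF assms(1,2)]) (use assms(4) SS_mem(2)[OF assms(3)] in auto)

lemma SUE:
  assumes "x \<in> SU"
  obtains f I where "finite I" "\<And>l. f l \<in> SS l" "\<And>l. l \<notin> I \<Longrightarrow> f l = \<zero>\<^bsub>H d\<^esub>" "x = finsum (H d) f I"
  using assms unfolding SU_def by blast

lemma finsum_SS_diff: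
  assumes "\<And>l. f l \<in> SS l" "\<And>l. f' l \<in> SS l"
  shows "finsum (H d) f K \<ominus>\<^bsub>H d\<^esub> finsum (H d) f' K = finsum (H d) (\<lambda>l. f l \<ominus>\<^bsub>H d\<^esub> f' l) K"
proof -
  have c: "f \<in> K \<rightarrow> carrier (H d)" "f' \<in> K \<rightarrow> carrier (H d)" "(\<lambda>l. f l \<ominus>\<^bsub>H d\<^esub> f' l) \<in> K \<rightarrow> carrier (H d)"
    using SS_mem(2)[OF assms(1)] SS_mem(2)[OF assms(2)] by auto
  have "finsum (H d) (\<lambda>l. f l \<ominus>\<^bsub>H d\<^esub> f' l) K \<oplus>\<^bsub>H d\<^esub> finsum (H d) f' K = finsum (H d) f K"
    unfolding Hd.finsum_addf[OF c(3,2), symmetric] using c SS_mem(2)[OF assms(1)] SS_mem(2)[OF assms(2)]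
    by (intro Hd.finsum_cong') (auto intro!: Hd.minus_add_cancel)
  then show ?thesis
    using Hd.minus_add_cancel(3)[OF Hd.finsum_closed[OF c(3)] Hd.finsum_closed[OF c(2)]] by simp
qed

lemma SU_sub: "subgroup SU (add_monoid (H d))"
proof (rule Hd.subgroupI_diff)
  show "SU \<subseteq> carrier (H d)"
    using SS_mem(2) by (auto simp: SU_def intro!: Hd.finsum_closed)
  show "\<zero>\<^bsub>H d\<^esub> \<in> SU"
    unfolding SU_def using SS_mem(1) by (auto intro!: exI[of _ "\<lambda>_. \<zero>\<^bsub>H d\<^esub>"])
  fix x y assume "x \<in> SU" "y \<in> SU"
  then obtain f I f' I' where f: "finite I" "\<And>l. f l \<in> SS l" "\<And>l. l \<notin> I \<Longrightarrow> f l = \<zero>\<^bsub>H d\<^esub>" "x = finsum (H d) f I"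
    "finite I'" "\<And>l. f' l \<in> SS l" "\<And>l. l \<notin> I' \<Longrightarrow> f' l = \<zero>\<^bsub>H d\<^esub>" "y = finsum (H d) f' I'"
    by (metis SUE)
  have "x = finsum (H d) f (I \<union> I')" "y = finsum (H d) f' (I \<union> I')"
    unfolding f(4,8) using f(1,5) by (intro finsum_SS_extend f(2,3,6,7); simp)+
  then have "x \<ominus>\<^bsub>H d\<^esub> y = finsum (H d) (\<lambda>l. f l \<ominus>\<^bsub>H d\<^esub> f' l) (I \<union> I')"
    using finsum_SS_diff[of f f' "I \<union> I'"] f by simp
  then show "x \<ominus>\<^bsub>H d\<^esub> y \<in> SU"
    unfolding SU_def using f SS_mem(5) by (intro CollectI exI[of _ "\<lambda>l. f l \<ominus>\<^bsub>H d\<^esub> f' l"] exI[of _ "I \<union> I'"]) auto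
qed

lemma SS_SocH: "SS l \<subseteq> SocH"
  using SS_mem(2) SS_socle by (auto simp: SocH_def)

lemma submodule_SocH: "submodule SocH (mpoly_ring n) (H d)"
proof (rule Hd.submoduleI_diff, rule Hd.subgroupI_diff)
  show "x \<ominus>\<^bsub>H d\<^esub> y \<in> SocH" if "x \<in> SocH" "y \<in> SocH" for x y
    using that irr_closed by (auto simp: SocH_def Hd.smult_r_diff)
  show "r \<odot>\<^bsub>H d\<^esub> x \<in> SocH" if "r \<in> carrier (mpoly_ring n)" "x \<in> SocH" for r x
    using that irr_closed Hd.smult_r_null[of r] by (auto simp: SocH_def Hd.smult_left_comm[of _ r])
qed (use irr_closed Hd.smult_r_null in \<open>auto simp: SocH_def\<close>)

lemma SU_SocH: "SU \<subseteq> SocH"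
proof
  fix x assume "x \<in> SU"
  then obtain f I where f: "finite I" "\<And>l. f l \<in> SS l" "x = finsum (H d) f I" by (metis SUE)
  have sg: "subgroup SocH (add_monoid (H d))" using submodule_SocH by (simp add: submodule_def)
  note sm = Hd.subgroup_mem[OF sg]
  have "finsum (H d) f I \<in> SocH"
    using f(1)
  proof (induction I rule: finite_induct)
    case (insert l I)
    have "f \<in> I \<rightarrow> carrier (H d)" "f l \<in> carrier (H d)" using SS_mem(2)[OF f(2)] by auto
    moreover have "f l \<in> SocH" using SS_SocH f(2) by blast
    ultimately show ?case using insert sm(3) by (simp add: Hd.finsum_insert)
  qed (simp add: sm(1))
  then show "x \<in> SocH" using f(3) by simp
qed

text \<open>A polynomial minus its constant term lies in the irrelevant ideal. Hence closure under
  constants is the only scalar condition that a submodule of the socle has to satisfy.\<close>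

lemma socle_smult:
  assumes "r \<in> carrier (mpoly_ring n)" "x \<in> SocH"
  shows "r \<odot>\<^bsub>H d\<^esub> x = Const (Poly_Mapping.lookup r 0) \<odot>\<^bsub>H d\<^esub> x"
proof -
  let ?c = "Const (Poly_Mapping.lookup r 0)"
  have q: "r - ?c \<in> irrelevant_ideal n" by (rule minus_constant_term_irrelevant[OF assms(1)])
  have "r \<odot>\<^bsub>H d\<^esub> x = ((r - ?c) + ?c) \<odot>\<^bsub>H d\<^esub> x" by simp
  also have "\<dots> = (r - ?c) \<odot>\<^bsub>H d\<^esub> x \<oplus>\<^bsub>H d\<^esub> ?c \<odot>\<^bsub>H d\<^esub> x"
    using Hd.smult_l_distr[of "r - ?c" ?c x] irr_closed[OF q] assms(2) by (simp add: SocH_def)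
  also have "\<dots> = ?c \<odot>\<^bsub>H d\<^esub> x"
    using q assms(2) by (simp add: SocH_def)
  finally show ?thesis .
qed

lemma submodule_SU: "submodule SU (mpoly_ring n) (H d)"
proof (rule Hd.submoduleI_diff[OF SU_sub])
  fix r :: "'k mpoly" and x assume r: "r \<in> carrier (mpoly_ring n)" and x: "x \<in> SU"
  obtain f I where f: "finite I" "\<And>l. f l \<in> SS l" "\<And>l. l \<notin> I \<Longrightarrow> f l = \<zero>\<^bsub>H d\<^esub>" "x = finsum (H d) f I"
    using SUE[OF x] by metis
  let ?c = "Const (Poly_Mapping.lookup r 0) :: 'k mpoly"
  have "r \<odot>\<^bsub>H d\<^esub> x = ?c \<odot>\<^bsub>H d\<^esub> x" using socle_smult[OF r] SU_SocH x by blast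
  also have "\<dots> = finsum (H d) (\<lambda>l. ?c \<odot>\<^bsub>H d\<^esub> f l) I"
    unfolding f(4) using f(1,2) SS_mem(2) by (intro Hd.finsum_smult_ldistr) auto
  finally show "r \<odot>\<^bsub>H d\<^esub> x \<in> SU"
    unfolding SU_def using f SS_Const Hd.smult_r_null[of ?c] by (intro CollectI exI[of _ "\<lambda>l. ?c \<odot>\<^bsub>H d\<^esub> f l"] exI[of _ I]) auto
qed

lemma SU_unique:
  assumes "finite I" "\<And>l. f l \<in> component (H d) l" "\<And>l. f' l \<in> component (H d) l" "finsum (H d) f I = finsum (H d) f' I" "l \<in> I"
  shows "f l = f' l"
proof -
  note cm = Hd.subgroup_mem[OF component_H_sub]
  have c: "f \<in> I \<rightarrow> carrier (H d)" "f' \<in> I \<rightarrow> carrier (H d)" "(\<lambda>l. f l \<ominus>\<^bsub>H d\<^esub> f' l) \<in> I \<rightarrow> carrier (H d)"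
    using cm(2)[OF assms(2)] cm(2)[OF assms(3)] by auto
  have "finsum (H d) (\<lambda>l. f l \<ominus>\<^bsub>H d\<^esub> f' l) I \<oplus>\<^bsub>H d\<^esub> finsum (H d) f' I = finsum (H d) f I"
    unfolding Hd.finsum_addf[OF c(3,2), symmetric] using c cm(2)[OF assms(2)] cm(2)[OF assms(3)]
    by (intro Hd.finsum_cong') (auto intro!: Hd.minus_add_cancel)
  then have "finsum (H d) (\<lambda>l. f l \<ominus>\<^bsub>H d\<^esub> f' l) I = \<zero>\<^bsub>H d\<^esub>"
    using assms(4) Hd.minus_add_cancel(3)[OF Hd.finsum_closed[OF c(3)] Hd.finsum_closed[OF c(2)]]
      Hd.finsum_closed[OF c(2)] by simp
  then have "f l \<ominus>\<^bsub>H d\<^esub> f' l = \<zero>\<^bsub>H d\<^esub>"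
    using cm(5)[OF assms(2,3)] by (intro H_independent[OF assms(1) _ _ assms(5), of "\<lambda>l. f l \<ominus>\<^bsub>H d\<^esub> f' l" d])
  then show ?thesis
    using Hd.minus_add_cancel(1)[of "f l" "f' l"] cm(2)[OF assms(2)] cm(2)[OF assms(3)] by simp
qed

text \<open>An element of degree \<open>l\<close> is also a sum of one term; uniqueness of the
  decomposition identifies it with the \<open>l\<close>-part of any other expression, so
  intersecting with a component creates nothing new.\<close>

lemma SU_component: "component (H d) l \<inter> SU = SS l"
proof
  show "SS l \<subseteq> component (H d) l \<inter> SU"
  proof
    fix x assume x: "x \<in> SS l"
    have "x = finsum (H d) (\<lambda>i. if i = l then x else \<zero>\<^bsub>H d\<^esub>) {l}"
      using SS_mem(2)[OF x] by (simp add: Hd.finsum_insert)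
    then have "x \<in> SU"
      unfolding SU_def using x SS_mem(1) by (intro CollectI exI[of _ "\<lambda>i. if i = l then x else \<zero>\<^bsub>H d\<^esub>"] exI[of _ "{l}"]) auto
    then show "x \<in> component (H d) l \<inter> SU" using x SS_component by blast
  qed
  show "component (H d) l \<inter> SU \<subseteq> SS l"
  proof
    fix x assume x: "x \<in> component (H d) l \<inter> SU"
    then obtain f I where f: "finite I" "\<And>l. f l \<in> SS l" "\<And>l. l \<notin> I \<Longrightarrow> f l = \<zero>\<^bsub>H d\<^esub>" "x = finsum (H d) f I"
      by (metis IntD2 SUE)
    let ?f' = "\<lambda>i. if l = i then x else \<zero>\<^bsub>H d\<^esub>"
    have xc: "x \<in> carrier (H d)" using x Hd.subgroup_mem(2)[OF SU_sub] by blast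
    have "finsum (H d) f (insert l I) = x" using finsum_SS_extend[of "insert l I" I f] f by auto
    also have "\<dots> = finsum (H d) ?f' (insert l I)"
      by (rule Hd.finsum_singleton[of l "insert l I" "\<lambda>_. x", symmetric]) (use xc f(1) in auto)
    finally have eq: "finsum (H d) f (insert l I) = finsum (H d) ?f' (insert l I)" .
    have "f l = ?f' l"
    proof (rule SU_unique[OF _ _ _ eq])
      show "f i \<in> component (H d) i" for i using f(2) SS_component by blast
      show "?f' i \<in> component (H d) i" for i
        using x Hd.subgroup_mem(1)[OF component_H_sub] by (cases "l = i") simp_all
    qed (use f(1) in auto)
    then show "x \<in> SS l" using f(2)[of l] by simp
  qed
qed

definition GS :: "('k mpoly, (nat set \<Rightarrow> ('m \<times> nat) set) set) gmodule" where
  "GS = restrict_gmodule (socle n (H d)) SU"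

lemma module_socle_H: "module (mpoly_ring n) (socle n (H d))"
  unfolding socle_H by (rule module_restrict_gmodule[OF module_H submodule_SocH])

lemma submodule_SU_socle: "submodule SU (mpoly_ring n) (socle n (H d))"
proof -
  interpret S: module "mpoly_ring n" "socle n (H d)" by (rule module_socle_H)
  show ?thesis
  proof (rule S.submoduleI_diff, rule S.subgroupI_diff)
    show "SU \<subseteq> carrier (socle n (H d))" using SU_SocH by (simp add: socle_H)
    show "\<zero>\<^bsub>socle n (H d)\<^esub> \<in> SU" using Hd.subgroup_mem(1)[OF SU_sub] by (simp add: socle_H)
    show "x \<ominus>\<^bsub>socle n (H d)\<^esub> y \<in> SU" if "x \<in> SU" "y \<in> SU" for x y
      using subsetD[OF SU_SocH that(1)] subsetD[OF SU_SocH that(2)]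
        restrict_gmodule_minus[OF module_H submodule_SocH, of x y] Hd.subgroup_mem(5)[OF SU_sub that]
      by (simp add: socle_H)
    show "r \<odot>\<^bsub>socle n (H d)\<^esub> x \<in> SU" if "r \<in> carrier (mpoly_ring n)" "x \<in> SU" for r x
      using submodule.smult_closed[OF submodule_SU that] by (simp add: socle_H)
  qed
qed

lemma GS_simps:
  "carrier GS = SU" "zero GS = zero (H d)" "add GS = add (H d)" "smult GS = smult (H d)" "component GS l = SS l"
  using SU_component SU_SocH by (auto simp: GS_def socle_H)

lemma module_GS: "module (mpoly_ring n) GS"
  unfolding GS_def by (rule module_restrict_gmodule[OF module_socle_H submodule_SU_socle])

lemma GS_minus: "x \<in> SU \<Longrightarrow> y \<in> SU \<Longrightarrow> x \<ominus>\<^bsub>GS\<^esub> y = x \<ominus>\<^bsub>H d\<^esub> y"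
  using restrict_gmodule_minus[OF module_socle_H submodule_SU_socle, of x y]
    restrict_gmodule_minus[OF module_H submodule_SocH, of x y] SU_SocH by (auto simp: GS_def socle_H)

lemma GS_finsum: "(\<And>l. l \<in> A \<Longrightarrow> f l \<in> SU) \<Longrightarrow> finsum GS f A = finsum (H d) f A"
  using finsum_restrict_gmodule[OF module_socle_H submodule_SU_socle, of A f]
    finsum_restrict_gmodule[OF module_H submodule_SocH, of A f] SU_SocH by (auto simp: GS_def socle_H subset_iff)

lemma SS_SU: "SS l \<subseteq> SU"
  using SU_component by blast

lemma GS_component_sub: "subgroup (component GS l) (add_monoid GS)"
proof -
  interpret G: module "mpoly_ring n" GS by (rule module_GS)
  show ?thesis
  proof (rule G.subgroupI_diff)
    show "x \<ominus>\<^bsub>GS\<^esub> y \<in> component GS l" if "x \<in> component GS l" "y \<in> component GS l" for x y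
    proof -
      have xy: "x \<in> SS l" "y \<in> SS l" using that unfolding GS_simps by auto
      then have "x \<in> SU" "y \<in> SU" using SS_SU by blast+
      from GS_minus[OF this] SS_mem(5)[OF xy] show ?thesis unfolding GS_simps by simp
    qed
  qed (use SS_SU SS_mem(1) in \<open>auto simp: GS_simps socle_H\<close>)
qed

text \<open>Uniqueness of components comes from \<open>H_independent\<close>. A form of positive
  degree acts as zero on the socle, so the degree condition has content for constants only.\<close>

lemma graded_submodule_SU: "graded_submodule n SU (socle n (H d))"
  unfolding graded_submodule_def graded_module_def GS_def[symmetric]
proof (intro conjI allI ballI impI submodule_SU_socle module_GS GS_component_sub)
  fix x assume "x \<in> carrier GS"
  then obtain f I where f: "finite I" "\<And>l. f l \<in> SS l" "\<And>l. l \<notin> I \<Longrightarrow> f l = \<zero>\<^bsub>H d\<^esub>" "x = finsum (H d) f I"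
    unfolding GS_simps by (metis SUE)
  have fs: "finsum GS c A = finsum (H d) c A" if "\<forall>k. c k \<in> component GS k" for c A
    using that SS_SU unfolding GS_simps(5) by (intro GS_finsum) blast
  have supp: "finsum (H d) c {k. c k \<noteq> \<zero>\<^bsub>GS\<^esub>} = finsum (H d) c K" if "\<And>k. c k \<in> SS k" "finite K" "{k. c k \<noteq> \<zero>\<^bsub>GS\<^esub>} \<subseteq> K" for c K
    using that by (intro finsum_SS_extend) (auto simp: GS_simps socle_H)
  show "\<exists>!c. (\<forall>k. c k \<in> component GS k) \<and> finite {k. c k \<noteq> \<zero>\<^bsub>GS\<^esub>} \<and> x = finsum GS c {k. c k \<noteq> \<zero>\<^bsub>GS\<^esub>}"
  proof (rule ex1I[of _ f])
    have sub: "{k. f k \<noteq> \<zero>\<^bsub>GS\<^esub>} \<subseteq> I" using f(3) by (auto simp: GS_simps socle_H)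
    have fc: "\<forall>k. f k \<in> component GS k" using f(2) by (simp add: GS_simps(5))
    show "(\<forall>k. f k \<in> component GS k) \<and> finite {k. f k \<noteq> \<zero>\<^bsub>GS\<^esub>} \<and> x = finsum GS f {k. f k \<noteq> \<zero>\<^bsub>GS\<^esub>}"
      using finite_subset[OF sub f(1)] supp[OF f(2,1) sub] fs[OF fc] fc f(4) by simp
  next
    fix c assume c: "(\<forall>k. c k \<in> component GS k) \<and> finite {k. c k \<noteq> \<zero>\<^bsub>GS\<^esub>} \<and> x = finsum GS c {k. c k \<noteq> \<zero>\<^bsub>GS\<^esub>}"
    then have cS: "\<And>k. c k \<in> SS k" by (simp add: GS_simps(5))
    let ?K = "I \<union> {k. c k \<noteq> \<zero>\<^bsub>GS\<^esub>}"
    have K: "finite ?K" using c f(1) by simp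
    have "finsum (H d) c ?K = x" using c fs[of c] supp[OF cS K] by simp
    moreover have "finsum (H d) f ?K = x" using finsum_SS_extend[OF K _ f(2,3)] f(4) by simp
    ultimately have eq: "finsum (H d) c ?K = finsum (H d) f ?K" by simp
    have e: "c k = f k" if "k \<in> ?K" for k
      by (rule SU_unique[OF K _ _ eq that]) (use cS f(2) SS_component in auto)
    show "c = f"
    proof
      fix k show "c k = f k"
        using e[of k] f(3)[of k] by (cases "k \<in> ?K") (auto simp: GS_simps socle_H)
    qed
  qed
next
  fix i k and p :: "'k mpoly" and x assume p: "p \<in> carrier (mpoly_ring n)" and x: "x \<in> component GS k" and h: "homogeneous i p"
  have xS: "x \<in> SS k" using x by (simp add: GS_simps(5))
  have e: "p \<odot>\<^bsub>H d\<^esub> x = Const (Poly_Mapping.lookup p 0) \<odot>\<^bsub>H d\<^esub> x"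
    using socle_smult[OF p] SS_SocH xS by blast
  have "p \<odot>\<^bsub>H d\<^esub> x \<in> SS (k + int i)"
  proof (cases "i = 0")
    case True
    then show ?thesis using SS_Const[OF xS] e by simp
  next
    case False
    then have "Poly_Mapping.lookup p 0 = 0"
      using h monom_degree_0 by (metis homogeneous_def in_keys_iff)
    then have "p \<odot>\<^bsub>H d\<^esub> x = \<zero>\<^bsub>H d\<^esub>"
      using e Hd.smult_l_null[OF SS_mem(2)[OF xS]] by (simp add: Const_simps)
    then show ?thesis using SS_mem(1) by simp
  qed
  then show "p \<odot>\<^bsub>GS\<^esub> x \<in> component GS (k + int i)" by (simp add: GS_simps)
qed

end

section \<open>Summing linear sections over all subsets\<close>

text \<open>\<open>Y\<close> indexes the subsets of \<open>{..<d}\<close>, and \<open>E y\<close> is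
  the space in which the classes for the subset lie: a component of local cohomology for a proper
  subset, of \<S> for the full one. \<open>E_rho\<close> keeps the class of every socle
  representative inside \<open>E y\<close>, so that a section can be subtracted from it.\<close>

locale socle_sections = buchsbaum_sop n M \<theta> d
  for n and M :: "('k::field mpoly, 'm) gmodule" and \<theta> d +
  fixes k :: int and Y :: "'y set" and F :: "'y \<Rightarrow> nat list"
    and E :: "'y \<Rightarrow> (nat set \<Rightarrow> ('m \<times> nat) set) set set" and \<sigma> :: "'y \<Rightarrow> (nat set \<Rightarrow> ('m \<times> nat) set) set \<Rightarrow> 'm"
  assumes Y: "finite Y" and F: "\<And>y. y \<in> Y \<Longrightarrow> distinct (F y) \<and> set (F y) \<subseteq> {..<d}"
    and F_inj: "\<And>y y'. y \<in> Y \<Longrightarrow> y' \<in> Y \<Longrightarrow> set (F y) = set (F y') \<Longrightarrow> y = y'"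
    and F_onto: "\<And>A. A \<subseteq> {..<d} \<Longrightarrow> \<exists>y\<in>Y. set (F y) = A"
    and E_sub: "\<And>y. y \<in> Y \<Longrightarrow> subgroup (E y) (add_monoid (H (length (F y))))"
    and E_rho: "\<And>y w t. y \<in> Y \<Longrightarrow> w \<in> Soc k \<Longrightarrow> rho (F y) k w t \<Longrightarrow> t \<in> E y"
    and \<sigma>: "\<And>y t. y \<in> Y \<Longrightarrow> t \<in> E y \<Longrightarrow> rho (F y) k (\<sigma> y t) t \<and> \<sigma> y t \<in> Soc k"
    and \<sigma>_add: "\<And>y t t'. y \<in> Y \<Longrightarrow> t \<in> E y \<Longrightarrow> t' \<in> E y \<Longrightarrow>
      \<sigma> y (t \<oplus>\<^bsub>H (length (F y))\<^esub> t') = \<sigma> y t \<oplus>\<^bsub>M\<^esub> \<sigma> y t'"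
    and \<sigma>_Const: "\<And>y t c. y \<in> Y \<Longrightarrow> t \<in> E y \<Longrightarrow>
      \<sigma> y (Const c \<odot>\<^bsub>H (length (F y))\<^esub> t) = Const c \<odot>\<^bsub>M\<^esub> \<sigma> y t"
begin

definition Phi :: "('y \<Rightarrow> (nat set \<Rightarrow> ('m \<times> nat) set) set) \<Rightarrow> 'm" where
  "Phi t = finsum M (\<lambda>y. \<sigma> y (t y)) Y"

lemma Soc_mem: "w \<in> Soc k \<Longrightarrow> w \<in> carrier M" "w \<in> Soc k \<Longrightarrow> w \<in> comp k"
  using comp_mem(2) by (auto simp: Soc_def)

lemma \<sigma>_carrier: "y \<in> Y \<Longrightarrow> t \<in> E y \<Longrightarrow> \<sigma> y t \<in> carrier M"
  using \<sigma> Soc_mem(1) by blast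

lemma E_mem:
  assumes "y \<in> Y"
  shows "\<zero>\<^bsub>H (length (F y))\<^esub> \<in> E y" "t \<in> E y \<Longrightarrow> t \<in> carrier (H (length (F y)))"
    "t \<in> E y \<Longrightarrow> t' \<in> E y \<Longrightarrow> t \<oplus>\<^bsub>H (length (F y))\<^esub> t' \<in> E y" "t \<in> E y \<Longrightarrow> t' \<in> E y \<Longrightarrow> t \<ominus>\<^bsub>H (length (F y))\<^esub> t' \<in> E y"
proof -
  interpret Hj: module "mpoly_ring n" "H (length (F y))" by (rule module_H)
  note m = Hj.subgroup_mem[OF E_sub[OF assms]]
  show "\<zero>\<^bsub>H (length (F y))\<^esub> \<in> E y" "t \<in> E y \<Longrightarrow> t \<in> carrier (H (length (F y)))"
    "t \<in> E y \<Longrightarrow> t' \<in> E y \<Longrightarrow> t \<oplus>\<^bsub>H (length (F y))\<^esub> t' \<in> E y" "t \<in> E y \<Longrightarrow> t' \<in> E y \<Longrightarrow> t \<ominus>\<^bsub>H (length (F y))\<^esub> t' \<in> E y"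
    using m by blast+
qed

lemma \<sigma>_zero: "y \<in> Y \<Longrightarrow> \<sigma> y \<zero>\<^bsub>H (length (F y))\<^esub> = \<zero>\<^bsub>M\<^esub>"
proof -
  assume y: "y \<in> Y"
  interpret Hj: module "mpoly_ring n" "H (length (F y))" by (rule module_H)
  have c: "\<sigma> y \<zero>\<^bsub>H (length (F y))\<^esub> \<in> carrier M" using \<sigma>_carrier[OF y E_mem(1)[OF y]] .
  have "\<sigma> y \<zero>\<^bsub>H (length (F y))\<^esub> = \<sigma> y \<zero>\<^bsub>H (length (F y))\<^esub> \<oplus>\<^bsub>M\<^esub> \<sigma> y \<zero>\<^bsub>H (length (F y))\<^esub>"
    using \<sigma>_add[OF y E_mem(1)[OF y] E_mem(1)[OF y]] by simp
  then show ?thesis using c M.minus_add_cancel(3)[OF c c] by simp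
qed

lemma Phi_summand: "\<forall>y\<in>Y. t y \<in> E y \<Longrightarrow> (\<lambda>y. \<sigma> y (t y)) \<in> Y \<rightarrow> carrier M"
  using \<sigma>_carrier by blast

lemma Phi_Soc: "\<forall>y\<in>Y. t y \<in> E y \<Longrightarrow> Phi t \<in> Soc k"
proof -
  assume t: "\<forall>y\<in>Y. t y \<in> E y"
  have "finsum M (\<lambda>y. \<sigma> y (t y)) A \<in> Soc k" if "finite A" "A \<subseteq> Y" for A
    using that
  proof (induction A rule: finite_induct)
    case (insert y A)
    have "(\<lambda>y. \<sigma> y (t y)) \<in> A \<rightarrow> carrier M" "\<sigma> y (t y) \<in> carrier M" "\<sigma> y (t y) \<in> Soc k"
      using t insert.prems \<sigma>_carrier \<sigma> by auto
    with insert show ?case using M.subgroup_mem(3)[OF Soc_sub] by (simp add: M.finsum_insert)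
  qed (simp add: M.subgroup_mem(1)[OF Soc_sub])
  then show ?thesis unfolding Phi_def using Y by blast
qed

lemma Phi_add:
  assumes "\<forall>y\<in>Y. t y \<in> E y" "\<forall>y\<in>Y. t' y \<in> E y"
  shows "Phi (\<lambda>y. t y \<oplus>\<^bsub>H (length (F y))\<^esub> t' y) = Phi t \<oplus>\<^bsub>M\<^esub> Phi t'"
  unfolding Phi_def M.finsum_addf[OF Phi_summand[OF assms(1)] Phi_summand[OF assms(2)], symmetric]
  using assms \<sigma>_carrier by (intro M.finsum_cong') (auto simp: \<sigma>_add)

lemma Phi_diff:
  assumes "\<forall>y\<in>Y. t y \<in> E y" "\<forall>y\<in>Y. t' y \<in> E y"
  shows "Phi (\<lambda>y. t y \<ominus>\<^bsub>H (length (F y))\<^esub> t' y) = Phi t \<ominus>\<^bsub>M\<^esub> Phi t'"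
proof -
  let ?s = "\<lambda>y. t y \<ominus>\<^bsub>H (length (F y))\<^esub> t' y"
  have s: "\<forall>y\<in>Y. ?s y \<in> E y" using assms E_mem(4) by blast
  have "Phi t = Phi (\<lambda>y. ?s y \<oplus>\<^bsub>H (length (F y))\<^esub> t' y)"
    unfolding Phi_def
  proof (rule M.finsum_cong'[OF refl])
    fix y assume y: "y \<in> Y"
    interpret Hj: module "mpoly_ring n" "H (length (F y))" by (rule module_H)
    show "\<sigma> y (t y) = \<sigma> y (?s y \<oplus>\<^bsub>H (length (F y))\<^esub> t' y)"
      using Hj.minus_add_cancel(1)[of "t y" "t' y"] assms y E_mem(2)[OF y] by simp
  next
    show "(\<lambda>y. \<sigma> y (?s y \<oplus>\<^bsub>H (length (F y))\<^esub> t' y)) \<in> Y \<rightarrow> carrier M"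
      using assms s E_mem(3) \<sigma>_carrier by blast
  qed
  then have "Phi t = Phi ?s \<oplus>\<^bsub>M\<^esub> Phi t'" using Phi_add[OF s assms(2)] by simp
  then show ?thesis
    using M.minus_add_cancel(3)[OF Soc_mem(1)[OF Phi_Soc[OF s]] Soc_mem(1)[OF Phi_Soc[OF assms(2)]]] by simp
qed

lemma Phi_Const:
  assumes "\<forall>y\<in>Y. t y \<in> E y"
  shows "Phi (\<lambda>y. Const c \<odot>\<^bsub>H (length (F y))\<^esub> t y) = Const c \<odot>\<^bsub>M\<^esub> Phi t"
proof -
  have "Const c \<odot>\<^bsub>M\<^esub> Phi t = finsum M (\<lambda>y. Const c \<odot>\<^bsub>M\<^esub> \<sigma> y (t y)) Y"
    unfolding Phi_def by (rule finsum_smult[OF Y]) (use Phi_summand[OF assms(1)] in auto)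
  also have "\<dots> = Phi (\<lambda>y. Const c \<odot>\<^bsub>H (length (F y))\<^esub> t y)"
    unfolding Phi_def using assms \<sigma>_carrier by (intro M.finsum_cong') (auto simp: \<sigma>_Const)
  finally show ?thesis by simp
qed

text \<open>Downward induction on the size of the subset. The summands of larger subsets vanish by
  induction, those of the remaining subsets miss an element of \<open>F y\<close> and are dying for
  \<open>F y\<close>, and \<open>Phi t\<close> is dying as an element of \<open>NN\<close>. So the
  summand of \<open>y\<close> is dying too, and its class is zero.\<close>

lemma Phi_inj:
  assumes t: "\<forall>y\<in>Y. t y \<in> E y" and NN: "Phi t \<in> NN" and "y \<in> Y"
  shows "t y = \<zero>\<^bsub>H (length (F y))\<^esub>"
  using \<open>y \<in> Y\<close>
proof (induction "d - length (F y)" arbitrary: y rule: less_induct)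
  case less
  note Fy = F[OF less.prems]
  define Dy where "Dy = {w \<in> comp k. \<iota> w \<in> dying (F y) k}"
  have Dsub: "subgroup Dy (add_monoid M)"
  proof (rule M.subgroupI_diff)
    show "Dy \<subseteq> carrier M" using comp_mem(2) by (auto simp: Dy_def)
    have "\<iota> \<zero>\<^bsub>M\<^esub> \<in> dying (F y) k"
      using CN_dying[of "F y" k] Fy \<iota>_g[OF comp_mem(1)] \<iota>_CNs[OF Nb_submodule M.zero_closed] N_mem(1)[OF Nb_submodule] by blast
    then show "\<zero>\<^bsub>M\<^esub> \<in> Dy" by (simp add: Dy_def comp_mem(1))
    show "u \<ominus>\<^bsub>M\<^esub> w \<in> Dy" if "u \<in> Dy" "w \<in> Dy" for u w
      using that comp_mem(2) C.subgroup_mem(5)[OF dying_sub] Fy by (auto simp: Dy_def \<iota>_diff intro: comp_mem(5))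
  qed
  note Dm = M.subgroup_mem[OF Dsub]
  have PhiD: "Phi t \<in> Dy"
    using CN_dying[of "F y" k] Fy Soc_mem[OF Phi_Soc[OF t]] \<iota>_g \<iota>_CNs[OF Nb_submodule] NN
    unfolding Dy_def by blast
  have other: "\<sigma> y' (t y') \<in> Dy" if y': "y' \<in> Y" "y' \<noteq> y" for y'
  proof (cases "length (F y') > length (F y)")
    case True
    have "length (F y') \<le> d" using F[OF y'(1)] by (metis card_lessThan card_mono distinct_card finite_lessThan)
    then have "t y' = \<zero>\<^bsub>H (length (F y'))\<^esub>" using True by (intro less.hyps y'(1)) simp
    then show ?thesis using \<sigma>_zero[OF y'(1)] Dm(1) by simp
  next
    case False
    \<comment> \<open>A set at most as large as \<open>F y\<close> and different from it cannot
      contain it.\<close>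
    have "\<not> set (F y) \<subseteq> set (F y')"
    proof
      assume sub: "set (F y) \<subseteq> set (F y')"
      have "card (set (F y')) \<le> card (set (F y))"
        using False F[OF y'(1)] Fy by (simp add: distinct_card)
      then have "set (F y) = set (F y')" using sub by (intro card_seteq) simp_all
      then show False using F_inj[OF less.prems y'(1)] y'(2) by simp
    qed
    then obtain i where "i \<in> set (F y)" "i \<notin> set (F y')" by blast
    moreover have s: "rho (F y') k (\<sigma> y' (t y')) (t y')" "\<sigma> y' (t y') \<in> Soc k" using \<sigma> y' t by auto
    moreover have "\<iota> (\<sigma> y' (t y')) \<in> Zc (upd (\<lambda>_. 0) (F y')) 0 k"
      using rho_Zc s(1) F[OF y'(1)] by blast
    ultimately show ?thesis
      using Zc_dying[of "F y" "F y'" i k] Fy F[OF y'(1)] Soc_mem(2) unfolding Dy_def by blast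
  qed
  have rest: "finsum M (\<lambda>y. \<sigma> y (t y)) A \<in> Dy" if "finite A" "A \<subseteq> Y - {y}" for A
    using that
  proof (induction A rule: finite_induct)
    case (insert z A)
    have "(\<lambda>y. \<sigma> y (t y)) \<in> A \<rightarrow> carrier M" "\<sigma> z (t z) \<in> carrier M" "\<sigma> z (t z) \<in> Dy"
      using t insert.prems \<sigma>_carrier other by auto
    with insert show ?case using Dm(3) by (simp add: M.finsum_insert)
  qed (simp add: Dm(1))
  have yc: "\<sigma> y (t y) \<in> carrier M" "(\<lambda>y. \<sigma> y (t y)) \<in> Y - {y} \<rightarrow> carrier M"
    using t less.prems \<sigma>_carrier by auto
  have "Phi t = \<sigma> y (t y) \<oplus>\<^bsub>M\<^esub> finsum M (\<lambda>y. \<sigma> y (t y)) (Y - {y})"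
    unfolding Phi_def using M.finsum_insert[of "Y - {y}" y "\<lambda>y. \<sigma> y (t y)"] Y yc less.prems
    by (simp add: insert_absorb)
  then have "\<sigma> y (t y) \<in> Dy"
    using PhiD rest[of "Y - {y}"] Y yc M.subgroup_cancel(2)[OF Dsub] by simp
  then show ?case
    using rho_dying[of "F y"] Fy \<sigma>[OF less.prems] t less.prems unfolding Dy_def by blast
qed

text \<open>Upward induction on the size: subtracting the section of its class makes an element
  related to zero, and \<open>rho_ker\<close> then expresses it by elements of \<open>NN\<close> and
  of smaller subsets.\<close>

lemma Phi_surj:
  assumes "w \<in> Soc k"
  shows "\<exists>t. (\<forall>y\<in>Y. t y \<in> E y) \<and> w \<ominus>\<^bsub>M\<^esub> Phi t \<in> NN"
proof -
  \<comment> \<open>The elements reached modulo \<open>NN\<close>; they form a subgroup, so they can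
    serve as the \<open>I\<close> of \<open>rho_ker\<close>.\<close>
  define I where "I = {w \<in> comp k. \<exists>t. (\<forall>y\<in>Y. t y \<in> E y) \<and> w \<ominus>\<^bsub>M\<^esub> Phi t \<in> NN}"
  note Nm = N_mem[OF Nb_submodule]
  have Phi0: "Phi (\<lambda>y. \<zero>\<^bsub>H (length (F y))\<^esub>) = \<zero>\<^bsub>M\<^esub>"
  proof -
    have "Phi (\<lambda>y. \<zero>\<^bsub>H (length (F y))\<^esub>) = finsum M (\<lambda>_. \<zero>\<^bsub>M\<^esub>) Y"
      unfolding Phi_def using \<sigma>_zero by (intro M.finsum_cong') auto
    then show ?thesis by simp
  qed
  have Phi_c: "Phi t \<in> carrier M" if "\<forall>y\<in>Y. t y \<in> E y" for t using Soc_mem(1)[OF Phi_Soc[OF that]] .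
  have NNI: "w \<in> I" if "w \<in> comp k" "w \<in> NN" for w
    unfolding I_def using that E_mem(1) Nm(2)
    by (intro CollectI conjI exI[of _ "\<lambda>y. \<zero>\<^bsub>H (length (F y))\<^esub>"]) (auto simp: Phi0)
  have I: "subgroup I (add_monoid M)"
  proof (rule M.subgroupI_diff)
    show "I \<subseteq> carrier M" using comp_mem(2) by (auto simp: I_def)
    show "\<zero>\<^bsub>M\<^esub> \<in> I" using NNI comp_mem(1) Nm(1) by blast
    fix u w assume "u \<in> I" "w \<in> I"
    then obtain t t' where t: "u \<in> comp k" "\<forall>y\<in>Y. t y \<in> E y" "u \<ominus>\<^bsub>M\<^esub> Phi t \<in> NN"
      "w \<in> comp k" "\<forall>y\<in>Y. t' y \<in> E y" "w \<ominus>\<^bsub>M\<^esub> Phi t' \<in> NN" by (auto simp: I_def)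
    have "(u \<ominus>\<^bsub>M\<^esub> w) \<ominus>\<^bsub>M\<^esub> Phi (\<lambda>y. t y \<ominus>\<^bsub>H (length (F y))\<^esub> t' y) \<in> NN"
      using Nm(5)[OF t(3,6)] comp_mem(2)[OF t(1)] comp_mem(2)[OF t(4)] Phi_c[OF t(2)] Phi_c[OF t(5)]
      by (simp add: Phi_diff[OF t(2,5)] M.minus_minus_minus)
    moreover have "\<forall>y\<in>Y. t y \<ominus>\<^bsub>H (length (F y))\<^esub> t' y \<in> E y" using t E_mem(4) by blast
    ultimately show "u \<ominus>\<^bsub>M\<^esub> w \<in> I" unfolding I_def
      by (intro CollectI conjI exI[of _ "\<lambda>y. t y \<ominus>\<^bsub>H (length (F y))\<^esub> t' y"] comp_mem(5)[OF t(1,4)])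
  qed
  have \<sigma>I: "\<sigma> y s \<in> I" if y: "y \<in> Y" "s \<in> E y" for y s
  proof -
    let ?t = "\<lambda>y'. if y = y' then s else \<zero>\<^bsub>H (length (F y'))\<^esub>"
    have t: "\<forall>y\<in>Y. ?t y \<in> E y" using y E_mem(1) by auto
    have "Phi ?t = finsum M (\<lambda>y'. if y = y' then \<sigma> y' s else \<zero>\<^bsub>M\<^esub>) Y"
      unfolding Phi_def using \<sigma>_zero \<sigma>_carrier[OF y] by (intro M.finsum_cong') auto
    also have "\<dots> = finsum M (\<lambda>y'. if y = y' then \<sigma> y s else \<zero>\<^bsub>M\<^esub>) Y"
      using \<sigma>_carrier[OF y] by (intro M.finsum_cong') auto
    also have "\<dots> = \<sigma> y s"
      by (rule M.finsum_singleton[OF y(1) Y, of "\<lambda>_. \<sigma> y s"]) (use \<sigma>_carrier[OF y] in auto)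
    finally have "\<sigma> y s \<ominus>\<^bsub>M\<^esub> Phi ?t \<in> NN" using \<sigma>_carrier[OF y] Nm(1) by simp
    then show ?thesis unfolding I_def
      using t Soc_mem(2)[of "\<sigma> y s"] \<sigma>[OF y] by (intro CollectI conjI exI[of _ ?t]) simp_all
  qed
  have main: "w \<in> I" if "y \<in> Y" "w \<in> Soc k" "\<iota> w \<in> Zc (upd (\<lambda>_. 0) (F y)) 0 k" for w y
    using that
  proof (induction "length (F y)" arbitrary: w y rule: less_induct)
    case less
    note Fy = F[OF less.prems(1), THEN conjunct1] F[OF less.prems(1), THEN conjunct2]
    obtain s where s: "rho (F y) k w s" using rho_exists[OF Fy Soc_mem(2)] less.prems by blast
    have sE: "s \<in> E y" using E_rho[OF less.prems(1,2) s] .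
    interpret Hj: module "mpoly_ring n" "H (length (F y))" by (rule module_H)
    have r: "rho (F y) k (w \<ominus>\<^bsub>M\<^esub> \<sigma> y s) \<zero>\<^bsub>H (length (F y))\<^esub>"
      using rho_diff[OF Fy s] \<sigma>[OF less.prems(1) sE] E_mem(2)[OF less.prems(1) sE] by fastforce
    have len: "length (F y) \<le> d" using Fy by (metis card_lessThan card_mono distinct_card finite_lessThan)
    have "w \<ominus>\<^bsub>M\<^esub> \<sigma> y s \<in> I"
    proof (rule rho_ker[OF Fy len r I NNI])
      fix w' i assume i: "i \<in> set (F y)" and w': "w' \<in> comp k" "\<iota> w' \<in> Zc (upd (\<lambda>_. 0) (removeAll i (F y))) 0 k"
      have R: "distinct (removeAll i (F y))" "set (removeAll i (F y)) \<subseteq> {..<d}" using Fy by (auto simp: distinct_removeAll)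
      obtain y' where y': "y' \<in> Y" "set (F y') = set (removeAll i (F y))" using F_onto[OF R(2)] by blast
      have "length (F y') < length (F y)"
      proof -
        have "card (set (F y')) < card (set (F y))" using y'(2) i by (intro psubset_card_mono) auto
        then show ?thesis using F[OF y'(1)] Fy by (simp add: distinct_card)
      qed
      moreover have "length (removeAll i (F y)) = length (F y')"
        using R(1) F[OF y'(1)] y'(2) by (metis distinct_card)
      \<comment> \<open>The induction hypothesis asks for a socle representative; a cocycle for
        fewer than \<open>d\<close> parameters is one automatically.\<close>
      ultimately have "w' \<in> Soc k"
        using Zc_irrelevant[OF R _ w'] w'(1) len by (auto simp: Soc_def)
      moreover have "upd (\<lambda>_. 0) (F y') = upd (\<lambda>_. 0) (removeAll i (F y))" using y'(2) by (simp add: upd_def)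
      ultimately show "w' \<in> I"
        using less.hyps[OF \<open>length (F y') < length (F y)\<close> y'(1)] w'(2) by simp
    qed
    then show ?case
      using M.subgroup_cancel(1)[OF I \<sigma>I[OF less.prems(1) sE] Soc_mem(1)[OF less.prems(2)]] by simp
  qed
  \<comment> \<open>Every socle representative is a cocycle for the full set, so \<open>main\<close>
    applies to all of them.\<close>
  obtain y where y: "y \<in> Y" "set (F y) = {..<d}" using F_onto[of "{..<d}"] by auto
  have "upd (\<lambda>_. 0) (F y) = full" using y(2) by (auto simp: upd_def full_def)
  then have "w \<in> I" using main[OF y(1) assms] Soc_Zc[OF assms] by simp
  then show ?thesis by (simp add: I_def)
qed

end

lemma (in socle_sections) Phi_cong: "(\<And>y. y \<in> Y \<Longrightarrow> t y = t' y) \<Longrightarrow> (\<forall>y\<in>Y. t' y \<in> E y) \<Longrightarrow> Phi t = Phi t'"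
  unfolding Phi_def using \<sigma>_carrier by (intro M.finsum_cong') auto

section \<open>The isomorphism in a fixed degree\<close>

context buchsbaum_sop
begin

text \<open>Both kinds of target live in the local cohomology module of index \<open>card A\<close>,
  since the full set has \<open>d\<close> elements; this lets \<open>target_simps\<close> treat them
  alike.\<close>

definition target :: "int \<Rightarrow> nat set \<Rightarrow> ('k, (nat set \<Rightarrow> ('m \<times> nat) set) set) module" where
  "target k A = (if A = {..<d} then component_space GS (k - int d)
     else component_space (H (card A)) (k - int (card A)))"

lemma target_simps:
  "zero (target k A) = zero (H (card A))" "add (target k A) = add (H (card A))"
  "smult (target k A) c = smult (H (card A)) (Const c)"
  by (auto simp: target_def component_space_def GS_simps)

lemma carrier_target:
  "carrier (target k A) = (if A = {..<d} then SS (k - int d) else component (H (card A)) (k - int (card A)))"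
  by (auto simp: target_def component_space_def GS_simps)

lemma module_target: "module field_ring (target k A)"
proof (cases "A = {..<d}")
  case True
  have "module field_ring (component_space GS (k - int d))"
    by (rule module_component_space[OF module_GS GS_component_sub]) (use SS_Const in \<open>simp add: GS_simps\<close>)
  then show ?thesis using True by (simp add: target_def)
next
  case False
  then show ?thesis
    using module_component_space[OF module_H component_H_sub component_H_Const] by (simp add: target_def)
qed

lemma target_sub: "subgroup (carrier (target k A)) (add_monoid (H (card A)))"
  using SS_sub component_H_sub by (auto simp: carrier_target)

lemma sorted_list_facts:
  assumes "A \<subseteq> {..<d}"
  shows "distinct (sorted_list_of_set A)" "set (sorted_list_of_set A) = A" "length (sorted_list_of_set A) = card A"
  using finite_subset[OF assms] by auto

lemma target_rho:
  assumes A: "A \<subseteq> {..<d}" and "w \<in> Soc k" "rho (sorted_list_of_set A) k w t"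
  shows "t \<in> carrier (target k A)"
proof (cases "A = {..<d}")
  case True
  then have "rhoF k w t" using assms(3) by (simp add: lessThan_atLeast0)
  then show ?thesis using True assms(2) by (auto simp: carrier_target SS_def)
next
  case False
  note s = sorted_list_facts[OF A]
  have "t \<in> component (H (length (sorted_list_of_set A))) (k - int (length (sorted_list_of_set A)))"
    by (rule rho_comp(2)[OF _ _ assms(3)]) (use s A in simp_all)
  then show ?thesis using False s by (simp add: carrier_target)
qed

text \<open>Totality of the relation on its target has two sources: surjectivity of the connecting
  homomorphisms for a proper subset, and the definition of \<open>SS\<close> for the full one. A
  linear section is needed because the relation is not the graph of a map in that direction.\<close>

lemma target_section:
  assumes A: "A \<subseteq> {..<d}"
  shows "\<exists>\<sigma>. (\<forall>t\<in>carrier (target k A). rho (sorted_list_of_set A) k (\<sigma> t) t \<and> \<sigma> t \<in> Soc k) \<and>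
    (\<forall>t\<in>carrier (target k A). \<forall>t'\<in>carrier (target k A). \<sigma> (t \<oplus>\<^bsub>H (card A)\<^esub> t') = \<sigma> t \<oplus>\<^bsub>M\<^esub> \<sigma> t') \<and>
    (\<forall>c. \<forall>t\<in>carrier (target k A). \<sigma> (Const c \<odot>\<^bsub>H (card A)\<^esub> t) = Const c \<odot>\<^bsub>M\<^esub> \<sigma> t)"
proof -
  let ?F = "sorted_list_of_set A"
  note s = sorted_list_facts[OF A]
  have F: "distinct ?F" "set ?F \<subseteq> {..<d}" using s A by simp_all
  have mod: "module field_ring (component_space M k)"
    by (rule module_component_space[OF module_axioms comp_sub])
      (use comp_smult[OF homogeneous_Const Const_closed, of _ k] in simp)
  define \<rho> where "\<rho> u t \<longleftrightarrow> rho ?F k u t \<and> u \<in> Soc k" for u t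
  have "\<exists>\<sigma>. (\<forall>t\<in>carrier (target k A). \<rho> (\<sigma> t) t) \<and>
    (\<forall>t\<in>carrier (target k A). \<forall>t'\<in>carrier (target k A).
       \<sigma> (t \<oplus>\<^bsub>target k A\<^esub> t') = \<sigma> t \<oplus>\<^bsub>component_space M k\<^esub> \<sigma> t') \<and>
    (\<forall>c. \<forall>t\<in>carrier (target k A). \<sigma> (c \<odot>\<^bsub>target k A\<^esub> t) = c \<odot>\<^bsub>component_space M k\<^esub> \<sigma> t)"
  proof (rule linear_section[OF mod module_target])
    show "a \<in> carrier (component_space M k) \<and> t \<in> carrier (target k A)" if "\<rho> a t" for a t
      using that target_rho[OF A, of a k t] by (simp add: \<rho>_def component_space_def Soc_def)
    show "\<rho> (a \<oplus>\<^bsub>component_space M k\<^esub> a') (t \<oplus>\<^bsub>target k A\<^esub> t')" if "\<rho> a t" "\<rho> a' t'" for a t a' t'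
      using that rho_add[OF F, of k a t a' t'] M.subgroup_mem(3)[OF Soc_sub, of a k a'] s(3)
      by (simp add: \<rho>_def component_space_def target_simps)
    show "\<rho> (c \<odot>\<^bsub>component_space M k\<^esub> a) (c \<odot>\<^bsub>target k A\<^esub> t)" if "\<rho> a t" for a t c
      using that rho_Const[OF F, of k a t c] Soc_Const[of a k c] s(3)
      by (simp add: \<rho>_def component_space_def target_simps)
    show "\<exists>a. \<rho> a t" if t: "t \<in> carrier (target k A)" for t
    proof (cases "A = {..<d}")
      case True
      then show ?thesis using t by (auto simp: carrier_target SS_def \<rho>_def lessThan_atLeast0)
    next
      case False
      then have len: "length ?F < d"
        using A s(3) psubset_card_mono[of "{..<d}" A] by auto
      obtain u where u: "rho ?F k u t" using rho_surj[OF F len, of t k] t False s(3) by (auto simp: carrier_target)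
      then have "u \<in> Soc k"
        using Zc_irrelevant[OF F len rho_comp(1)[OF F u] rho_Zc[OF F u]] rho_comp(1)[OF F u] by (simp add: Soc_def)
      then show ?thesis using u by (auto simp: \<rho>_def)
    qed
  qed
  then show ?thesis by (simp add: \<rho>_def target_simps component_space_def)
qed

lemma component_socle_quotient:
  "component (socle n (quotient_gmodule M NN)) k = (\<lambda>u. NN +>\<^bsub>M\<^esub> u) ` Soc k"
proof -
  note q = carrier_quotient quotient_zero[OF module_axioms Nb_submodule] quotient_smult[OF module_axioms Nb_submodule]
  have *: "p \<odot>\<^bsub>quotient_gmodule M NN\<^esub> (NN +>\<^bsub>M\<^esub> u) = \<zero>\<^bsub>quotient_gmodule M NN\<^esub> \<longleftrightarrow> p \<odot>\<^bsub>M\<^esub> u \<in> NN"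
    if "p \<in> irrelevant_ideal n" "u \<in> carrier M" for p :: "'k mpoly" and u
    using that irr_closed coset_eq_iff[OF module_axioms Nb_submodule, of "p \<odot>\<^bsub>M\<^esub> u" "\<zero>\<^bsub>M\<^esub>"]
    by (simp add: q)
  let ?Q = "quotient_gmodule M NN"
  have "component (socle n ?Q) k =
    (\<lambda>u. NN +>\<^bsub>M\<^esub> u) ` comp k \<inter> {y \<in> carrier ?Q. \<forall>p\<in>irrelevant_ideal n. p \<odot>\<^bsub>?Q\<^esub> y = \<zero>\<^bsub>?Q\<^esub>}"
    by (simp add: socle_def component_quotient[OF module_axioms Nb_submodule])
  also have "\<dots> = (\<lambda>u. NN +>\<^bsub>M\<^esub> u) ` {u \<in> comp k. \<forall>p\<in>irrelevant_ideal n. p \<odot>\<^bsub>?Q\<^esub> (NN +>\<^bsub>M\<^esub> u) = \<zero>\<^bsub>?Q\<^esub>}"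
  proof (intro equalityI subsetI)
    fix y assume "y \<in> (\<lambda>u. NN +>\<^bsub>M\<^esub> u) ` {u \<in> comp k. \<forall>p\<in>irrelevant_ideal n. p \<odot>\<^bsub>?Q\<^esub> (NN +>\<^bsub>M\<^esub> u) = \<zero>\<^bsub>?Q\<^esub>}"
    then obtain u where u: "u \<in> comp k" "\<forall>p\<in>irrelevant_ideal n. p \<odot>\<^bsub>?Q\<^esub> (NN +>\<^bsub>M\<^esub> u) = \<zero>\<^bsub>?Q\<^esub>" "y = NN +>\<^bsub>M\<^esub> u"
      by (elim imageE CollectE conjE)
    moreover have "y \<in> carrier ?Q"
      unfolding u(3) carrier_quotient[OF module_axioms Nb_submodule] using comp_mem(2)[OF u(1)] by (rule imageI)
    ultimately show "y \<in> (\<lambda>u. NN +>\<^bsub>M\<^esub> u) ` comp k \<inter> {y \<in> carrier ?Q. \<forall>p\<in>irrelevant_ideal n. p \<odot>\<^bsub>?Q\<^esub> y = \<zero>\<^bsub>?Q\<^esub>}"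
      by simp
  qed force
  also have "{u \<in> comp k. \<forall>p\<in>irrelevant_ideal n. p \<odot>\<^bsub>?Q\<^esub> (NN +>\<^bsub>M\<^esub> u) = \<zero>\<^bsub>?Q\<^esub>} = Soc k"
    unfolding Soc_def using * comp_mem(2) by blast
  finally show ?thesis .
qed

text \<open>The copies of local cohomology in degree \<open>j\<close> are matched with the
  \<open>j\<close>-element subsets through bijections \<open>e j\<close> from the numbers below
  \<open>d choose j\<close>. All of these subsets are proper as \<open>j < d\<close>; the full set
  accounts for the last summand.\<close>

lemma socle_quotient_iso:
  "module_iso field_ring (component_space (socle n (quotient_gmodule M NN)) k)
     (direct_sum {..<d} (\<lambda>j. copies (d choose j) (component_space (H j) (k - int j)))
       \<oplus>\<^sub>m component_space GS (k - int d))" (is "module_iso _ ?V ?W")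
proof -
  let ?F = "sorted_list_of_set :: nat set \<Rightarrow> nat list" and ?E = "\<lambda>A. carrier (target k A)"
  define good where "good A \<sigma> \<longleftrightarrow> (\<forall>t\<in>?E A. rho (?F A) k (\<sigma> t) t \<and> \<sigma> t \<in> Soc k) \<and>
    (\<forall>t\<in>?E A. \<forall>t'\<in>?E A. \<sigma> (t \<oplus>\<^bsub>H (card A)\<^esub> t') = \<sigma> t \<oplus>\<^bsub>M\<^esub> \<sigma> t') \<and>
    (\<forall>c. \<forall>t\<in>?E A. \<sigma> (Const c \<odot>\<^bsub>H (card A)\<^esub> t) = Const c \<odot>\<^bsub>M\<^esub> \<sigma> t)" for A \<sigma>
  have "\<exists>\<sigma>. \<forall>A\<in>Pow {..<d}. good A (\<sigma> A)"
    by (rule bchoice) (unfold good_def, use target_section in blast)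
  then obtain \<sigma> where good: "\<And>A. A \<subseteq> {..<d} \<Longrightarrow> good A (\<sigma> A)" by blast
  have \<sigma>: "t \<in> ?E A \<Longrightarrow> rho (?F A) k (\<sigma> A t) t \<and> \<sigma> A t \<in> Soc k"
    "t \<in> ?E A \<Longrightarrow> t' \<in> ?E A \<Longrightarrow> \<sigma> A (t \<oplus>\<^bsub>H (card A)\<^esub> t') = \<sigma> A t \<oplus>\<^bsub>M\<^esub> \<sigma> A t'"
    "t \<in> ?E A \<Longrightarrow> \<sigma> A (Const c \<odot>\<^bsub>H (card A)\<^esub> t) = Const c \<odot>\<^bsub>M\<^esub> \<sigma> A t" if "A \<in> Pow {..<d}" for A t t' c
    using good[of A] that unfolding good_def by blast+
  interpret S: socle_sections n M \<theta> d k "Pow {..<d}" ?F ?E \<sigma>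
  proof (intro socle_sections.intro socle_sections_axioms.intro, goal_cases)
    case (3 A) then show ?case using sorted_list_facts[of A] by simp
  next
    case (4 A A') then show ?case using sorted_list_facts(2)[of A] sorted_list_facts(2)[of A'] by simp
  next
    case (5 A) then show ?case using sorted_list_facts(2)[of A] by (intro bexI[of _ A]) simp_all
  next
    case (6 A) then show ?case using target_sub[of k A] sorted_list_facts(3)[of A] by simp
  next
    case (7 A w t) then show ?case using target_rho[of A w k t] by simp
  next
    case (8 A t) then show ?case by (rule \<sigma>(1))
  next
    case (9 A t t') then show ?case using \<sigma>(2)[of A t t'] sorted_list_facts(3)[of A] by simp
  next
    case (10 A t c) then show ?case using \<sigma>(3)[of A t c] sorted_list_facts(3)[of A] by simp
  qed (simp_all add: buchsbaum_sop_axioms)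
  have "\<exists>e. bij_betw e {..<d choose j} {A. A \<subseteq> {..<d} \<and> card A = j}" for j
    using ex_bij_betw_nat_finite[of "{A. A \<subseteq> {..<d} \<and> card A = j}"] n_subsets[of "{..<d}" j]
    by (simp add: lessThan_atLeast0)
  then have "\<exists>e. \<forall>j. bij_betw (e j) {..<d choose j} {A. A \<subseteq> {..<d} \<and> card A = j}" by (intro choice allI)
  then obtain e where e: "\<And>j. bij_betw (e j) {..<d choose j} {A. A \<subseteq> {..<d} \<and> card A = j}" by blast
  \<comment> \<open>The inverse enumeration: the position of \<open>A\<close> among the subsets of
    its size.\<close>
  define ix where "ix A = inv_into {..<d choose card A} (e (card A)) A" for A
  have ix: "ix A < d choose card A" "e (card A) (ix A) = A" if "A \<subseteq> {..<d}" for A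
    using that e[of "card A"] bij_betw_inv_into_right[OF e, of A "card A"] inv_into_into[of A "e (card A)" "{..<d choose card A}"]
    by (auto simp: ix_def bij_betw_def)
  have e_sub: "e j l \<subseteq> {..<d}" "card (e j l) = j" "ix (e j l) = l" if "l < d choose j" for j l
    using that bij_betwE[OF e[of j]] bij_betw_inv_into_left[OF e[of j]] by (auto simp: ix_def)
  have card_lt: "card A < d" if "A \<subseteq> {..<d}" "A \<noteq> {..<d}" for A
    using that psubset_card_mono[of "{..<d}" A] by auto
  have W: "carrier ?W = (\<Pi>\<^sub>E j\<in>{..<d}. \<Pi>\<^sub>E l\<in>{..<d choose j}. component (H j) (k - int j)) \<times> SS (k - int d)"
    by (simp add: direct_sum2_def direct_sum_def copies_def component_space_def GS_simps)
  \<comment> \<open>Re-indexes an element of the direct sum by subsets, the form in which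
    \<open>Phi\<close> expects it.\<close>
  define enc where "enc x A = (if A = {..<d} then snd x else fst x (card A) (ix A))"
    for x :: "(nat \<Rightarrow> nat \<Rightarrow> (nat set \<Rightarrow> ('m \<times> nat) set) set) \<times> (nat set \<Rightarrow> ('m \<times> nat) set) set" and A
  have encE: "\<forall>A\<in>Pow {..<d}. enc x A \<in> ?E A" if "x \<in> carrier ?W" for x
  proof
    fix A assume A: "A \<in> Pow {..<d}"
    show "enc x A \<in> ?E A"
    proof (cases "A = {..<d}")
      case False
      have "fst x \<in> (\<Pi>\<^sub>E j\<in>{..<d}. \<Pi>\<^sub>E l\<in>{..<d choose j}. component (H j) (k - int j))"
        using that unfolding W mem_Times_iff by (rule conjunct1)
      then have "fst x (card A) \<in> (\<Pi>\<^sub>E l\<in>{..<d choose card A}. component (H (card A)) (k - int (card A)))"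
        using card_lt[of A] A False by (auto dest: PiE_mem)
      then have "fst x (card A) (ix A) \<in> component (H (card A)) (k - int (card A))"
        using ix[of A] A by (auto dest: PiE_mem)
      then show ?thesis using False by (simp add: enc_def carrier_target)
    qed (use that W in \<open>auto simp: enc_def carrier_target\<close>)
  qed
  have enc_add: "enc (x \<oplus>\<^bsub>?W\<^esub> y) A = enc x A \<oplus>\<^bsub>H (length (?F A))\<^esub> enc y A" if "A \<in> Pow {..<d}" for x y A
    using that card_lt[of A] ix[of A] sorted_list_facts(3)[of A]
    by (auto simp: enc_def direct_sum2_def direct_sum_def copies_def component_space_def GS_simps)
  have enc_smult: "enc (c \<odot>\<^bsub>?W\<^esub> x) A = Const c \<odot>\<^bsub>H (length (?F A))\<^esub> enc x A" if "A \<in> Pow {..<d}" for x c A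
    using that card_lt[of A] ix[of A] sorted_list_facts(3)[of A]
    by (auto simp: enc_def direct_sum2_def direct_sum_def copies_def component_space_def GS_simps)
  have W_eqI: "x = y" if xy: "x \<in> carrier ?W" "y \<in> carrier ?W" and eq: "\<And>A. A \<subseteq> {..<d} \<Longrightarrow> enc x A = enc y A" for x y
  proof (rule prod_eqI)
    show "snd x = snd y" using eq[of "{..<d}"] by (simp add: enc_def)
    have fxy: "fst x \<in> (\<Pi>\<^sub>E j\<in>{..<d}. \<Pi>\<^sub>E l\<in>{..<d choose j}. component (H j) (k - int j))"
      "fst y \<in> (\<Pi>\<^sub>E j\<in>{..<d}. \<Pi>\<^sub>E l\<in>{..<d choose j}. component (H j) (k - int j))"
      using xy unfolding W mem_Times_iff by (blast dest: conjunct1)+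
    show "fst x = fst y"
    proof (rule PiE_ext[OF fxy])
      fix j assume j: "j \<in> {..<d}"
      show "fst x j = fst y j"
      proof (rule PiE_ext[OF PiE_mem[OF fxy(1) j] PiE_mem[OF fxy(2) j]])
        fix l assume "l \<in> {..<d choose j}"
        then have l: "e j l \<subseteq> {..<d}" "card (e j l) = j" "ix (e j l) = l" using e_sub[of l j] by auto
        then have "e j l \<noteq> {..<d}" using j by auto
        then show "fst x j l = fst y j l" using eq[OF l(1)] l by (simp add: enc_def)
      qed
    qed
  qed
  let ?f = "\<lambda>x. NN +>\<^bsub>M\<^esub> S.Phi (enc x)"
  note Pc = S.Soc_mem(1)[OF S.Phi_Soc]
  note ceq = coset_eq_iff[OF module_axioms Nb_submodule]
  have Vc: "carrier ?V = (\<lambda>u. NN +>\<^bsub>M\<^esub> u) ` Soc k"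
    by (simp add: component_space_def component_socle_quotient)
  have Vops: "add ?V = add (quotient_gmodule M NN)" "smult ?V c = smult (quotient_gmodule M NN) (Const c)" for c
    by (simp_all add: component_space_def socle_def)
  have Wmod: "x \<oplus>\<^bsub>?W\<^esub> y \<in> carrier ?W" "c \<odot>\<^bsub>?W\<^esub> x \<in> carrier ?W"
    if "x \<in> carrier ?W" "y \<in> carrier ?W" for x y c
  proof -
    have m: "module field_ring (component_space (H j) (k - int j))" for j
      using module_component_space[OF module_H component_H_sub component_H_Const] .
    have "module field_ring (copies (d choose j) (component_space (H j) (k - int j)))" for j
      unfolding copies_def by (rule module_direct_sum[OF cring_field_ring m])
    then have D: "module field_ring (direct_sum {..<d} (\<lambda>j. copies (d choose j) (component_space (H j) (k - int j))))" (is "module _ ?D")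
      by (rule module_direct_sum[OF cring_field_ring])
    have G: "module field_ring (component_space GS (k - int d))"
      using module_target[of k "{..<d}"] by (simp add: target_def)
    interpret D: module field_ring ?D by (rule D)
    interpret G: module field_ring "component_space GS (k - int d)" by (rule G)
    show "x \<oplus>\<^bsub>?W\<^esub> y \<in> carrier ?W" "c \<odot>\<^bsub>?W\<^esub> x \<in> carrier ?W"
      using that D.smult_closed[of c] G.smult_closed[of c] by (auto simp: direct_sum2_def)
  qed
  show ?thesis
  proof (rule module_iso_inverse[where f = ?f])
    show "bij_betw ?f (carrier ?W) (carrier ?V)"
      unfolding bij_betw_def
    proof
      show "inj_on ?f (carrier ?W)"
      proof (rule inj_onI, rule W_eqI)
        fix x y A assume xy: "x \<in> carrier ?W" "y \<in> carrier ?W" and eq: "?f x = ?f y" and A: "A \<subseteq> {..<d}"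
        interpret HA: module "mpoly_ring n" "H (length (?F A))" by (rule module_H)
        have "S.Phi (enc x) \<ominus>\<^bsub>M\<^esub> S.Phi (enc y) \<in> NN" using eq ceq Pc encE xy by simp
        then have "S.Phi (\<lambda>A. enc x A \<ominus>\<^bsub>H (length (?F A))\<^esub> enc y A) \<in> NN"
          using S.Phi_diff[OF encE[OF xy(1)] encE[OF xy(2)]] by simp
        moreover have "\<forall>A\<in>Pow {..<d}. enc x A \<ominus>\<^bsub>H (length (?F A))\<^esub> enc y A \<in> ?E A"
          using encE[OF xy(1)] encE[OF xy(2)] S.E_mem(4) by blast
        ultimately have z: "enc x A \<ominus>\<^bsub>H (length (?F A))\<^esub> enc y A = \<zero>\<^bsub>H (length (?F A))\<^esub>"
          using S.Phi_inj[of "\<lambda>A. enc x A \<ominus>\<^bsub>H (length (?F A))\<^esub> enc y A" A] A by simp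
        have c: "enc x A \<in> carrier (H (length (?F A)))" "enc y A \<in> carrier (H (length (?F A)))"
          using encE[OF xy(1)] encE[OF xy(2)] S.E_mem(2)[of A] A by simp_all
        show "enc x A = enc y A" using HA.minus_add_cancel(1)[OF c, symmetric] HA.l_zero[OF c(2)] unfolding z by (rule trans)
      qed
      show "?f ` carrier ?W = carrier ?V"
      proof
        show "?f ` carrier ?W \<subseteq> carrier ?V" unfolding Vc using S.Phi_Soc encE by blast
        show "carrier ?V \<subseteq> ?f ` carrier ?W"
        proof
          fix v assume "v \<in> carrier ?V"
          then obtain w where w: "w \<in> Soc k" "v = NN +>\<^bsub>M\<^esub> w" unfolding Vc by blast
          obtain t where t: "\<forall>A\<in>Pow {..<d}. t A \<in> ?E A" "w \<ominus>\<^bsub>M\<^esub> S.Phi t \<in> NN" using S.Phi_surj[OF w(1)] by blast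
          define x where "x = ((\<lambda>j\<in>{..<d}. \<lambda>l\<in>{..<d choose j}. t (e j l)), t {..<d})"
          have tel: "t (e j l) \<in> component (H j) (k - int j)" if "j < d" "l < d choose j" for j l
          proof -
            have "e j l \<noteq> {..<d}"
            proof
              assume "e j l = {..<d}"
              then have "card (e j l) = d" by (simp only: card_lessThan)
              then show False using e_sub(2)[OF that(2)] that(1) by linarith
            qed
            moreover have "t (e j l) \<in> ?E (e j l)" using t(1) e_sub(1)[OF that(2)] by (blast intro: PowI)
            ultimately show ?thesis using e_sub(2)[OF that(2)] by (simp add: carrier_target)
          qed
          have xW: "x \<in> carrier ?W"
            unfolding W x_def
          proof (intro SigmaI PiE_I)
            show "t {..<d} \<in> SS (k - int d)" using bspec[OF t(1), of "{..<d}"] by (simp add: carrier_target)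
          qed (simp_all add: tel)
          have "enc x A = t A" if "A \<in> Pow {..<d}" for A
            using that ix[of A] card_lt[of A] by (cases "A = {..<d}") (simp_all add: enc_def x_def)
          then have "S.Phi (enc x) = S.Phi t" using t(1) by (intro S.Phi_cong) auto
          then have "v = ?f x" using w t ceq[OF S.Soc_mem(1)[OF w(1)] Pc[OF t(1)]] by simp
          then show "v \<in> ?f ` carrier ?W" using xW by blast
        qed
      qed
    qed
  next
    fix x y assume xy: "x \<in> carrier ?W" "y \<in> carrier ?W"
    have "S.Phi (enc (x \<oplus>\<^bsub>?W\<^esub> y)) = S.Phi (\<lambda>A. enc x A \<oplus>\<^bsub>H (length (?F A))\<^esub> enc y A)"
      using enc_add encE[OF xy(1)] encE[OF xy(2)] S.E_mem(3) by (intro S.Phi_cong) auto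
    then show "x \<oplus>\<^bsub>?W\<^esub> y \<in> carrier ?W \<and> ?f (x \<oplus>\<^bsub>?W\<^esub> y) = ?f x \<oplus>\<^bsub>?V\<^esub> ?f y"
      using Wmod(1)[OF xy] S.Phi_add[OF encE[OF xy(1)] encE[OF xy(2)]]
        quotient_add[OF module_axioms Nb_submodule Pc[OF encE[OF xy(1)]] Pc[OF encE[OF xy(2)]]]
      by (simp add: Vops)
  next
    fix c :: 'k and x assume x: "x \<in> carrier ?W"
    have "S.Phi (enc (c \<odot>\<^bsub>?W\<^esub> x)) = S.Phi (\<lambda>A. Const c \<odot>\<^bsub>H (length (?F A))\<^esub> enc x A)"
      using enc_smult encE[OF Wmod(2)[OF x x, of c]] by (intro S.Phi_cong) auto
    then show "c \<odot>\<^bsub>?W\<^esub> x \<in> carrier ?W \<and> ?f (c \<odot>\<^bsub>?W\<^esub> x) = c \<odot>\<^bsub>?V\<^esub> ?f x"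
      using Wmod(2)[OF x x] S.Phi_Const[OF encE[OF x]]
        quotient_smult[OF module_axioms Nb_submodule Const_closed Pc[OF encE[OF x]]]
      by (simp add: Vops)
  qed
qed

end

section \<open>Assembly for the given list of parameters\<close>

lemma has_krull_dim_unique: "has_krull_dim R M d \<Longrightarrow> has_krull_dim R M e \<Longrightarrow> d = e"
  unfolding has_krull_dim_def by (meson le_antisym)

theorem theorem2p2:
  fixes n d :: nat
    and M :: "('k::field mpoly, 'm) gmodule"
    and \<theta>s :: "'k mpoly list"
  assumes "infinite (UNIV :: 'k set)"
    and "graded_module n M"
    and "noetherian_module (mpoly_ring n) M"
    and "has_krull_dim (mpoly_ring n) M d"
    and "lsop n M \<theta>s"
    and "buchsbaum n M"
  shows "\<exists>\<S>. graded_submodule n \<S> (socle n (local_cohomology n d M)) \<and>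
    (\<forall>k::int. module_iso field_ring
       (component_space (socle n (quotient_by_seq n M \<theta>s)) k)
       (direct_sum {..<d} (\<lambda>j. copies (d choose j)
            (component_space (local_cohomology n j M) (k - int j)))
          \<oplus>\<^sub>m component_space (restrict_gmodule (socle n (local_cohomology n d M)) \<S>) (k - int d)))"
proof -
  \<comment> \<open>The Krull dimension is unique, so the system of parameters has length
    \<open>d\<close>.\<close>
  have "d = length \<theta>s"
    using has_krull_dim_unique[OF assms(4)] assms(5) by (simp add: lsop_def hsop_def)
  then interpret buchsbaum_sop n M "\<lambda>i. \<theta>s ! i" d
    using buchsbaum_sopI[OF assms(2,5,6)] by simp
  \<comment> \<open>Identifies \<open>NN\<close>, formed with all exponents equal to 1, with the
    submodule divided out in the theorem.\<close>
  have "scalar_set_mult (mpoly_ring n) ((\<lambda>i. (\<theta>s ! i) ^ full i) ` {i. i < d \<and> 0 < full i}) M = NN"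
    by (rule scalar_set_mult_Nb) (rule \<theta>_carrier)
  moreover have "(\<lambda>i. (\<theta>s ! i) ^ full i) ` {i. i < d \<and> 0 < full i} = set \<theta>s"
  proof -
    have full: "full i = 1" if "i < d" for i using that by (simp add: full_def upd_def)
    then have "{i. i < d \<and> 0 < full i} = {..<d}" by auto
    then show ?thesis using full \<open>d = length \<theta>s\<close> by (auto simp: set_conv_nth intro!: image_eqI)
  qed
  ultimately have "quotient_by_seq n M \<theta>s = quotient_gmodule M NN" by (simp add: quotient_by_seq_def)
  then show ?thesis
    using graded_submodule_SU socle_quotient_iso unfolding GS_def by (intro exI[of _ SU]) simp
qed

end
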